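(* Let $E$ be an elliptic curve over $\mathbb{Q}$ without complex multiplication and $p$ a prime, and let $K$ be the minimal field as in the context, assumed to satisfy Assumptions (I)–(III). Suppose that $\operatorname{Gal}(\mathbb{Q}(E[p])/\mathbb{Q})$, viewed as a subgroup of $GL_2(\mathbb{F}_p)$ via its action on $E[p]$, is contained in a Borel subgroup. If its order is not divisible by $4$, then: (1) $p\equiv 3\pmod 4$; and (2) for every prime $q\neq p$ at which $E/\mathbb{Q}$ has additive reduction, $E$ has potentially good reduction at $q$ and $4\mid v_q(\Delta)$, where $\Delta$ is the (minimal) discriminant of $E$. Conversely, if (1) and (2) hold and moreover $E/\mathbb{Q}$ is semistable at $2$ and $3$, or it is otherwise known that $|I_2|$ and $|I_3|$ are odd, then the order of $\operatorname{Gal}(\mathbb{Q}(E[p])/\mathbb{Q})$ is not divisible by $4$.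
   Context: $K_\infty=\mathbb{Q}(E[p^\infty])$. $K$ denotes the minimal finite Galois extension of $\mathbb{Q}$ contained in $K_\infty$ such that $\operatorname{Gal}(K_\infty/K)$ is pro-$p$. Assumptions: (I) $p\ge 5$; (II) $E$ has good ordinary reduction at all places of $K$ above $p$; (III) $\operatorname{Gal}(K_\infty/K)$ is pro-$p$. A Borel subgroup of $GL_2(\mathbb{F}_p)$ is a conjugate of the group of upper triangular invertible matrices. For a rational prime $q$, $I_q$ denotes the inertia subgroup at $q$ in $\operatorname{Gal}(K/\mathbb{Q})$ (which is abelian in the Borel case, so $I_q$ is well defined). $v_q$ is the $q$-adic valuation. *)

theory Defs
  imports
    "HOL-Analysis.Analysis"
    "HOL-Computational_Algebra.Computational_Algebra"
    "HOL-Algebra.Algebra"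
    "HOL-Algebra.Algebraic_Closure_Type"
begin

hide_const (open) Divisibility.prime Polynomial.order

section \<open>Fields of algebraic numbers and their Galois groups\<close>

text \<open>All number fields, and the infinite extension generated by the p-power torsion, are
  subfields of the complex numbers.\<close>

abbreviation \<CC> :: "complex ring"
  where "\<CC> \<equiv> ring_of_type_algebra"

definition Qbar :: "complex ring"
  where "Qbar = \<CC>\<lparr>carrier := {x. algebraic x}\<rparr>"

definition number_field :: "complex set \<Rightarrow> bool"
  where "number_field L \<longleftrightarrow> subfield L \<CC> \<and> ring.finite_dimension \<CC> \<rat> L"

definition Gal :: "complex set \<Rightarrow> complex set \<Rightarrow> (complex \<Rightarrow> complex) monoid"
  where "Gal M F = (BijGroup M)\<lparr>carrier :=
    {\<sigma> \<in> Bij M. \<sigma> \<in> ring_hom (\<CC>\<lparr>carrier := M\<rparr>) (\<CC>\<lparr>carrier := M\<rparr>) \<and> (\<forall>x\<in>F. \<sigma> x = x)}\<rparr>"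

definition finite_galois_over_Q :: "complex set \<Rightarrow> bool"
  where "finite_galois_over_Q L \<longleftrightarrow>
    number_field L \<and> {x \<in> L. \<forall>\<sigma>\<in>carrier (Gal L \<rat>). \<sigma> x = x} = \<rat>"

text \<open>The Krull topology on a Galois group is the topology of pointwise convergence, for the
  discrete topology on the field.\<close>

definition krull_topology :: "complex set \<Rightarrow> complex set \<Rightarrow> (complex \<Rightarrow> complex) topology"
  where "krull_topology M F =
    subtopology (product_topology (\<lambda>_. discrete_topology M) M) (carrier (Gal M F))"

text \<open>A profinite group is pro-p if and only if each open normal subgroup has p-power index.
  (An infinite index would be counted as 0 here, so it is excluded.)\<close>

definition pro_p_galois :: "nat \<Rightarrow> complex set \<Rightarrow> complex set \<Rightarrow> bool"
  where "pro_p_galois p M F \<longleftrightarrow>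
    (\<forall>N. N \<lhd> Gal M F \<and> openin (krull_topology M F) N \<longrightarrow> (\<exists>k. card (rcosets\<^bsub>Gal M F\<^esub> N) = p ^ k))"


section \<open>Places and inertia\<close>

definition ring_of_integers :: "complex set \<Rightarrow> complex set"
  where "ring_of_integers K = {x \<in> K. algebraic_int x}"

definition primes_above :: "complex set \<Rightarrow> nat \<Rightarrow> complex set set"
  where "primes_above K q =
    {\<pp>. primeideal \<pp> (\<CC>\<lparr>carrier := ring_of_integers K\<rparr>) \<and> of_nat q \<in> \<pp>}"

definition rat_place :: "nat \<Rightarrow> complex set"
  where "rat_place q = {of_int (int q * z) | z. True}"

definition local_ring :: "complex set \<Rightarrow> complex set \<Rightarrow> complex set"
  where "local_ring K \<pp> = {a / b | a b. a \<in> ring_of_integers K \<and> b \<in> ring_of_integers K - \<pp>}"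

definition local_max_ideal :: "complex set \<Rightarrow> complex set \<Rightarrow> complex set"
  where "local_max_ideal K \<pp> = {a / b | a b. a \<in> \<pp> \<and> b \<in> ring_of_integers K - \<pp>}"

definition residue_field :: "complex set \<Rightarrow> complex set \<Rightarrow> complex set ring"
  where "residue_field K \<pp> = \<CC>\<lparr>carrier := local_ring K \<pp>\<rparr> Quot local_max_ideal K \<pp>"

definition residue :: "complex set \<Rightarrow> complex set \<Rightarrow> complex \<Rightarrow> complex set"
  where "residue K \<pp> x = local_max_ideal K \<pp> +>\<^bsub>\<CC>\<lparr>carrier := local_ring K \<pp>\<rparr>\<^esub> x"

definition inertia_group :: "complex set \<Rightarrow> complex set \<Rightarrow> (complex \<Rightarrow> complex) set"
  where "inertia_group K \<pp> =
    {\<sigma> \<in> carrier (Gal K \<rat>). \<forall>x\<in>ring_of_integers K. \<sigma> x - x \<in> \<pp>}"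


section \<open>Weierstrass equations\<close>

text \<open>The equation \<open>y\<^sup>2 + a1 x y + a3 y = x\<^sup>3 + a2 x\<^sup>2 + a4 x + a6\<close>.\<close>

datatype 'a weierstrass = Weierstrass (a1: 'a) (a2: 'a) (a3: 'a) (a4: 'a) (a6: 'a)

definition b2 :: "'a::comm_ring_1 weierstrass \<Rightarrow> 'a"
  where "b2 W = a1 W ^ 2 + 4 * a2 W"

definition b4 :: "'a::comm_ring_1 weierstrass \<Rightarrow> 'a"
  where "b4 W = 2 * a4 W + a1 W * a3 W"

definition b6 :: "'a::comm_ring_1 weierstrass \<Rightarrow> 'a"
  where "b6 W = a3 W ^ 2 + 4 * a6 W"

definition b8 :: "'a::comm_ring_1 weierstrass \<Rightarrow> 'a"
  where "b8 W = a1 W ^ 2 * a6 W + 4 * a2 W * a6 W - a1 W * a3 W * a4 W + a2 W * a3 W ^ 2 - a4 W ^ 2"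

definition c4 :: "'a::comm_ring_1 weierstrass \<Rightarrow> 'a"
  where "c4 W = b2 W ^ 2 - 24 * b4 W"

definition disc :: "'a::comm_ring_1 weierstrass \<Rightarrow> 'a"
  where "disc W = - (b2 W ^ 2 * b8 W) - 8 * b4 W ^ 3 - 27 * b6 W ^ 2 + 9 * b2 W * b4 W * b6 W"

definition elliptic_curve_over :: "complex set \<Rightarrow> complex weierstrass \<Rightarrow> bool"
  where "elliptic_curve_over F W \<longleftrightarrow> set_weierstrass W \<subseteq> F \<and> disc W \<noteq> 0"

text \<open>The equation obtained by substituting \<open>u\<^sup>2 x + r\<close> for \<open>x\<close> and
  \<open>u\<^sup>3 y + s u\<^sup>2 x + t\<close> for \<open>y\<close>.\<close>

definition change_variables ::
    "complex \<Rightarrow> complex \<Rightarrow> complex \<Rightarrow> complex \<Rightarrow> complex weierstrass \<Rightarrow> complex weierstrass"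
  where "change_variables u r s t W = Weierstrass
    ((a1 W + 2 * s) / u)
    ((a2 W - s * a1 W + 3 * r - s ^ 2) / u ^ 2)
    ((a3 W + r * a1 W + 2 * t) / u ^ 3)
    ((a4 W - s * a3 W + 2 * r * a2 W - (t + r * s) * a1 W + 3 * r ^ 2 - 2 * s * t) / u ^ 4)
    ((a6 W + r * a4 W + r ^ 2 * a2 W + r ^ 3 - t * a3 W - t ^ 2 - r * t * a1 W) / u ^ 6)"

definition isomorphic_over :: "complex set \<Rightarrow> complex weierstrass \<Rightarrow> complex weierstrass \<Rightarrow> bool"
  where "isomorphic_over F W W' \<longleftrightarrow>
    (\<exists>u\<in>F - {0}. \<exists>r\<in>F. \<exists>s\<in>F. \<exists>t\<in>F. W' = change_variables u r s t W)"


section \<open>The group of points\<close>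

datatype 'a point = Infinity | Affine 'a 'a

definition on_curve :: "('a, 'm) ring_scheme \<Rightarrow> 'a weierstrass \<Rightarrow> 'a \<Rightarrow> 'a \<Rightarrow> bool"
  where "on_curve R W x y \<longleftrightarrow> x \<in> carrier R \<and> y \<in> carrier R \<and>
    y \<otimes>\<^bsub>R\<^esub> y \<oplus>\<^bsub>R\<^esub> a1 W \<otimes>\<^bsub>R\<^esub> x \<otimes>\<^bsub>R\<^esub> y \<oplus>\<^bsub>R\<^esub> a3 W \<otimes>\<^bsub>R\<^esub> y =
    x \<otimes>\<^bsub>R\<^esub> x \<otimes>\<^bsub>R\<^esub> x \<oplus>\<^bsub>R\<^esub> a2 W \<otimes>\<^bsub>R\<^esub> x \<otimes>\<^bsub>R\<^esub> x \<oplus>\<^bsub>R\<^esub> a4 W \<otimes>\<^bsub>R\<^esub> x \<oplus>\<^bsub>R\<^esub> a6 W"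

definition points :: "('a, 'm) ring_scheme \<Rightarrow> 'a weierstrass \<Rightarrow> 'a point set"
  where "points R W = insert Infinity {Affine x y | x y. on_curve R W x y}"

definition chord_slope ::
    "('a, 'm) ring_scheme \<Rightarrow> 'a weierstrass \<Rightarrow> 'a \<Rightarrow> 'a \<Rightarrow> 'a \<Rightarrow> 'a \<Rightarrow> 'a"
  where "chord_slope R W x1 y1 x2 y2 =
    (if x1 \<noteq> x2 then (y2 \<ominus>\<^bsub>R\<^esub> y1) \<otimes>\<^bsub>R\<^esub> inv\<^bsub>R\<^esub> (x2 \<ominus>\<^bsub>R\<^esub> x1)
     else (add_pow R (3::nat) (x1 \<otimes>\<^bsub>R\<^esub> x1) \<oplus>\<^bsub>R\<^esub> add_pow R (2::nat) (a2 W \<otimes>\<^bsub>R\<^esub> x1) \<oplus>\<^bsub>R\<^esub> a4 W \<ominus>\<^bsub>R\<^esub> a1 W \<otimes>\<^bsub>R\<^esub> y1)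
       \<otimes>\<^bsub>R\<^esub> inv\<^bsub>R\<^esub> (add_pow R (2::nat) y1 \<oplus>\<^bsub>R\<^esub> a1 W \<otimes>\<^bsub>R\<^esub> x1 \<oplus>\<^bsub>R\<^esub> a3 W))"

fun add_points ::
    "('a, 'm) ring_scheme \<Rightarrow> 'a weierstrass \<Rightarrow> 'a point \<Rightarrow> 'a point \<Rightarrow> 'a point"
  where
    "add_points R W Infinity T = T"
  | "add_points R W S Infinity = S"
  | "add_points R W (Affine x1 y1) (Affine x2 y2) =
      (if x1 = x2 \<and> y1 \<oplus>\<^bsub>R\<^esub> y2 \<oplus>\<^bsub>R\<^esub> a1 W \<otimes>\<^bsub>R\<^esub> x2 \<oplus>\<^bsub>R\<^esub> a3 W = \<zero>\<^bsub>R\<^esub> then Infinity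
       else let l = chord_slope R W x1 y1 x2 y2;
                x = l \<otimes>\<^bsub>R\<^esub> l \<oplus>\<^bsub>R\<^esub> a1 W \<otimes>\<^bsub>R\<^esub> l \<ominus>\<^bsub>R\<^esub> a2 W \<ominus>\<^bsub>R\<^esub> x1 \<ominus>\<^bsub>R\<^esub> x2
            in Affine x (l \<otimes>\<^bsub>R\<^esub> (x1 \<ominus>\<^bsub>R\<^esub> x) \<ominus>\<^bsub>R\<^esub> y1 \<ominus>\<^bsub>R\<^esub> a1 W \<otimes>\<^bsub>R\<^esub> x \<ominus>\<^bsub>R\<^esub> a3 W))"

definition point_group :: "('a, 'm) ring_scheme \<Rightarrow> 'a weierstrass \<Rightarrow> 'a point monoid"
  where "point_group R W = \<lparr>carrier = points R W, mult = add_points R W, one = Infinity\<rparr>"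

definition torsion :: "('a, 'm) ring_scheme \<Rightarrow> 'a weierstrass \<Rightarrow> nat \<Rightarrow> 'a point set"
  where "torsion R W n =
    {T \<in> points R W. T [^]\<^bsub>point_group R W\<^esub> n = \<one>\<^bsub>point_group R W\<^esub>}"


section \<open>Complex multiplication\<close>

fun homogeneous_coords :: "complex point \<Rightarrow> complex ^ 3"
  where
    "homogeneous_coords (Affine x y) = vector [x, y, 1]"
  | "homogeneous_coords Infinity = vector [0, 1, 0]"

text \<open>Three forms of degree \<open>d\<close> in three variables, evaluated at \<open>v\<close>; \<open>C i j\<close> is the
  vector of their coefficients at the monomial \<open>X\<^sup>i Y\<^sup>j Z\<^sup>k\<close> with \<open>k = d - i - j\<close>.\<close>

definition eval_forms :: "nat \<Rightarrow> (nat \<Rightarrow> nat \<Rightarrow> complex ^ 3) \<Rightarrow> complex ^ 3 \<Rightarrow> complex ^ 3"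
  where "eval_forms d C v =
    (\<Sum>i\<le>d. \<Sum>j\<le>d - i. ((v $ 1) ^ i * (v $ 2) ^ j * (v $ 3) ^ (d - i - j)) *s C i j)"

text \<open>Morphisms of projective curves are maps that are, near every point, given by forms of the
  same degree without a common zero.\<close>

definition self_morphism :: "complex weierstrass \<Rightarrow> (complex point \<Rightarrow> complex point) \<Rightarrow> bool"
  where "self_morphism W \<phi> \<longleftrightarrow>
    (\<forall>T\<in>points Qbar W. \<phi> T \<in> points Qbar W) \<and>
    (\<forall>T\<in>points Qbar W. \<exists>d C. (\<forall>i j k. algebraic (C i j $ k)) \<and>
      eval_forms d C (homogeneous_coords T) \<noteq> 0 \<and>
      (\<forall>S\<in>points Qbar W. eval_forms d C (homogeneous_coords S) \<noteq> 0 \<longrightarrow>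
        (\<exists>l. eval_forms d C (homogeneous_coords S) = l *s homogeneous_coords (\<phi> S))))"

text \<open>An endomorphism is a self-morphism that fixes the origin.\<close>

definition complex_multiplication :: "complex weierstrass \<Rightarrow> bool"
  where "complex_multiplication W \<longleftrightarrow>
    (\<exists>\<phi>. self_morphism W \<phi> \<and> \<phi> Infinity = Infinity \<and>
      (\<forall>n::int. \<exists>T\<in>points Qbar W. \<phi> T \<noteq> T [^]\<^bsub>point_group Qbar W\<^esub> n))"


section \<open>Reduction types\<close>

definition minimal_model ::
    "complex set \<Rightarrow> complex set \<Rightarrow> complex weierstrass \<Rightarrow> complex weierstrass \<Rightarrow> bool"
  where "minimal_model K \<pp> W W' \<longleftrightarrow>
    isomorphic_over K W W' \<and> set_weierstrass W' \<subseteq> local_ring K \<pp> \<and>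
    (\<forall>W''. isomorphic_over K W W'' \<and> set_weierstrass W'' \<subseteq> local_ring K \<pp> \<longrightarrow>
      disc W'' / disc W' \<in> local_ring K \<pp>)"

definition good_reduction :: "complex set \<Rightarrow> complex set \<Rightarrow> complex weierstrass \<Rightarrow> bool"
  where "good_reduction K \<pp> W \<longleftrightarrow>
    (\<exists>W'. minimal_model K \<pp> W W' \<and> disc W' \<notin> local_max_ideal K \<pp>)"

text \<open>The reduction of a minimal model is singular if and only if \<open>disc\<close> vanishes in the residue
  field; the singular point is then a node if \<open>c4\<close> does not vanish there and a cusp if it does.\<close>

definition multiplicative_reduction :: "complex set \<Rightarrow> complex set \<Rightarrow> complex weierstrass \<Rightarrow> bool"
  where "multiplicative_reduction K \<pp> W \<longleftrightarrow>
    (\<exists>W'. minimal_model K \<pp> W W' \<and> disc W' \<in> local_max_ideal K \<pp> \<and> c4 W' \<notin> local_max_ideal K \<pp>)"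

definition additive_reduction :: "complex set \<Rightarrow> complex set \<Rightarrow> complex weierstrass \<Rightarrow> bool"
  where "additive_reduction K \<pp> W \<longleftrightarrow>
    (\<exists>W'. minimal_model K \<pp> W W' \<and> disc W' \<in> local_max_ideal K \<pp> \<and> c4 W' \<in> local_max_ideal K \<pp>)"

definition semistable_reduction :: "complex set \<Rightarrow> complex set \<Rightarrow> complex weierstrass \<Rightarrow> bool"
  where "semistable_reduction K \<pp> W \<longleftrightarrow> good_reduction K \<pp> W \<or> multiplicative_reduction K \<pp> W"

definition potentially_good_reduction :: "nat \<Rightarrow> complex weierstrass \<Rightarrow> bool"
  where "potentially_good_reduction q W \<longleftrightarrow>
    (\<exists>L. number_field L \<and> (\<forall>\<pp>\<in>primes_above L q. good_reduction L \<pp> W))"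

text \<open>A curve over a field \<open>k\<close> of characteristic \<open>p\<close> is ordinary if it has a nonzero
  \<open>p\<close>-torsion point over an algebraic closure of \<open>k\<close>. The map \<open>ring.indexed_const k\<close> is the
  embedding of \<open>k\<close> into the library's algebraic closure.\<close>

definition ordinary :: "nat \<Rightarrow> ('a, 'm) ring_scheme \<Rightarrow> 'a weierstrass \<Rightarrow> bool"
  where "ordinary p k W \<longleftrightarrow>
    torsion (field.alg_closure k) (map_weierstrass (ring.indexed_const k) W) p \<noteq> {Infinity}"

definition good_ordinary_reduction ::
    "nat \<Rightarrow> complex set \<Rightarrow> complex set \<Rightarrow> complex weierstrass \<Rightarrow> bool"
  where "good_ordinary_reduction p K \<pp> W \<longleftrightarrow>
    (\<exists>W'. minimal_model K \<pp> W W' \<and> disc W' \<notin> local_max_ideal K \<pp> \<and>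
      ordinary p (residue_field K \<pp>) (map_weierstrass (residue K \<pp>) W'))"

text \<open>\<open>d\<close> is the discriminant of a global minimal model of the rational curve \<open>W\<close>.\<close>

definition minimal_discriminant :: "complex weierstrass \<Rightarrow> int \<Rightarrow> bool"
  where "minimal_discriminant W d \<longleftrightarrow>
    (\<exists>W'. (\<forall>q. prime q \<longrightarrow> minimal_model \<rat> (rat_place q) W W') \<and> disc W' = of_int d)"


section \<open>Torsion fields and the Galois representation on the p-torsion\<close>

definition coordinates :: "complex point set \<Rightarrow> complex set"
  where "coordinates A = (\<Union>T\<in>A. set_point T)"

definition torsion_field :: "complex weierstrass \<Rightarrow> nat \<Rightarrow> complex set"
  where "torsion_field W n = generate_field \<CC> (coordinates (torsion Qbar W n))"

definition p_power_torsion_field :: "complex weierstrass \<Rightarrow> nat \<Rightarrow> complex set"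
  where "p_power_torsion_field W p =
    generate_field \<CC> (coordinates (\<Union>n. torsion Qbar W (p ^ n)))"

definition minimal_pro_p_base :: "nat \<Rightarrow> complex weierstrass \<Rightarrow> complex set \<Rightarrow> bool"
  where "minimal_pro_p_base p W K \<longleftrightarrow>
    (let admissible = (\<lambda>L. finite_galois_over_Q L \<and> L \<subseteq> p_power_torsion_field W p \<and>
                           pro_p_galois p (p_power_torsion_field W p) L)
     in admissible K \<and> (\<forall>L. admissible L \<longrightarrow> K \<subseteq> L))"

text \<open>Matrices modulo \<open>p\<close> are represented by integer matrices with entries in \<open>{0..<p}\<close>.\<close>

definition mod_matrix :: "nat \<Rightarrow> int ^ 2 ^ 2 \<Rightarrow> int ^ 2 ^ 2"
  where "mod_matrix p A = (\<chi> i j. A $ i $ j mod int p)"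

definition GL2 :: "nat \<Rightarrow> (int ^ 2 ^ 2) monoid"
  where "GL2 p = \<lparr>carrier = {A. mod_matrix p A = A \<and> coprime (det A) (int p)},
    mult = (\<lambda>A B. mod_matrix p (A ** B)), one = mat 1\<rparr>"

definition borel_subgroup :: "nat \<Rightarrow> (int ^ 2 ^ 2) set \<Rightarrow> bool"
  where "borel_subgroup p B \<longleftrightarrow> (\<exists>g\<in>carrier (GL2 p).
    B = {g \<otimes>\<^bsub>GL2 p\<^esub> A \<otimes>\<^bsub>GL2 p\<^esub> inv\<^bsub>GL2 p\<^esub> g | A. A \<in> carrier (GL2 p) \<and> A $ 2 $ 1 = 0})"

definition torsion_basis :: "complex weierstrass \<Rightarrow> nat \<Rightarrow> complex point \<Rightarrow> complex point \<Rightarrow> bool"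
  where "torsion_basis W p S T \<longleftrightarrow> S \<in> torsion Qbar W p \<and> T \<in> torsion Qbar W p \<and>
    bij_betw (\<lambda>(a, b). S [^]\<^bsub>point_group Qbar W\<^esub> a \<otimes>\<^bsub>point_group Qbar W\<^esub> T [^]\<^bsub>point_group Qbar W\<^esub> b)
      ({0..<p} \<times> {0..<p}) (torsion Qbar W p)"

text \<open>The columns of the matrix are the coordinates of the images of the basis vectors.\<close>

definition mod_p_representation ::
    "complex weierstrass \<Rightarrow> nat \<Rightarrow> complex point \<Rightarrow> complex point \<Rightarrow> (complex \<Rightarrow> complex) \<Rightarrow> int ^ 2 ^ 2"
  where "mod_p_representation W p S T \<sigma> = (THE A. A \<in> carrier (GL2 p) \<and>
    map_point \<sigma> S = S [^]\<^bsub>point_group Qbar W\<^esub> (A $ 1 $ 1) \<otimes>\<^bsub>point_group Qbar W\<^esub> T [^]\<^bsub>point_group Qbar W\<^esub> (A $ 2 $ 1) \<and>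
    map_point \<sigma> T = S [^]\<^bsub>point_group Qbar W\<^esub> (A $ 1 $ 2) \<otimes>\<^bsub>point_group Qbar W\<^esub> T [^]\<^bsub>point_group Qbar W\<^esub> (A $ 2 $ 2))"

end

(* Neither the Weil pairing nor Tate curves are used.  Let G be the Galois group of Q(E[p]); it
   stabilises a line C in E[p].  For a Galois-stable symmetric set Z of nonzero p-torsion points
   let Y_Z be the product of 2 y + a1 x + a3 over one point from each pair {P, -P} in Z.  Galois
   elements multiply Y_Z by signs, so Y_Z^2 is rational; an involution multiplies it by (-1)^m,
   where 2 m is the number of points of Z that it negates.  The product of Y over all nonzero
   p-torsion is irrational, since its square is, up to sign, p times a rational square.
   Write Y1, Y2 for the products over C - {O} and E[p] - C.  Counting signs, if 4 does not divide
   |G|, then p = 3 mod 4 and Y1 or Y2 is rational; conversely 4 does not divide |G| if p = 3 mod 4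
   and each Yi is rational or a rational multiple of sqrt(-p).
   At a prime q different from p, the valuation of Yi^2 and, for q = 2, its class modulo 4 up to
   squares are read off a model over a valuation ring above q: a minimal model, a model with good
   reduction over an extension, or, when j is not integral, a model with the given j.  Passing
   to this model scales Yi by u^(3 h), where h, the number of factors, is odd, and in the
   potentially good case u^12 has the valuation of the discriminant. *)
theory Submission
  imports Defs "HOL-Number_Theory.Residues"
begin

alias coeff = Polynomial.coeff
alias degree = Polynomial.degree
alias lead_coeff = Polynomial.lead_coeff
alias monom = Polynomial.monom
alias smult = Polynomial.smult

section \<open>The group law\<close>

text \<open>The signs are Legendre symbols: by Gauss's lemma an element of G multiplies the product
  over C by the symbol of its eigenvalue on C, and the product over E[p] - C by the symbol of its
  eigenvalue on E[p] / C. Hence p = 3 mod 4 is decisive: then the squares modulo p form a group of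
  odd order, and the two signs see the whole 2-part of G. Together the signs give the symbol of the
  determinant. That this symbol is not trivial, which a pairing would show, is here an identity
  between the abscissas of the p-torsion, and it comes from the differential equation of
  multiplication by p. The obstacle in the local part is that the scaling factor u between a
  rational curve and a good local model is in general neither rational nor unramified at q.
  Therefore places are valuation rings of the whole field of complex numbers in which q is not
  invertible: one such ring serves the torsion coordinates, u and every number field at once, and
  meets the rational numbers in the localisation at q. No completion is used.\<close>

definition on_ec :: "complex weierstrass => complex => complex => bool"
 where "on_ec W x y \<longleftrightarrow> y ^ 2 + a1 W * x * y + a3 W * y = x ^ 3 + a2 W * x ^ 2 + a4 W * x + a6 W"

text \<open>The group law is developed on all complex points with the plain field operations;
  \<open>points_Qbar\<close> and \<open>add_points_Qbar\<close> transfer it to the definitions over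
  a ring. The complex plane is also where the limits of the next section are taken.\<close>

definition ec :: "complex weierstrass => complex point set"
 where "ec W = insert Infinity {Affine x y | x y. on_ec W x y}"

definition ec_slope :: "complex weierstrass => complex => complex => complex => complex => complex"
 where "ec_slope W x1 y1 x2 y2 =
  (if x1 ~= x2 then (y2 - y1) / (x2 - x1)
   else (3 * x1 ^ 2 + 2 * a2 W * x1 + a4 W - a1 W * y1) / (2 * y1 + a1 W * x1 + a3 W))"

fun ec_add :: "complex weierstrass => complex point => complex point => complex point"
 where
  "ec_add W Infinity T = T"
 | "ec_add W S Infinity = S"
 | "ec_add W (Affine x1 y1) (Affine x2 y2) =
   (if x1 = x2 \<and> y1 + y2 + a1 W * x2 + a3 W = 0 then Infinity
    else let l = ec_slope W x1 y1 x2 y2; x = l ^ 2 + a1 W * l - a2 W - x1 - x2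
      in Affine x (l * (x1 - x) - y1 - a1 W * x - a3 W))"

fun ec_neg :: "complex weierstrass => complex point => complex point"
 where
  "ec_neg W Infinity = Infinity"
 | "ec_neg W (Affine x y) = Affine x (- y - a1 W * x - a3 W)"

lemma ec_simps [simp]: "Infinity \<in> ec W" "Affine x y \<in> ec W \<longleftrightarrow> on_ec W x y"
 by (auto simp: ec_def)

lemma ec_neg_ec: "P \<in> ec W ==> ec_neg W P \<in> ec W"
 by (cases P) (auto simp: on_ec_def algebra_simps power2_eq_square)

lemma ec_neg_neg [simp]: "ec_neg W (ec_neg W P) = P"
 by (cases P) auto

lemma ec_add_Infinity [simp]: "ec_add W P Infinity = P"
 by (cases P) auto

lemma ec_add_neg [simp]: "ec_add W P (ec_neg W P) = Infinity"
 by (cases P) (auto simp: algebra_simps)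

lemma on_ec_same_x:
 assumes "on_ec W x y" "on_ec W x y'"
 shows "y' = y \<or> y + y' + a1 W * x + a3 W = 0"
proof -
 have "(y' - y) * (y + y' + a1 W * x + a3 W) = 0"
  using assms unfolding on_ec_def by Groebner_Basis.algebra
 then show ?thesis by auto
qed

lemma ec_add_comm:
 assumes "P \<in> ec W" "Q \<in> ec W"
 shows "ec_add W P Q = ec_add W Q P"
proof (cases P)
 case (Affine x1 y1)
 show ?thesis
 proof (cases Q)
  case Q: (Affine x2 y2)
  show ?thesis
  proof (cases "x1 = x2")
   case True
   then have "y2 = y1 \<or> y1 + y2 + a1 W * x1 + a3 W = 0"
    using assms on_ec_same_x[of W x1 y1 y2] Affine Q by simp
   moreover have "y2 + y1 + a1 W * x2 + a3 W = y1 + y2 + a1 W * x2 + a3 W" by simp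
   ultimately show ?thesis using True unfolding Affine Q ec_add.simps by metis
  next
   case False
   define l where "l = (y2 - y1) / (x2 - x1)"
   have l': "l = (y1 - y2) / (x1 - x2)" unfolding l_def by (metis minus_diff_eq minus_divide_divide)
   have l: "l * x1 - y1 = l * x2 - y2" using False unfolding l_def by (simp add: field_simps)
   have s: "ec_slope W x1 y1 x2 y2 = l" "ec_slope W x2 y2 x1 y1 = l"
    using False l' by (auto simp: ec_slope_def l_def)
   have "l * (x1 - x) - y1 = l * (x2 - x) - y2" for x using l by (simp add: algebra_simps)
   then show ?thesis using False s by (auto simp: Affine Q Let_def algebra_simps)
  qed
 qed auto
qed auto

section \<open>Associativity on short Weierstrass curves\<close>

definition short :: "complex => complex => complex weierstrass"
 where "short A B = Weierstrass 0 0 0 A B"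

lemma short_sel [simp]: "a1 (short A B) = 0" "a2 (short A B) = 0" "a3 (short A B) = 0"
  "a4 (short A B) = A" "a6 (short A B) = B"
 by (auto simp: short_def)

lemma disc_short: "disc (short A B) = -16 * (4 * A ^ 3 + 27 * B ^ 2)"
 by (simp add: disc_def b2_def b4_def b6_def b8_def power_mult_distrib algebra_simps)

lemma on_short: "on_ec (short A B) x y \<longleftrightarrow> y ^ 2 = x ^ 3 + A * x + B"
 by (simp add: on_ec_def)

locale short_curve =
 fixes A B :: complex
 assumes nonsing: "4 * A ^ 3 + 27 * B ^ 2 ~= 0"
begin

abbreviation "W \<equiv> short A B"

text \<open>The line \<open>y = l x + n\<close> meets the curve in points with abscissas \<open>x1\<close>, \<open>x2\<close>, \<open>x3\<close>,
 counted with multiplicity.\<close>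

definition cut :: "complex => complex => complex => complex => complex => bool"
 where "cut l n x1 x2 x3 \<longleftrightarrow> x1 + x2 + x3 = l ^ 2 \<and> x1 * x2 + x1 * x3 + x2 * x3 = A - 2 * l * n
  \<and> x1 * x2 * x3 = n ^ 2 - B"

lemma smooth:
 assumes "x ^ 3 + A * x + B = 0" "3 * x ^ 2 + A = 0"
 shows False
proof -
 have "4 * A ^ 3 + 27 * B ^ 2 = 0" using assms by Groebner_Basis.algebra
 then show False using nonsing by simp
qed

lemma cut_on: "cut l n x1 x2 x3 ==> on_ec W x1 (l * x1 + n)"
 unfolding cut_def on_short by Groebner_Basis.algebra

lemma cut_perm: "cut l n x1 x2 x3 ==> cut l n x2 x1 x3" "cut l n x1 x2 x3 ==> cut l n x1 x3 x2"
 unfolding cut_def by (auto simp: algebra_simps)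

lemma cut_add:
 assumes "cut l n x1 x2 x3"
 shows "ec_add W (Affine x1 (l * x1 + n)) (Affine x2 (l * x2 + n)) = Affine x3 (- (l * x3 + n))"
proof -
 have s: "x1 + x2 + x3 = l ^ 2" using assms by (simp add: cut_def)
 have slope: "ec_slope W x1 (l * x1 + n) x2 (l * x2 + n) = l \<and> \<not> (x1 = x2 \<and> l * x1 + n + (l * x2 + n) = 0)"
 proof (cases "x1 = x2")
  case True
  \<comment> \<open>Here x1 is a double root of x^3 + A x + B - (l x + n)^2, so the derivative at x1
    yields the tangent slope; smoothness excludes l x1 + n = 0.\<close>
  have t: "3 * x1 ^ 2 + A = 2 * l * (l * x1 + n)"
   using assms unfolding cut_def True by Groebner_Basis.algebra
  have "l * x1 + n ~= 0"
   using smooth[of x1] cut_on[OF assms] t by (auto simp: on_short)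
  then have "2 * (l * x1 + n) ~= 0" by (metis mult_eq_0_iff zero_neq_numeral)
  then have "(3 * x1 ^ 2 + A) / (2 * (l * x1 + n)) = l" using t by (simp add: divide_eq_eq)
  then show ?thesis using \<open>2 * (l * x1 + n) ~= 0\<close> True by (simp add: ec_slope_def)
 next
  case False
  then show ?thesis by (simp add: ec_slope_def field_simps)
 qed
 have x3: "x3 = l ^ 2 - x1 - x2" using s by (simp add: algebra_simps)
 have "l * (x1 - x3) - (l * x1 + n) = - (l * x3 + n)" by (simp add: algebra_simps)
 moreover have "l ^ 2 - x1 - x2 = x3" using x3 by simp
 ultimately show ?thesis using slope by (auto simp: Let_def simp del: minus_add_distrib)
qed

lemma cut_ex:
 assumes "on_ec W x1 y1" "on_ec W x2 y2" "\<not> (x1 = x2 \<and> y1 + y2 = 0)"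
 obtains l n x3 where "cut l n x1 x2 x3" "y1 = l * x1 + n" "y2 = l * x2 + n"
proof -
 define l where "l = ec_slope W x1 y1 x2 y2"
 define n where "n = y1 - l * x1"
 define x3 where "x3 = l ^ 2 - x1 - x2"
 have y1: "y1 = l * x1 + n" by (simp add: n_def)
 have e1: "y1 ^ 2 = x1 ^ 3 + A * x1 + B" and e2: "y2 ^ 2 = x2 ^ 3 + A * x2 + B"
  using assms by (auto simp: on_short)
 show thesis
 proof (cases "x1 = x2")
  case True
  then have y2: "y2 = y1" using on_ec_same_x[of W x1 y1 y2] assms by auto
  then have "y1 ~= 0" using assms True by auto
  then have l: "2 * l * y1 = 3 * x1 ^ 2 + A" using True y2 by (simp add: l_def ec_slope_def)
  have "x1 * x1 + x1 * x3 + x1 * x3 = A - 2 * l * n"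
   using l unfolding x3_def True[symmetric] y1 by Groebner_Basis.algebra
  moreover have "x1 * x1 * x3 = n ^ 2 - B"
   using l e1 unfolding x3_def True[symmetric] y1 by Groebner_Basis.algebra
  ultimately have "cut l n x1 x2 x3"
   unfolding cut_def True[symmetric] by (simp add: x3_def True)
  then show thesis using that y1 y2 True by metis
 next
  case False
  then have l: "l * (x2 - x1) = y2 - y1" by (simp add: l_def ec_slope_def)
  then have y2: "y2 = l * x2 + n" by (simp add: n_def algebra_simps)
  have "(x1 - x2) * (x1 * x2 + x1 * x3 + x2 * x3 - (A - 2 * l * n)) = 0"
   unfolding x3_def using e1 e2 unfolding y1 y2 by Groebner_Basis.algebra
  moreover have "(x1 - x2) * (x1 * x2 * x3 - (n ^ 2 - B)) = 0"
   unfolding x3_def using e1 e2 unfolding y1 y2 by Groebner_Basis.algebra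
  ultimately have "cut l n x1 x2 x3" using False by (auto simp: cut_def x3_def)
  then show thesis using that y1 y2 by blast
 qed
qed

text \<open>Reduces every identity of the group law to collinear triples: in the last case P, Q and
  -(P + Q) lie on one line, and the other cases are settled by the laws for the neutral element and
  the inverse.\<close>

lemma add_cases:
 assumes "P \<in> ec W" "Q \<in> ec W"
 obtains "P = Infinity" | "Q = Infinity" | "Q = ec_neg W P" | l n x1 x2 x3 where "cut l n x1 x2 x3"
  "P = Affine x1 (l * x1 + n)" "Q = Affine x2 (l * x2 + n)" "ec_add W P Q = Affine x3 (- (l * x3 + n))"
proof (cases P)
 case (Affine x1 y1)
 show thesis
 proof (cases Q)
  case Q: (Affine x2 y2)
  show thesis
  proof (cases "x1 = x2 \<and> y1 + y2 = 0")
   case True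
   then have "y2 = - y1" by (simp add: add_eq_0_iff)
   then show thesis using that(3) True Affine Q by simp
  next
   case False
   then obtain l n x3 where "cut l n x1 x2 x3" "y1 = l * x1 + n" "y2 = l * x2 + n"
    using cut_ex[of x1 y1 x2 y2] assms Affine Q by auto
   then show thesis using that(4) cut_add Affine Q by blast
  qed
 qed (use that in auto)
qed (use that in auto)

lemma add_closed:
 assumes "P \<in> ec W" "Q \<in> ec W" shows "ec_add W P Q \<in> ec W"
proof (rule add_cases[OF assms])
 fix l n x1 x2 x3
 assume "cut l n x1 x2 x3" "ec_add W P Q = Affine x3 (- (l * x3 + n))"
 moreover have "cut l n x3 x1 x2" using calculation(1) cut_perm by blast
 ultimately show ?thesis using cut_on[of l n x3 x1 x2] by (simp add: on_short del: minus_add_distrib)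
qed (use assms in auto)

lemma neg_cut: "cut l n x1 x2 x3 ==> cut (-l) (-n) x1 x2 x3"
 by (simp add: cut_def)

text \<open>The line through P, Q and -(P + Q), reflected in the x-axis, passes through -P, -Q and P
  + Q, which says that (P + Q) - Q = P.\<close>

lemma add_cancel:
 assumes "P \<in> ec W" "Q \<in> ec W" shows "ec_add W (ec_add W P Q) (ec_neg W Q) = P"
proof (rule add_cases[OF assms])
 fix l n x1 x2 x3
 assume c: "cut l n x1 x2 x3" and PQ: "P = Affine x1 (l * x1 + n)" "Q = Affine x2 (l * x2 + n)"
  "ec_add W P Q = Affine x3 (- (l * x3 + n))"
 have "cut (-l) (-n) x3 x2 x1" using neg_cut[OF c] cut_perm by blast
 from cut_add[OF this] show ?thesis using PQ by (simp add: algebra_simps)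
next
 assume "Q = ec_neg W P" then show ?thesis by simp
qed auto

lemma neg_add:
 assumes "P \<in> ec W" "Q \<in> ec W" shows "ec_neg W (ec_add W P Q) = ec_add W (ec_neg W P) (ec_neg W Q)"
proof (rule add_cases[OF assms])
 fix l n x1 x2 x3
 assume c: "cut l n x1 x2 x3" and PQ: "P = Affine x1 (l * x1 + n)" "Q = Affine x2 (l * x2 + n)"
  "ec_add W P Q = Affine x3 (- (l * x3 + n))"
 from cut_add[OF neg_cut[OF c]] show ?thesis using PQ by (simp add: algebra_simps)
next
 assume "Q = ec_neg W P"
 then show ?thesis using ec_add_neg[of W P] ec_add_comm[of P W "ec_neg W P"] ec_neg_ec[of P W] assms by simp
qed auto

text \<open>Key point: the four slopes of the lines in the associativity diagram satisfy
 \<open>l1 + l2 = l3 + l4\<close>.\<close>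

lemma assoc_generic:
 assumes c1: "cut l1 n1 xA xB m" and c2: "cut l2 n2 m xC t" and c3: "cut l3 n3 xB xC n"
  and M: "l1 * m + n1 = - (l2 * m + n2)"
  and yB: "l1 * xB + n1 = l3 * xB + n3" and yC: "l2 * xC + n2 = l3 * xC + n3"
  and nd: "xB = xC ==> m ~= xB"
 defines "l4 \<equiv> l1 + l2 - l3" and "n4 \<equiv> - n3 - (l1 + l2) * n"
 shows "cut l4 n4 xA n t" "l4 * xA + n4 = l1 * xA + n1" "l4 * n + n4 = - (l3 * n + n3)"
  "l4 * t + n4 = l2 * t + n2"
proof -
 note c = c1[unfolded cut_def] c2[unfolded cut_def] c3[unfolded cut_def]
 define s where "s = l1 + l2"
 have n1: "n1 = l3 * xB + n3 - l1 * xB" and n2: "n2 = l3 * xC + n3 - l2 * xC"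
  using yB yC by (auto simp: algebra_simps)
 have m: "m = l1 ^ 2 - xA - xB" and n: "n = l3 ^ 2 - xB - xC" and t: "t = l2 ^ 2 - m - xC"
  using c by (auto simp: algebra_simps)
 have sm: "n1 + n2 = - s * m" using M unfolding s_def by Groebner_Basis.algebra
 \<comment> \<open>The relation that puts A, B + C and -((A + B) + C) on one line. For xB different
   from xC the symmetric functions of the two lines through abscissa m are compared, and the factor
   xC - xB cancels.\<close>
 have key: "xA - xC = s * (l1 - l3)"
 proof (cases "xB = xC")
  case False
  have e1: "s * (l1 - l2) = xA + xB - xC - t"
   using m t unfolding s_def by Groebner_Basis.algebra
  have "xA * xB + xA * m + xB * m = A - 2 * l1 * n1" "m * xC + m * t + xC * t = A - 2 * l2 * n2"
   using c by auto
  then have "xA * xB - xC * t = - 2 * l1 * n1 + 2 * l2 * n2 - m * (s * (l1 - l2))"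
   unfolding e1 by Groebner_Basis.algebra
  also have "\<dots> = - 2 * l1 * n1 + 2 * l2 * n2 + (n1 + n2) * (l1 - l2)"
   unfolding sm by (simp add: algebra_simps)
  also have "\<dots> = - (s * (n1 - n2))" unfolding s_def by (simp add: algebra_simps)
  finally have e2: "s * (n1 - n2) = xC * t - xA * xB" by (simp add: algebra_simps)
  have e3: "l1 * xC + n1 - (l2 * xC + n2) = (l1 - l3) * (xC - xB)"
   using yB yC by Groebner_Basis.algebra
  have "s * ((l1 - l3) * (xC - xB)) = s * (l1 - l2) * xC + s * (n1 - n2)"
   unfolding e3[symmetric] by (simp add: algebra_simps)
  also have "\<dots> = (xC - xB) * (xA - xC)" unfolding e1 e2 by (simp add: algebra_simps)
  finally have "(xC - xB) * (xA - xC - s * (l1 - l3)) = 0" by (simp add: algebra_simps)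
  then show ?thesis using False by simp
 next
  case True
  \<comment> \<open>Now B = C and the third line is the tangent at B. The derivative of the cubic at
    xB is computed along the tangent and along the line through A and B; \<open>nd\<close> supplies
    the factor xB - m to be cancelled.\<close>
  then have "m ~= xB" using nd by simp
  moreover have h1: "3 * xB ^ 2 + A - 2 * l1 * (l1 * xB + n1) = (xB - xA) * (xB - m)"
   using c1 unfolding cut_def by Groebner_Basis.algebra
  moreover have h2: "3 * xB ^ 2 + A = 2 * l3 * (l3 * xB + n3)"
   using c3 unfolding cut_def True by Groebner_Basis.algebra
  moreover have "2 * (l1 * xB + n1) = s * (xB - m)"
   using sm yB yC True unfolding s_def by Groebner_Basis.algebra
  moreover have "2 * l3 * (l3 * xB + n3) - 2 * l1 * (l1 * xB + n1) = (l3 - l1) * (2 * (l1 * xB + n1))"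
   unfolding yB by (simp add: algebra_simps)
  ultimately have "(l3 - l1) * (s * (xB - m)) = (xB - xA) * (xB - m)" by metis
  then have "(xB - m) * (xA - xC - s * (l1 - l3)) = 0"
   unfolding True by Groebner_Basis.algebra
  then show ?thesis using \<open>m ~= xB\<close> by simp
 qed
 have l: "l4 = s - l3" "n4 = - n3 - s * n" by (simp_all add: l4_def n4_def s_def)
 have mn: "xA - xC - n + m = l1 ^ 2 - l3 ^ 2" using m n by Groebner_Basis.algebra
 have nm: "n - m = (l1 - l3) * (l2 - l3)" using key mn unfolding s_def by Groebner_Basis.algebra
 have tB: "t - xB = s * (l2 - l3)" using nm t n unfolding s_def by Groebner_Basis.algebra
 have u1: "l1 * xC + n1 + l3 * xC + n3 = s * (xC - m)"
  using sm yC unfolding s_def by Groebner_Basis.algebra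
 show l4A: "l4 * xA + n4 = l1 * xA + n1"
  using u1 key mn unfolding l by Groebner_Basis.algebra
 show l4n: "l4 * n + n4 = - (l3 * n + n3)" unfolding l by (simp add: algebra_simps)
 show l4t: "l4 * t + n4 = l2 * t + n2"
  using sm yB nm tB unfolding l s_def by Groebner_Basis.algebra
 have sum: "xA + n + t = l4 ^ 2" using key n tB unfolding l s_def by Groebner_Basis.algebra
 have nt: "n * t = xB * m + (l1 - l4) * (n1 + n4)"
  using nm tB yB unfolding l s_def by Groebner_Basis.algebra
 show "cut l4 n4 xA n t"
  unfolding cut_def
 proof (intro conjI)
  show "xA + n + t = l4 ^ 2" by (rule sum)
  have "A = 2 * l1 * n1 + xA * (l1 ^ 2 - xA) + xB * m" using c1 unfolding cut_def by Groebner_Basis.algebra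
  then show "xA * n + xA * t + n * t = A - 2 * l4 * n4"
   using sum nt l4A by Groebner_Basis.algebra
  have "B = n1 ^ 2 - xA * xB * m" using c1 unfolding cut_def by Groebner_Basis.algebra
  then show "xA * n * t = n4 ^ 2 - B" using nt l4A by Groebner_Basis.algebra
 qed
qed

text \<open>After cancellation has settled the cases with a neutral sum, the side condition of
  \<open>assoc_generic\<close> remains: if Q = R, then P + Q has another abscissa than Q. Otherwise
  P + Q = Q, which makes P neutral, or P + Q = -R, which makes the sum of all three neutral.\<close>

lemma add_assoc:
 assumes PQR: "P \<in> ec W" "Q \<in> ec W" "R \<in> ec W"
 shows "ec_add W (ec_add W P Q) R = ec_add W P (ec_add W Q R)"
proof -
 note comm = ec_add_comm[of _ W]
 have cl [simp]: "ec_neg W U \<in> ec W" "ec_add W U V \<in> ec W" if "U \<in> ec W" "V \<in> ec W" for U V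
  using that ec_neg_ec add_closed by blast+
 have cl1 [simp]: "ec_neg W U \<in> ec W" if "U \<in> ec W" for U using that ec_neg_ec by blast
 have canc: "ec_add W U (ec_add W (ec_neg W U) V) = V" if "U \<in> ec W" "V \<in> ec W" for U V
  using add_cancel[of V "ec_neg W U"] comm that by (metis cl1 add_closed ec_neg_neg)
 show ?thesis
 proof (rule add_cases[OF PQR(1,2)])
  assume "Q = ec_neg W P" then show ?thesis using canc PQR by simp
 next
  fix l1 n1 xA xB m
  assume 1: "cut l1 n1 xA xB m" "P = Affine xA (l1 * xA + n1)" "Q = Affine xB (l1 * xB + n1)"
   "ec_add W P Q = Affine m (- (l1 * m + n1))"
  show ?thesis
  proof (rule add_cases[OF PQR(2,3)])
   assume R: "R = ec_neg W Q" then show ?thesis using add_cancel[OF PQR(1,2)] by simp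
  next
   fix l3 n3 xB' xC n
   assume 3: "cut l3 n3 xB' xC n" "Q = Affine xB' (l3 * xB' + n3)" "R = Affine xC (l3 * xC + n3)"
    "ec_add W Q R = Affine n (- (l3 * n + n3))"
   have xB': "xB' = xB" "l1 * xB + n1 = l3 * xB + n3" using 1 3 by auto
   show ?thesis
   proof (rule add_cases[OF add_closed[OF PQR(1,2)] PQR(3)])
    assume R: "R = ec_neg W (ec_add W P Q)"
    have "ec_add W Q R = ec_add W Q (ec_add W (ec_neg W Q) (ec_neg W P))"
     unfolding R using neg_add comm PQR by simp
    also have "\<dots> = ec_neg W P" using canc PQR by simp
    finally show ?thesis unfolding R by simp
   next
    fix l2 n2 m' xC' t
    assume 2: "cut l2 n2 m' xC' t" "ec_add W P Q = Affine m' (l2 * m' + n2)" "R = Affine xC' (l2 * xC' + n2)"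
     "ec_add W (ec_add W P Q) R = Affine t (- (l2 * t + n2))"
    have eqs: "m' = m" "xC' = xC" "l2 * m + n2 = - (l1 * m + n1)" "l2 * xC + n2 = l3 * xC + n3"
     using 1 2 3 by auto
    have M: "l1 * m + n1 = - (l2 * m + n2)" unfolding eqs by simp
    show ?thesis
    proof (cases "ec_add W Q R = ec_neg W P")
     case True
     have "ec_add W P Q = ec_add W P (ec_add W (ec_add W Q R) (ec_neg W R))"
      using add_cancel PQR by simp
     also have "\<dots> = ec_neg W R" unfolding True using canc PQR by simp
     finally have "ec_add W (ec_add W P Q) R = Infinity"
      using comm[of "ec_neg W R" R] PQR by simp
     then show ?thesis unfolding True by simp
    next
     case False
     have "m ~= xB" if "xB = xC"
     proof
      assume "m = xB"
      have QR: "R = Q" using that 1 3 xB' by simp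
      have "ec_add W P Q \<in> {Q, ec_neg W Q}"
       using 1 \<open>m = xB\<close> on_ec_same_x[of W xB "l1 * xB + n1" "- (l1 * xB + n1)"] by auto
      then consider "ec_add W P Q = Q" | "ec_add W P Q = ec_neg W R" using QR by auto
      then show False
      proof cases
       case 1
       then have "P = ec_add W Q (ec_neg W Q)" using add_cancel[OF PQR(1,2)] by simp
       then show False using \<open>P = Affine xA (l1 * xA + n1)\<close> by simp
      next
       case 2
       then have "ec_add W (ec_add W P Q) R = Infinity"
        using comm[of "ec_neg W R" R] PQR by simp
       then show False using \<open>ec_add W (ec_add W P Q) R = Affine t (- (l2 * t + n2))\<close> by simp
      qed
     qed
     note g = assoc_generic[OF 1(1) 2(1)[unfolded eqs] 3(1)[unfolded xB'(1)] M xB'(2) eqs(4) this]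
     from cut_add[OF g(1)] show ?thesis
      using 1 2 3 g(2-4) by simp
    qed
   next
    assume "ec_add W P Q = Infinity" then show ?thesis using 1(4) by simp
   next
    assume "R = Infinity" then show ?thesis by simp
   qed
  next
   assume "Q = Infinity" then show ?thesis by simp
  next
   assume "R = Infinity" then show ?thesis by simp
  qed
 qed auto
qed

end

section \<open>Changes of variables and general Weierstrass equations\<close>

definition cv :: "complex => complex => complex => complex => complex point => complex point"
 where "cv u r s t P = (case P of Infinity => Infinity
  | Affine x y => Affine ((x - r) / u ^ 2) ((y - s * (x - r) - t) / u ^ 3))"

lemma cv_simps [simp]: "cv u r s t Infinity = Infinity"
 "cv u r s t (Affine x y) = Affine ((x - r) / u ^ 2) ((y - s * (x - r) - t) / u ^ 3)"
 by (simp_all add: cv_def)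

definition c6 :: "'a::comm_ring_1 weierstrass => 'a"
 where "c6 W = - (b2 W ^ 3) + 36 * b2 W * b4 W - 216 * b6 W"

lemma disc_c4_c6: "1728 * disc W = c4 W ^ 3 - c6 W ^ 2" for W :: "complex weierstrass"
proof -
 have "4 * b8 W = b2 W * b6 W - b4 W ^ 2"
  by (simp add: b2_def b4_def b6_def b8_def power2_eq_square algebra_simps)
 then show ?thesis unfolding disc_def c4_def c6_def by Groebner_Basis.algebra
qed

lemma on_ec_diff: "on_ec W x y \<longleftrightarrow>
  y ^ 2 + a1 W * x * y + a3 W * y - x ^ 3 - a2 W * x ^ 2 - a4 W * x - a6 W = 0"
 unfolding on_ec_def by Groebner_Basis.algebra

context
 fixes W W' :: "complex weierstrass" and u r s t :: complex
 assumes u: "u ~= 0" and W': "W' = change_variables u r s t W"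
begin

lemma cv_coeffs:
 "a1 W = u * a1 W' - 2 * s"
 "a2 W = u ^ 2 * a2 W' + s * a1 W - 3 * r + s ^ 2"
 "a3 W = u ^ 3 * a3 W' - r * a1 W - 2 * t"
 "a4 W = u ^ 4 * a4 W' + s * a3 W - 2 * r * a2 W + (t + r * s) * a1 W - 3 * r ^ 2 + 2 * s * t"
 "a6 W = u ^ 6 * a6 W' - r * a4 W - r ^ 2 * a2 W - r ^ 3 + t * a3 W + t ^ 2 + r * t * a1 W"
 using u unfolding W' change_variables_def by (simp_all add: algebra_simps)

lemma cv_b: "u ^ 2 * b2 W' = b2 W + 12 * r" "u ^ 4 * b4 W' = b4 W + r * b2 W + 6 * r ^ 2"
 "u ^ 6 * b6 W' = b6 W + 2 * r * b4 W + r ^ 2 * b2 W + 4 * r ^ 3"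
 unfolding b2_def b4_def b6_def using cv_coeffs by Groebner_Basis.algebra+

lemma cv_c4: "c4 W = u ^ 4 * c4 W'"
 unfolding c4_def using cv_b by Groebner_Basis.algebra

lemma cv_c6: "c6 W = u ^ 6 * c6 W'"
 unfolding c6_def using cv_b by Groebner_Basis.algebra

lemma cv_disc: "disc W = u ^ 12 * disc W'"
proof -
 have "1728 * disc W = u ^ 12 * (1728 * disc W')"
  unfolding disc_c4_c6 cv_c4 cv_c6 by Groebner_Basis.algebra
 then show ?thesis by simp
qed

lemma cv_on_ec_aux:
 "(u ^ 3 * y + s * u ^ 2 * x + t) ^ 2 + a1 W * (u ^ 2 * x + r) * (u ^ 3 * y + s * u ^ 2 * x + t)
   + a3 W * (u ^ 3 * y + s * u ^ 2 * x + t) - (u ^ 2 * x + r) ^ 3 - a2 W * (u ^ 2 * x + r) ^ 2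
   - a4 W * (u ^ 2 * x + r) - a6 W
  = u ^ 6 * (y ^ 2 + a1 W' * x * y + a3 W' * y - x ^ 3 - a2 W' * x ^ 2 - a4 W' * x - a6 W')"
 using cv_coeffs by Groebner_Basis.algebra

lemma cv_inv:
 obtains x' y' where "x = u ^ 2 * x' + r" "y = u ^ 3 * y' + s * u ^ 2 * x' + t"
  "cv u r s t (Affine x y) = Affine x' y'"
proof
 show "x = u ^ 2 * ((x - r) / u ^ 2) + r" using u by simp
 show "y = u ^ 3 * ((y - s * (x - r) - t) / u ^ 3) + s * u ^ 2 * ((x - r) / u ^ 2) + t" using u by simp
qed simp

lemma cv_ec: "cv u r s t P \<in> ec W' \<longleftrightarrow> P \<in> ec W"
proof (cases P)
 case (Affine x y)
 obtain x' y' where xy: "x = u ^ 2 * x' + r" "y = u ^ 3 * y' + s * u ^ 2 * x' + t"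
  "cv u r s t P = Affine x' y'" using cv_inv Affine by metis
 show ?thesis unfolding xy(3) unfolding Affine ec_simps on_ec_diff xy(1,2) cv_on_ec_aux using u by simp
qed simp

text \<open>\<open>cv\<close> inverts the substitution of \<open>change_variables\<close>, so slopes
  of chords and tangents transform by l = u l' + s; the coordinates of the sum follow from
  this.\<close>

lemma cv_ec_add:
 assumes PQ: "P \<in> ec W" "Q \<in> ec W"
 shows "cv u r s t (ec_add W P Q) = ec_add W' (cv u r s t P) (cv u r s t Q)"
proof (cases P)
 case (Affine x1 y1)
 obtain x1' y1' where p: "x1 = u ^ 2 * x1' + r" "y1 = u ^ 3 * y1' + s * u ^ 2 * x1' + t"
  "cv u r s t P = Affine x1' y1'" using cv_inv Affine by metis
 show ?thesis
 proof (cases Q)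
  case Q: (Affine x2 y2)
  obtain x2' y2' where q: "x2 = u ^ 2 * x2' + r" "y2 = u ^ 3 * y2' + s * u ^ 2 * x2' + t"
   "cv u r s t Q = Affine x2' y2'" using cv_inv Q by metis
  have xx: "x1 = x2 \<longleftrightarrow> x1' = x2'" using u by (auto simp: p q)
  have den: "y1 + y2 + a1 W * x2 + a3 W = u ^ 3 * (y1' + y2' + a1 W' * x2' + a3 W')" if "x1' = x2'"
   unfolding p q that using cv_coeffs(1,3) by Groebner_Basis.algebra
  show ?thesis
  proof (cases "x1 = x2 \<and> y1 + y2 + a1 W * x2 + a3 W = 0")
   case True
   then have "ec_add W P Q = Infinity" "ec_add W' (Affine x1' y1') (Affine x2' y2') = Infinity"
    using xx den u by (auto simp: Affine Q)
   then show ?thesis using p(3) q(3) by simp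
  next
   case False
   then have F': "\<not> (x1' = x2' \<and> y1' + y2' + a1 W' * x2' + a3 W' = 0)" using xx den u by auto
   define l where "l = ec_slope W x1 y1 x2 y2"
   define l' where "l' = ec_slope W' x1' y1' x2' y2'"
   have l: "l = u * l' + s"
   proof (cases "x1' = x2'")
    case True
    then have "x1 = x2" using xx by simp
    have "y2 = y1"
     using on_ec_same_x[of W x1 y1 y2] False \<open>x1 = x2\<close> PQ Affine Q by auto
    then have "y2' = y1'" using u True \<open>x1 = x2\<close> by (simp add: p q)
    define e where "e = 2 * y1' + a1 W' * x1' + a3 W'"
    have e: "2 * y1 + a1 W * x1 + a3 W = u ^ 3 * e" "e ~= 0"
     using den F' True \<open>y2 = y1\<close> \<open>y2' = y1'\<close> \<open>x1 = x2\<close> by (auto simp: e_def)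
    define d where "d = 3 * x1' ^ 2 + 2 * a2 W' * x1' + a4 W' - a1 W' * y1'"
    have d: "3 * x1 ^ 2 + 2 * a2 W * x1 + a4 W - a1 W * y1 = u ^ 4 * d + s * (u ^ 3 * e)"
     unfolding p d_def e_def using cv_coeffs by Groebner_Basis.algebra
    have "l = (u ^ 4 * d + s * (u ^ 3 * e)) / (u ^ 3 * e)"
     using \<open>x1 = x2\<close> e d by (simp add: l_def ec_slope_def)
    also have "d = l' * e" using True e(2) by (simp add: l'_def ec_slope_def d_def e_def)
    also have "u ^ 4 * (l' * e) + s * (u ^ 3 * e) = (u * l' + s) * (u ^ 3 * e)" by Groebner_Basis.algebra
    also have "\<dots> / (u ^ 3 * e) = u * l' + s" using u e(2) by simp
    finally show ?thesis .
   next
    case F: False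
    then have "l' * (x2' - x1') = y2' - y1'" "l * (x2 - x1) = y2 - y1"
     using xx unfolding l_def l'_def ec_slope_def by simp_all
    then have "u ^ 2 * (x2' - x1') * l = u ^ 2 * (x2' - x1') * (u * l' + s)"
     unfolding p q by Groebner_Basis.algebra
    then show ?thesis using u F by simp
   qed
   define x3 where "x3 = l ^ 2 + a1 W * l - a2 W - x1 - x2"
   define x3' where "x3' = l' ^ 2 + a1 W' * l' - a2 W' - x1' - x2'"
   have x3: "x3 = u ^ 2 * x3' + r"
    unfolding x3_def x3'_def p q l using cv_coeffs(1,2) by Groebner_Basis.algebra
   have y3: "l * (x1 - x3) - y1 - a1 W * x3 - a3 W
     = u ^ 3 * (l' * (x1' - x3') - y1' - a1 W' * x3' - a3 W') + s * u ^ 2 * x3' + t"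
    unfolding x3 p l using cv_coeffs(1,3) by Groebner_Basis.algebra
   have "ec_add W P Q = Affine x3 (l * (x1 - x3) - y1 - a1 W * x3 - a3 W)"
    using False by (simp add: Affine Q Let_def l_def x3_def)
   moreover have "ec_add W' (Affine x1' y1') (Affine x2' y2') =
     Affine x3' (l' * (x1' - x3') - y1' - a1 W' * x3' - a3 W')"
    using F' by (simp add: Let_def l'_def x3'_def)
   moreover have "cv u r s t (Affine x3 (l * (x1 - x3) - y1 - a1 W * x3 - a3 W)) =
     Affine x3' (l' * (x1' - x3') - y1' - a1 W' * x3' - a3 W')"
    unfolding cv_simps y3 unfolding x3 using u by simp
   ultimately show ?thesis using p(3) q(3) by simp
  qed
 qed auto
qed auto

lemma cv_inj: "inj (cv u r s t)"
proof (rule injI)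
 fix P Q assume "cv u r s t P = cv u r s t Q"
 then show "P = Q" using u by (cases P; cases Q) auto
qed

end

definition ec_group :: "complex weierstrass => complex point monoid"
 where "ec_group W = \<lparr>carrier = ec W, mult = ec_add W, one = Infinity\<rparr>"

lemma ec_group_simps [simp]: "carrier (ec_group W) = ec W" "mult (ec_group W) = ec_add W"
 "one (ec_group W) = Infinity"
 by (simp_all add: ec_group_def)

text \<open>Completing the square and then the cube. The values of r, s, t are stated explicitly
  because later uses need that they are rational for a rational curve, so that A and B are rational
  as well.\<close>

lemma short_form:
 assumes W: "disc W ~= 0"
 defines "r \<equiv> - b2 W / 12" and "s \<equiv> - a1 W / 2"
 defines "t \<equiv> - (a3 W + r * a1 W) / 2"
 shows "\<exists>A B. change_variables 1 r s t W = short A B \<and> short_curve A B"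
proof -
 define W' where "W' = change_variables 1 r s t W"
 have "a1 W' = 0" by (simp add: W'_def change_variables_def s_def)
 moreover have "12 * r = - b2 W" "2 * s = - a1 W" by (simp_all add: r_def s_def)
 then have "4 * (a2 W - s * a1 W + 3 * r - s ^ 2) = 0" unfolding b2_def by Groebner_Basis.algebra
 then have "a2 W - s * a1 W + 3 * r - s ^ 2 = 0" by (metis mult_eq_0_iff zero_neq_numeral)
 then have "a2 W' = 0" by (simp add: W'_def change_variables_def)
 moreover have "a3 W + r * a1 W + 2 * t = 0" by (simp add: t_def)
 then have "a3 W' = 0" by (simp add: W'_def change_variables_def)
 ultimately have "W' = short (a4 W') (a6 W')" by (simp add: short_def weierstrass.expand)
 moreover have "disc W' ~= 0" using cv_disc[of 1 W' r s t W] W by (simp add: W'_def)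
 ultimately have "disc (short (a4 W') (a6 W')) ~= 0" by metis
 then have "short_curve (a4 W') (a6 W')" unfolding short_curve_def disc_short
  by (metis mult_zero_right)
 then show ?thesis using \<open>W' = short (a4 W') (a6 W')\<close> unfolding W'_def by metis
qed

lemma comm_group_ec_group:
 assumes W: "disc W ~= 0"
 shows "comm_group (ec_group W)"
proof -
 obtain r s t A B where cv: "short A B = change_variables 1 r s t W" and "short_curve A B"
  using short_form[OF W] by metis
 interpret short_curve A B by fact
 let ?c = "cv 1 r s t"
 note c = cv_ec[OF one_neq_zero cv] cv_ec_add[OF one_neq_zero cv]
 have cl: "ec_add W P Q \<in> ec W" if "P \<in> ec W" "Q \<in> ec W" for P Q
  using that c(1) c(2)[OF that] add_closed[of "?c P" "?c Q"] by metis
 have assoc: "ec_add W (ec_add W P Q) R = ec_add W P (ec_add W Q R)"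
  if "P \<in> ec W" "Q \<in> ec W" "R \<in> ec W" for P Q R
 proof -
  have "?c (ec_add W (ec_add W P Q) R) = ?c (ec_add W P (ec_add W Q R))"
   using that c(1) c(2) cl add_assoc[of "?c P" "?c Q" "?c R"] by metis
  then show ?thesis using cv_inj[OF one_neq_zero] by (metis injD)
 qed
 show ?thesis
 proof (rule comm_groupI)
  fix P assume P: "P \<in> carrier (ec_group W)"
  show "\<exists>Q\<in>carrier (ec_group W). Q \<otimes>\<^bsub>ec_group W\<^esub> P = \<one>\<^bsub>ec_group W\<^esub>"
   using P ec_add_comm[of P W "ec_neg W P"] ec_neg_ec[of P W] by (intro bexI[of _ "ec_neg W P"]) auto
 qed (use cl assoc ec_add_comm in auto)
qed

lemma inv_ec_group:
 assumes "disc W ~= 0" "P \<in> ec W"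
 shows "inv\<^bsub>ec_group W\<^esub> P = ec_neg W P"
proof -
 interpret comm_group "ec_group W" by (rule comm_group_ec_group) fact
 show ?thesis using assms ec_neg_ec[of P W] by (intro inv_equality) (auto simp: ec_add_comm[of "ec_neg W P"])
qed

section \<open>Rational functions and multiplication by n\<close>

definition rat_poly :: "complex poly => bool"
 where "rat_poly q \<longleftrightarrow> (\<forall>i. coeff q i \<in> \<rat>)"

lemma rat_poly_simps [simp]:
 "rat_poly 0" "rat_poly 1" "c \<in> \<rat> ==> rat_poly q ==> rat_poly (pCons c q)"
 by (auto simp: rat_poly_def coeff_pCons split: nat.splits)

lemma rat_poly_ops:
 assumes "rat_poly q" "rat_poly r"
 shows "rat_poly (q + r)" "rat_poly (q - r)" "rat_poly (q * r)"
 using assms by (auto simp: rat_poly_def coeff_mult intro!: Rats_sum Rats_mult)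

lemma rat_poly_root_algebraic:
 assumes "rat_poly q" "q ~= 0" "poly q x = 0"
 shows "algebraic x"
 using assms algebraicI'[of q x] by (auto simp: rat_poly_def)

text \<open>Agreement is required only off a finite set. Thus the value of a division by zero and
  the finitely many abscissas where an addition formula degenerates never have to be
  tracked.\<close>

definition rat_fun :: "(complex => complex) => bool"
 where "rat_fun F \<longleftrightarrow> (\<exists>N D. rat_poly N \<and> rat_poly D \<and> D ~= 0 \<and>
  (\<forall>\<^sub>F x in cofinite. poly D x ~= 0 \<and> F x = poly N x / poly D x))"

lemma poly_cofinite: "D ~= 0 ==> \<forall>\<^sub>F x in cofinite. poly D x ~= 0" for D :: "complex poly"
 using poly_roots_finite[of D] by (simp add: eventually_cofinite)

lemma rat_funI:
 assumes "rat_poly N" "rat_poly D" "D ~= 0" "\<forall>\<^sub>F x in cofinite. poly D x ~= 0 --> F x = poly N x / poly D x"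
 shows "rat_fun F"
 unfolding rat_fun_def
proof (intro exI conjI)
 show "\<forall>\<^sub>F x in cofinite. poly D x ~= 0 \<and> F x = poly N x / poly D x"
  using assms(4) poly_cofinite[OF assms(3)] by eventually_elim auto
qed (use assms in auto)

lemma rat_fun_poly: "rat_poly q ==> rat_fun (\<lambda>x. poly q x)"
 by (rule rat_funI[of q 1]) auto

lemma rat_fun_ops:
 assumes "rat_fun F" "rat_fun G"
 shows "rat_fun (\<lambda>x. F x + G x)" "rat_fun (\<lambda>x. F x - G x)" "rat_fun (\<lambda>x. F x * G x)" "rat_fun (\<lambda>x. F x / G x)"
proof -
 from assms obtain N D N' D' where
  N: "rat_poly N" "rat_poly D" "D ~= 0" "\<forall>\<^sub>F x in cofinite. poly D x ~= 0 \<and> F x = poly N x / poly D x" and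
  N': "rat_poly N'" "rat_poly D'" "D' ~= 0" "\<forall>\<^sub>F x in cofinite. poly D' x ~= 0 \<and> G x = poly N' x / poly D' x"
  unfolding rat_fun_def by blast
 have ev: "\<forall>\<^sub>F x in cofinite. P x"
  if "\<And>x. poly D x ~= 0 ==> poly D' x ~= 0 ==> F x = poly N x / poly D x ==> G x = poly N' x / poly D' x ==> P x" for P
  using N(4) N'(4) by eventually_elim (use that in auto)
 show "rat_fun (\<lambda>x. F x + G x)"
  by (rule rat_funI[of "N * D' + N' * D" "D * D'"], simp_all add: rat_poly_ops N N')
    (rule ev, simp add: add_frac_eq diff_frac_eq)
 show "rat_fun (\<lambda>x. F x - G x)"
  by (rule rat_funI[of "N * D' - N' * D" "D * D'"], simp_all add: rat_poly_ops N N')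
    (rule ev, simp add: add_frac_eq diff_frac_eq)
 show "rat_fun (\<lambda>x. F x * G x)"
  by (rule rat_funI[of "N * N'" "D * D'"]) (use N N' in \<open>auto simp: rat_poly_ops intro!: ev\<close>)
 show "rat_fun (\<lambda>x. F x / G x)"
 proof (cases "N' = 0")
  case False
  show ?thesis
   by (rule rat_funI[of "N * D'" "D * N'"]) (use N N' False in \<open>auto simp: rat_poly_ops intro!: ev\<close>)
 next
  case True
  show ?thesis
   by (rule rat_funI[of 0 1]) (use True in \<open>auto intro!: ev\<close>)
 qed
qed

text \<open>Turns a nonzero limit at infinity into nonvanishing off a finite set; this is how the
  denominators of the addition formulas are controlled.\<close>

lemma rat_fun_cases:
 assumes "rat_fun F"
 shows "(\<forall>\<^sub>F x in cofinite. F x = 0) \<or> (\<forall>\<^sub>F x in cofinite. F x ~= 0)"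
proof -
 from assms obtain N D where N: "\<forall>\<^sub>F x in cofinite. poly D x ~= 0 \<and> F x = poly N x / poly D x"
  unfolding rat_fun_def by metis
 show ?thesis
 proof (cases "N = 0")
  case True
  then show ?thesis using N by (auto elim: eventually_mono)
 next
  case False
  have "\<forall>\<^sub>F x in cofinite. F x ~= 0" using N poly_cofinite[OF False] by eventually_elim auto
  then show ?thesis ..
 qed
qed

lemma cofinite_infinity: "eventually P cofinite ==> eventually P at_infinity" for P :: "complex => bool"
proof -
 assume "eventually P cofinite"
 then have "finite {x. \<not> P x}" by (simp add: eventually_cofinite)
 then have "bounded {x. \<not> P x}" by (rule finite_imp_bounded)
 then obtain b where "\<And>x. \<not> P x ==> norm x \<le> b" by (auto simp: bounded_iff)
 then have "P x" if "norm x \<ge> b + 1" for x using that by force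
 then show ?thesis unfolding eventually_at_infinity by blast
qed

lemma cofinite_open: "eventually P cofinite ==> \<exists>S. open S \<and> finite (- S) \<and> (\<forall>x\<in>S. P x)" for P :: "complex => bool"
 by (rule exI[of _ "- {x. \<not> P x}"]) (auto simp: eventually_cofinite intro: finite_imp_closed)

lemma cofinite_nhds:
 fixes P :: "complex => bool"
 assumes "eventually P cofinite" shows "\<forall>\<^sub>F x in cofinite. eventually P (nhds x)"
proof -
 obtain S where S: "open S" "finite (- S)" "\<forall>x\<in>S. P x" using cofinite_open[OF assms] by metis
 have "eventually P (nhds x)" if "x \<in> S" for x using S that by (auto simp: eventually_nhds)
 then have "{x. \<not> eventually P (nhds x)} \<subseteq> - S" by auto
 then show ?thesis using S(2) by (auto simp: eventually_cofinite intro: finite_subset)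
qed

lemma rat_fun_differentiable:
 assumes "rat_fun F" shows "\<forall>\<^sub>F x in cofinite. F field_differentiable (at x)"
proof -
 from assms obtain N D where N: "\<forall>\<^sub>F x in cofinite. poly D x ~= 0 \<and> F x = poly N x / poly D x"
  unfolding rat_fun_def by metis
 from cofinite_nhds[OF N] show ?thesis
 proof eventually_elim
  case (elim x)
  then have "poly D x ~= 0" using eventually_nhds_x_imp_x by force
  then have "(\<lambda>x. poly N x / poly D x) field_differentiable (at x)"
   by (intro field_differentiable_divide) (auto simp: field_differentiable_def intro: poly_DERIV)
  moreover have "\<forall>\<^sub>F y in nhds x. poly N y / poly D y = F y" using elim by eventually_elim auto
  ultimately show ?case unfolding field_differentiable_def
   by (metis DERIV_cong_ev)
 qed
qed

section \<open>Multiplication by n as a pair of rational functions\<close>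

context short_curve
begin

abbreviation f :: "complex => complex" where "f x \<equiv> x ^ 3 + A * x + B"
abbreviation G :: "complex point monoid" where "G \<equiv> ec_group W"

text \<open>Multiplication by n is (x, y) -> (R x, y S x). The clause on the derivative says that it
  pulls the invariant differential dx / y back to n dx / y; the equation after it says that the
  image lies on the curve. The limits record R ~ x / n^2 and S ~ 1 / n^3, from which a quotient of
  leading coefficients is read off later.\<close>

definition mul_fun :: "nat => (complex => complex) => (complex => complex) => bool"
 where "mul_fun n R S \<longleftrightarrow> rat_fun R \<and> rat_fun S \<and>
  (\<forall>\<^sub>F x in cofinite. (\<forall>y. y ^ 2 = f x --> Affine x y [^]\<^bsub>G\<^esub> n = Affine (R x) (y * S x)) \<and>
   (R has_field_derivative of_nat n * S x) (at x) \<and> f (R x) = f x * S x ^ 2) \<and>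
  ((\<lambda>x. R x / x) \<longlongrightarrow> 1 / of_nat n ^ 2) at_infinity \<and> (S \<longlongrightarrow> 1 / of_nat n ^ 3) at_infinity"

lemma group_G: "comm_group G"
 by (rule comm_group_ec_group)
   (use nonsing in \<open>metis disc_short mult_eq_0_iff neg_equal_0_iff_equal zero_neq_numeral\<close>)

lemma f_cofinite: "\<forall>\<^sub>F x in cofinite. f x ~= 0"
 using poly_cofinite[of "[:B, A, 0, 1:]"] by (simp add: algebra_simps power3_eq_cube)

lemma infinity_ne: "\<forall>\<^sub>F x in at_infinity. x ~= (c::complex)"
 by (rule cofinite_infinity) (simp add: eventually_cofinite)

lemma inverse_infinity: "((\<lambda>x::complex. c / x ^ Suc k) \<longlongrightarrow> 0) at_infinity"
proof -
 have "((\<lambda>x::complex. c * inverse x ^ Suc k) \<longlongrightarrow> c * 0 ^ Suc k) at_infinity"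
  by (intro tendsto_mult tendsto_const tendsto_power tendsto_inverse_0)
 then show ?thesis by (simp add: divide_inverse power_inverse)
qed

lemma inverse_infinity': "((\<lambda>x::complex. c / x ^ 2) \<longlongrightarrow> 0) at_infinity" "((\<lambda>x::complex. c / x ^ 3) \<longlongrightarrow> 0) at_infinity"
proof -
 have "Suc 1 = 2" "Suc 2 = 3" by simp_all
 then show "((\<lambda>x::complex. c / x ^ 2) \<longlongrightarrow> 0) at_infinity" "((\<lambda>x::complex. c / x ^ 3) \<longlongrightarrow> 0) at_infinity"
  using inverse_infinity[of c 1] inverse_infinity[of c 2] by metis+
qed

lemma f_infinity: "((\<lambda>x. f x / x ^ 3) \<longlongrightarrow> 1) at_infinity"
proof -
 have "((\<lambda>x. 1 + A / x ^ 2 + B / x ^ 3) \<longlongrightarrow> 1 + 0 + 0) at_infinity"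
  by (intro tendsto_add tendsto_const inverse_infinity')
 moreover have "\<forall>\<^sub>F x in at_infinity. 1 + A / x ^ 2 + B / x ^ 3 = f x / x ^ 3"
  using infinity_ne[of 0] by eventually_elim (simp add: add_divide_distrib power2_eq_square power3_eq_cube)
 ultimately show ?thesis using Lim_transform_eventually by fastforce
qed

lemma df_infinity: "((\<lambda>x. (3 * x ^ 2 + A) / x ^ 2) \<longlongrightarrow> 3) at_infinity"
proof -
 have "((\<lambda>x. 3 + A / x ^ 2) \<longlongrightarrow> 3 + 0) at_infinity"
  by (intro tendsto_add tendsto_const inverse_infinity')
 moreover have "\<forall>\<^sub>F x in at_infinity. 3 + A / x ^ 2 = (3 * x ^ 2 + A) / x ^ 2"
  using infinity_ne[of 0] by eventually_elim (simp add: add_divide_distrib)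
 ultimately show ?thesis using Lim_transform_eventually by fastforce
qed

lemma rat_fun_f:
 assumes "A \<in> \<rat>" "B \<in> \<rat>"
 shows "rat_fun f" "rat_fun (\<lambda>x. 3 * x ^ 2 + A)" "rat_fun (\<lambda>x. x)" "c \<in> \<rat> ==> rat_fun (\<lambda>_. c)"
proof -
 show "rat_fun f" using rat_fun_poly[of "[:B, A, 0, 1:]"] assms by (simp add: algebra_simps power3_eq_cube)
 show "rat_fun (\<lambda>x. 3 * x ^ 2 + A)" using rat_fun_poly[of "[:A, 0, 3:]"] assms by (simp add: algebra_simps power2_eq_square)
 show "rat_fun (\<lambda>x. x)" using rat_fun_poly[of "[:0, 1:]"] by simp
 show "rat_fun (\<lambda>_. c)" if "c \<in> \<rat>" using rat_fun_poly[of "[:c:]"] that by simp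
qed

lemma mul_fun_1:
 assumes "A \<in> \<rat>" "B \<in> \<rat>"
 shows "mul_fun 1 (\<lambda>x. x) (\<lambda>_. 1)"
proof -
 interpret G: comm_group G by (rule group_G)
 have "((\<lambda>x::complex. x / x) \<longlongrightarrow> 1) at_infinity"
  by (rule tendsto_eventually) (use infinity_ne[of 0] in \<open>auto elim: eventually_mono\<close>)
 moreover have "Affine x y [^]\<^bsub>G\<^esub> (1::nat) = Affine x y" if "y ^ 2 = f x" for x y
  using that G.nat_pow_eone[of "Affine x y"] by (simp add: on_short)
 ultimately show ?thesis
  unfolding mul_fun_def using rat_fun_f[OF assms] by auto
qed

text \<open>Doubling is a base case of its own because the chord formula in
  \<open>mul_fun_Suc\<close> divides by R x - x, which is identically zero for n = 1.\<close>

lemma mul_fun_2: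
 assumes "A \<in> \<rat>" "B \<in> \<rat>"
 defines "R \<equiv> (\<lambda>x. (3 * x ^ 2 + A) ^ 2 / (4 * f x) - 2 * x)"
 defines "S \<equiv> (\<lambda>x. (3 * x ^ 2 + A) * (x - R x) / (2 * f x) - 1)"
 shows "mul_fun 2 R S"
proof -
 interpret G: comm_group G by (rule group_G)
 note rf = rat_fun_f[OF assms(1,2)]
 have R: "rat_fun R" unfolding R_def power2_eq_square[of "3 * _ ^ 2 + A"] by (intro rat_fun_ops rf) auto
 have S: "rat_fun S" unfolding S_def by (intro rat_fun_ops rf R) auto
 have cub: "(x - a)^2 * (x - a) = (x-a)^3" for x a :: complex by (simp add: power2_eq_square power3_eq_cube)
 have "\<forall>\<^sub>F x in cofinite. (\<forall>y. y ^ 2 = f x --> Affine x y [^]\<^bsub>G\<^esub> (2::nat) = Affine (R x) (y * S x)) \<and>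
   (R has_field_derivative of_nat 2 * S x) (at x) \<and> f (R x) = f x * S x ^ 2"
  using f_cofinite
 proof eventually_elim
  case (elim x)
  have dbl: "Affine x y [^]\<^bsub>G\<^esub> (2::nat) = Affine (R x) (y * S x)" if y: "y ^ 2 = f x" for y
  proof -
   have y0: "y ~= 0" using y elim by auto
   have "Affine x y [^]\<^bsub>G\<^esub> (2::nat) = ec_add W (Affine x y) (Affine x y)"
    using G.nat_pow_Suc[of "Affine x y" 1] G.nat_pow_eone[of "Affine x y"] y
    by (simp add: on_short numeral_2_eq_2)
   also define l where "l = (3 * x ^ 2 + A) / (2 * y)"
   have "ec_add W (Affine x y) (Affine x y) = Affine (l ^ 2 - x - x) (l * (x - (l ^ 2 - x - x)) - y)"
    using y0 by (simp add: l_def ec_slope_def Let_def)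
   also have "l ^ 2 - x - x = R x"
    unfolding R_def l_def y[symmetric] by (simp add: power_divide power_mult_distrib)
   also have "l * (x - R x) - y = y * S x"
    unfolding S_def y[symmetric] l_def using y0 by (simp add: field_simps power2_eq_square)
   finally show ?thesis .
  qed
  moreover have "(R has_field_derivative of_nat 2 * S x) (at x)"
  proof -
   have Df: "(f has_field_derivative 3 * x ^ 2 + A) (at x)"
    and Dd: "((\<lambda>x. 3 * x ^ 2 + A) has_field_derivative 6 * x) (at x)"
    by (auto intro!: derivative_eq_intros)
   have eq: "(of_nat 2 * (6 * x * d ^ (2 - Suc 0)) * (4 * g) - d ^ 2 * (4 * d)) / (4 * g * (4 * g)) - 2
    = of_nat 2 * (d * (x - (d ^ 2 / (4 * g) - 2 * x)) / (2 * g) - 1)" if "g ~= 0" for d g :: complex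
    using that by (simp add: field_simps power2_eq_square power3_eq_cube)
   have "4 * f x ~= 0" using elim by (metis mult_eq_0_iff zero_neq_numeral)
   from DERIV_diff[OF DERIV_divide[OF DERIV_power[OF Dd, of 2] DERIV_cmult[OF Df, of 4] this] DERIV_cmult_Id[of 2]]
   show ?thesis unfolding eq[OF elim] R_def S_def .
  qed
  moreover have "f (R x) = f x * S x ^ 2"
  proof -
   define y where "y = csqrt (f x)"
   have y: "y ^ 2 = f x" by (simp add: y_def)
   have "Affine (R x) (y * S x) \<in> ec W" using dbl[OF y] G.nat_pow_closed[of "Affine x y" 2] y by (simp add: on_short)
   then show ?thesis using y by (simp add: on_short power_mult_distrib)
  qed
  ultimately show ?case by blast
 qed
 moreover have R_inf: "((\<lambda>x. R x / x) \<longlongrightarrow> 1 / of_nat 2 ^ 2) at_infinity"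
 proof -
  have eq: "(d / x ^ 2) ^ 2 / (4 * (g / x ^ 3)) - 2 = (d ^ 2 / (4 * g) - 2 * x) / x"
   if "x ~= 0" "g ~= 0" for d g x :: complex
   using that by (simp add: field_simps power2_eq_square power3_eq_cube)
  have "((\<lambda>x. ((3 * x ^ 2 + A) / x ^ 2) ^ 2 / (4 * (f x / x ^ 3)) - 2) \<longlongrightarrow> 3 ^ 2 / (4 * 1) - 2) at_infinity"
   by (intro tendsto_intros f_infinity df_infinity) auto
  moreover have "\<forall>\<^sub>F x in at_infinity. ((3 * x ^ 2 + A) / x ^ 2) ^ 2 / (4 * (f x / x ^ 3)) - 2 = R x / x"
   using infinity_ne[of 0] cofinite_infinity[OF f_cofinite]
   by eventually_elim (unfold R_def, rule eq)
  ultimately show ?thesis using Lim_transform_eventually by fastforce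
 qed
 moreover have "(S \<longlongrightarrow> 1 / of_nat 2 ^ 3) at_infinity"
 proof -
  have eq: "d / x ^ 2 * (1 - r / x) / (2 * (g / x ^ 3)) - 1 = d * (x - r) / (2 * g) - 1"
   if "x ~= 0" "g ~= 0" for d g x r :: complex
   using that by (simp add: field_simps power2_eq_square power3_eq_cube)
  have "((\<lambda>x. ((3 * x ^ 2 + A) / x ^ 2) * (1 - R x / x) / (2 * (f x / x ^ 3)) - 1) \<longlongrightarrow> 3 * (1 - 1 / of_nat 2 ^ 2) / (2 * 1) - 1) at_infinity"
   by (intro tendsto_intros f_infinity df_infinity R_inf) auto
  moreover have "\<forall>\<^sub>F x in at_infinity. ((3 * x ^ 2 + A) / x ^ 2) * (1 - R x / x) / (2 * (f x / x ^ 3)) - 1 = S x"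
   using infinity_ne[of 0] cofinite_infinity[OF f_cofinite]
   by eventually_elim (unfold S_def, rule eq)
  ultimately show ?thesis using Lim_transform_eventually by fastforce
 qed
 ultimately show ?thesis using R S unfolding mul_fun_def by blast
qed

text \<open>\<open>R'\<close> and \<open>S'\<close> come from the chord through n P and P. The
  derivative of \<open>R'\<close> involves that of S, for which no formula is at hand; it is
  eliminated by differentiating f (R x) = f x * S x ^ 2.\<close>

lemma mul_fun_Suc:
 assumes "A \<in> \<rat>" "B \<in> \<rat>" and RS: "mul_fun n R S" and n: "n \<ge> 2"
 defines "R' \<equiv> (\<lambda>x. f x * (S x - 1) ^ 2 / (R x - x) ^ 2 - R x - x)"
 defines "S' \<equiv> (\<lambda>x. (S x - 1) * (x - R' x) / (R x - x) - 1)"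
 shows "mul_fun (Suc n) R' S'"
proof -
 interpret G: comm_group G by (rule group_G)
 note rf = rat_fun_f[OF assms(1,2)]
 have RS': "rat_fun R" "rat_fun S"
  "\<forall>\<^sub>F x in cofinite. (\<forall>y. y ^ 2 = f x --> Affine x y [^]\<^bsub>G\<^esub> n = Affine (R x) (y * S x)) \<and>
   (R has_field_derivative of_nat n * S x) (at x) \<and> f (R x) = f x * S x ^ 2"
  "((\<lambda>x. R x / x) \<longlongrightarrow> 1 / of_nat n ^ 2) at_infinity" "(S \<longlongrightarrow> 1 / of_nat n ^ 3) at_infinity"
  using RS unfolding mul_fun_def by blast+
 have frac: "(a * q / m ^ 3) / (a * b / m ^ 2) = q / (m * b)" if "a ~= 0" "m ~= 0" for a m q b :: complex
  using that by (simp add: power2_eq_square power3_eq_cube)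
 have R': "rat_fun R'"
  unfolding R'_def power2_eq_square by (intro rat_fun_ops rf RS') auto
 have S': "rat_fun S'" unfolding S'_def by (intro rat_fun_ops rf RS' R') auto
 have n2: "of_nat n ^ 2 ~= (1::complex)" "(of_nat n :: complex) ~= 0"
 proof -
  have "of_nat n ^ 2 = (1::complex) \<longleftrightarrow> n ^ 2 = 1" by (metis of_nat_1 of_nat_eq_iff of_nat_power)
  then show "of_nat n ^ 2 ~= (1::complex)" using n by (auto simp: power2_eq_square)
 qed (use n in auto)
 \<comment> \<open>R x = x at almost all x would make the limit of R x / x equal to 1 instead of 1 /
   n^2.\<close>
 have Rx: "\<forall>\<^sub>F x in cofinite. R x - x ~= 0"
 proof (rule ccontr)
  assume "\<not> ?thesis"
  then have "\<forall>\<^sub>F x in cofinite. R x - x = 0"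
   using rat_fun_cases[of "\<lambda>x. R x - x"] rat_fun_ops(2)[OF RS'(1) rf(3)] by blast
  from cofinite_infinity[OF this] infinity_ne[of 0] have "\<forall>\<^sub>F x in at_infinity. R x / x = 1"
   by eventually_elim simp
  then have "((\<lambda>x. R x / x) \<longlongrightarrow> 1) at_infinity" by (rule tendsto_eventually)
  then have "1 / of_nat n ^ 2 = (1::complex)" using tendsto_unique RS'(4) trivial_limit_at_infinity by blast
  then show False using n2 by simp
 qed
 have S0: "\<forall>\<^sub>F x in cofinite. S x ~= 0"
 proof (rule ccontr)
  assume "\<not> ?thesis"
  then have "\<forall>\<^sub>F x in cofinite. S x = 0"
   using rat_fun_cases[OF RS'(2)] by blast
  then have "(S \<longlongrightarrow> 0) at_infinity" by (intro tendsto_eventually cofinite_infinity)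
  then have "1 / of_nat n ^ 3 = (0::complex)" using tendsto_unique RS'(5) trivial_limit_at_infinity by blast
  then show False using n by simp
 qed
 have "\<forall>\<^sub>F x in cofinite. (\<forall>y. y ^ 2 = f x --> Affine x y [^]\<^bsub>G\<^esub> Suc n = Affine (R' x) (y * S' x)) \<and>
   (R' has_field_derivative of_nat (Suc n) * S' x) (at x) \<and> f (R' x) = f x * S' x ^ 2"
  using f_cofinite RS'(3) cofinite_nhds[OF RS'(3)] Rx S0 rat_fun_differentiable[OF RS'(2)]
 proof eventually_elim
  case (elim x)
  have fR: "f (R x) = f x * S x ^ 2" using elim by blast
  have add: "Affine x y [^]\<^bsub>G\<^esub> Suc n = Affine (R' x) (y * S' x)" if y: "y ^ 2 = f x" for y
  proof -
   define l where "l = y * (S x - 1) / (R x - x)"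
   have sl: "ec_slope W (R x) (y * S x) x y = l"
    using elim by (simp add: l_def ec_slope_def frac_eq_eq algebra_simps)
   have l2: "l ^ 2 - R x - x = R' x"
    unfolding R'_def l_def y[symmetric] by (simp add: power_divide power_mult_distrib)
   have "l * (R x - x) = y * (S x - 1)" using elim by (simp add: l_def)
   then have "l * (R x - R' x) - y * S x = l * (x - R' x) - y" by (simp add: algebra_simps)
   then have l3: "l * (R x - R' x) - y * S x = y * S' x"
    unfolding S'_def l_def by (simp add: algebra_simps)
   have "Affine x y [^]\<^bsub>G\<^esub> Suc n = ec_add W (Affine (R x) (y * S x)) (Affine x y)"
    using elim y by (simp add: on_short)
   also have "\<dots> = Affine (l ^ 2 - R x - x) (l * (R x - (l ^ 2 - R x - x)) - y * S x)"
    using elim by (simp add: Let_def sl)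
   also have "\<dots> = Affine (R' x) (y * S' x)" unfolding l2 l3 ..
   finally show ?thesis .
  qed
  moreover have "(R' has_field_derivative of_nat (Suc n) * S' x) (at x)"
  proof -
   obtain s where s: "(S has_field_derivative s) (at x)"
    using elim by (auto simp: field_differentiable_def)
   have DR: "(R has_field_derivative of_nat n * S x) (at x)" using elim by blast
   have Df: "(f has_field_derivative 3 * z ^ 2 + A) (at z)" for z
    by (auto intro!: derivative_eq_intros)
   have d1: "((\<lambda>x. f (R x)) has_field_derivative (3 * R x ^ 2 + A) * (of_nat n * S x)) (at x)"
    using DERIV_chain2[OF Df DR] .
   have d2: "((\<lambda>x. f x * S x ^ 2) has_field_derivative (3 * x ^ 2 + A) * S x ^ 2 + of_nat 2 * (s * S x ^ (2 - Suc 0)) * f x) (at x)"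
    using DERIV_mult[OF Df DERIV_power[OF s, of 2]] .
   have ev: "\<forall>\<^sub>F x in nhds x. f (R x) = f x * S x ^ 2"
    using elim(3) by eventually_elim blast
   have "(3 * R x ^ 2 + A) * (of_nat n * S x) = (3 * x ^ 2 + A) * S x ^ 2 + of_nat 2 * (s * S x ^ (2 - Suc 0)) * f x"
    using DERIV_unique[OF DERIV_cong_ev[OF refl ev refl, THEN iffD1, OF d1] d2] .
   then have "S x * ((3 * R x ^ 2 + A) * of_nat n - (3 * x ^ 2 + A) * S x - 2 * s * f x) = 0"
    by (simp add: algebra_simps power2_eq_square)
   then have s': "2 * s * f x = (3 * R x ^ 2 + A) * of_nat n - (3 * x ^ 2 + A) * S x"
    using elim by simp
   have "R x - x ~= 0" using elim by simp
   then have r2: "(R x - x) ^ 2 ~= 0" by simp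
   note D = DERIV_diff[OF DERIV_diff[OF DERIV_divide[OF DERIV_mult[OF Df DERIV_power[OF DERIV_diff[OF s DERIV_const[of 1]], of 2]]
      DERIV_power[OF DERIV_diff[OF DR DERIV_ident], of 2] r2] DR] DERIV_ident]
   \<comment> \<open>Taylor expansions of the cubic between x and R x, about either end, with f (R
     x) - f x rewritten by means of S.\<close>
   have K1: "f x * (S x ^ 2 - 1) = (R x - x) * (3 * x ^ 2 + A) + (2 * x + R x) * (R x - x) ^ 2"
    and K2: "f x * (S x ^ 2 - 1) = (3 * R x ^ 2 + A) * (R x - x) - (2 * R x + x) * (R x - x) ^ 2"
    using fR by Groebner_Basis.algebra+
   \<comment> \<open>The derivative of the chord formula with everything replaced by variables: g is
     f x, df and dg are the derivatives of f at x and at R x, b is S x, a is S x - 1, z is R x, r is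
     R x - x, m is n.\<close>
   have eq: "(((df * a ^ 2 + of_nat 2 * ((s - 0) * a ^ (2 - Suc 0)) * g) * r ^ 2
      - g * a ^ 2 * (of_nat 2 * ((m * b - 1) * r ^ (2 - Suc 0)))) / (r ^ 2 * r ^ 2) - m * b - 1)
     = (m + 1) * (a * (x - (g * a ^ 2 / r ^ 2 - z - x)) / r - 1)"
    if r: "r ~= 0" "r = z - x" and a: "b = a + 1" and s: "2 * s * g = dg * m - df * b"
     and K: "g * (b ^ 2 - 1) = r * df + (2 * x + z) * r ^ 2" "g * (b ^ 2 - 1) = dg * r - (2 * z + x) * r ^ 2"
    for df a g r m b dg z s x :: complex
   proof -
    have c: "g * (2 * a * b - a ^ 2) = dg * r - r ^ 3 - (2 * x + z) * r ^ 2"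
     "g * (2 * a + a ^ 2) = df * r + (2 * x + z) * r ^ 2"
     using K a r(2) by Groebner_Basis.algebra+
    have "(df * a ^ 2 + 2 * (s * a) * g) * r ^ 2 - g * a ^ 2 * (2 * ((m * b - 1) * r)) - (m * b + 1) * r ^ 4
     = (df * a ^ 2 + a * (dg * m - df * b)) * r ^ 2 - g * a ^ 2 * (2 * ((m * b - 1) * r)) - (m * b + 1) * r ^ 4"
     unfolding s[symmetric] by Groebner_Basis.algebra
    also have "\<dots> = (m + 1) * (a * (2 * x + z) * r ^ 3 - g * a ^ 3 * r - r ^ 4)"
     using c a by Groebner_Basis.algebra
    finally have "((df * a ^ 2 + 2 * (s * a) * g) * r ^ 2 - g * a ^ 2 * (2 * ((m * b - 1) * r))) / r ^ 4 - (m * b + 1)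
     = (m + 1) * ((a * (2 * x + z) * r ^ 3 - g * a ^ 3 * r) / r ^ 4 - 1)"
     using r(1) by (simp add: field_simps)
    moreover have "(a * (2 * x + z) * r ^ 3 - g * a ^ 3 * r) / r ^ 4 = a * (x - (g * a ^ 2 / r ^ 2 - z - x)) / r"
     using r(1) by (simp add: field_simps power2_eq_square power3_eq_cube power4_eq_xxxx)
    ultimately show ?thesis by (simp add: diff_diff_eq flip: power_add)
   qed
   have "S x = S x - 1 + 1" by simp
   note eq' = eq[OF \<open>R x - x ~= 0\<close> refl this s' K1 K2]
   have "of_nat (Suc n) = of_nat n + (1::complex)" by simp
   then show ?thesis using D unfolding eq' R'_def S'_def by (simp only:)
  qed
  moreover have "f (R' x) = f x * S' x ^ 2"
  proof -
   define y where "y = csqrt (f x)"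
   have y: "y ^ 2 = f x" by (simp add: y_def)
   have "Affine (R' x) (y * S' x) \<in> ec W"
    using add[OF y] G.nat_pow_closed[of "Affine x y" "Suc n"] y by (simp only: on_short ec_simps ec_group_simps)
   then show ?thesis using y by (simp add: on_short power_mult_distrib)
  qed
  ultimately show ?case by blast
 qed
 moreover have R_inf: "((\<lambda>x. R' x / x) \<longlongrightarrow> 1 / of_nat (Suc n) ^ 2) at_infinity"
 proof -
  have "((\<lambda>x. (f x / x ^ 3) * (S x - 1) ^ 2 / (R x / x - 1) ^ 2 - R x / x - 1) \<longlongrightarrow>
    1 * (1 / of_nat n ^ 3 - 1) ^ 2 / (1 / of_nat n ^ 2 - 1) ^ 2 - 1 / of_nat n ^ 2 - 1) at_infinity"
   using n2 by (intro tendsto_intros f_infinity RS') (auto simp: divide_simps)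
  moreover have "1 * (1 / m ^ 3 - 1) ^ 2 / (1 / m ^ 2 - 1) ^ 2 - 1 / m ^ 2 - 1 = 1 / (m + 1) ^ 2"
   if "m ~= 0" "m ^ 2 ~= 1" for m :: complex
  proof -
   have "m ~= 1" "m + 1 ~= 0" using that by (auto simp: add_eq_0_iff2)
   have "1 / m ^ 3 - 1 = (1 - m) * (m ^ 2 + m + 1) / m ^ 3" using that by (simp add: field_simps power2_eq_square power3_eq_cube)
   moreover have "1 / m ^ 2 - 1 = (1 - m) * (m + 1) / m ^ 2" using that by (simp add: field_simps power2_eq_square)
   ultimately have "(1 / m ^ 3 - 1) / (1 / m ^ 2 - 1) = (m ^ 2 + m + 1) / (m * (m + 1))"
    using frac[of "1 - m" m "m ^ 2 + m + 1" "m + 1"] that \<open>m ~= 1\<close> by simp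
   then have "(1 / m ^ 3 - 1) ^ 2 / (1 / m ^ 2 - 1) ^ 2 = (m ^ 2 + m + 1) ^ 2 / (m * (m + 1)) ^ 2"
    by (metis power_divide)
   moreover have "(m ^ 2 + m + 1) ^ 2 / (m * (m + 1)) ^ 2 - 1 / m ^ 2 - 1 = 1 / (m + 1) ^ 2"
   proof -
    have "1 / m ^ 2 = (m + 1) ^ 2 / (m * (m + 1)) ^ 2" "1 = (m * (m + 1)) ^ 2 / (m * (m + 1)) ^ 2"
     "1 / (m + 1) ^ 2 = m ^ 2 / (m * (m + 1)) ^ 2"
     using that \<open>m + 1 ~= 0\<close> by (auto simp: power_mult_distrib)
    then have "(m ^ 2 + m + 1) ^ 2 / (m * (m + 1)) ^ 2 - 1 / m ^ 2 - 1
      = ((m ^ 2 + m + 1) ^ 2 - (m + 1) ^ 2 - (m * (m + 1)) ^ 2) / (m * (m + 1)) ^ 2"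
     by (metis diff_divide_distrib)
    also have "(m ^ 2 + m + 1) ^ 2 - (m + 1) ^ 2 - (m * (m + 1)) ^ 2 = m ^ 2" by Groebner_Basis.algebra
    finally show ?thesis using that \<open>m + 1 ~= 0\<close> by (simp add: power_mult_distrib)
   qed
   ultimately show ?thesis by simp
  qed
  ultimately have "((\<lambda>x. (f x / x ^ 3) * (S x - 1) ^ 2 / (R x / x - 1) ^ 2 - R x / x - 1) \<longlongrightarrow>
    1 / of_nat (Suc n) ^ 2) at_infinity" using n2 by (simp add: add.commute)
  moreover have eq: "g / x ^ 3 * a ^ 2 / (r / x - 1) ^ 2 - r / x - 1 = (g * a ^ 2 / (r - x) ^ 2 - r - x) / x"
   if "x ~= 0" "r - x ~= 0" for g a r x :: complex
  proof -
   have rx: "r / x - 1 = (r - x) / x" using that by (simp add: diff_divide_distrib)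
   have "g / x ^ 3 * a ^ 2 / ((r - x) / x) ^ 2 = g * a ^ 2 / (r - x) ^ 2 / x"
    using that by (simp add: power2_eq_square power3_eq_cube)
   then show ?thesis unfolding rx using that by (simp add: diff_divide_distrib)
  qed
  have "\<forall>\<^sub>F x in at_infinity. (f x / x ^ 3) * (S x - 1) ^ 2 / (R x / x - 1) ^ 2 - R x / x - 1 = R' x / x"
   using infinity_ne[of 0] cofinite_infinity[OF Rx]
   by eventually_elim (unfold R'_def, rule eq)
  ultimately show ?thesis using Lim_transform_eventually by fastforce
 qed
 moreover have "(S' \<longlongrightarrow> 1 / of_nat (Suc n) ^ 3) at_infinity"
 proof -
  have lim: "((\<lambda>x. (S x - 1) * (1 - R' x / x) / (R x / x - 1) - 1) \<longlongrightarrow>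
    (1 / of_nat n ^ 3 - 1) * (1 - 1 / of_nat (Suc n) ^ 2) / (1 / of_nat n ^ 2 - 1) - 1) at_infinity"
   using n2 by (intro tendsto_intros f_infinity RS' R_inf) (auto simp: divide_simps)
  have val: "(1 / m ^ 3 - 1) * (1 - 1 / (m + 1) ^ 2) / (1 / m ^ 2 - 1) - 1 = 1 / (m + 1) ^ 3"
   if "m ~= 0" "m ^ 2 ~= 1" for m :: complex
  proof -
   have "m ~= 1" "m + 1 ~= 0" using that by (auto simp: add_eq_0_iff2)
   have "1 / m ^ 3 - 1 = (1 - m) * (m ^ 2 + m + 1) / m ^ 3" using that by (simp add: field_simps power2_eq_square power3_eq_cube)
   moreover have "1 / m ^ 2 - 1 = (1 - m) * (m + 1) / m ^ 2" using that by (simp add: field_simps power2_eq_square)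
   ultimately have "(1 / m ^ 3 - 1) / (1 / m ^ 2 - 1) = (m ^ 2 + m + 1) / (m * (m + 1))"
    using frac[of "1 - m" m "m ^ 2 + m + 1" "m + 1"] that \<open>m ~= 1\<close> by simp
   moreover have "1 - 1 / (m + 1) ^ 2 = ((m + 1) ^ 2 - 1) / (m + 1) ^ 2"
    using \<open>m + 1 ~= 0\<close> by (simp add: diff_divide_distrib)
   then have "1 - 1 / (m + 1) ^ 2 = m * (m + 2) / (m + 1) ^ 2"
    by (simp add: algebra_simps power2_eq_square)
   moreover have "(1 / m ^ 3 - 1) * (1 - 1 / (m + 1) ^ 2) / (1 / m ^ 2 - 1) = (1 / m ^ 3 - 1) / (1 / m ^ 2 - 1) * (1 - 1 / (m + 1) ^ 2)"
    by simp
   ultimately have "(1 / m ^ 3 - 1) * (1 - 1 / (m + 1) ^ 2) / (1 / m ^ 2 - 1) = (m ^ 2 + m + 1) / (m * (m + 1)) * (m * (m + 2) / (m + 1) ^ 2)"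
    by metis
   also have "\<dots> = (m ^ 2 + m + 1) * (m + 2) / (m + 1) ^ 3" using that by (simp add: power2_eq_square power3_eq_cube)
   also have "(m ^ 2 + m + 1) * (m + 2) = (m + 1) ^ 3 + 1" by Groebner_Basis.algebra
   also have "\<dots> / (m + 1) ^ 3 = 1 + 1 / (m + 1) ^ 3" using \<open>m + 1 ~= 0\<close> by (simp add: add_divide_distrib)
   finally show ?thesis by simp
  qed
  have sn: "of_nat (Suc n) = of_nat n + (1::complex)" by simp
  have "((\<lambda>x. (S x - 1) * (1 - R' x / x) / (R x / x - 1) - 1) \<longlongrightarrow>
    1 / of_nat (Suc n) ^ 3) at_infinity" using lim unfolding sn val[OF n2(2,1)] .
  moreover have eq: "a * (1 - q / x) / (r / x - 1) - 1 = a * (x - q) / (r - x) - 1"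
   if "x ~= 0" "r - x ~= 0" for a q r x :: complex
  proof -
   have rx: "r / x - 1 = (r - x) / x" "1 - q / x = (x - q) / x" using that by (auto simp: diff_divide_distrib)
   show ?thesis unfolding rx using that by simp
  qed
  have "\<forall>\<^sub>F x in at_infinity. (S x - 1) * (1 - R' x / x) / (R x / x - 1) - 1 = S' x"
   using infinity_ne[of 0] cofinite_infinity[OF Rx]
   by eventually_elim (unfold S'_def, rule eq)
  ultimately show ?thesis using Lim_transform_eventually by fastforce
 qed
 ultimately show ?thesis using R' S' unfolding mul_fun_def by blast
qed

lemma mul_fun_ex:
 assumes "A \<in> \<rat>" "B \<in> \<rat>" "n \<ge> 1"
 shows "\<exists>R S. mul_fun n R S"
proof (cases "n = 1")
 case True
 then show ?thesis using mul_fun_1 assms by blast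
next
 case False
 then have "n \<ge> 2" using assms by simp
 then show ?thesis
  by (induction n rule: dec_induct) (use mul_fun_2 mul_fun_Suc assms in \<open>blast+\<close>)
qed

end

text \<open>In characteristic zero the derivative of P / Q lowers the order of a zero by exactly
  one: with P = (X - a)^(k+1) U, the cofactor of (X - a)^k takes the nonzero value (k + 1) U(a) Q(a)
  at a.\<close>

lemma order_wronskian:
 fixes P Q :: "complex poly"
 assumes P: "P ~= 0" "Polynomial.order a P = Suc k" and Q: "poly Q a ~= 0"
 shows "Polynomial.order a (pderiv P * Q - P * pderiv Q) = k" "pderiv P * Q - P * pderiv Q ~= 0"
proof -
 obtain U where U: "P = [:-a, 1:] ^ Suc k * U" "\<not> [:-a, 1:] dvd U"
  using order_decomp[OF P(1), of a] P(2) by metis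
 define V where "V = [:-a, 1:] * (pderiv U * Q - U * pderiv Q) + smult (of_nat (Suc k)) (U * Q)"
 have "poly U a ~= 0" using U(2) by (simp add: poly_eq_0_iff_dvd)
 then have V: "poly V a ~= 0" using Q by (simp add: V_def del: of_nat_Suc)
 have eq: "pderiv P * Q - P * pderiv Q = [:-a, 1:] ^ k * V"
  unfolding U(1) lemma_order_pderiv1 V_def by (simp add: algebra_simps del: of_nat_Suc)
 have nz: "[:-a, 1:] ^ k * V ~= 0" using V by auto
 then show "pderiv P * Q - P * pderiv Q ~= 0" unfolding eq .
 show "Polynomial.order a (pderiv P * Q - P * pderiv Q) = k"
  unfolding eq order_mult[OF nz] order_power_n_n using order_0I[OF V] by simp
qed

lemma poly_eq_cofinite:
 fixes p q :: "complex poly"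
 assumes "\<forall>\<^sub>F x in cofinite. poly p x = poly q x"
 shows "p = q"
proof (rule ccontr)
 assume "p ~= q"
 then have "p - q ~= 0" by simp
 then have "\<forall>\<^sub>F x in cofinite. poly p x - poly q x ~= 0" using poly_cofinite[of "p - q"] by simp
 then have "\<forall>\<^sub>F x::complex in cofinite. False" using assms by eventually_elim simp
 then show False by (simp add: infinite_UNIV_char_0)
qed

section \<open>Values of multiplication by n and multiplicities of torsion abscissas\<close>

context short_curve
begin

text \<open>Continuity of translation at the origin: a point whose abscissa tends to infinity tends
  to the neutral element, so adding it to a fixed affine point changes the abscissa by a quantity
  that tends to 0.\<close>

lemma shift_limit:
 fixes \<xi> \<eta> :: "'a => complex"
 assumes P: "y0 ^ 2 = f x0" and ev: "\<forall>\<^sub>F i in F. \<eta> i ^ 2 = f (\<xi> i)" and lim: "filterlim \<xi> at_infinity F"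
 obtains u v where "\<forall>\<^sub>F i in F. ec_add W (Affine x0 y0) (Affine (\<xi> i) (\<eta> i)) = Affine (u i) (v i)"
  "(u \<longlongrightarrow> x0) F"
proof -
 define u where "u i = ((\<eta> i - y0) / (\<xi> i - x0)) ^ 2 - x0 - \<xi> i" for i
 define v where "v i = (\<eta> i - y0) / (\<xi> i - x0) * (x0 - u i) - y0" for i
 note comp = filterlim_compose[OF _ lim]
 have ne: "\<forall>\<^sub>F i in F. \<xi> i ~= c" for c
  using eventually_compose_filterlim[OF infinity_ne[of c] lim] .
 have "\<forall>\<^sub>F i in F. ec_add W (Affine x0 y0) (Affine (\<xi> i) (\<eta> i)) = Affine (u i) (v i)"
  using ne[of x0] by eventually_elim (auto simp: ec_slope_def Let_def u_def v_def)
 moreover have "(u \<longlongrightarrow> x0) F"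
 proof -
  have i1: "((\<lambda>i. c / \<xi> i) \<longlongrightarrow> 0) F" for c
   using comp[OF inverse_infinity[of c 0]] by simp
  have i2: "((\<lambda>i. c / \<xi> i ^ 2) \<longlongrightarrow> 0) F" for c
   using comp[OF inverse_infinity'(1)] .
  have "((\<lambda>i. f (\<xi> i) / \<xi> i ^ 3 * (1 / \<xi> i)) \<longlongrightarrow> 1 * 0) F"
   by (intro tendsto_mult comp[OF f_infinity] i1)
  moreover have "\<forall>\<^sub>F i in F. f (\<xi> i) / \<xi> i ^ 3 * (1 / \<xi> i) = (\<eta> i / \<xi> i ^ 2) ^ 2"
   using ev by eventually_elim (simp add: power_divide power2_eq_square power3_eq_cube)
  ultimately have "((\<lambda>i. (\<eta> i / \<xi> i ^ 2) ^ 2) \<longlongrightarrow> 1 * 0) F" by (rule Lim_transform_eventually)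
  then have "((\<lambda>i. norm ((\<eta> i / \<xi> i ^ 2) ^ 2)) \<longlongrightarrow> 0) F" by (intro tendsto_norm_zero) simp
  then have "((\<lambda>i. norm (\<eta> i / \<xi> i ^ 2) ^ 2) \<longlongrightarrow> 0) F" unfolding norm_power .
  \<comment> \<open>The square of the ordinate grows like the cube of the abscissa, so the ordinate
    is of smaller order than the square of the abscissa.\<close>
  then have eta: "((\<lambda>i. \<eta> i / \<xi> i ^ 2) \<longlongrightarrow> 0) F"
   using tendsto_norm_zero_iff by (subst (asm) power_tendsto_0_iff) auto
  have "((\<lambda>i. (x0 + (A + x0 ^ 2) / \<xi> i + (B + y0 ^ 2 - x0 ^ 3) / \<xi> i ^ 2 - 2 * y0 * (\<eta> i / \<xi> i ^ 2)) / (1 - x0 / \<xi> i) ^ 2)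
    \<longlongrightarrow> (x0 + 0 + 0 - 2 * y0 * 0) / (1 - 0) ^ 2) F"
   by (intro tendsto_divide tendsto_add tendsto_diff tendsto_mult tendsto_power tendsto_const i1 i2 eta) simp
  then have "((\<lambda>i. (x0 + (A + x0 ^ 2) / \<xi> i + (B + y0 ^ 2 - x0 ^ 3) / \<xi> i ^ 2 - 2 * y0 * (\<eta> i / \<xi> i ^ 2)) / (1 - x0 / \<xi> i) ^ 2)
    \<longlongrightarrow> x0) F" by simp
  moreover have "\<forall>\<^sub>F i in F. (x0 + (A + x0 ^ 2) / \<xi> i + (B + y0 ^ 2 - x0 ^ 3) / \<xi> i ^ 2 - 2 * y0 * (\<eta> i / \<xi> i ^ 2)) / (1 - x0 / \<xi> i) ^ 2 = u i"
   using ev ne[of 0] ne[of x0]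
  proof eventually_elim
   case (elim i)
   define s where "s = \<xi> i"
   define h where "h = \<eta> i"
   have s: "s ~= 0" "s ~= x0" "s - x0 ~= 0" "h ^ 2 = f s" using elim by (auto simp: s_def h_def)
   have "x0 + (A + x0 ^ 2) / s + (B + y0 ^ 2 - x0 ^ 3) / s ^ 2 - 2 * y0 * (h / s ^ 2)
     = (x0 * s ^ 2 + (A + x0 ^ 2) * s + (B + y0 ^ 2 - x0 ^ 3) - 2 * y0 * h) / s ^ 2"
    using s by (simp add: add_divide_distrib diff_divide_distrib power2_eq_square)
   also have "x0 * s ^ 2 + (A + x0 ^ 2) * s + (B + y0 ^ 2 - x0 ^ 3) - 2 * y0 * h = (h - y0) ^ 2 - (x0 + s) * (s - x0) ^ 2"
    using s(4) by Groebner_Basis.algebra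
   also have "(1 - x0 / s) = (s - x0) / s" using s by (simp add: diff_divide_distrib)
   then have "(1 - x0 / s) ^ 2 = (s - x0) ^ 2 / s ^ 2" by (simp add: power_divide)
   moreover have "((h - y0) ^ 2 - (x0 + s) * (s - x0) ^ 2) / s ^ 2 / ((s - x0) ^ 2 / s ^ 2) = ((h - y0) ^ 2 - (x0 + s) * (s - x0) ^ 2) / (s - x0) ^ 2"
    using s by simp
   moreover have "\<dots> = ((h - y0) / (s - x0)) ^ 2 - x0 - s"
    using s by (simp add: diff_divide_distrib[of "_ ^ 2"] power_divide)
   ultimately show ?case unfolding u_def s_def h_def by metis
  qed
  ultimately show ?thesis by (rule Lim_transform_eventually)
 qed
 ultimately show thesis using that by blast
qed

text \<open>The fraction for R is reduced over the complex numbers, so N and D have no common zero.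
  For D itself it is recorded only that it divides a nonzero rational polynomial; this already makes
  its roots algebraic.\<close>

definition mul_polys :: "nat => complex poly => complex poly => bool"
 where "mul_polys n N D \<longleftrightarrow> D ~= 0 \<and> coprime N D \<and> (\<exists>D0. rat_poly D0 \<and> D0 ~= 0 \<and> D dvd D0) \<and>
  (\<exists>S. mul_fun n (\<lambda>x. poly N x / poly D x) S)"

lemma mul_polys_ex:
 assumes "A \<in> \<rat>" "B \<in> \<rat>" "n \<ge> 1"
 shows "\<exists>N D. mul_polys n N D"
proof -
 obtain R S where RS: "mul_fun n R S" using mul_fun_ex[OF assms] by blast
 then obtain N0 D0 where N0: "rat_poly D0" "D0 ~= 0" "\<forall>\<^sub>F x in cofinite. poly D0 x ~= 0 \<and> R x = poly N0 x / poly D0 x"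
  unfolding mul_fun_def rat_fun_def by blast
 define g where "g = gcd N0 D0"
 define N where "N = N0 div g"
 define D where "D = D0 div g"
 have g: "N0 = N * g" "D0 = D * g" "g ~= 0" unfolding N_def D_def g_def using N0 by auto
 have "coprime N D" using N0 unfolding N_def D_def g_def by (intro div_gcd_coprime) auto
 have ev: "\<forall>\<^sub>F x in cofinite. R x = poly N x / poly D x"
  using N0(3) by eventually_elim (auto simp: g)
 note RS' = RS[unfolded mul_fun_def]
 have "rat_fun R" using RS' by blast
 have "mul_fun n (\<lambda>x. poly N x / poly D x) S"
  unfolding mul_fun_def
 proof (intro conjI)
  show "rat_fun (\<lambda>x. poly N x / poly D x)"
  proof -
   obtain N1 D1 where 1: "rat_poly N1" "rat_poly D1" "D1 ~= 0" "\<forall>\<^sub>F x in cofinite. poly D1 x ~= 0 \<and> R x = poly N1 x / poly D1 x"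
    using \<open>rat_fun R\<close> unfolding rat_fun_def by blast
   from ev 1(4) have "\<forall>\<^sub>F x in cofinite. poly D1 x ~= 0 --> poly N x / poly D x = poly N1 x / poly D1 x"
    by eventually_elim auto
   then show ?thesis using rat_funI[of N1 D1] 1(1-3) by metis
  qed
  have "\<forall>\<^sub>F x in cofinite. (\<forall>y. y ^ 2 = f x --> Affine x y [^]\<^bsub>G\<^esub> n = Affine (R x) (y * S x)) \<and>
   (R has_field_derivative of_nat n * S x) (at x) \<and> f (R x) = f x * S x ^ 2"
   using RS' by blast
  with ev cofinite_nhds[OF ev] show "\<forall>\<^sub>F x in cofinite. (\<forall>y. y ^ 2 = f x --> Affine x y [^]\<^bsub>G\<^esub> n = Affine (poly N x / poly D x) (y * S x)) \<and>
   ((\<lambda>x. poly N x / poly D x) has_field_derivative of_nat n * S x) (at x) \<and> f (poly N x / poly D x) = f x * S x ^ 2"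
  proof eventually_elim
   case (elim x)
   then have "((\<lambda>x. poly N x / poly D x) has_field_derivative of_nat n * S x) (at x)"
    using DERIV_cong_ev[OF refl elim(2) refl] by blast
   then show ?case using elim by simp
  qed
  have lim: "((\<lambda>x. R x / x) \<longlongrightarrow> 1 / of_nat n ^ 2) at_infinity" using RS' by blast
  have "\<forall>\<^sub>F x in at_infinity. R x / x = poly N x / poly D x / x"
   using cofinite_infinity[OF ev] by eventually_elim simp
  with lim show "((\<lambda>x. poly N x / poly D x / x) \<longlongrightarrow> 1 / of_nat n ^ 2) at_infinity"
   by (rule Lim_transform_eventually)
 qed (use RS' in auto)
 moreover have "D ~= 0" "D dvd D0" using g N0 by auto
 ultimately show ?thesis unfolding mul_polys_def using N0 \<open>coprime N D\<close> by blast
qed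

lemma coprime_no_common_root: "coprime N D ==> poly D x = 0 ==> poly N x ~= 0" for N D :: "complex poly"
 by (metis coprime_common_divisor is_unit_poly_iff poly_eq_0_iff_dvd poly_pCons mult_zero_right add.right_neutral
   pCons_eq_iff one_neq_zero pCons_0_0)

text \<open>\<open>mul_fun\<close> gives no control at a prescribed x0. So P is translated by the
  point with abscissa x and ordinate \<open>\<eta> x\<close>, with x tending to infinity: the
  translate is eventually a point where the formulas hold, it approaches P, and n times it is n P
  plus a point that tends to the origin.\<close>

lemma mul_polys_value:
 assumes mp: "mul_polys n N D" and P: "Affine x0 y0 \<in> ec W" and n: "n \<ge> 1"
 shows "case Affine x0 y0 [^]\<^bsub>G\<^esub> n of Infinity => poly D x0 = 0
  | Affine a b => poly D x0 ~= 0 \<and> poly N x0 = a * poly D x0"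
proof -
 interpret G: comm_group G by (rule group_G)
 obtain S where cop: "D ~= 0" "coprime N D" and RS: "mul_fun n (\<lambda>x. poly N x / poly D x) S"
  using mp unfolding mul_polys_def by blast
 define R where "R x = poly N x / poly D x" for x
 have good: "\<forall>\<^sub>F x in cofinite. (\<forall>y. y ^ 2 = f x --> Affine x y [^]\<^bsub>G\<^esub> n = Affine (R x) (y * S x)) \<and> f (R x) = f x * S x ^ 2"
  and lim: "((\<lambda>x. R x / x) \<longlongrightarrow> 1 / of_nat n ^ 2) at_infinity"
  using RS unfolding mul_fun_def R_def by (auto elim: eventually_mono)
 define \<eta> where "\<eta> x = csqrt (f x)" for x
 have eta: "\<eta> x ^ 2 = f x" for x by (simp add: \<eta>_def)
 have y0: "y0 ^ 2 = f x0" using P by (simp add: on_short)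
 let ?P = "Affine x0 y0"
 obtain u v where XY: "\<forall>\<^sub>F x in at_infinity. ec_add W ?P (Affine x (\<eta> x)) = Affine (u x) (v x)"
  "(u \<longlongrightarrow> x0) at_infinity"
 proof (rule shift_limit[OF y0])
  show "\<forall>\<^sub>F x in at_infinity. \<eta> x ^ 2 = f x" using eta by simp
  show "filterlim (\<lambda>x::complex. x) at_infinity at_infinity" by (rule filterlim_ident)
 qed blast
 have onW: "Affine x (\<eta> x) \<in> ec W" for x by (simp add: on_short eta)
 \<comment> \<open>Subtracting P from the translate recovers x, so only finitely many x move the
   abscissa into a given finite set.\<close>
 have avoid: "\<forall>\<^sub>F x in at_infinity. u x \<notin> bad" if bad: "finite bad" for bad
 proof -
  define K where "K = (\<Union>c\<in>bad. {y. y ^ 2 = f c} \<times> {c})"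
  have "finite {y. y ^ 2 = f c}" for c using poly_roots_finite[of "[:- f c, 0, 1:]"]
   by (simp add: power2_eq_square algebra_simps)
  then have "finite K" unfolding K_def using bad by auto
  define h where "h = (\<lambda>(y, c). case ec_add W (ec_neg W ?P) (Affine c y) of Affine a b => a | Infinity => 0)"
  have "finite (h ` K)" using \<open>finite K\<close> by simp
  then have "\<forall>\<^sub>F x in at_infinity. x \<notin> h ` K" by (intro cofinite_infinity) (simp add: eventually_cofinite)
  with XY(1) show ?thesis
  proof eventually_elim
   case (elim x)
   show ?case
   proof
    assume "u x \<in> bad"
    have "Affine (u x) (v x) \<in> ec W" using elim(1) add_closed[OF P onW[of x]] by simp
    then have "(v x, u x) \<in> K" using \<open>u x \<in> bad\<close> by (auto simp: K_def on_short)
    have "ec_add W (ec_neg W ?P) (ec_add W ?P (Affine x (\<eta> x))) = Affine x (\<eta> x)"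
     using add_cancel[of "Affine x (\<eta> x)" "?P"] ec_add_comm[of _ W] P onW[of x] add_closed[OF P onW[of x]] ec_neg_ec[OF P]
     by metis
    then have "ec_add W (ec_neg W ?P) (Affine (u x) (v x)) = Affine x (\<eta> x)" unfolding elim(1) .
    then have "h (v x, u x) = x" unfolding h_def prod.case by (simp only: point.case)
    then show False using elim \<open>(v x, u x) \<in> K\<close> by (metis imageI)
   qed
  qed
 qed
 have Rinf: "filterlim R at_infinity at_infinity"
 proof -
  have "filterlim (\<lambda>x. R x / x * x) at_infinity at_infinity"
   by (rule tendsto_mult_filterlim_at_infinity[OF lim _ filterlim_ident]) (use n in auto)
  moreover have "\<forall>\<^sub>F x in at_infinity. R x / x * x = R x" using infinity_ne[of 0] by eventually_elim simp
  ultimately show ?thesis by (rule filterlim_cong[OF refl refl, THEN iffD1, rotated])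
 qed
 have "finite {x. \<not> ((\<forall>y. y ^ 2 = f x --> Affine x y [^]\<^bsub>G\<^esub> n = Affine (R x) (y * S x)) \<and> f (R x) = f x * S x ^ 2 \<and> poly D x ~= 0)}"
  using eventually_conj[OF good poly_cofinite[OF cop(1)]] by (simp add: eventually_cofinite Collect_neg_eq conj_assoc)
 from avoid[OF this] have goodX: "\<forall>\<^sub>F x in at_infinity. (\<forall>y. y ^ 2 = f (u x) --> Affine (u x) y [^]\<^bsub>G\<^esub> n = Affine (R (u x)) (y * S (u x))) \<and> poly D (u x) ~= 0"
  by eventually_elim auto
 have sum: "\<forall>\<^sub>F x in at_infinity. ec_add W (?P [^]\<^bsub>G\<^esub> n) (Affine (R x) (\<eta> x * S x)) = Affine (R (u x)) (v x * S (u x)) \<and> poly D (u x) ~= 0"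
  using XY(1) goodX cofinite_infinity[OF good]
 proof eventually_elim
  case (elim x)
  have "Affine (u x) (v x) \<in> ec W" using elim(1) add_closed[OF P onW[of x]] by simp
  then have "Affine (u x) (v x) [^]\<^bsub>G\<^esub> n = Affine (R (u x)) (v x * S (u x))" using elim by (simp add: on_short)
  moreover have "Affine (u x) (v x) [^]\<^bsub>G\<^esub> n = ec_add W (?P [^]\<^bsub>G\<^esub> n) (Affine x (\<eta> x) [^]\<^bsub>G\<^esub> n)"
   using G.nat_pow_distrib[of ?P "Affine x (\<eta> x)" n] elim(1) P onW[of x] by simp
  moreover have "Affine x (\<eta> x) [^]\<^bsub>G\<^esub> n = Affine (R x) (\<eta> x * S x)" using elim eta by blast
  ultimately show ?case using elim by simp
 qed
 have DX: "((\<lambda>x. poly D (u x)) \<longlongrightarrow> poly D x0) at_infinity" "((\<lambda>x. poly N (u x)) \<longlongrightarrow> poly N x0) at_infinity"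
  using XY(2) by (intro tendsto_poly; simp)+
 show ?thesis
 proof (cases "?P [^]\<^bsub>G\<^esub> n")
  case Infinity
  have "poly D x0 = 0"
  proof (rule ccontr)
   assume "poly D x0 ~= 0"
   then have "((\<lambda>x. poly N (u x) / poly D (u x)) \<longlongrightarrow> poly N x0 / poly D x0) at_infinity"
    by (intro tendsto_divide DX)
   moreover have "\<forall>\<^sub>F x in at_infinity. poly N (u x) / poly D (u x) = R x"
    using sum by eventually_elim (simp add: Infinity R_def)
   ultimately have "(R \<longlongrightarrow> poly N x0 / poly D x0) at_infinity" by (rule Lim_transform_eventually)
   then show False using not_tendsto_and_filterlim_at_infinity[OF trivial_limit_at_infinity _ Rinf] by blast
  qed
  then show ?thesis using Infinity by simp
 next
  case (Affine a b)
  have "Affine a b \<in> ec W" using G.nat_pow_closed[of ?P n] P Affine by simp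
  then have b: "b ^ 2 = f a" by (simp add: on_short)
  have "\<forall>\<^sub>F x in at_infinity. (\<eta> x * S x) ^ 2 = f (R x)"
   using cofinite_infinity[OF good] by eventually_elim (simp add: power_mult_distrib eta)
  from shift_limit[OF b this Rinf] obtain u' v' where u': "\<forall>\<^sub>F x in at_infinity. ec_add W (Affine a b) (Affine (R x) (\<eta> x * S x)) = Affine (u' x) (v' x)"
   "(u' \<longlongrightarrow> a) at_infinity" by blast
  have "\<forall>\<^sub>F x in at_infinity. u' x * poly D (u x) = poly N (u x)"
   using sum u'(1)
  proof eventually_elim
   case (elim x)
   then have "R (u x) = u' x" unfolding Affine by (metis point.inject)
   then show ?case using elim unfolding R_def by (auto simp: divide_eq_eq)
  qed
  then have "((\<lambda>x. poly N (u x)) \<longlongrightarrow> a * poly D x0) at_infinity"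
   by (rule Lim_transform_eventually[OF tendsto_mult[OF u'(2) DX(1)]])
  then have "poly N x0 = a * poly D x0"
   using tendsto_unique[OF trivial_limit_at_infinity DX(2)] by blast
  moreover have "poly D x0 ~= 0"
   using coprime_no_common_root[OF cop(2), of x0] calculation by auto
  ultimately show ?thesis using Affine by simp
 qed
qed

lemma torsion_algebraic_finite:
 fixes n :: nat
 assumes "A \<in> \<rat>" "B \<in> \<rat>" "n \<ge> 1"
 shows "finite {P \<in> ec W. P [^]\<^bsub>G\<^esub> n = Infinity}"
  "Affine x y \<in> ec W ==> Affine x y [^]\<^bsub>G\<^esub> n = Infinity ==> algebraic x"
proof -
 obtain N D where mp: "mul_polys n N D" using mul_polys_ex[OF assms] by blast
 then obtain D0 where D: "D ~= 0" "rat_poly D0" "D0 ~= 0" "D dvd D0" unfolding mul_polys_def by blast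
 have root: "poly D x = 0" if "Affine x y \<in> ec W" "Affine x y [^]\<^bsub>G\<^esub> n = Infinity" for x y
  using mul_polys_value[OF mp that(1) assms(3)] that(2) by simp
 then show "algebraic x" if "Affine x y \<in> ec W" "Affine x y [^]\<^bsub>G\<^esub> n = Infinity"
  using D that rat_poly_root_algebraic[of D0 x] by (metis dvdE mult_zero_left poly_mult)
 have "finite {y. y ^ 2 = f c}" for c using poly_roots_finite[of "[:- f c, 0, 1:]"]
  by (simp add: power2_eq_square algebra_simps)
 then have "finite (\<Union>x\<in>{x. poly D x = 0}. Affine x ` {y. y ^ 2 = f x})"
  using poly_roots_finite[OF D(1)] by auto
 moreover have "{P \<in> ec W. P [^]\<^bsub>G\<^esub> n = Infinity} \<subseteq> insert Infinity (\<Union>x\<in>{x. poly D x = 0}. Affine x ` {y. y ^ 2 = f x})"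
 proof
  fix P assume "P \<in> {P \<in> ec W. P [^]\<^bsub>G\<^esub> n = Infinity}"
  then show "P \<in> insert Infinity (\<Union>x\<in>{x. poly D x = 0}. Affine x ` {y. y ^ 2 = f x})"
   using root by (cases P) (auto simp: on_short)
 qed
 ultimately show "finite {P \<in> ec W. P [^]\<^bsub>G\<^esub> n = Infinity}" using finite_subset by blast
qed

text \<open>R' = n S and f (R) = f S^2 eliminate S and leave f R'^2 = n^2 f (R). For R = N / D,
  multiplication by D^4 makes this an identity of polynomials.\<close>

lemma mul_polys_ode:
 assumes mp: "mul_polys n N D"
 shows "[:B, A, 0, 1:] * (pderiv N * D - N * pderiv D) ^ 2 = [:of_nat n ^ 2:] * (N ^ 3 + [:A:] * N * D ^ 2 + [:B:] * D ^ 3) * D"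
proof (rule poly_eq_cofinite)
 obtain S where D: "D ~= 0" and RS: "mul_fun n (\<lambda>x. poly N x / poly D x) S"
  using mp unfolding mul_polys_def by blast
 have good: "\<forall>\<^sub>F x in cofinite. ((\<lambda>x. poly N x / poly D x) has_field_derivative of_nat n * S x) (at x)
   \<and> f (poly N x / poly D x) = f x * S x ^ 2"
  using RS unfolding mul_fun_def by (auto elim: eventually_mono)
 show "\<forall>\<^sub>F x in cofinite. poly ([:B, A, 0, 1:] * (pderiv N * D - N * pderiv D) ^ 2) x =
   poly ([:of_nat n ^ 2:] * (N ^ 3 + [:A:] * N * D ^ 2 + [:B:] * D ^ 3) * D) x"
  using good poly_cofinite[OF D]
 proof eventually_elim
  case (elim x)
  define a b a' b' where "a = poly N x" and "b = poly D x" and "a' = poly (pderiv N) x" and "b' = poly (pderiv D) x"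
  have b: "b ~= 0" using elim by (simp add: b_def)
  have "((\<lambda>x. poly N x / poly D x) has_field_derivative (a' * b - a * b') / (b * b)) (at x)"
   unfolding a_def b_def a'_def b'_def using elim by (intro DERIV_divide poly_DERIV) auto
  then have "of_nat n * S x = (a' * b - a * b') / (b * b)" using elim DERIV_unique by blast
  then have 1: "of_nat n * S x * b ^ 2 = a' * b - a * b'" using b by (simp add: power2_eq_square)
  have "f (a / b) * b ^ 3 = a ^ 3 + A * a * b ^ 2 + B * b ^ 3"
   using b by (simp add: power_divide field_simps power2_eq_square power3_eq_cube)
  moreover have "f (a / b) = f x * S x ^ 2" using elim by (simp add: a_def b_def)
  ultimately have 2: "f x * S x ^ 2 * b ^ 3 = a ^ 3 + A * a * b ^ 2 + B * b ^ 3" by metis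
  have fx: "poly [:B, A, 0, 1:] x = f x" by (simp add: algebra_simps power3_eq_cube)
  have "f x * (a' * b - a * b') ^ 2 = of_nat n ^ 2 * (a ^ 3 + A * a * b ^ 2 + B * b ^ 3) * b"
   unfolding 1[symmetric] 2[symmetric] by Groebner_Basis.algebra
  then show ?case unfolding poly_mult poly_power poly_diff poly_add fx
   by (simp add: a_def b_def a'_def b'_def)
 qed
qed

lemma linear_product_order:
 fixes q :: "complex poly"
 assumes q: "q ~= 0" and r: "\<And>z. poly q z = 0 \<longleftrightarrow> z \<in> Z" and Z: "finite Z" and m: "\<And>z. z \<in> Z ==> Polynomial.order z q = m z"
 shows "poly q x = lead_coeff q * (\<Prod>z\<in>Z. (x - z) ^ m z)"
proof -
 have "{z. poly q z = 0} = Z" using r by auto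
 then have "q = smult (lead_coeff q) (\<Prod>z\<in>Z. [:-z, 1:] ^ Polynomial.order z q)"
  using complex_poly_decompose[of q] by simp
 then have "poly q x = lead_coeff q * (\<Prod>z\<in>Z. poly ([:-z, 1:] ^ Polynomial.order z q) x)"
  by (metis poly_smult poly_prod)
 also have "(\<Prod>z\<in>Z. poly ([:-z, 1:] ^ Polynomial.order z q) x) = (\<Prod>z\<in>Z. (x - z) ^ m z)"
  by (intro prod.cong) (auto simp: m)
 finally show ?thesis .
qed

text \<open>Both \<open>x([n]P) - e\<close> and its denominator split completely, and the multiplicities are read off
 the differential equation \<open>f R'\<^sup>2 = n\<^sup>2 f(R)\<close>; the value at \<open>e\<close> then gives the identity.\<close>

lemma torsion_product:
 fixes n :: nat
 assumes AB: "A \<in> \<rat>" "B \<in> \<rat>" and n: "odd n" and e: "f e = 0"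
 defines "Z \<equiv> {x. \<exists>y. Affine x y \<in> ec W \<and> Affine x y [^]\<^bsub>G\<^esub> n = Infinity}"
 shows "finite Z" "(3 * e ^ 2 + A) ^ (2 * card Z) = of_nat n ^ 4 * (\<Prod>x\<in>Z. (e - x) ^ 4)"
proof -
 interpret G: comm_group G by (rule group_G)
 have n1: "n \<ge> 1" using n by (cases n) auto
 obtain N D where mp: "mul_polys n N D" using mul_polys_ex[OF AB n1] by blast
 then obtain S where D: "D ~= 0" "coprime N D" and RS: "mul_fun n (\<lambda>x. poly N x / poly D x) S"
  unfolding mul_polys_def by blast
 note val = mul_polys_value[OF mp _ n1]
 have ex_y: "\<exists>y. Affine x y \<in> ec W" for x by (rule exI[of _ "csqrt (f x)"]) (simp add: on_short)
 have rootD: "poly D x = 0 \<longleftrightarrow> x \<in> Z" for x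
 proof
  assume "poly D x = 0"
  obtain y where y: "Affine x y \<in> ec W" using ex_y by blast
  then have "Affine x y [^]\<^bsub>G\<^esub> n = Infinity" using val[OF y] \<open>poly D x = 0\<close> by (auto split: point.splits)
  then show "x \<in> Z" using y by (auto simp: Z_def)
 next
  assume "x \<in> Z"
  then obtain y where y: "Affine x y \<in> ec W" "Affine x y [^]\<^bsub>G\<^esub> n = Infinity" by (auto simp: Z_def)
  then show "poly D x = 0" using val[OF y(1)] by simp
 qed
 then have "Z = {x. poly D x = 0}" by auto
 then show finZ: "finite Z" using poly_roots_finite[OF D(1)] by simp
 define d where "d = 3 * e ^ 2 + A"
 have d: "d ~= 0" using smooth[of e] e by (auto simp: d_def)
 let ?T = "Affine e 0"
 have odd_two: "Affine x 0 [^]\<^bsub>G\<^esub> n = Affine x 0" if "f x = 0" for x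
 proof -
  let ?T = "Affine x 0"
  have T: "?T \<in> ec W" using that by (simp add: on_short)
  have T2: "?T [^]\<^bsub>G\<^esub> (2::nat) = Infinity" using G.nat_pow_eone[of ?T] T G.nat_pow_Suc[of ?T 1] by (simp add: numeral_2_eq_2)
  obtain k where k: "n = 2 * k + 1" using n by (metis oddE)
  have "?T [^]\<^bsub>G\<^esub> (2 * k) = Infinity" using G.nat_pow_pow[of ?T 2 k] T T2 G.nat_pow_one by simp
  then show ?thesis using G.nat_pow_mult[of ?T "2 * k" 1] T G.nat_pow_eone[of ?T] by (simp add: k)
 qed
 have T: "?T \<in> ec W" using e by (simp add: on_short)
 note Tn = odd_two[OF e]
 have fZ: "f x ~= 0" if x: "x \<in> Z" for x
 proof
  assume f: "f x = 0"
  from x obtain y where y: "Affine x y \<in> ec W" "Affine x y [^]\<^bsub>G\<^esub> n = Infinity" by (auto simp: Z_def)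
  then have "y = 0" using f by (simp add: on_short)
  then show False using y odd_two[OF f] by simp
 qed
 have eZ: "e \<notin> Z" using fZ e by blast
 \<comment> \<open>The action on abscissas of translation by the 2-torsion point (e, 0); d is the
   derivative of the cubic at e, nonzero by smoothness. This map is its own inverse.\<close>
 define \<phi> where "\<phi> x = e + d / (x - e)" for x
 have shift: "\<exists>y'. ec_add W (Affine x y) ?T = Affine (\<phi> x) y'" if "Affine x y \<in> ec W" "x ~= e" for x y
 proof -
  have y: "y ^ 2 = (x - e) * (x ^ 2 + e * x + e ^ 2 + A)" using that e unfolding ec_simps on_short by Groebner_Basis.algebra
  have "(y / (x - e)) ^ 2 - x - e = (y ^ 2 - (x + e) * (x - e) ^ 2) / (x - e) ^ 2"
   using that by (simp add: power_divide diff_divide_distrib add_divide_distrib algebra_simps)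
  also have "y ^ 2 - (x + e) * (x - e) ^ 2 = (x - e) * (e * (x - e) + d)" unfolding y d_def by Groebner_Basis.algebra
  also have "\<dots> / (x - e) ^ 2 = \<phi> x" using that by (simp add: \<phi>_def power2_eq_square add_divide_distrib)
  finally have x3: "(y / (x - e)) ^ 2 - x - e = \<phi> x" .
  have "(0 - y) / (e - x) = y / (x - e)" by (metis diff_0 minus_diff_eq minus_divide_divide)
  then show ?thesis using that x3 by (simp add: ec_slope_def Let_def)
 qed
 \<comment> \<open>The numerator of R - e. Its zeros are the abscissas of points whose n-fold is (e,
   0). As n is odd, these points are the translates by (e, 0) of the n-torsion points, the neutral
   element giving e itself.\<close>
 define Ne where "Ne = N - [:e:] * D"
 have rootNe: "poly Ne x = 0 \<longleftrightarrow> x = e \<or> x \<in> \<phi> ` Z" for x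
 proof
  assume x: "poly Ne x = 0"
  then have "poly D x ~= 0" "poly N x = e * poly D x"
   using coprime_no_common_root[OF D(2), of x] by (auto simp: Ne_def)
  obtain y where y: "Affine x y \<in> ec W" using ex_y by blast
  then obtain a b where ab: "Affine x y [^]\<^bsub>G\<^esub> n = Affine a b" "poly N x = a * poly D x"
   using val[OF y] \<open>poly D x ~= 0\<close> by (auto split: point.splits)
  then have "a = e" using \<open>poly D x ~= 0\<close> \<open>poly N x = e * poly D x\<close> by simp
  then have "b = 0" using G.nat_pow_closed[of "Affine x y" n] y ab e by (simp add: on_short)
  let ?P = "ec_add W (Affine x y) ?T"
  have P: "?P \<in> ec W" using add_closed y T by blast
  have "?P [^]\<^bsub>G\<^esub> n = ec_add W ?T ?T"
   using G.nat_pow_distrib[of "Affine x y" ?T n] y T ab Tn \<open>a = e\<close> \<open>b = 0\<close> by simp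
  then have Pn: "?P [^]\<^bsub>G\<^esub> n = Infinity" by simp
  show "x = e \<or> x \<in> \<phi> ` Z"
  proof (cases "x = e")
   case False
   obtain y' where y': "?P = Affine (\<phi> x) y'" using shift[OF y False] by blast
   then have "\<phi> x \<in> Z" using P Pn by (auto simp: Z_def)
   moreover have "\<phi> (\<phi> x) = x" using d False by (simp add: \<phi>_def)
   ultimately show ?thesis by (metis imageI)
  qed simp
 next
  assume "x = e \<or> x \<in> \<phi> ` Z"
  then have "\<exists>y. Affine x y \<in> ec W \<and> Affine x y [^]\<^bsub>G\<^esub> n = ?T"
  proof
   assume "x = e" then show ?thesis using T Tn by blast
  next
   assume "x \<in> \<phi> ` Z"
   then obtain z where "x = \<phi> z" "z \<in> Z" by blast
   then obtain y where z: "x = \<phi> z" "Affine z y \<in> ec W" "Affine z y [^]\<^bsub>G\<^esub> n = Infinity" "z ~= e"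
    using eZ unfolding Z_def by blast
   obtain y' where y': "ec_add W (Affine z y) ?T = Affine x y'" using shift[OF z(2,4)] z(1) by blast
   have "Affine x y' [^]\<^bsub>G\<^esub> n = ?T"
    unfolding y'[symmetric] using G.nat_pow_distrib[of "Affine z y" ?T n] z(2,3) T Tn by (simp del: ec_add.simps(3))
   then show ?thesis using add_closed[OF z(2) T] unfolding y' by blast
  qed
  then obtain y where y: "Affine x y \<in> ec W" "Affine x y [^]\<^bsub>G\<^esub> n = ?T" by blast
  show "poly Ne x = 0" using val[OF y(1)] y(2) by (simp add: Ne_def)
 qed
 have D0: "poly D x ~= 0" if "poly Ne x = 0" for x
  using that coprime_no_common_root[OF D(2), of x] by (auto simp: Ne_def)
 have N0: "poly N x ~= 0" if "poly D x = 0" for x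
  using that coprime_no_common_root[OF D(2)] by blast
 let ?F = "[:B, A, 0, 1:] :: complex poly"
 have F: "poly ?F x = f x" for x by (simp add: algebra_simps power3_eq_cube)
 have B': "B = - (e * (e ^ 2 + A))" using e by Groebner_Basis.algebra
 have Fe: "?F = [:-e, 1:] * [:e ^ 2 + A, e, 1:]"
  by (simp add: B' power2_eq_square)
 have f_root: "Polynomial.order e ?F = 1"
 proof -
  have "poly [:e ^ 2 + A, e, 1:] e ~= 0" using d by (simp add: d_def power2_eq_square algebra_simps)
  note o = order_0I[OF this]
  have nz: "[:-e, 1:] * [:e ^ 2 + A, e, 1:] ~= 0"
   by (metis mult_eq_0_iff one_neq_zero pCons_eq_0_iff)
  show ?thesis unfolding Fe order_mult[OF nz] o using order_power_n_n[of e 1] by simp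
 qed
 \<comment> \<open>The cubic factors as (X - e) (X^2 + e X + e^2 + A); \<open>Ne\<close> and
   \<open>Gp\<close> are the two factors homogenised and evaluated at (N, D), and \<open>H\<close>
   is the whole cubic.\<close>
 define Gp where "Gp = N ^ 2 + [:e:] * N * D + [:e ^ 2 + A:] * D ^ 2"
 define H where "H = N ^ 3 + [:A:] * N * D ^ 2 + [:B:] * D ^ 3"
 have He: "H = Ne * Gp"
 proof -
  have "[:B:] = - (([:e:]) ^ 3 + [:A:] * [:e:])" by (simp add: B' power2_eq_square power3_eq_cube algebra_simps)
  moreover have "[:e ^ 2 + A:] = ([:e:]) ^ 2 + [:A:]" by (simp add: power2_eq_square)
  ultimately show ?thesis unfolding H_def Ne_def Gp_def by Groebner_Basis.algebra
 qed
 define V where "V = pderiv N * D - N * pderiv D"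
 have V: "V = pderiv Ne * D - Ne * pderiv D"
  unfolding V_def Ne_def by (simp add: pderiv_diff pderiv_smult algebra_simps)
 have ode: "?F * V ^ 2 = [:of_nat n ^ 2:] * H * D"
  unfolding V_def H_def by (rule mul_polys_ode[OF mp])
 have n0: "[:of_nat n ^ 2 :: complex:] ~= 0" using n1 by simp
 have order_n: "Polynomial.order x [:of_nat n ^ 2 :: complex:] = 0" for x using n1 by (intro order_0I) simp
 have Ne0: "Ne ~= 0"
 proof
  assume "Ne = 0"
  then have "UNIV \<subseteq> insert e (\<phi> ` Z)" using rootNe by auto
  then show False using finZ finite_subset infinite_UNIV_char_0 by (metis finite_imageI finite_insert)
 qed
 have ord_pos: "\<exists>k. Polynomial.order x q = Suc k" if "poly q x = 0" "q ~= 0" for q :: "complex poly" and x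
  using that order_root[of q x] by (cases "Polynomial.order x q") auto
 have wr: "Polynomial.order x V = k \<and> V ~= 0" if "poly Ne x = 0" "Polynomial.order x Ne = Suc k" for x k
  unfolding V using order_wronskian[OF Ne0 that(2) D0[OF that(1)]] by blast
 have V0: "V ~= 0" using wr[of e] ord_pos[of Ne e] rootNe Ne0 by blast
 have FV: "?F * V ^ 2 ~= 0" using V0 by (metis mult_eq_0_iff one_neq_zero pCons_eq_0_iff power_eq_0_iff)
 then have HD: "[:of_nat n ^ 2:] * H * D ~= 0" unfolding ode .
 then have H0: "H ~= 0" by auto
 \<comment> \<open>The orders of both sides of the differential equation at x. With
   \<open>order_wronskian\<close>, which lowers an order by one, this determines each
   multiplicity.\<close>
 have count: "Polynomial.order x ?F + 2 * Polynomial.order x V = Polynomial.order x H + Polynomial.order x D" for x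
 proof -
  have "Polynomial.order x (?F * V ^ 2) = Polynomial.order x ([:of_nat n ^ 2:] * H * D)" unfolding ode ..
  moreover have "Polynomial.order x (V ^ 2) = 2 * Polynomial.order x V"
   using V0 order_mult[of V V x] by (simp add: power2_eq_square)
  moreover have "[:of_nat n ^ 2:] * H ~= 0" using HD by auto
  ultimately show ?thesis using order_mult[OF FV, of x] order_mult[OF HD, of x] order_mult[of "[:of_nat n ^ 2:]" H x] order_n[of x]
   by simp
 qed
 have ordF: "Polynomial.order x ?F = 0" if "f x ~= 0" for x using that by (intro order_0I) (simp only: F not_False_eq_True)
 \<comment> \<open>If D has order k + 1, the Wronskian has order k while \<open>H\<close> and the
   cubic do not vanish, so 2 k = k + 1.\<close>
 have ordD: "Polynomial.order z D = 2" if z: "z \<in> Z" for z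
 proof -
  have Dz: "poly D z = 0" using rootD z by blast
  then obtain k where k: "Polynomial.order z D = Suc k" using ord_pos D by blast
  have "V = - (pderiv D * N - D * pderiv N)" unfolding V_def by simp
  then have "Polynomial.order z V = k" using order_wronskian(1)[OF D(1) k N0[OF Dz]] by (metis order_uminus)
  moreover have "Polynomial.order z H = 0" using Dz N0[OF Dz] by (intro order_0I) (simp add: H_def)
  ultimately show ?thesis using count[of z] ordF[OF fZ[OF z]] k by simp
 qed
 have ordH: "Polynomial.order x H = Polynomial.order x Ne \<and> Polynomial.order x D = 0" if "poly Ne x = 0" for x
 proof -
  have "poly N x = e * poly D x" using that by (simp add: Ne_def)
  then have "poly Gp x = d * poly D x ^ 2" by (simp add: Gp_def d_def power2_eq_square algebra_simps)
  then have "poly Gp x ~= 0" using d D0[OF that] by simp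
  then show ?thesis using order_mult[of Ne Gp x] He H0 order_0I[of Gp x] order_0I[OF D0[OF that]] by simp
 qed
 \<comment> \<open>At e the cubic has a simple zero, so 1 + 2 k = k + 1 and \<open>Ne\<close> has a
   simple zero; at the other zeros 2 k = k + 1, and they are double.\<close>
 have ordNe: "Polynomial.order x Ne = (if x = e then 1 else 2)" if x: "x \<in> insert e (\<phi> ` Z)" for x
 proof -
  have Nx: "poly Ne x = 0" using rootNe x by blast
  then obtain k where k: "Polynomial.order x Ne = Suc k" using ord_pos Ne0 by blast
  have kk: "Polynomial.order x ?F + 2 * k = Suc k" using count[of x] wr[OF Nx k] ordH[OF Nx] k by simp
  show ?thesis
  proof (cases "x = e")
   case True
   then show ?thesis using kk f_root k by simp
  next
   case False
   have "f x ~= 0"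
   proof
    assume f: "f x = 0"
    have "Affine x 0 \<in> ec W" using f by (simp add: on_short)
    from val[OF this] odd_two[OF f] have "poly N x = x * poly D x" by simp
    then have "(x - e) * poly D x = 0" using Nx by (simp add: Ne_def algebra_simps)
    then show False using False D0[OF Nx] by simp
   qed
   then show ?thesis using kk ordF[of x] k False by simp
  qed
 qed
 define a where "a = lead_coeff Ne"
 define b where "b = lead_coeff D"
 have ab: "a ~= 0" "b ~= 0" using Ne0 D by (auto simp: a_def b_def)
 have Dx: "poly D x = b * (\<Prod>z\<in>Z. (x - z) ^ 2)" for x
  unfolding b_def by (rule linear_product_order) (use D rootD finZ ordD in auto)
 have inj: "inj_on \<phi> Z"
  using eZ d by (auto simp: inj_on_def \<phi>_def)
 have e\<phi>: "e \<notin> \<phi> ` Z" using eZ d by (auto simp: \<phi>_def)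
 have Nex: "poly Ne x = a * ((x - e) * (\<Prod>z\<in>Z. (x - \<phi> z) ^ 2))" for x
 proof -
  have "poly Ne x = a * (\<Prod>z\<in>insert e (\<phi> ` Z). (x - z) ^ (if z = e then 1 else 2))"
   unfolding a_def by (rule linear_product_order) (use Ne0 rootNe finZ ordNe in auto)
  also have "(\<Prod>z\<in>insert e (\<phi> ` Z). (x - z) ^ (if z = e then 1 else 2)) = (x - e) * (\<Prod>z\<in>\<phi> ` Z. (x - z) ^ (if z = e then 1 else 2))"
   using finZ e\<phi> by (subst prod.insert) auto
  also have "(\<Prod>z\<in>\<phi> ` Z. (x - z) ^ (if z = e then 1 else 2)) = (\<Prod>z\<in>\<phi> ` Z. (x - z) ^ 2)"
   using e\<phi> by (intro prod.cong) auto
  also have "\<dots> = (\<Prod>z\<in>Z. (x - \<phi> z) ^ 2)" using inj by (simp add: prod.reindex)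
  finally show ?thesis .
 qed
 \<comment> \<open>Every factor (x - c) / (x - c') tends to 1, so the limit of R x / x is the
   quotient of the leading coefficients.\<close>
 have lc: "a / b = 1 / of_nat n ^ 2"
 proof -
  have quot: "((\<lambda>x::complex. (x - c) / (x - c')) \<longlongrightarrow> 1) at_infinity" for c c'
  proof -
   have "((\<lambda>x. (1 - c / x) / (1 - c' / x)) \<longlongrightarrow> (1 - 0) / (1 - 0)) at_infinity"
    using inverse_infinity[of _ 0] by (intro tendsto_intros) auto
   then have l: "((\<lambda>x. (1 - c / x) / (1 - c' / x)) \<longlongrightarrow> 1) at_infinity" by simp
   have "\<forall>\<^sub>F x in at_infinity. (1 - c / x) / (1 - c' / x) = (x - c) / (x - c')"
    using infinity_ne[of 0]
   proof eventually_elim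
    case (elim x)
    then have "1 - c / x = (x - c) / x" "1 - c' / x = (x - c') / x" by (auto simp: diff_divide_distrib)
    then show ?case using elim by simp
   qed
   then show ?thesis by (rule Lim_transform_eventually[OF l])
  qed
  have "((\<lambda>x. a / b * ((x - e) / (x - 0)) * (\<Prod>z\<in>Z. ((x - \<phi> z) / (x - z)) ^ 2)) \<longlongrightarrow> a / b * 1 * (\<Prod>z\<in>Z. 1 ^ 2)) at_infinity"
   by (intro tendsto_mult tendsto_const quot tendsto_prod tendsto_power)
  then have l1: "((\<lambda>x. a / b * ((x - e) / (x - 0)) * (\<Prod>z\<in>Z. ((x - \<phi> z) / (x - z)) ^ 2)) \<longlongrightarrow> a / b) at_infinity"
   by simp
  have l2: "((\<lambda>x. poly N x / poly D x / x) \<longlongrightarrow> 1 / of_nat n ^ 2) at_infinity"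
   using RS unfolding mul_fun_def by blast
  have "((\<lambda>x. poly N x / poly D x / x - e / x) \<longlongrightarrow> 1 / of_nat n ^ 2 - 0) at_infinity"
   using inverse_infinity[of e 0] by (intro tendsto_diff l2) simp
  moreover have "\<forall>\<^sub>F x in at_infinity. poly N x / poly D x / x - e / x = a / b * ((x - e) / (x - 0)) * (\<Prod>z\<in>Z. ((x - \<phi> z) / (x - z)) ^ 2)"
   using infinity_ne[of 0] cofinite_infinity[OF poly_cofinite[OF D(1)]]
  proof eventually_elim
   case (elim x)
   have "poly N x / poly D x - e = poly Ne x / poly D x" using elim by (simp add: Ne_def diff_divide_distrib)
   also have "\<dots> = a / b * (x - e) * ((\<Prod>z\<in>Z. (x - \<phi> z) ^ 2) / (\<Prod>z\<in>Z. (x - z) ^ 2))"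
    unfolding Nex Dx by simp
   also have "(\<Prod>z\<in>Z. (x - \<phi> z) ^ 2) / (\<Prod>z\<in>Z. (x - z) ^ 2) = (\<Prod>z\<in>Z. ((x - \<phi> z) / (x - z)) ^ 2)"
    by (simp add: prod_dividef power_divide)
   finally have "(poly N x / poly D x - e) / x = a / b * (x - e) * (\<Prod>z\<in>Z. ((x - \<phi> z) / (x - z)) ^ 2) / x" by simp
   moreover have "poly N x / poly D x / x - e / x = (poly N x / poly D x - e) / x" by (simp add: diff_divide_distrib)
   moreover have "a / b * (x - e) * c / x = a / b * ((x - e) / (x - 0)) * c" for c by simp
   ultimately show ?case by metis
  qed
  ultimately have "((\<lambda>x. a / b * ((x - e) / (x - 0)) * (\<Prod>z\<in>Z. ((x - \<phi> z) / (x - z)) ^ 2)) \<longlongrightarrow> 1 / of_nat n ^ 2 - 0) at_infinity"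
   by (rule Lim_transform_eventually)
  then show ?thesis using tendsto_unique[OF trivial_limit_at_infinity l1] by simp
 qed
 define N1 where "N1 = [:a:] * (\<Prod>z\<in>Z. [:- \<phi> z, 1:] ^ 2)"
 have N1x: "poly N1 x = a * (\<Prod>z\<in>Z. (x - \<phi> z) ^ 2)" for x by (simp add: N1_def poly_prod)
 have NeN1: "Ne = [:-e, 1:] * N1"
  by (rule poly_eq_cofinite) (simp add: Nex N1x algebra_simps)
 have N1e: "poly N1 e ~= 0" using ab e\<phi> finZ by (auto simp: N1x)
 have pe: "poly (pderiv Ne) e = poly N1 e"
  unfolding NeN1 pderiv_mult poly_add poly_mult by (simp add: pderiv_pCons)
 \<comment> \<open>Cancelling X - e and evaluating at e turns the differential equation into
   \<open>N1\<close>(e) = n^2 D(e).\<close>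
 have "[:-e, 1:] * ([:e ^ 2 + A, e, 1:] * V ^ 2) = [:-e, 1:] * ([:of_nat n ^ 2:] * N1 * Gp * D)"
  using ode unfolding Fe He NeN1 by (simp only: mult_ac)
 then have "[:e ^ 2 + A, e, 1:] * V ^ 2 = [:of_nat n ^ 2:] * N1 * Gp * D"
  using mult_left_cancel[of "[:-e, 1:]"] by (metis one_neq_zero pCons_eq_0_iff)
 then have "poly ([:e ^ 2 + A, e, 1:] * V ^ 2) e = poly ([:of_nat n ^ 2:] * N1 * Gp * D) e" by simp
 moreover have "poly [:e ^ 2 + A, e, 1:] e = d" by (simp add: d_def power2_eq_square algebra_simps)
 moreover have "poly V e = poly N1 e * poly D e"
  unfolding V poly_diff poly_mult pe using rootNe[of e] by simp
 moreover have "poly Gp e = d * poly D e ^ 2"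
 proof -
  have "poly N e = e * poly D e" using rootNe[of e] by (simp add: Ne_def)
  then show ?thesis by (simp add: Gp_def d_def power2_eq_square algebra_simps)
 qed
 ultimately have "d * (poly N1 e * poly D e) ^ 2 = of_nat n ^ 2 * poly N1 e * (d * poly D e ^ 2) * poly D e"
  by (simp only: poly_mult poly_power poly_pCons poly_0 mult_zero_right add_0_right)
 then have "(d * poly N1 e * poly D e ^ 2) * poly N1 e = (d * poly N1 e * poly D e ^ 2) * (of_nat n ^ 2 * poly D e)"
  by (simp add: power2_eq_square algebra_simps)
 then have "poly N1 e = of_nat n ^ 2 * poly D e"
  using d N1e D0[of e] rootNe by simp
 then have fin: "a * (\<Prod>z\<in>Z. (e - \<phi> z) ^ 2) = of_nat n ^ 2 * (b * (\<Prod>z\<in>Z. (e - z) ^ 2))"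
  unfolding N1x Dx .
 have nn: "(of_nat n :: complex) ~= 0" using n1 by simp
 have "b = of_nat n ^ 2 * a" using lc ab nn by (simp add: field_simps)
 then have fin': "(\<Prod>z\<in>Z. (e - \<phi> z) ^ 2) = of_nat n ^ 4 * (\<Prod>z\<in>Z. (e - z) ^ 2)"
  using fin ab by (simp add: power2_eq_square power4_eq_xxxx)
 \<comment> \<open>The formula for the translation gives (e - \<phi> z) (e - z) = d, which removes
   the translated abscissas from the identity.\<close>
 have "(\<Prod>z\<in>Z. (e - \<phi> z) ^ 2) * (\<Prod>z\<in>Z. (e - z) ^ 2) = (\<Prod>z\<in>Z. d ^ 2)"
  unfolding prod.distrib[symmetric]
 proof (rule prod.cong[OF refl])
  fix z assume "z \<in> Z"
  then have ne: "z - e ~= 0" using eZ by auto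
  have "e - \<phi> z = - (d / (z - e))" "e - z = - (z - e)" by (simp_all add: \<phi>_def)
  then have "(e - \<phi> z) * (e - z) = d / (z - e) * (z - e)" by (metis minus_mult_minus)
  then have "(e - \<phi> z) * (e - z) = d" using ne by simp
  then show "(e - \<phi> z) ^ 2 * (e - z) ^ 2 = d ^ 2" by (metis power_mult_distrib)
 qed
 also have "\<dots> = d ^ (2 * card Z)" by (simp add: power_mult)
 finally show "(3 * e ^ 2 + A) ^ (2 * card Z) = of_nat n ^ 4 * (\<Prod>x\<in>Z. (e - x) ^ 4)"
  unfolding fin' by (simp add: d_def mult.assoc flip: prod.distrib power_add)
qed

end

section \<open>Valuation rings of the complex numbers\<close>

definition csubring :: "complex set => bool"
 where "csubring R \<longleftrightarrow> 1 \<in> R \<and> (\<forall>x\<in>R. \<forall>y\<in>R. x - y \<in> R \<and> x * y \<in> R)"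

lemma csubringD:
 assumes "csubring R"
 shows "1 \<in> R" "0 \<in> R" "x \<in> R ==> y \<in> R ==> x - y \<in> R" "x \<in> R ==> y \<in> R ==> x * y \<in> R"
  "x \<in> R ==> - x \<in> R" "x \<in> R ==> y \<in> R ==> x + y \<in> R" "x \<in> R ==> x ^ n \<in> R"
  "of_nat n \<in> R" "of_int k \<in> R" "numeral m \<in> R"
proof -
 have 1: "1 \<in> R" and d: "\<And>x y. x \<in> R ==> y \<in> R ==> x - y \<in> R" and m: "\<And>x y. x \<in> R ==> y \<in> R ==> x * y \<in> R"
  using assms by (auto simp: csubring_def)
 have 0: "0 \<in> R" using d[OF 1 1] by simp
 have neg: "- x \<in> R" if "x \<in> R" for x using d[OF 0 that] by simp
 have plus: "x + y \<in> R" if "x \<in> R" "y \<in> R" for x y using d[OF that(1) neg[OF that(2)]] by simp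
 have nat: "of_nat n \<in> R" for n by (induction n) (auto intro: 0 1 plus)
 show "of_int k \<in> R" using nat neg[OF nat] by (cases k) (auto simp del: of_nat_Suc)
 show "numeral m \<in> R" using nat[of "numeral m"] by simp
 show "x ^ n \<in> R" if "x \<in> R" using that by (induction n) (auto intro: 1 m)
 show "1 \<in> R" "0 \<in> R" "of_nat n \<in> R" by (fact 1 0 nat)+
 show "x \<in> R ==> y \<in> R ==> x - y \<in> R" "x \<in> R ==> y \<in> R ==> x * y \<in> R"
  "x \<in> R ==> - x \<in> R" "x \<in> R ==> y \<in> R ==> x + y \<in> R"
  by (fact d m neg plus)+
qed

lemma csubring_sum: "csubring R ==> (\<And>i. i \<in> I ==> h i \<in> R) ==> (\<Sum>i\<in>I. h i) \<in> R"
 by (induction I rule: infinite_finite_induct) (auto intro: csubringD)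

lemma csubring_prod: "csubring R ==> (\<And>i. i \<in> I ==> h i \<in> R) ==> (\<Prod>i\<in>I. h i) \<in> R"
 by (induction I rule: infinite_finite_induct) (auto intro: csubringD)

definition coeffs_in :: "complex set => complex poly => bool"
 where "coeffs_in R u \<longleftrightarrow> (\<forall>i. coeff u i \<in> R)"

lemma coeffs_in_ops:
 assumes R: "csubring R"
 shows "coeffs_in R 0" "coeffs_in R 1" "c \<in> R ==> coeffs_in R u ==> coeffs_in R (pCons c u)"
  "coeffs_in R u ==> coeffs_in R v ==> coeffs_in R (u - v)"
  "coeffs_in R u ==> coeffs_in R v ==> coeffs_in R (u * v)"
  "c \<in> R ==> coeffs_in R (monom c n)"
  "coeffs_in R u ==> x \<in> R ==> poly u x \<in> R"
 using csubringD[OF R]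
 by (auto simp: coeffs_in_def coeff_pCons coeff_mult poly_altdef split: nat.splits intro!: csubring_sum[OF R])

lemma csubring_adjoin:
 assumes R: "csubring R" shows "csubring {poly u x | u. coeffs_in R u}"
 unfolding csubring_def
proof (safe)
 show "\<exists>u. 1 = poly u x \<and> coeffs_in R u" by (rule exI[of _ 1]) (simp add: coeffs_in_ops[OF R])
 fix u v assume uv: "coeffs_in R u" "coeffs_in R v"
 show "\<exists>w. poly u x - poly v x = poly w x \<and> coeffs_in R w"
  by (rule exI[of _ "u - v"]) (simp add: coeffs_in_ops[OF R] uv)
 show "\<exists>w. poly u x * poly v x = poly w x \<and> coeffs_in R w"
  by (rule exI[of _ "u * v"]) (simp add: coeffs_in_ops[OF R] uv)
qed

definition val_ring :: "complex set => bool"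
 where "val_ring A \<longleftrightarrow> csubring A \<and> (\<forall>x. x \<in> A \<or> inverse x \<in> A)"

text \<open>A maximal subring containing \<open>q\<close> but not \<open>1/q\<close> is a valuation ring.\<close>

lemma val_ring_descent:
 assumes A: "csubring A" and q: "q \<in> A" "inverse q \<notin> A"
  and unit: "\<And>b. b \<in> A ==> inverse (1 - q * b) \<in> A"
  and x: "x ~= 0"
  and a: "\<And>i. a i \<in> A" "1 = q * (\<Sum>i\<le>n. a i * x ^ i)"
  and b: "\<And>i. b i \<in> A" "1 = q * (\<Sum>i\<le>m. b i * inverse x ^ i)"
  and mn: "m \<le> n"
 shows "\<exists>k<n. \<exists>c. (\<forall>i. c i \<in> A) \<and> 1 = q * (\<Sum>i\<le>k. c i * x ^ i)"
proof (cases n)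
 case 0
 then have "1 = q * a 0" using a(2) by simp
 then have "inverse q = a 0" by (metis inverse_unique)
 then show ?thesis using a(1)[of 0] q by simp
next
 case (Suc k)
 define w where "w = inverse (1 - q * b 0)"
 have w: "w \<in> A" unfolding w_def using unit b(1) by blast
 have "1 - q * b 0 ~= 0"
 proof
  assume "1 - q * b 0 = 0"
  then have "1 = q * b 0" by simp
  then have "inverse q = b 0" by (metis inverse_unique)
  then show False using b(1)[of 0] q by simp
 qed
 \<comment> \<open>In the relation for the inverse of x the constant term is moved to the left; 1 -
   q b0 being invertible in A, multiplication by x^n expresses x^n by lower powers of x, which is
   possible as m is at most n.\<close>
 then have w1: "w * (1 - q * b 0) = 1" by (simp add: w_def)
 have "1 = q * (b 0 + (\<Sum>i\<in>{1..m}. b i * inverse x ^ i))"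
  using b(2) by (simp add: atMost_atLeast0 sum.atLeast_Suc_atMost)
 then have "1 - q * b 0 = q * (\<Sum>i\<in>{1..m}. b i * inverse x ^ i)" by (simp add: algebra_simps)
 then have "1 = w * (q * (\<Sum>i\<in>{1..m}. b i * inverse x ^ i))" using w1 by simp
 then have "x ^ n = w * (q * (\<Sum>i\<in>{1..m}. b i * inverse x ^ i)) * x ^ n" by simp
 also have "\<dots> = (\<Sum>i\<in>{1..m}. w * q * b i * (inverse x ^ i * x ^ n))"
  by (simp add: sum_distrib_left sum_distrib_right mult_ac)
 also have "\<dots> = (\<Sum>i\<in>{1..m}. w * q * b i * x ^ (n - i))"
 proof (rule sum.cong[OF refl])
  fix i assume "i \<in> {1..m}"
  then have "n = i + (n - i)" using mn by simp
  then have "x ^ n = x ^ i * x ^ (n - i)" by (metis power_add)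
  then show "w * q * b i * (inverse x ^ i * x ^ n) = w * q * b i * x ^ (n - i)"
   using x by (simp add: power_inverse)
 qed
 also have "\<dots> = (\<Sum>j\<in>{n - m..k}. w * q * b (n - j) * x ^ j)"
  by (rule sum.reindex_bij_witness[of _ "\<lambda>j. n - j" "\<lambda>i. n - i"]) (use mn Suc in auto)
 also have "\<dots> = (\<Sum>j\<le>k. (if n - m \<le> j then w * q * b (n - j) else 0) * x ^ j)"
  by (rule sum.mono_neutral_cong_left) auto
 finally have xn: "x ^ n = (\<Sum>j\<le>k. (if n - m \<le> j then w * q * b (n - j) else 0) * x ^ j)" .
 define c where "c j = a j + a n * (if n - m \<le> j then w * q * b (n - j) else 0)" for j
 have "(\<Sum>i\<le>n. a i * x ^ i) = (\<Sum>i\<le>k. a i * x ^ i) + a n * x ^ n" by (simp add: Suc)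
 also have "\<dots> = (\<Sum>i\<le>k. c i * x ^ i)"
  unfolding xn c_def by (simp add: sum_distrib_left sum.distrib[symmetric] algebra_simps)
 finally have "1 = q * (\<Sum>i\<le>k. c i * x ^ i)" using a(2) by simp
 moreover have "\<forall>i. c i \<in> A" unfolding c_def using a(1) b(1) w q csubringD[OF A] by auto
 ultimately show ?thesis using Suc by blast
qed

text \<open>Chevalley's argument. If A is maximal among the subrings omitting 1 / q, adjoining a
  missing x produces 1 / q, that is, a relation 1 = q g(x). If x and its inverse were both missing,
  \<open>val_ring_descent\<close> would shorten one of two relations of least degree.\<close>

lemma val_ring_exists:
 assumes R: "csubring R" and q: "q \<in> R" "inverse q \<notin> R"
 shows "\<exists>A. val_ring A \<and> R \<subseteq> A \<and> inverse q \<notin> A"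
proof -
 define F where "F = {A. csubring A \<and> R \<subseteq> A \<and> inverse q \<notin> A}"
 have "R \<in> F" using R q by (simp add: F_def)
 have "\<exists>M\<in>F. \<forall>X'\<in>F. M \<subseteq> X' --> X' = M"
 proof (rule subset_Zorn_nonempty)
  show "F ~= {}" using \<open>R \<in> F\<close> by blast
  fix C assume C: "C ~= {}" "subset.chain F C"
  then have CF: "C \<subseteq> F" and tot: "\<And>A A'. A \<in> C ==> A' \<in> C ==> A \<subseteq> A' \<or> A' \<subseteq> A"
   by (auto simp: subset_chain_def)
  have "csubring (\<Union>C)"
   unfolding csubring_def
  proof (intro conjI ballI)
   show "1 \<in> \<Union>C" using C(1) CF by (auto simp: F_def csubring_def)
   fix x y assume "x \<in> \<Union>C" "y \<in> \<Union>C"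
   then obtain A A' where AA: "x \<in> A" "y \<in> A'" "A \<in> C" "A' \<in> C" by blast
   then obtain A'' where "A'' \<in> C" "x \<in> A''" "y \<in> A''" using tot[of A A'] by blast
   moreover from this have "csubring A''" using CF by (auto simp: F_def)
   ultimately show "x - y \<in> \<Union>C" "x * y \<in> \<Union>C" unfolding csubring_def by blast+
  qed
  then show "\<Union>C \<in> F" using C(1) CF by (auto simp: F_def)
 qed
 then obtain A where A: "csubring A" "R \<subseteq> A" "inverse q \<notin> A" and max: "\<And>A'. A' \<in> F ==> A \<subseteq> A' ==> A' = A"
  by (auto simp: F_def)
 have qA: "q \<in> A" using q A by blast
 have adj: "inverse q \<in> {poly u x | u. coeffs_in A u}" if x: "x \<notin> A" for x
 proof (rule ccontr)
  assume n: "inverse q \<notin> {poly u x | u. coeffs_in A u}"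
  have sub: "A \<subseteq> {poly u x | u. coeffs_in A u}"
  proof
   fix c assume "c \<in> A"
   then have "coeffs_in A [:c:]" by (simp add: coeffs_in_ops[OF A(1)])
   moreover have "c = poly [:c:] x" by simp
   ultimately show "c \<in> {poly u x | u. coeffs_in A u}" by blast
  qed
  then have "{poly u x | u. coeffs_in A u} \<in> F"
   using n A csubring_adjoin[OF A(1)] by (auto simp: F_def)
  then have "{poly u x | u. coeffs_in A u} = A" using max sub by blast
  moreover have "coeffs_in A [:0, 1:]" using csubringD[OF A(1)] by (simp add: coeffs_in_ops[OF A(1)])
  then have "poly [:0, 1:] x \<in> {poly u x | u. coeffs_in A u}" by blast
  ultimately show False using x by simp
 qed
 have q0: "q ~= 0" using A csubringD[OF A(1)] by auto
 have expand: "\<exists>n a. (\<forall>i. a i \<in> A) \<and> 1 = q * (\<Sum>i\<le>n. a i * x ^ i)" if "x \<notin> A" for x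
 proof -
  from adj[OF that] obtain u where u: "coeffs_in A u" "inverse q = poly u x" by blast
  then have "1 = q * (\<Sum>i\<le>degree u. coeff u i * x ^ i)"
   using q0 unfolding poly_altdef[symmetric] by (metis right_inverse)
  then show ?thesis using u(1) unfolding coeffs_in_def by blast
 qed
 \<comment> \<open>If 1 - q b were not invertible in A, then 1 / q would be a polynomial in its
   inverse. Denominators are cleared by (1 - q b)^n, which is 1 modulo q A, and this puts 1 / q into
   A.\<close>
 have unit: "inverse (1 - q * b) \<in> A" if b: "b \<in> A" for b
 proof (rule ccontr)
  assume "inverse (1 - q * b) \<notin> A"
  then obtain n a where a: "\<And>i. a i \<in> A" "1 = q * (\<Sum>i\<le>n. a i * inverse (1 - q * b) ^ i)"
   using expand by blast
  have c0: "1 - q * b ~= 0"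
   using \<open>inverse (1 - q * b) \<notin> A\<close> csubringD(2)[OF A(1)] by auto
  have "(1 - q * b) ^ n = q * (\<Sum>i\<le>n. a i * inverse (1 - q * b) ^ i) * (1 - q * b) ^ n" using a(2) by simp
  also have "\<dots> = q * (\<Sum>i\<le>n. a i * (inverse (1 - q * b) ^ i * (1 - q * b) ^ n))"
   by (simp only: sum_distrib_right mult.assoc)
  also have "(\<Sum>i\<le>n. a i * (inverse (1 - q * b) ^ i * (1 - q * b) ^ n)) = (\<Sum>i\<le>n. a i * (1 - q * b) ^ (n - i))"
  proof (rule sum.cong[OF refl])
   fix i assume "i \<in> {..n}"
   then have "(1 - q * b) ^ n = (1 - q * b) ^ i * (1 - q * b) ^ (n - i)" by (simp flip: power_add)
   then show "a i * (inverse (1 - q * b) ^ i * (1 - q * b) ^ n) = a i * (1 - q * b) ^ (n - i)"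
    using c0 by (simp add: power_inverse)
  qed
  finally have 1: "(1 - q * b) ^ n = q * (\<Sum>i\<le>n. a i * (1 - q * b) ^ (n - i))" .
  have "\<exists>b'\<in>A. (1 - q * b) ^ k = 1 - q * b'" for k
  proof (induction k)
   case 0 show ?case by (rule bexI[of _ 0]) (use csubringD[OF A(1)] in auto)
  next
   case (Suc k)
   then obtain b' where "b' \<in> A" "(1 - q * b) ^ k = 1 - q * b'" by blast
   then have "(1 - q * b) ^ Suc k = 1 - q * (b + b' - q * b * b')" by (simp only: power_Suc) (simp add: algebra_simps)
   moreover have "b + b' - q * b * b' \<in> A" by (intro csubringD(3,4,6)[OF A(1)] b qA \<open>b' \<in> A\<close>)
   ultimately show ?case by blast
  qed
  then obtain b' where b': "b' \<in> A" "(1 - q * b) ^ n = 1 - q * b'" by blast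
  then have "1 = q * (b' + (\<Sum>i\<le>n. a i * (1 - q * b) ^ (n - i)))" using 1 by (simp add: algebra_simps)
  then have "inverse q = b' + (\<Sum>i\<le>n. a i * (1 - q * b) ^ (n - i))" by (metis inverse_unique)
  moreover have "b' + (\<Sum>i\<le>n. a i * (1 - q * b) ^ (n - i)) \<in> A"
   by (intro csubringD(6,4,7,3,1)[OF A(1)] csubring_sum[OF A(1)] a(1) b qA b'(1))
  ultimately show False using A by simp
 qed
 have "x \<in> A \<or> inverse x \<in> A" for x
 proof (rule ccontr)
  assume "\<not> ?thesis"
  then have x: "x \<notin> A" "inverse x \<notin> A" by auto
  have x0: "x ~= 0" using x csubringD(2)[OF A(1)] by auto
  define P where "P x n \<longleftrightarrow> (\<exists>c. (\<forall>i. c i \<in> A) \<and> 1 = q * (\<Sum>i\<le>n. c i * x ^ i))" for x n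
  have ex: "\<exists>n. P x n" "\<exists>n. P (inverse x) n" unfolding P_def using expand[OF x(1)] expand[OF x(2)] by blast+
  define n where "n = (LEAST n. P x n)"
  define m where "m = (LEAST n. P (inverse x) n)"
  have n: "P x n" "\<And>k. k < n ==> \<not> P x k" unfolding n_def using ex(1) by (auto intro: LeastI_ex dest: not_less_Least)
  have m: "P (inverse x) m" "\<And>k. k < m ==> \<not> P (inverse x) k" unfolding m_def using ex(2) by (auto intro: LeastI_ex dest: not_less_Least)
  obtain a where a: "\<And>i. a i \<in> A" "1 = q * (\<Sum>i\<le>n. a i * x ^ i)" using n(1) unfolding P_def by blast
  obtain b where b: "\<And>i. b i \<in> A" "1 = q * (\<Sum>i\<le>m. b i * inverse x ^ i)" using m(1) unfolding P_def by blast
  show False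
  proof (cases "m \<le> n")
   case True
   from val_ring_descent[OF A(1) qA A(3) unit x0 a b True] show False using n(2) unfolding P_def by blast
  next
   case False
   have "1 = q * (\<Sum>i\<le>n. a i * inverse (inverse x) ^ i)" using a(2) by simp
   from val_ring_descent[OF A(1) qA A(3) unit _ b a(1) this] x0 False show False using m(2) unfolding P_def by auto
  qed
 qed
 then show ?thesis using A unfolding val_ring_def by blast
qed

text \<open>If x were missing, its inverse would lie in A; dividing the equation by x^(n-1), with n
  its degree, expresses x by powers of the inverse.\<close>

lemma val_ring_integrally_closed:
 assumes A: "val_ring A" and u: "coeffs_in A u" "lead_coeff u = 1" "poly u x = 0"
 shows "x \<in> A"
proof (rule ccontr)
 assume x: "x \<notin> A"
 have R: "csubring A" using A by (simp add: val_ring_def)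
 have ix: "inverse x \<in> A" using A x by (auto simp: val_ring_def)
 have x0: "x ~= 0" using x csubringD(2)[OF R] by auto
 define n where "n = degree u"
 have "n ~= 0"
 proof
  assume "n = 0"
  then obtain c where "u = [:c:]" unfolding n_def using degree_eq_zeroE by blast
  then show False using u by simp
 qed
 then obtain k where k: "n = Suc k" by (cases n) auto
 have "0 = (\<Sum>i\<le>n. coeff u i * x ^ i)" using u(3) by (simp add: poly_altdef n_def)
 also have "\<dots> = (\<Sum>i\<le>k. coeff u i * x ^ i) + x ^ n" using u(2) by (simp add: n_def[symmetric] k)
 finally have "x ^ k * x = - (\<Sum>i\<le>k. coeff u i * x ^ i)" by (simp add: k add_eq_0_iff2 mult.commute)
 then have "inverse x ^ k * (x ^ k * x) = inverse x ^ k * - (\<Sum>i\<le>k. coeff u i * x ^ i)" by simp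
 then have "x = - (\<Sum>i\<le>k. coeff u i * (inverse x ^ k * x ^ i))"
  using x0 by (simp add: power_inverse sum_distrib_left mult_ac)
 also have "(\<Sum>i\<le>k. coeff u i * (inverse x ^ k * x ^ i)) = (\<Sum>i\<le>k. coeff u i * inverse x ^ (k - i))"
 proof (rule sum.cong[OF refl])
  fix i assume "i \<in> {..k}"
  then have "inverse x ^ k = inverse x ^ (k - i) * inverse x ^ i" by (simp flip: power_add)
  then show "coeff u i * (inverse x ^ k * x ^ i) = coeff u i * inverse x ^ (k - i)"
   using x0 by (simp add: power_inverse)
 qed
 also have "- \<dots> \<in> A"
  using u(1) ix csubringD[OF R] by (auto simp: coeffs_in_def intro!: csubringD(5)[OF R] csubring_sum[OF R])
 finally show False using x by simp
qed

lemma csubring_Ints: "csubring \<int>" and csubring_Rats: "csubring \<rat>"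
 by (auto simp: csubring_def)

text \<open>If 1 / x is not invertible in B[1 / x], \<open>val_ring_exists\<close> yields a
  valuation ring without x. If it is, x is a polynomial in 1 / x, and clearing denominators gives a
  monic equation.\<close>

lemma integral_iff_val_rings:
 assumes B: "csubring B"
 shows "(\<exists>u. coeffs_in B u \<and> lead_coeff u = 1 \<and> poly u x = 0) \<longleftrightarrow> (\<forall>A. val_ring A \<and> B \<subseteq> A --> x \<in> A)"
proof
 assume "\<exists>u. coeffs_in B u \<and> lead_coeff u = 1 \<and> poly u x = 0"
 then show "\<forall>A. val_ring A \<and> B \<subseteq> A --> x \<in> A"
  using val_ring_integrally_closed[of _ _ x] by (auto simp: coeffs_in_def subset_iff)
next
 assume all: "\<forall>A. val_ring A \<and> B \<subseteq> A --> x \<in> A"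
 note D = csubringD[OF B]
 define R where "R = {poly u (inverse x) | u. coeffs_in B u}"
 have R: "csubring R" unfolding R_def by (rule csubring_adjoin[OF B])
 have "coeffs_in B [:0, 1:]" using D by (simp add: coeffs_in_def coeff_pCons split: nat.splits)
 then have "poly [:0, 1:] (inverse x) \<in> R" unfolding R_def by blast
 then have ix: "inverse x \<in> R" by simp
 have BR: "B \<subseteq> R"
 proof
  fix c assume "c \<in> B"
  then have "coeffs_in B [:c:]" using D by (simp add: coeffs_in_def coeff_pCons split: nat.splits)
  then have "poly [:c:] (inverse x) \<in> R" unfolding R_def by blast
  then show "c \<in> R" by simp
 qed
 have "inverse (inverse x) \<in> R"
  using val_ring_exists[OF R ix] all BR by auto
 then obtain u where u: "coeffs_in B u" "x = poly u (inverse x)" by (auto simp: R_def)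
 show "\<exists>u. coeffs_in B u \<and> lead_coeff u = 1 \<and> poly u x = 0"
 proof (cases "x = 0")
  case True
  then show ?thesis using \<open>coeffs_in B [:0, 1:]\<close> by (intro exI[of _ "[:0, 1:]"]) simp
 next
  case x0: False
  define n where "n = degree u"
  define v where "v = monom 1 (Suc n) - (\<Sum>i\<le>n. monom (coeff u i) (n - i))"
  have "x * x ^ n = (\<Sum>i\<le>n. coeff u i * inverse x ^ i) * x ^ n"
   using u(2) by (simp add: poly_altdef n_def)
  also have "\<dots> = (\<Sum>i\<le>n. coeff u i * (inverse x ^ i * x ^ n))"
   by (simp only: sum_distrib_right mult.assoc)
  also have "\<dots> = (\<Sum>i\<le>n. coeff u i * x ^ (n - i))"
  proof (rule sum.cong[OF refl])
   fix i assume "i \<in> {..n}"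
   then have "x ^ n = x ^ i * x ^ (n - i)" by (simp flip: power_add)
   then show "coeff u i * (inverse x ^ i * x ^ n) = coeff u i * x ^ (n - i)"
    using x0 by (simp add: power_inverse)
  qed
  finally have root: "poly v x = 0" by (simp add: v_def poly_monom poly_sum)
  have deg: "degree (\<Sum>i\<le>n. monom (coeff u i) (n - i)) \<le> n"
   by (rule degree_sum_le) (auto intro: order_trans[OF degree_monom_le])
  have cv: "coeff v (Suc n) = 1"
   using deg by (simp add: v_def coeff_eq_0)
  moreover have "degree v \<le> Suc n"
   unfolding v_def using deg by (intro degree_diff_le) (auto intro: order_trans[OF degree_monom_le])
  ultimately have "degree v = Suc n" using le_degree[of v "Suc n"] by simp
  then have "lead_coeff v = 1" using cv by simp
  moreover have "coeffs_in B v"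
   using u(1) by (auto simp: v_def coeffs_in_def coeff_sum intro!: D csubring_sum[OF B])
  ultimately show ?thesis using root by blast
 qed
qed

lemma csubring_integral: "csubring {x. \<forall>A. val_ring A \<and> B \<subseteq> A --> x \<in> A}"
 by (auto simp: csubring_def val_ring_def)

text \<open>Writes the algebraic integers as an intersection of rings: closure under sums and
  products is then immediate, and integers lie in every place by definition.\<close>

lemma algebraic_int_iff_val_rings: "algebraic_int x \<longleftrightarrow> (\<forall>A. val_ring A --> x \<in> A)"
proof -
 have "\<int> \<subseteq> A" if "val_ring A" for A
  using that csubringD(9) unfolding val_ring_def by (metis Ints_cases subsetI)
 then show ?thesis
  using integral_iff_val_rings[OF csubring_Ints, of x] unfolding algebraic_int.simps coeffs_in_def by auto
qed

lemma algebraic_iff_val_rings: "algebraic x \<longleftrightarrow> (\<forall>A. val_ring A \<and> \<rat> \<subseteq> A --> x \<in> A)"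
proof -
 have "algebraic x \<longleftrightarrow> (\<exists>u. coeffs_in \<rat> u \<and> lead_coeff u = 1 \<and> poly u x = 0)"
 proof
  assume "algebraic x"
  then obtain u where u: "\<forall>i. coeff u i \<in> \<rat>" "u ~= 0" "poly u x = 0" by (auto simp: algebraic_altdef)
  then show "\<exists>u. coeffs_in \<rat> u \<and> lead_coeff u = 1 \<and> poly u x = 0"
   by (intro exI[of _ "smult (inverse (lead_coeff u)) u"]) (auto simp: coeffs_in_def)
 qed (auto simp: algebraic_altdef coeffs_in_def)
 then show ?thesis using integral_iff_val_rings[OF csubring_Rats] by simp
qed

lemma csubring_algebraic_int: "csubring {x. algebraic_int x}"
 unfolding csubring_def algebraic_int_iff_val_rings by (auto simp: val_ring_def csubring_def)

lemma csubring_invariants: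
 assumes R: "csubring R" and V: "set_weierstrass V \<subseteq> R"
 shows "b2 V \<in> R" "b4 V \<in> R" "b6 V \<in> R" "b8 V \<in> R" "c4 V \<in> R" "c6 V \<in> R" "disc V \<in> R"
proof -
 note D = csubringD[OF R]
 have a: "a1 V \<in> R" "a2 V \<in> R" "a3 V \<in> R" "a4 V \<in> R" "a6 V \<in> R" using V by (cases V; simp)+
 show b: "b2 V \<in> R" unfolding b2_def using a by (intro D(3-7,10))
 show b4: "b4 V \<in> R" unfolding b4_def using a by (intro D(3-7,10))
 show b6: "b6 V \<in> R" unfolding b6_def using a by (intro D(3-7,10))
 show b8: "b8 V \<in> R" unfolding b8_def using a by (intro D(3-7,10))
 show "c4 V \<in> R" unfolding c4_def using b b4 by (intro D(3-7,10))
 show "c6 V \<in> R" unfolding c6_def using b b4 b6 by (intro D(3-7,10))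
 show "disc V \<in> R" unfolding disc_def using b b4 b6 b8 by (intro D(3-7,10))
qed

section \<open>Automorphisms of subfields of the complex numbers\<close>

definition csubfield :: "complex set => bool"
 where "csubfield F \<longleftrightarrow> csubring F \<and> (\<forall>x\<in>F. inverse x \<in> F)"

lemma csubfieldD:
 assumes "csubfield F"
 shows "csubring F" "x \<in> F ==> inverse x \<in> F" "x \<in> F ==> y \<in> F ==> x / y \<in> F" "r \<in> \<rat> ==> r \<in> F"
proof -
 show R: "csubring F" and i: "x \<in> F ==> inverse x \<in> F" for x using assms by (auto simp: csubfield_def)
 show d: "x \<in> F ==> y \<in> F ==> x / y \<in> F" for x y
  using i csubringD(4)[OF R] by (simp add: divide_inverse)
 show "r \<in> F" if r: "r \<in> \<rat>"
 proof -
  obtain a where "r = of_rat a" using r by (auto elim: Rats_cases)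
  then obtain m n :: int where "r = of_int m / of_int n"
   by (metis of_rat_rat quotient_of_denom_pos quotient_of_div of_rat_divide of_rat_of_int_eq surj_pair)
  then show ?thesis using d csubringD(9)[OF R] by simp
 qed
qed

lemma csubring_algebraic: "csubfield {x. algebraic x}"
 using csubring_integral[of \<rat>] unfolding csubfield_def algebraic_iff_val_rings[symmetric] by auto

lemma CC_simps [simp]: "carrier \<CC> = UNIV" "mult \<CC> = (*)" "one \<CC> = 1" "\<zero>\<^bsub>\<CC>\<^esub> = 0" "add \<CC> = (+)"
 by (simp_all add: ring_of_type_algebra_def fun_eq_iff)

lemma field_CC: "field \<CC>"
 by (rule field_from_type_algebra)

lemma CC_inv [simp]: "x ~= 0 ==> inv\<^bsub>\<CC>\<^esub> x = inverse x" for x :: complex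
proof -
 interpret CC: field \<CC> by (rule field_CC)
 show "x ~= 0 ==> inv\<^bsub>\<CC>\<^esub> x = inverse x" by (rule CC.comm_inv_char) auto
qed

lemma CC_uminus [simp]: "\<ominus>\<^bsub>\<CC>\<^esub> x = - x" for x :: complex
proof -
 interpret CC: field \<CC> by (rule field_CC)
 show ?thesis using CC.minus_equality[of "- x" x] by simp
qed

lemma subfield_CC: "subfield F \<CC> \<longleftrightarrow> csubfield F"
proof -
 interpret CC: field \<CC> by (rule field_CC)
 show ?thesis
proof
 assume F: "subfield F \<CC>"
 note S = subringE[OF subfieldE(1)[OF F]]
 have "x - y \<in> F" if "x \<in> F" "y \<in> F" for x y using S(7)[of x "- y"] S(5)[of y] that by simp
 moreover have "inverse x \<in> F" if "x \<in> F" for x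
  using CC.subfield_m_inv(1)[OF F, of x] that S(2) by (cases "x = 0") auto
 ultimately show "csubfield F" using S by (auto simp: csubfield_def csubring_def)
next
 assume F: "csubfield F"
 note D = csubringD[OF csubfieldD(1)[OF F]]
 show "subfield F \<CC>"
 proof (rule CC.subfieldI')
  show "subring F \<CC>" by (rule CC.subringI) (use D in auto)
  show "\<And>k. k \<in> F - {\<zero>\<^bsub>\<CC>\<^esub>} ==> inv\<^bsub>\<CC>\<^esub> k \<in> F" using csubfieldD(2)[OF F] by auto
 qed
qed
qed

lemma generate_field_CC:
 shows "csubfield (generate_field \<CC> H)" "H \<subseteq> generate_field \<CC> H"
  "csubfield F ==> H \<subseteq> F ==> generate_field \<CC> H \<subseteq> F"
 using field.generate_field_is_subfield[OF field_CC, of H] field.generate_field_min_subfield1[OF field_CC, of H F]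
  generate_field.incl[of _ H \<CC>]
 by (auto simp: subfield_CC)

text \<open>Partial homomorphisms are encoded by their graphs, so that the union of a chain is again
  one and Zorn's lemma applies. Inverses are not mentioned since a ring of algebraic numbers
  containing the rationals is a field (\<open>hom_graph_inverse\<close>), and the clause on (0, b)
  makes the graph single-valued.\<close>

definition hom_graph :: "(complex \<times> complex) set => bool"
 where "hom_graph g \<longleftrightarrow> (\<forall>r\<in>\<rat>. (r, r) \<in> g) \<and>
  (\<forall>(a, b)\<in>g. \<forall>(c, d)\<in>g. (a - c, b - d) \<in> g \<and> (a * c, b * d) \<in> g) \<and>
  (\<forall>b. (0, b) \<in> g --> b = 0) \<and> (\<forall>(a, b)\<in>g. algebraic a)"

lemma hom_graphD:
 assumes "hom_graph g"
 shows "r \<in> \<rat> ==> (r, r) \<in> g" "(a, b) \<in> g ==> (c, d) \<in> g ==> (a - c, b - d) \<in> g"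
  "(a, b) \<in> g ==> (c, d) \<in> g ==> (a * c, b * d) \<in> g" "(a, b) \<in> g ==> (c, d) \<in> g ==> (a + c, b + d) \<in> g"
  "(0, b) \<in> g ==> b = 0" "(a, b) \<in> g ==> algebraic a" "(a, b) \<in> g ==> (a, c) \<in> g ==> b = c"
proof -
 show 1: "r \<in> \<rat> ==> (r, r) \<in> g" and 2: "(a, b) \<in> g ==> (c, d) \<in> g ==> (a - c, b - d) \<in> g"
  and "(a, b) \<in> g ==> (c, d) \<in> g ==> (a * c, b * d) \<in> g"
  and 0: "(0, b) \<in> g ==> b = 0" and "(a, b) \<in> g ==> algebraic a" for a b c d r
  using assms unfolding hom_graph_def by blast+
 show "(a, b) \<in> g ==> (c, d) \<in> g ==> (a + c, b + d) \<in> g"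
  using 2[of a b "0 - c" "0 - d"] 2[of 0 0 c d] 1[of 0] by simp
 show "(a, b) \<in> g ==> (a, c) \<in> g ==> b = c" using 2[of a b a c] 0[of "b - c"] by simp
qed

definition poly_graph :: "(complex \<times> complex) set => (complex poly \<times> complex poly) set"
 where "poly_graph g = {(u, u'). \<forall>i. (coeff u i, coeff u' i) \<in> g}"

lemma hom_graph_sum:
 assumes "hom_graph g" "\<And>i. i \<in> I ==> (h i, k i) \<in> g"
 shows "((\<Sum>i\<in>I. h i), (\<Sum>i\<in>I. k i)) \<in> g"
 using assms(2) by (induction I rule: infinite_finite_induct) (auto intro: hom_graphD[OF assms(1)])

lemma poly_graph_ops:
 assumes g: "hom_graph g"
 shows "(u, u') \<in> poly_graph g ==> (v, v') \<in> poly_graph g ==> (u - v, u' - v') \<in> poly_graph g"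
  "(u, u') \<in> poly_graph g ==> (v, v') \<in> poly_graph g ==> (u * v, u' * v') \<in> poly_graph g"
  "(c, c') \<in> g ==> (monom c n, monom c' n) \<in> poly_graph g"
  "rat_poly u ==> (u, u) \<in> poly_graph g"
  "(c, c') \<in> g ==> ([:c:], [:c':]) \<in> poly_graph g"
proof -
 note D = hom_graphD[OF g]
 show "(u, u') \<in> poly_graph g ==> (v, v') \<in> poly_graph g ==> (u - v, u' - v') \<in> poly_graph g"
  by (auto simp: poly_graph_def intro: D)
 show "(u, u') \<in> poly_graph g ==> (v, v') \<in> poly_graph g ==> (u * v, u' * v') \<in> poly_graph g"
  by (auto simp: poly_graph_def coeff_mult intro!: hom_graph_sum[OF g] D)
 show "(c, c') \<in> g ==> (monom c n, monom c' n) \<in> poly_graph g"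
  by (auto simp: poly_graph_def intro!: D)
 show "rat_poly u ==> (u, u) \<in> poly_graph g" by (auto simp: poly_graph_def rat_poly_def intro!: D)
 show "(c, c') \<in> g ==> ([:c:], [:c':]) \<in> poly_graph g"
  by (auto simp: poly_graph_def coeff_pCons intro!: D split: nat.splits)
qed

lemma poly_graph_eval:
 assumes g: "hom_graph g" and u: "(u, u') \<in> poly_graph g" and a: "(a, a') \<in> g"
 shows "(poly u a, poly u' a') \<in> g"
 using u
proof (induction u arbitrary: u')
 case 0
 then have "\<forall>i. coeff u' i = 0" using hom_graphD(5)[OF g] by (auto simp: poly_graph_def)
 then have "u' = 0" by (simp add: poly_eq_iff)
 then show ?case using hom_graphD(1)[OF g, of 0] by simp
next
 case (pCons c u)
 obtain c' v where u': "u' = pCons c' v" by (cases u')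
 have all: "(coeff (pCons c u) i, coeff (pCons c' v) i) \<in> g" for i using pCons.prems u' by (auto simp: poly_graph_def)
 have "(u, v) \<in> poly_graph g" using all[of "Suc _"] by (auto simp: poly_graph_def)
 from pCons.IH[OF this] all[of 0] show ?case using u' a hom_graphD(3,4)[OF g] by simp
qed

text \<open>A nonzero algebraic a satisfies a rational equation c + a q(a) = 0 with c nonzero, which
  shows the inverse of a as - q(a) / c.\<close>

lemma hom_graph_inverse:
 assumes g: "hom_graph g" and a: "(a, b) \<in> g" "a ~= 0"
 shows "\<exists>c. (inverse a, c) \<in> g" "b ~= 0"
proof -
 have "algebraic a" using hom_graphD(6)[OF g a(1)] .
 then obtain p0 where p0: "coeff p0 0 ~= 0" "poly (map_poly of_int p0) a = 0"
  using algebraicE'_nonzero[of a] a(2) by blast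
 define p :: "complex poly" where "p = map_poly of_int p0"
 have p: "poly p a = 0" "coeff p 0 ~= 0" "rat_poly p"
  using p0 by (auto simp: p_def rat_poly_def coeff_map_poly)
 obtain c q where q: "p = pCons c q" by (cases p)
 have c: "c ~= 0" "c \<in> \<rat>" and "rat_poly q"
  using p(2,3) unfolding q rat_poly_def by (auto dest: spec[of _ 0] spec[of _ "Suc _"])
 have "a * poly q a = - c" using p(1) q by (simp add: add_eq_0_iff2 add.commute)
 then have "a * (poly q a * - inverse c) = 1" using c by (simp flip: mult.assoc)
 then have "inverse a = poly q a * - inverse c" by (metis inverse_unique)
 moreover have "(poly q a * - inverse c, poly q b * - inverse c) \<in> g"
  using c a \<open>rat_poly q\<close> by (intro hom_graphD(3)[OF g] poly_graph_eval[OF g] poly_graph_ops(4)[OF g] hom_graphD(1)[OF g]) auto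
 ultimately show 1: "\<exists>c. (inverse a, c) \<in> g" by auto
 then obtain d where "(inverse a, d) \<in> g" by blast
 then have "(1, b * d) \<in> g" using hom_graphD(3)[OF g a(1)] a(2) by force
 then have "b * d = 1" using hom_graphD(1)[OF g, of 1] hom_graphD(7)[OF g] Rats_1 by blast
 then show "b ~= 0" by auto
qed

text \<open>The assignment u(x) -> u'(x') is well defined because m has least degree among the
  polynomials over the domain with root x: any such u is reduced modulo m, and the same reduction is
  performed on the transported polynomials, where m' vanishes at x'.\<close>

lemma hom_graph_extend:
 assumes g: "hom_graph g" and x: "algebraic x"
  and m: "(m, m') \<in> poly_graph g" "m ~= 0" "poly m x = 0"
  and min: "\<And>u u'. (u, u') \<in> poly_graph g ==> poly u x = 0 ==> u ~= 0 ==> degree m \<le> degree u"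
  and x': "poly m' x' = 0"
 shows "\<exists>g'. hom_graph g' \<and> g \<subseteq> g' \<and> (x, x') \<in> g'"
proof -
 note P = poly_graph_ops[OF g]
 define lc where "lc = lead_coeff m"
 have lc0: "lc ~= 0" using m by (simp add: lc_def)
 obtain lc' where lc': "(lc, lc') \<in> g" using m(1) by (auto simp: poly_graph_def lc_def)
 obtain il' where il: "(inverse lc, il') \<in> g" using hom_graph_inverse(1)[OF g lc' lc0] by blast
 have key: "poly u' x' = 0" if "(u, u') \<in> poly_graph g" "poly u x = 0" for u u'
  using that
 proof (induction "degree u" arbitrary: u u' rule: less_induct)
  case less
  show ?case
  proof (cases "u = 0")
   case True
   then have "\<forall>i. coeff u' i = 0" using less.prems(1) hom_graphD(5)[OF g] by (auto simp: poly_graph_def)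
   then have "u' = 0" by (simp add: poly_eq_iff)
   then show ?thesis by simp
  next
   case False
   then have le: "degree m \<le> degree u" using min less.prems by blast
   define k where "k = degree u - degree m"
   define a where "a = lead_coeff u"
   obtain a' where a': "(a, a') \<in> g" using less.prems(1) by (auto simp: poly_graph_def a_def)
   \<comment> \<open>One step of the division by m, carried out simultaneously on both sides; its
     coefficients stay in the graph.\<close>
   define w where "w = monom (a * inverse lc) k * m"
   define w' where "w' = monom (a' * il') k * m'"
   have w: "(w, w') \<in> poly_graph g" unfolding w_def w'_def by (intro P(2,3) hom_graphD(3)[OF g] a' il m(1))
   have dw: "degree w = degree u"
    using le lc0 False m(2) by (simp add: w_def k_def a_def degree_mult_eq degree_monom_eq monom_eq_0_iff)
   have "lead_coeff (monom (a * inverse lc) k) = a * inverse lc"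
    using lc0 False by (simp add: degree_monom_eq a_def)
   then have lw: "lead_coeff w = a"
    unfolding w_def lead_coeff_mult using lc0 by (simp add: lc_def)
   have sub: "(u - w, u' - w') \<in> poly_graph g" using P(1) less.prems(1) w by blast
   have r: "poly (u - w) x = 0" using less.prems(2) m(3) by (simp add: w_def)
   have "poly (u' - w') x' = 0"
   proof (cases "degree u = 0")
    case True
    then obtain c where "u = [:c:]" using degree_eq_zeroE by blast
    then show ?thesis using less.prems(2) False by simp
   next
    case d: False
    have "degree (u - w) < degree u"
    proof (rule ccontr)
     assume "\<not> ?thesis"
     moreover have "degree (u - w) \<le> degree u" using dw by (intro degree_diff_le) auto
     ultimately have e: "degree (u - w) = degree u" by simp
     have "coeff (u - w) (degree u) = 0" using lw dw by (simp add: a_def)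
     then have "u - w = 0" using e by (metis leading_coeff_0_iff)
     then show False using e d by simp
    qed
    from less.hyps[OF this sub r] show ?thesis .
   qed
   then show ?thesis using x' by (simp add: w'_def)
  qed
 qed
 define g' where "g' = {(poly u x, poly u' x') | u u'. (u, u') \<in> poly_graph g}"
 have "hom_graph g'"
  unfolding hom_graph_def
 proof (intro conjI ballI allI impI; clarify?)
  fix r :: complex assume "r \<in> \<rat>"
  then have "([:r:], [:r:]) \<in> poly_graph g" by (intro P(5) hom_graphD(1)[OF g])
  then show "(r, r) \<in> g'" unfolding g'_def by force
 next
  fix b assume "(0, b) \<in> g'"
  then show "b = 0" unfolding g'_def using key by force
 next
  fix a b assume "(a, b) \<in> g'"
  then obtain u u' where u: "a = poly u x" "(u, u') \<in> poly_graph g" unfolding g'_def by blast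
  have "coeffs_in {x. algebraic x} u" using u(2) hom_graphD(6)[OF g] by (auto simp: coeffs_in_def poly_graph_def)
  then show "algebraic a" using coeffs_in_ops(7)[OF csubfieldD(1)[OF csubring_algebraic], of u x] x u by simp
 next
  fix a b c d assume "(a, b) \<in> g'" "(c, d) \<in> g'"
  then obtain u u' v v' where u: "a = poly u x" "b = poly u' x'" "(u, u') \<in> poly_graph g"
   "c = poly v x" "d = poly v' x'" "(v, v') \<in> poly_graph g" unfolding g'_def by blast
  have "a - c = poly (u - v) x" "b - d = poly (u' - v') x'" "a * c = poly (u * v) x" "b * d = poly (u' * v') x'"
   by (simp_all add: u)
  then show "(a - c, b - d) \<in> g' \<and> (a * c, b * d) \<in> g'" unfolding g'_def using P(1,2)[OF u(3,6)] by blast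
 qed
 moreover have "g \<subseteq> g'"
 proof
  fix ab assume "ab \<in> g"
  then obtain a b where ab: "ab = (a, b)" "(a, b) \<in> g" by (cases ab) auto
  then have "([:a:], [:b:]) \<in> poly_graph g" by (intro P(5))
  then show "ab \<in> g'" unfolding g'_def ab(1) by force
 qed
 moreover have "(x, x') \<in> g'"
 proof -
  have "(monom 1 1, monom 1 1) \<in> poly_graph g" by (intro P(3) hom_graphD(1)[OF g]) simp
  then have "(poly (monom 1 1) x, poly (monom 1 1) x') \<in> g'" unfolding g'_def by blast
  then show ?thesis by (simp add: poly_monom)
 qed
 ultimately show ?thesis by blast
qed

lemma hom_graph_min_poly:
 assumes g: "hom_graph g" and x: "algebraic x"
 obtains m m' where "(m, m') \<in> poly_graph g" "m ~= 0" "poly m x = 0"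
  "\<And>u u'. (u, u') \<in> poly_graph g ==> poly u x = 0 ==> u ~= 0 ==> degree m \<le> degree u"
proof -
 obtain q where "\<forall>i. coeff q i \<in> \<int>" "q ~= 0" "poly q x = 0" using x by (auto simp: algebraic_def)
 then have "rat_poly q" using Ints_subset_Rats by (auto simp: rat_poly_def)
 then have ex: "\<exists>u. u \<in> {(u, u'). (u, u') \<in> poly_graph g \<and> poly u x = 0 \<and> u ~= 0}"
  using poly_graph_ops(4)[OF g] \<open>q ~= 0\<close> \<open>poly q x = 0\<close> by blast
 define mm where "mm = arg_min (\<lambda>(u, u'). degree u) (\<lambda>u. u \<in> {(u, u'). (u, u') \<in> poly_graph g \<and> poly u x = 0 \<and> u ~= 0})"
 obtain w where w: "w \<in> {(u, u'). (u, u') \<in> poly_graph g \<and> poly u x = 0 \<and> u ~= 0}" using ex by blast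
 note am = arg_min_nat_lemma[of "\<lambda>u. u \<in> {(u, u'). (u, u') \<in> poly_graph g \<and> poly u x = 0 \<and> u ~= 0}", OF w,
   of "\<lambda>(u, u'). degree u", folded mm_def]
 obtain m m' where mm: "mm = (m, m')" by (cases mm)
 show thesis
  by (rule that[of m m']) (use am mm in auto)
qed

text \<open>Zorn's lemma: a maximal graph extends to any algebraic x, since the transported minimal
  polynomial is not constant and so has a complex root.\<close>

lemma hom_graph_total:
 assumes g: "hom_graph g"
 obtains g' where "hom_graph g'" "g \<subseteq> g'" "\<And>x. algebraic x ==> \<exists>y. (x, y) \<in> g'"
proof -
 define F where "F = {g'. hom_graph g' \<and> g \<subseteq> g'}"
 have "\<exists>M\<in>F. \<forall>X'\<in>F. M \<subseteq> X' --> X' = M"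
 proof (rule subset_Zorn_nonempty)
  show "F ~= {}" using g by (auto simp: F_def)
  fix C assume C: "C ~= {}" "subset.chain F C"
  then have CF: "C \<subseteq> F" and tot: "\<And>A A'. A \<in> C ==> A' \<in> C ==> A \<subseteq> A' \<or> A' \<subseteq> A"
   by (auto simp: subset_chain_def)
  have hg: "hom_graph h" if "h \<in> C" for h using that CF by (auto simp: F_def)
  have "hom_graph (\<Union>C)"
   unfolding hom_graph_def
  proof (intro conjI ballI allI impI; clarify?)
   fix r :: complex assume "r \<in> \<rat>"
   then show "(r, r) \<in> \<Union>C" using C(1) hg hom_graphD(1) by blast
  next
   fix b h assume "(0, b) \<in> h" "h \<in> C"
   then show "b = 0" using hg hom_graphD(5) by blast
  next
   fix a b h assume "(a, b) \<in> h" "h \<in> C"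
   then show "algebraic a" using hg hom_graphD(6) by blast
  next
   fix a b c d h h' assume A: "(a, b) \<in> h" "h \<in> C" "(c, d) \<in> h'" "h' \<in> C"
   then obtain k where "(a, b) \<in> k" "(c, d) \<in> k" "k \<in> C" using tot[of h h'] by blast
   then show "(a - c, b - d) \<in> \<Union>C \<and> (a * c, b * d) \<in> \<Union>C" using hg hom_graphD(2,3) by blast
  qed
  then show "\<Union>C \<in> F" using C(1) CF by (auto simp: F_def)
 qed
 then obtain M where M: "hom_graph M" "g \<subseteq> M" and max: "\<And>M'. M' \<in> F ==> M \<subseteq> M' ==> M' = M"
  by (auto simp: F_def)
 have "\<exists>y. (x, y) \<in> M" if x: "algebraic x" for x
 proof -
  obtain m m' where m: "(m, m') \<in> poly_graph M" "m ~= 0" "poly m x = 0"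
   "\<And>u u'. (u, u') \<in> poly_graph M ==> poly u x = 0 ==> u ~= 0 ==> degree m \<le> degree u"
   using hom_graph_min_poly[OF M(1) x] by blast
  have "degree m ~= 0"
  proof
   assume "degree m = 0"
   then obtain c where "m = [:c:]" using degree_eq_zeroE by blast
   then show False using m by simp
  qed
  moreover have "coeff m' (degree m) ~= 0"
   using hom_graph_inverse(2)[OF M(1), of "lead_coeff m"] m(1,2) by (auto simp: poly_graph_def)
  ultimately have "degree m' ~= 0" using le_degree[of m' "degree m"] by simp
  then obtain y where y: "poly m' y = 0"
   using fundamental_theorem_of_algebra[of m'] constant_degree[of m'] by auto
  obtain M' where "hom_graph M'" "M \<subseteq> M'" "(x, y) \<in> M'"
   using hom_graph_extend[OF M(1) x m(1-3) _ y] m(4) by blast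
  then show ?thesis using max[of M'] M(2) by (auto simp: F_def)
 qed
 then show thesis using that M by blast
qed

text \<open>The minimal polynomial of z over F has degree at least 2, and z is a simple root of it
  in characteristic zero; so there is another root, to which z can be sent.\<close>

lemma automorphism_moving:
 assumes F: "csubfield F" "\<And>x. x \<in> F ==> algebraic x" and z: "algebraic z" "z \<notin> F"
 obtains g where "hom_graph g" "\<And>c. c \<in> F ==> (c, c) \<in> g" "(z, z) \<notin> g" "\<And>x. algebraic x ==> \<exists>y. (x, y) \<in> g"
proof -
 note D = csubringD[OF csubfieldD(1)[OF F(1)]]
 have g0: "hom_graph (Id_on F)"
  unfolding hom_graph_def using D csubfieldD(4)[OF F(1)] F(2) by (auto simp: Id_on_iff)
 obtain m m' where m: "(m, m') \<in> poly_graph (Id_on F)" "m ~= 0" "poly m z = 0"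
   "\<And>u u'. (u, u') \<in> poly_graph (Id_on F) ==> poly u z = 0 ==> u ~= 0 ==> degree m \<le> degree u"
  using hom_graph_min_poly[OF g0 z(1)] by blast
 have "\<forall>i. coeff m i = coeff m' i \<and> coeff m i \<in> F"
  using m(1) unfolding poly_graph_def mem_Collect_eq prod.case Id_on_iff by metis
 then have mm: "m' = m" "coeffs_in F m" unfolding poly_eq_iff coeffs_in_def by metis+
 have d0: "degree m ~= 0"
 proof
  assume "degree m = 0"
  then obtain c where "m = [:c:]" using degree_eq_zeroE by blast
  then show False using m by simp
 qed
 have pd: "pderiv m ~= 0" using d0 by (simp add: pderiv_eq_0_iff)
 have dz: "poly (pderiv m) z ~= 0"
 proof
  assume r: "poly (pderiv m) z = 0"
  have "(pderiv m, pderiv m) \<in> poly_graph (Id_on F)"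
   using mm D(4,8) by (auto simp: poly_graph_def Id_on_iff coeffs_in_def coeff_pderiv simp del: of_nat_Suc)
  from m(4)[OF this r pd] show False using degree_pderiv[of m] d0 by simp
 qed
 obtain q where q: "m = [:-z, 1:] * q" using m(3) by (metis dvdE poly_eq_0_iff_dvd)
 have "degree q ~= 0"
 proof
  assume "degree q = 0"
  then obtain c where c: "q = [:c:]" using degree_eq_zeroE by blast
  then have "coeff m 0 = - z * c" "coeff m 1 = c" by (simp_all add: q)
  then have "- z * c \<in> F" "c \<in> F" using mm(2) unfolding coeffs_in_def by metis+
  moreover have "c ~= 0" using m(2) q c by auto
  ultimately have "- ((- z * c) / c) \<in> F" using csubfieldD(3)[OF F(1)] D(5) by blast
  then show False using z(2) \<open>c ~= 0\<close> by simp
 qed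
 then obtain z' where z': "poly q z' = 0"
  using fundamental_theorem_of_algebra[of q] constant_degree[of q] by auto
 have "z' ~= z"
  using dz z' unfolding q pderiv_mult poly_add poly_mult by (auto simp: pderiv_pCons)
 have "poly m' z' = 0" using z' mm(1) q by simp
 from hom_graph_extend[OF g0 z(1) m(1-3) _ this] m(4) obtain g1 where
  g1: "hom_graph g1" "Id_on F \<subseteq> g1" "(z, z') \<in> g1" by blast
 obtain g where g: "hom_graph g" "g1 \<subseteq> g" "\<And>x. algebraic x ==> \<exists>y. (x, y) \<in> g"
  using hom_graph_total[OF g1(1)] by blast
 have "(z, z) \<notin> g" using hom_graphD(7)[OF g(1)] g(2) g1(3) \<open>z' ~= z\<close> by blast
 then show thesis using that g g1(2) by blast
qed

section \<open>Automorphisms and Galois groups of subfields\<close>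

abbreviation AN :: "complex set" where "AN \<equiv> {x. algebraic x}"

text \<open>The target is the whole complex field, so that embeddings and automorphisms share one
  notion; bijectivity is added in \<open>Gal_iff\<close>.\<close>

definition fhom :: "complex set => (complex => complex) => bool"
 where "fhom M \<sigma> \<longleftrightarrow> csubfield M \<and> (\<forall>x\<in>M. \<forall>y\<in>M. \<sigma> (x - y) = \<sigma> x - \<sigma> y \<and> \<sigma> (x * y) = \<sigma> x * \<sigma> y) \<and> \<sigma> 1 = 1"

lemma fhomD:
 assumes "fhom M \<sigma>"
 shows "csubfield M" "csubring M" "\<sigma> 1 = 1" "\<sigma> 0 = 0" "x \<in> M ==> y \<in> M ==> \<sigma> (x - y) = \<sigma> x - \<sigma> y"
  "x \<in> M ==> y \<in> M ==> \<sigma> (x + y) = \<sigma> x + \<sigma> y" "x \<in> M ==> \<sigma> (- x) = - \<sigma> x"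
  "x \<in> M ==> y \<in> M ==> \<sigma> (x * y) = \<sigma> x * \<sigma> y" "x \<in> M ==> \<sigma> (inverse x) = inverse (\<sigma> x)"
  "x \<in> M ==> y \<in> M ==> \<sigma> (x / y) = \<sigma> x / \<sigma> y" "x \<in> M ==> \<sigma> (x ^ n) = \<sigma> x ^ n"
  "r \<in> \<rat> ==> \<sigma> r = r" "x \<in> M ==> \<sigma> x = 0 \<longleftrightarrow> x = 0" "inj_on \<sigma> M"
proof -
 show M: "csubfield M" and one: "\<sigma> 1 = 1" and minus: "\<And>x y. x \<in> M ==> y \<in> M ==> \<sigma> (x - y) = \<sigma> x - \<sigma> y"
  and mult: "\<And>x y. x \<in> M ==> y \<in> M ==> \<sigma> (x * y) = \<sigma> x * \<sigma> y"
  using assms unfolding fhom_def by blast+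
 show R: "csubring M" using csubfieldD(1)[OF M] .
 note D = csubringD[OF R]
 show zero: "\<sigma> 0 = 0" using minus[OF D(1) D(1)] by simp
 show neg: "\<sigma> (- x) = - \<sigma> x" if "x \<in> M" for x using minus[OF D(2) that] zero by simp
 show plus: "\<sigma> (x + y) = \<sigma> x + \<sigma> y" if "x \<in> M" "y \<in> M" for x y
  using minus[OF that(1) D(5)[OF that(2)]] neg[OF that(2)] by simp
 show inv: "\<sigma> (inverse x) = inverse (\<sigma> x)" if "x \<in> M" for x
 proof (cases "x = 0")
  case False
  then have "\<sigma> x * \<sigma> (inverse x) = 1" using mult[OF that csubfieldD(2)[OF M that]] one by simp
  then show ?thesis by (metis inverse_unique)
 qed (simp add: zero)
 show "\<sigma> (x / y) = \<sigma> x / \<sigma> y" if "x \<in> M" "y \<in> M"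
  using mult[OF that(1) csubfieldD(2)[OF M that(2)]] inv[OF that(2)] by (simp add: divide_inverse)
 then have div: "\<sigma> (x / y) = \<sigma> x / \<sigma> y" if "x \<in> M" "y \<in> M" for x y
  using mult[OF that(1) csubfieldD(2)[OF M that(2)]] inv[OF that(2)] by (simp add: divide_inverse)
 show "\<sigma> (x ^ n) = \<sigma> x ^ n" if "x \<in> M" using that by (induction n) (auto simp: one mult D)
 have nat: "\<sigma> (of_nat n) = of_nat n" for n by (induction n) (auto simp: zero one plus D)
 have int: "\<sigma> (of_int n) = of_int n" for n
  by (cases n) (auto simp: nat neg D simp del: of_nat_Suc)
 show "\<sigma> r = r" if r: "r \<in> \<rat>"
 proof -
  obtain a where "r = of_rat a" using r by (auto elim: Rats_cases)
  then obtain m n :: int where "r = of_int m / of_int n"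
   by (metis of_rat_rat quotient_of_denom_pos quotient_of_div of_rat_divide of_rat_of_int_eq surj_pair)
  then show ?thesis using div int D by simp
 qed
 show z: "\<sigma> x = 0 \<longleftrightarrow> x = 0" if "x \<in> M" for x
  using mult[OF that csubfieldD(2)[OF M that]] one zero by (cases "x = 0") auto
 show "inj_on \<sigma> M"
 proof (rule inj_onI)
  fix x y assume "x \<in> M" "y \<in> M" "\<sigma> x = \<sigma> y"
  then show "x = y" using minus[of x y] z[of "x - y"] D by simp
 qed
qed

lemma fhom_prod: "fhom M \<sigma> ==> (\<And>i. i \<in> I ==> h i \<in> M) ==> \<sigma> (\<Prod>i\<in>I. h i) = (\<Prod>i\<in>I. \<sigma> (h i))"
 by (induction I rule: infinite_finite_induct) (auto simp: fhomD csubring_prod)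

lemma csubfield_image:
 assumes h: "fhom M \<sigma>" and N: "csubfield N" "N \<subseteq> M"
 shows "csubfield (\<sigma> ` N)"
 unfolding csubfield_def csubring_def
proof (intro conjI ballI)
 note D = csubringD[OF csubfieldD(1)[OF N(1)]] csubfieldD(2)[OF N(1)]
 show "1 \<in> \<sigma> ` N" using fhomD(3)[OF h] D(1) by force
 fix x assume "x \<in> \<sigma> ` N"
 then obtain a where a: "x = \<sigma> a" "a \<in> N" by blast
 then have "a \<in> M" using N by blast
 then have "inverse x = \<sigma> (inverse a)" using fhomD(9)[OF h] a by simp
 moreover have "inverse a \<in> N" using csubfieldD(2)[OF N(1) a(2)] .
 ultimately show "inverse x \<in> \<sigma> ` N" by blast
 fix y assume "y \<in> \<sigma> ` N"
 then obtain b where b: "y = \<sigma> b" "b \<in> N" by blast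
 then have "b \<in> M" using N by blast
 then have "x - y = \<sigma> (a - b)" "x * y = \<sigma> (a * b)" using fhomD(5,8)[OF h \<open>a \<in> M\<close> \<open>b \<in> M\<close>] a b by simp_all
 moreover have "a - b \<in> N" "a * b \<in> N" using D(3,4) a b by blast+
 ultimately show "x - y \<in> \<sigma> ` N" "x * y \<in> \<sigma> ` N" by blast+
qed

text \<open>As a field, the equalizer contains the field generated by any set on which both maps
  agree; so an automorphism is determined by its values on generators.\<close>

lemma csubfield_equalizer:
 assumes h: "fhom M \<sigma>" "fhom M \<tau>"
 shows "csubfield {x \<in> M. \<sigma> x = \<tau> x}"
 unfolding csubfield_def csubring_def
 using csubringD[OF fhomD(2)[OF h(1)]] csubfieldD(2)[OF fhomD(1)[OF h(1)]] fhomD[OF h(1)] fhomD[OF h(2)]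
 by simp

lemma csubfield_preimage:
 assumes h: "fhom M \<sigma>" and N: "csubfield N"
 shows "csubfield {x \<in> M. \<sigma> x \<in> N}"
 unfolding csubfield_def csubring_def
 using csubringD[OF fhomD(2)[OF h(1)]] csubfieldD(2)[OF fhomD(1)[OF h(1)]] fhomD[OF h(1)]
  csubringD[OF csubfieldD(1)[OF N]] csubfieldD(2)[OF N]
 by simp

lemma Gal_iff:
 assumes "csubfield M"
 shows "\<sigma> \<in> carrier (Gal M F) \<longleftrightarrow> \<sigma> \<in> extensional M \<and> bij_betw \<sigma> M M \<and> fhom M \<sigma> \<and> (\<forall>x\<in>F. \<sigma> x = x)"
proof -
 have "\<sigma> \<in> ring_hom (\<CC>\<lparr>carrier := M\<rparr>) (\<CC>\<lparr>carrier := M\<rparr>) \<longleftrightarrow> fhom M \<sigma>" if b: "bij_betw \<sigma> M M"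
 proof
  assume "\<sigma> \<in> ring_hom (\<CC>\<lparr>carrier := M\<rparr>) (\<CC>\<lparr>carrier := M\<rparr>)"
  then have p: "\<And>x y. x \<in> M ==> y \<in> M ==> \<sigma> (x + y) = \<sigma> x + \<sigma> y" and m: "\<And>x y. x \<in> M ==> y \<in> M ==> \<sigma> (x * y) = \<sigma> x * \<sigma> y"
   and o: "\<sigma> 1 = 1" by (auto simp: ring_hom_def)
  have "\<sigma> (x - y) = \<sigma> x - \<sigma> y" if "x \<in> M" "y \<in> M" for x y
   using p[of "x - y" y] that csubringD(3)[OF csubfieldD(1)[OF assms]] by simp
  then show "fhom M \<sigma>" using assms m o by (auto simp: fhom_def)
 next
  assume "fhom M \<sigma>"
  then show "\<sigma> \<in> ring_hom (\<CC>\<lparr>carrier := M\<rparr>) (\<CC>\<lparr>carrier := M\<rparr>)"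
   using b by (auto simp: ring_hom_def fhomD bij_betw_def)
 qed
 then show ?thesis by (auto simp: Gal_def Bij_def)
qed

lemma Gal_mult: "\<sigma> \<in> carrier (Gal M F) ==> \<tau> \<in> carrier (Gal M F) ==> \<sigma> \<otimes>\<^bsub>Gal M F\<^esub> \<tau> = compose M \<sigma> \<tau>"
 by (auto simp: Gal_def BijGroup_def)

lemma Gal_one: "\<one>\<^bsub>Gal M F\<^esub> = (\<lambda>x\<in>M. x)"
 by (simp add: Gal_def BijGroup_def)

lemma Gal_group:
 assumes M: "csubfield M" and F: "F \<subseteq> M"
 shows "group (Gal M F)"
proof -
 interpret B: group "BijGroup M" by (rule group_BijGroup)
 have "subgroup (carrier (Gal M F)) (BijGroup M)"
 proof (rule B.subgroupI)
  show "carrier (Gal M F) \<subseteq> carrier (BijGroup M)" by (auto simp: Gal_def BijGroup_def)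
  have "(\<lambda>x\<in>M. x) \<in> carrier (Gal M F)"
   unfolding Gal_iff[OF M] using M F csubringD[OF csubfieldD(1)[OF M]]
   by (auto simp: fhom_def bij_betw_def inj_on_def)
  then show "carrier (Gal M F) ~= {}" by blast
 next
  fix \<sigma> assume s: "\<sigma> \<in> carrier (Gal M F)"
  then have S: "bij_betw \<sigma> M M" "fhom M \<sigma>" "\<forall>x\<in>F. \<sigma> x = x" using Gal_iff[OF M] by auto
  have inv: "inv\<^bsub>BijGroup M\<^esub> \<sigma> = (\<lambda>x\<in>M. inv_into M \<sigma> x)"
   using s by (intro inv_BijGroup) (auto simp: Gal_def BijGroup_def)
  let ?i = "\<lambda>x\<in>M. inv_into M \<sigma> x"
  have im: "inv_into M \<sigma> x \<in> M" "\<sigma> (inv_into M \<sigma> x) = x" if "x \<in> M" for x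
   using that S(1) by (auto simp: bij_betw_def inv_into_into f_inv_into_f)
  have inj: "inv_into M \<sigma> x = y" if "x \<in> M" "y \<in> M" "\<sigma> y = x" for x y
   using that im[of x] fhomD(14)[OF S(2)] by (metis inj_onD)
  note C = csubringD[OF csubfieldD(1)[OF M]]
  have "bij_betw ?i M M" using bij_betw_inv_into[OF S(1)] by (simp cong: bij_betw_cong)
  moreover have "fhom M ?i"
   unfolding fhom_def
  proof (intro conjI ballI)
   show "?i 1 = 1" using inj[OF C(1) C(1)] fhomD(3)[OF S(2)] C(1) by simp
   fix x y assume xy: "x \<in> M" "y \<in> M"
   show "?i (x - y) = ?i x - ?i y"
    using inj[of "x - y" "inv_into M \<sigma> x - inv_into M \<sigma> y"] xy im C(3) fhomD(5)[OF S(2)] by simp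
   show "?i (x * y) = ?i x * ?i y"
    using inj[of "x * y" "inv_into M \<sigma> x * inv_into M \<sigma> y"] xy im C(4) fhomD(8)[OF S(2)] by simp
  qed (rule M)
  moreover have "\<forall>x\<in>F. ?i x = x" using inj S(3) F by auto
  ultimately show "inv\<^bsub>BijGroup M\<^esub> \<sigma> \<in> carrier (Gal M F)" unfolding inv Gal_iff[OF M] by simp
 next
  fix \<sigma> \<tau> assume s: "\<sigma> \<in> carrier (Gal M F)" and t: "\<tau> \<in> carrier (Gal M F)"
  have S: "bij_betw \<sigma> M M" "fhom M \<sigma>" "\<forall>x\<in>F. \<sigma> x = x" and T: "bij_betw \<tau> M M" "fhom M \<tau>" "\<forall>x\<in>F. \<tau> x = x"
   using s t Gal_iff[OF M] by auto
  have "\<sigma> \<otimes>\<^bsub>BijGroup M\<^esub> \<tau> = compose M \<sigma> \<tau>" using s t by (auto simp: Gal_def BijGroup_def)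
  moreover have "bij_betw (compose M \<sigma> \<tau>) M M" using bij_betw_compose[OF T(1) S(1)] .
  moreover have tM: "\<tau> x \<in> M" if "x \<in> M" for x using T(1) that by (auto simp: bij_betw_def)
  note C = csubringD[OF csubfieldD(1)[OF M]]
  have "fhom M (compose M \<sigma> \<tau>)"
   unfolding fhom_def using M tM C fhomD[OF S(2)] fhomD[OF T(2)] by (simp add: compose_eq)
  moreover have "\<forall>x\<in>F. compose M \<sigma> \<tau> x = x" using S(3) T(3) F by (auto simp: compose_eq)
  ultimately show "\<sigma> \<otimes>\<^bsub>BijGroup M\<^esub> \<tau> \<in> carrier (Gal M F)" unfolding Gal_iff[OF M] by (auto simp: compose_def)
 qed
 from B.subgroup_imp_group[OF this] show ?thesis by (simp add: Gal_def)
qed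

text \<open>An embedding of the algebraic numbers that moves z maps the generating set onto itself
  and so restricts to an automorphism of the generated field. No finiteness enters, so this covers
  the p-torsion field and the p-power torsion field alike.\<close>

lemma Gal_moves:
 assumes H: "H \<subseteq> AN" and F: "csubfield F" "F \<subseteq> generate_field \<CC> H"
  and stab: "\<And>s. fhom AN s ==> (\<And>c. c \<in> F ==> s c = c) ==> s ` H = H"
  and z: "z \<in> generate_field \<CC> H" "z \<notin> F"
 shows "\<exists>\<sigma>\<in>carrier (Gal (generate_field \<CC> H) F). \<sigma> z ~= z"
proof -
 define M where "M = generate_field \<CC> H"
 have M: "csubfield M" "H \<subseteq> M" "M \<subseteq> AN"
  unfolding M_def using generate_field_CC H csubring_algebraic by auto
 have alg: "algebraic x" if "x \<in> M" for x using that M by blast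
 have Fal: "algebraic x" if "x \<in> F" for x using that F(2) alg unfolding M_def by blast
 from automorphism_moving[OF F(1) Fal] z obtain g where
  g: "hom_graph g" "\<And>c. c \<in> F ==> (c, c) \<in> g" "(z, z) \<notin> g" "\<And>x. algebraic x ==> \<exists>y. (x, y) \<in> g"
  using alg unfolding M_def by metis
 define s where "s x = (THE y. (x, y) \<in> g)" for x
 have s: "s x = y \<longleftrightarrow> (x, y) \<in> g" if "algebraic x" for x y
  unfolding s_def using g(4)[OF that] hom_graphD(7)[OF g(1)] by (metis the_equality)
 note A = csubringD[OF csubfieldD(1)[OF csubring_algebraic], unfolded mem_Collect_eq]
 have sg: "(x, s x) \<in> g" if "algebraic x" for x using s[OF that] by blast
 have hs: "fhom AN s"
  unfolding fhom_def
 proof (intro conjI ballI)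
  show "s 1 = 1" using s A(1) hom_graphD(1)[OF g(1)] by auto
  fix x y assume "x \<in> AN" "y \<in> AN"
  then show "s (x - y) = s x - s y" "s (x * y) = s x * s y"
   using s[of "x - y"] s[of "x * y"] A(3,4) sg hom_graphD(2,3)[OF g(1)] by auto
 qed (rule csubring_algebraic)
 have fixF: "s c = c" if "c \<in> F" for c using s[OF Fal[OF that]] g(2)[OF that] by blast
 have sH: "s ` H = H" using stab[OF hs] fixF by blast
 have "M \<subseteq> s ` M"
  unfolding M_def by (rule generate_field_CC(3)) (use csubfield_image[OF hs M(1,3)] sH M(2) in \<open>auto simp: M_def\<close>)
 moreover have "M \<subseteq> {x \<in> AN. s x \<in> M}"
  using generate_field_CC(3)[OF csubfield_preimage[OF hs M(1)], of H] sH M(2) H unfolding M_def by blast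
 ultimately have im: "s ` M = M" by blast
 define \<sigma> where "\<sigma> = restrict s M"
 have "inj_on s M" using fhomD(14)[OF hs] M(3) by (rule inj_on_subset)
 then have "bij_betw \<sigma> M M" using im by (simp add: \<sigma>_def bij_betw_def inj_on_def)
 moreover have "fhom M \<sigma>"
  unfolding fhom_def \<sigma>_def using M csubringD[OF csubfieldD(1)[OF M(1)]] fhomD(3,5,8)[OF hs] alg by simp
 moreover have "\<forall>x\<in>F. \<sigma> x = x" using fixF F(2) by (auto simp: \<sigma>_def M_def)
 ultimately have "\<sigma> \<in> carrier (Gal M F)" unfolding Gal_iff[OF M(1)] by (simp add: \<sigma>_def)
 moreover have "\<sigma> z ~= z" using z(1) g(3) s alg by (auto simp: \<sigma>_def M_def)
 ultimately show ?thesis unfolding M_def by blast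
qed

section \<open>Torsion points\<close>

locale rational_curve =
 fixes W :: "complex weierstrass"
 assumes W: "elliptic_curve_over \<rat> W"
begin

lemma disc_W: "disc W ~= 0" and coeffs: "a1 W \<in> \<rat>" "a2 W \<in> \<rat>" "a3 W \<in> \<rat>" "a4 W \<in> \<rat>" "a6 W \<in> \<rat>"
proof -
 show "disc W ~= 0" using W by (simp add: elliptic_curve_over_def)
 have "set_weierstrass W \<subseteq> \<rat>" using W by (simp add: elliptic_curve_over_def)
 then show "a1 W \<in> \<rat>" "a2 W \<in> \<rat>" "a3 W \<in> \<rat>" "a4 W \<in> \<rat>" "a6 W \<in> \<rat>"
  by (cases W; simp)+
qed

abbreviation E :: "complex point monoid" where "E \<equiv> ec_group W"

sublocale E: comm_group E
 by (rule comm_group_ec_group[OF disc_W])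

definition tors :: "nat => complex point set"
 where "tors n = {P \<in> ec W. P [^]\<^bsub>E\<^esub> n = Infinity}"

definition pts :: "complex set => complex point set"
 where "pts M = {P \<in> ec W. set_point P \<subseteq> M}"

lemma pts_simps [simp]: "Infinity \<in> pts M" "Affine x y \<in> pts M \<longleftrightarrow> on_ec W x y \<and> x \<in> M \<and> y \<in> M"
 by (auto simp: pts_def)

lemma pts_add:
 assumes M: "csubfield M" and P: "P \<in> pts M" "Q \<in> pts M"
 shows "ec_add W P Q \<in> pts M"
proof -
 note D = csubringD[OF csubfieldD(1)[OF M]] csubfieldD(3,4)[OF M]
 note c = coeffs[THEN D(12)]
 have "ec_add W P Q \<in> ec W" using P E.m_closed[of P Q] by (auto simp: pts_def)
 moreover have "set_point (ec_add W P Q) \<subseteq> M"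
 proof (cases P; cases Q)
  fix x1 y1 x2 y2 assume pq: "P = Affine x1 y1" "Q = Affine x2 y2"
  have in_M: "x1 \<in> M" "y1 \<in> M" "x2 \<in> M" "y2 \<in> M" using P pq by (auto simp: pts_def)
  have "ec_slope W x1 y1 x2 y2 \<in> M"
   unfolding ec_slope_def using in_M c by (auto intro!: D(1-11))
  then show ?thesis using in_M c unfolding pq by (auto simp: Let_def intro!: D(1-11))
 qed (use P in \<open>auto simp: pts_def\<close>)
 ultimately show ?thesis by (auto simp: pts_def)
qed

lemma map_point_add:
 assumes h: "fhom M \<sigma>" and P: "P \<in> pts M" "Q \<in> pts M"
 shows "map_point \<sigma> (ec_add W P Q) = ec_add W (map_point \<sigma> P) (map_point \<sigma> Q)"
proof (cases P; cases Q)
 fix x1 y1 x2 y2 assume pq: "P = Affine x1 y1" "Q = Affine x2 y2"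
 note D = csubringD[OF fhomD(2)[OF h]] csubfieldD(3,4)[OF fhomD(1)[OF h]]
 note c = coeffs[THEN D(12)] and c' = coeffs[THEN fhomD(12)[OF h]]
 note H = fhomD(5-8,10,11)[OF h]
 have num: "\<sigma> (numeral k) = numeral k" for k using fhomD(12)[OF h, of "numeral k"] by simp
 have in_M: "x1 \<in> M" "y1 \<in> M" "x2 \<in> M" "y2 \<in> M" using P pq by auto
 have xx: "\<sigma> x1 = \<sigma> x2 \<longleftrightarrow> x1 = x2" using inj_onD[OF fhomD(14)[OF h]] in_M by blast
 have "\<sigma> (y1 + y2 + a1 W * x2 + a3 W) = \<sigma> y1 + \<sigma> y2 + a1 W * \<sigma> x2 + a3 W"
  using in_M c c' by (simp add: H D)
 moreover have "y1 + y2 + a1 W * x2 + a3 W \<in> M" using in_M c by (simp add: D)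
 ultimately have yy: "\<sigma> y1 + \<sigma> y2 + a1 W * \<sigma> x2 + a3 W = 0 \<longleftrightarrow> y1 + y2 + a1 W * x2 + a3 W = 0"
  using fhomD(13)[OF h] by metis
 define l where "l = ec_slope W x1 y1 x2 y2"
 have l: "l \<in> M" unfolding l_def ec_slope_def using in_M c by (auto intro!: D(1-11))
 have sl: "ec_slope W (\<sigma> x1) (\<sigma> y1) (\<sigma> x2) (\<sigma> y2) = \<sigma> l"
  unfolding l_def ec_slope_def xx using in_M c c' by (simp add: H D num)
 define x3 where "x3 = l ^ 2 + a1 W * l - a2 W - x1 - x2"
 have x3: "x3 \<in> M" unfolding x3_def using in_M c l by (auto intro!: D(1-11))
 have sx3: "\<sigma> l ^ 2 + a1 W * \<sigma> l - a2 W - \<sigma> x1 - \<sigma> x2 = \<sigma> x3"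
  unfolding x3_def using in_M c c' l by (simp add: H D)
 have "\<sigma> (l * (x1 - x3) - y1 - a1 W * x3 - a3 W) = \<sigma> l * (\<sigma> x1 - \<sigma> x3) - \<sigma> y1 - a1 W * \<sigma> x3 - a3 W"
  using in_M c c' l x3 by (simp add: H D)
 then have "map_point \<sigma> (Affine x3 (l * (x1 - x3) - y1 - a1 W * x3 - a3 W)) =
   Affine (\<sigma> x3) (\<sigma> l * (\<sigma> x1 - \<sigma> x3) - \<sigma> y1 - a1 W * \<sigma> x3 - a3 W)" by simp
 then show ?thesis
  unfolding pq point.map ec_add.simps xx yy Let_def sl sx3 l_def[symmetric] x3_def[symmetric] by simp
qed (use assms in auto)

lemma map_point_pts:
 assumes h: "fhom M \<sigma>" and P: "P \<in> pts M"
 shows "map_point \<sigma> P \<in> ec W"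
proof (cases P)
 case (Affine x y)
 note D = csubringD[OF fhomD(2)[OF h]] csubfieldD(3,4)[OF fhomD(1)[OF h]]
 note c = coeffs[THEN D(12)] and c' = coeffs[THEN fhomD(12)[OF h]]
 note H = fhomD(5-8,10,11)[OF h]
 have xy: "x \<in> M" "y \<in> M" "y ^ 2 + a1 W * x * y + a3 W * y = x ^ 3 + a2 W * x ^ 2 + a4 W * x + a6 W"
  using P Affine by (auto simp: on_ec_def)
 then have "\<sigma> (y ^ 2 + a1 W * x * y + a3 W * y) = \<sigma> (x ^ 3 + a2 W * x ^ 2 + a4 W * x + a6 W)" by simp
 then show ?thesis using xy(1,2) c c' unfolding Affine by (simp add: H D on_ec_def)
qed simp

lemma pts_pow:
 assumes M: "csubfield M" and P: "P \<in> pts M"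
 shows "P [^]\<^bsub>E\<^esub> (n::nat) \<in> pts M"
 by (induction n) (use pts_add[OF M _ P] in auto)

lemma map_point_pow:
 assumes h: "fhom M \<sigma>" and P: "P \<in> pts M"
 shows "map_point \<sigma> (P [^]\<^bsub>E\<^esub> (n::nat)) = map_point \<sigma> P [^]\<^bsub>E\<^esub> n"
 by (induction n) (use map_point_add[OF h pts_pow[OF fhomD(1)[OF h] P] P] in auto)

lemma map_point_inj:
 assumes h: "fhom M \<sigma>" and P: "P \<in> pts M" "Q \<in> pts M" "map_point \<sigma> P = map_point \<sigma> Q"
 shows "P = Q"
 using P inj_onD[OF fhomD(14)[OF h]] by (cases P; cases Q) auto

text \<open>Transported from the short model, whose coefficients are rational because r, s and t
  are. The abscissas are algebraic there, and the ordinates are square roots of algebraic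
  numbers.\<close>

lemma tors_finite_algebraic:
 assumes n: "n \<ge> 1"
 shows "finite (tors n)" "tors n \<subseteq> pts AN"
proof -
 obtain A B where AB: "change_variables 1 (- b2 W / 12) (- a1 W / 2) (- (a3 W + (- b2 W / 12) * a1 W) / 2) W = short A B"
  and "short_curve A B" using short_form[OF disc_W] by blast
 define r s t where "r = - b2 W / 12" and "s = - a1 W / 2" and "t = - (a3 W + (- b2 W / 12) * a1 W) / 2"
 have cv: "short A B = change_variables 1 r s t W" unfolding r_def s_def t_def AB ..
 have rat: "r \<in> \<rat>" "s \<in> \<rat>" "t \<in> \<rat>"
  unfolding r_def s_def t_def b2_def using coeffs by (auto intro!: Rats_divide Rats_minus_iff[THEN iffD2] Rats_add Rats_mult Rats_power Rats_diff)
 have "A = a4 (change_variables 1 r s t W)" "B = a6 (change_variables 1 r s t W)" unfolding cv[symmetric] by simp_all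
 then have AB_rat: "A \<in> \<rat>" "B \<in> \<rat>"
  using coeffs rat by (auto simp: change_variables_def intro!: Rats_add Rats_mult Rats_power Rats_diff)
 interpret S: short_curve A B by fact
 let ?c = "cv 1 r s t"
 have pow: "?c P [^]\<^bsub>S.G\<^esub> k = ?c (P [^]\<^bsub>E\<^esub> k)" if "P \<in> ec W" for P and k :: nat
  by (induction k) (use cv_ec_add[OF one_neq_zero cv, of _ P] that E.nat_pow_closed[of P] in auto)
 have sub: "?c ` tors n \<subseteq> {P \<in> ec (short A B). P [^]\<^bsub>S.G\<^esub> n = Infinity}"
  using cv_ec[OF one_neq_zero cv] pow by (auto simp: tors_def)
 then have "finite (?c ` tors n)" using S.torsion_algebraic_finite(1)[OF AB_rat n] finite_subset by blast
 then show "finite (tors n)" using finite_imageD inj_on_subset[OF cv_inj[OF one_neq_zero cv]] by blast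
 note D = csubringD[OF csubfieldD(1)[OF csubring_algebraic]] csubfieldD(4)[OF csubring_algebraic]
 show "tors n \<subseteq> pts AN"
 proof
  fix P assume P: "P \<in> tors n"
  show "P \<in> pts AN"
  proof (cases P)
   case (Affine x y)
   have c: "Affine (x - r) (y - s * (x - r) - t) \<in> ec (short A B)" "Affine (x - r) (y - s * (x - r) - t) [^]\<^bsub>S.G\<^esub> n = Infinity"
    using sub P Affine by force+
   have x: "x - r \<in> AN" using S.torsion_algebraic_finite(2)[OF AB_rat n c] by simp
   have "(y - s * (x - r) - t) ^ 2 = (x - r) ^ 3 + A * (x - r) + B" using c(1) by (simp add: on_short)
   moreover have AN: "A \<in> AN" "B \<in> AN" "r \<in> AN" "s \<in> AN" "t \<in> AN" using D(11) AB_rat rat by blast+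
   have "(x - r) ^ 3 + A * (x - r) + B \<in> AN" by (intro D(4,6,7) x AN)
   ultimately have "algebraic ((y - s * (x - r) - t) ^ 2)" by simp
   then have "y - s * (x - r) - t \<in> AN"
    using algebraic_root[of _ "monom 1 2" "y - s * (x - r) - t"]
    by (simp add: poly_monom degree_monom_eq)
   then have "(y - s * (x - r) - t) + s * (x - r) + t \<in> AN" by (intro D(4,6,7) x AN)
   moreover have "(x - r) + r \<in> AN" by (intro D(6) x AN)
   ultimately show ?thesis using P Affine by (simp add: tors_def)
  qed simp
 qed
qed

lemma map_point_tors:
 assumes h: "fhom M \<sigma>" and n: "n \<ge> 1" and T: "tors n \<subseteq> pts M"
 shows "bij_betw (map_point \<sigma>) (tors n) (tors n)"
proof -
 have "map_point \<sigma> ` tors n \<subseteq> tors n"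
 proof safe
  fix P assume P: "P \<in> tors n"
  then have "P \<in> pts M" using T by blast
  then show "map_point \<sigma> P \<in> tors n"
   using map_point_pow[OF h, of P n] map_point_pts[OF h] P by (simp add: tors_def)
 qed
 moreover have "inj_on (map_point \<sigma>) (tors n)"
  using map_point_inj[OF h] T by (meson inj_onI subsetD)
 ultimately show ?thesis
  using endo_inj_surj[OF tors_finite_algebraic(1)[OF n]] by (auto simp: bij_betw_def)
qed

text \<open>The stability hypothesis of \<open>Gal_moves\<close>, for a single torsion level or for
  all powers of p at once.\<close>

lemma coordinates_stable:
 assumes h: "fhom AN s" and I: "\<And>n. n \<in> I ==> n \<ge> (1::nat)"
 shows "s ` coordinates (\<Union>n\<in>I. tors n) = coordinates (\<Union>n\<in>I. tors n)"
proof -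
 have im: "map_point s ` tors n = tors n" if "n \<in> I" for n
  using map_point_tors[OF h I[OF that] tors_finite_algebraic(2)[OF I[OF that]]] by (simp add: bij_betw_def)
 have "s ` coordinates (\<Union>n\<in>I. tors n) = coordinates (map_point s ` (\<Union>n\<in>I. tors n))"
  by (auto simp: coordinates_def point.set_map)
 also have "map_point s ` (\<Union>n\<in>I. tors n) = (\<Union>n\<in>I. tors n)" using im by (simp add: image_UN)
 finally show ?thesis .
qed

end

section \<open>Agreement with the definitions over the field of algebraic numbers\<close>

lemma Qbar_simps [simp]: "carrier Qbar = AN" "mult Qbar = (*)" "one Qbar = 1" "\<zero>\<^bsub>Qbar\<^esub> = 0" "add Qbar = (+)"
 using CC_simps by (simp_all add: Qbar_def)

lemma field_Qbar: "field Qbar"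
proof -
 interpret CC: field \<CC> by (rule field_CC)
 show ?thesis unfolding Qbar_def by (rule CC.subfield_iff(2)) (simp add: subfield_CC csubring_algebraic)
qed

lemma Qbar_uminus [simp]: "algebraic x ==> \<ominus>\<^bsub>Qbar\<^esub> x = - x" for x :: complex
proof -
 interpret Q: field Qbar by (rule field_Qbar)
 show "algebraic x ==> \<ominus>\<^bsub>Qbar\<^esub> x = - x" using Q.minus_equality[of "- x" x] by simp
qed

lemma Qbar_minus [simp]: "algebraic y ==> x \<ominus>\<^bsub>Qbar\<^esub> y = x - y" for x y :: complex
 by (simp add: a_minus_def)

lemma Qbar_inv [simp]: "algebraic x ==> x ~= 0 ==> inv\<^bsub>Qbar\<^esub> x = inverse x" for x :: complex
proof -
 interpret Q: field Qbar by (rule field_Qbar)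
 assume "algebraic x" "x ~= 0"
 then show ?thesis using csubfieldD(2)[OF csubring_algebraic, of x] by (intro Q.comm_inv_char) auto
qed

lemma Qbar_add_pow [simp]: "add_pow Qbar (n::nat) x = of_nat n * x"
 by (induction n) (auto simp: add_pow_def algebra_simps)

context rational_curve
begin

lemma points_Qbar: "points Qbar W = pts AN"
proof -
 have "on_curve Qbar W x y \<longleftrightarrow> algebraic x \<and> algebraic y \<and> on_ec W x y" for x y
  by (auto simp: on_curve_def on_ec_def power2_eq_square power3_eq_cube mult.assoc)
 then show ?thesis by (auto simp: points_def pts_def ec_def)
qed

lemma add_points_Qbar:
 assumes P: "P \<in> pts AN" "Q \<in> pts AN"
 shows "add_points Qbar W P Q = ec_add W P Q"
proof (cases P; cases Q)
 fix x1 y1 x2 y2 assume pq: "P = Affine x1 y1" "Q = Affine x2 y2"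
 note D = csubringD[OF csubfieldD(1)[OF csubring_algebraic], unfolded mem_Collect_eq]
  csubfieldD(2,3,4)[OF csubring_algebraic, unfolded mem_Collect_eq]
 note c = coeffs[THEN D(13)]
 have alg: "algebraic x1" "algebraic y1" "algebraic x2" "algebraic y2" using P pq by auto
 have on: "on_ec W x1 y1" "on_ec W x2 y2" using P pq by auto
 define den where "den = y1 + y2 + a1 W * x2 + a3 W"
 show ?thesis
 proof (cases "x1 = x2 \<and> den = 0")
  case True
  then show ?thesis by (simp add: pq den_def)
 next
  case False
  have slope: "chord_slope Qbar W x1 y1 x2 y2 = ec_slope W x1 y1 x2 y2"
  proof (cases "x1 = x2")
   case True
   then have "y2 = y1" using on_ec_same_x[of W x1 y1 y2] on False by (auto simp: den_def)
   then have nz: "2 * y1 + a1 W * x1 + a3 W ~= 0" using False True by (simp add: den_def)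
   moreover have "algebraic (2 * y1 + a1 W * x1 + a3 W)" using alg c by (intro D(4,6,10)) auto
   moreover have "algebraic (a1 W * y1)" using alg c by (intro D(4))
   ultimately show ?thesis
    using True by (simp add: chord_slope_def ec_slope_def divide_inverse power2_eq_square mult.assoc)
  next
   case False
   moreover have "algebraic (x2 - x1)" using alg D(3) by blast
   ultimately show ?thesis using alg by (simp add: chord_slope_def ec_slope_def divide_inverse)
  qed
  define l where "l = ec_slope W x1 y1 x2 y2"
  have l: "algebraic l" unfolding l_def ec_slope_def using alg c by (auto intro!: D(1-12))
  define x3 where "x3 = l ^ 2 + a1 W * l - a2 W - x1 - x2"
  have x3: "algebraic x3" unfolding x3_def using alg c l by (auto intro!: D(1-12))
  have "algebraic (a1 W * x3)" using x3 c D(4) by blast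
  moreover have "add_points Qbar W P Q = (let x = l * l + a1 W * l - a2 W - x1 - x2 in
    Affine x (l * (x1 \<ominus>\<^bsub>Qbar\<^esub> x) \<ominus>\<^bsub>Qbar\<^esub> y1 \<ominus>\<^bsub>Qbar\<^esub> a1 W * x \<ominus>\<^bsub>Qbar\<^esub> a3 W))"
   using False alg c unfolding pq add_points.simps slope l_def[symmetric] den_def Let_def by auto
  moreover have "l * l + a1 W * l - a2 W - x1 - x2 = x3" by (simp add: x3_def power2_eq_square)
  moreover have "ec_add W P Q = Affine x3 (l * (x1 - x3) - y1 - a1 W * x3 - a3 W)"
   using False unfolding pq ec_add.simps den_def Let_def l_def[symmetric] x3_def[symmetric] by auto
  ultimately show ?thesis using alg c x3 by (simp add: Let_def)
 qed
qed auto

lemma point_group_pow: "P \<in> pts AN ==> P [^]\<^bsub>point_group Qbar W\<^esub> (n::nat) = P [^]\<^bsub>E\<^esub> n"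
proof (induction n)
 case (Suc n)
 then show ?case using add_points_Qbar[OF pts_pow[OF csubring_algebraic]] by (simp add: point_group_def)
qed (simp add: point_group_def)

lemma torsion_Qbar: "n \<ge> 1 ==> torsion Qbar W n = tors n"
 using tors_finite_algebraic(2)[of n] point_group_pow
 by (auto simp: torsion_def tors_def points_Qbar) (auto simp: point_group_def pts_def)

lemma torsion_field_eq: "n \<ge> 1 ==> torsion_field W n = generate_field \<CC> (coordinates (tors n))"
 by (simp add: torsion_field_def torsion_Qbar)

lemma p_power_torsion_field_eq: "p \<ge> 1 ==> p_power_torsion_field W p = generate_field \<CC> (coordinates (\<Union>n. tors (p ^ n)))"
 by (simp add: p_power_torsion_field_def torsion_Qbar)

end

section \<open>Matrices modulo p and coordinates on the p-torsion\<close>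

lemma mod_matrix_mult:
 "mod_matrix p (mod_matrix p A ** B) = mod_matrix p (A ** B)"
 "mod_matrix p (A ** mod_matrix p B) = mod_matrix p (A ** B)" "mod_matrix p (mod_matrix p A) = mod_matrix p A"
 by (auto simp: mod_matrix_def vec_eq_iff matrix_matrix_mult_def sum_2 intro!: mod_add_cong mod_mult_cong)

lemma det_mod_matrix: "det (mod_matrix p A) mod int p = det A mod int p"
 by (auto simp: mod_matrix_def det_2 intro!: mod_diff_cong mod_mult_cong)

lemma coprime_mod_iff: "coprime (a mod m) m \<longleftrightarrow> coprime a m" for a m :: int
 by (metis coprime_iff_gcd_eq_1 gcd.commute gcd_red_int)

lemma monoid_GL2: "p \<ge> 2 ==> monoid (GL2 p)"
proof (rule monoidI)
 assume p: "p \<ge> 2"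
 show "\<one>\<^bsub>GL2 p\<^esub> \<in> carrier (GL2 p)"
  using p by (auto simp: GL2_def mod_matrix_def vec_eq_iff mat_def det_2)
 fix A B assume A: "A \<in> carrier (GL2 p)" and B: "B \<in> carrier (GL2 p)"
 have "coprime (det (mod_matrix p (A ** B))) (int p)"
  using A B coprime_mod_iff[of "det (mod_matrix p (A ** B))" "int p"] coprime_mod_iff[of "det (A ** B)" "int p"]
  by (simp add: GL2_def det_mod_matrix det_mul)
 then show "A \<otimes>\<^bsub>GL2 p\<^esub> B \<in> carrier (GL2 p)" by (simp add: GL2_def mod_matrix_mult)
next
 fix A B C
 show "A \<otimes>\<^bsub>GL2 p\<^esub> B \<otimes>\<^bsub>GL2 p\<^esub> C = A \<otimes>\<^bsub>GL2 p\<^esub> (B \<otimes>\<^bsub>GL2 p\<^esub> C)"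
  by (simp add: GL2_def mod_matrix_mult matrix_mul_assoc)
qed (auto simp: GL2_def)

lemma GL2_Units:
 assumes p: "p \<ge> 2" and g: "g \<in> carrier (GL2 p)"
 shows "g \<in> Units (GL2 p)"
proof -
 have "coprime (det g) (int p)" using g by (simp add: GL2_def)
 then obtain d v where "d * det g + v * int p = 1"
  using bezout_int[of "det g" "int p"] by (auto simp: coprime_iff_gcd_eq_1)
 then have "(det g * d) mod int p = 1 mod int p" by (metis mod_mult_self1 mult.commute mult.left_commute)
 then have d: "(det g * d) mod int p = 1" using p by simp
 define a b c e where "a = g $ 1 $ 1" and "b = g $ 1 $ 2" and "c = g $ 2 $ 1" and "e = g $ 2 $ 2"
 \<comment> \<open>The adjugate of g times an inverse of its determinant modulo p.\<close>
 define h0 :: "int ^ 2 ^ 2" where "h0 = vector [vector [d * e, - d * b], vector [- d * c, d * a]]"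
 define h where "h = mod_matrix p h0"
 have h0: "h0 $ 1 $ 1 = d * e" "h0 $ 1 $ 2 = - d * b" "h0 $ 2 $ 1 = - d * c" "h0 $ 2 $ 2 = d * a"
  by (simp_all add: h0_def)
 have dg: "det g = a * e - b * c" by (simp add: det_2 a_def b_def c_def e_def)
 have m1: "((a * e - b * c) * d) mod int p = 1" using d dg by simp
 have p1: "1 mod int p = 1" using p by simp
 have "mod_matrix p (h0 ** g) = mat 1" "mod_matrix p (g ** h0) = mat 1"
  using m1 p1 by (auto simp: mod_matrix_def vec_eq_iff matrix_matrix_mult_def sum_2 forall_2 mat_def h0 algebra_simps
    simp flip: a_def b_def c_def e_def)
 moreover have "coprime (det h) (int p)"
 proof -
  have "det h0 = d * d * det g" unfolding det_2[of h0] h0 dg by (simp add: algebra_simps)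
  moreover have "coprime d (int p)"
  proof (rule coprimeI)
   fix k assume "k dvd d" "k dvd int p"
   then have "k dvd det g * d mod int p" by (metis dvd_mod dvd_mult)
   then show "is_unit k" using d by simp
  qed
  ultimately have "coprime (det h0) (int p)" using \<open>coprime (det g) (int p)\<close> by simp
  then show ?thesis unfolding h_def using det_mod_matrix[of p h0] coprime_mod_iff by metis
 qed
 ultimately show ?thesis
  using g unfolding Units_def by (auto simp: GL2_def h_def mod_matrix_mult intro!: exI[of _ h])
qed

locale torsion_basis_curve = rational_curve +
 fixes p :: nat and S T :: "complex point"
 assumes p: "prime p" and basis: "torsion_basis W p S T"
begin

lemma p_pos: "p \<ge> 1" "p \<ge> 2" "0 < int p"
 using prime_ge_2_nat[OF p] by auto

lemma basis_tors: "S \<in> tors p" "T \<in> tors p" "S \<in> ec W" "T \<in> ec W" "S \<in> pts AN" "T \<in> pts AN"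
 "S [^]\<^bsub>E\<^esub> p = Infinity" "T [^]\<^bsub>E\<^esub> p = Infinity"
 using basis tors_finite_algebraic(2)[OF p_pos(1)] unfolding torsion_basis_def torsion_Qbar[OF p_pos(1)] by (auto simp: tors_def)

text \<open>Coordinates are arbitrary integers, of which only the classes modulo p matter; linear
  algebra modulo p is thus done with integer arithmetic.\<close>

definition lin :: "int => int => complex point"
 where "lin u v = S [^]\<^bsub>E\<^esub> u \<otimes>\<^bsub>E\<^esub> T [^]\<^bsub>E\<^esub> v"

lemma int_pow_mod_p:
 assumes "P \<in> ec W" "P [^]\<^bsub>E\<^esub> p = Infinity"
 shows "P [^]\<^bsub>E\<^esub> (z mod int p) = P [^]\<^bsub>E\<^esub> z"
proof -
 have P: "P \<in> carrier E" using assms by simp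
 have "P [^]\<^bsub>E\<^esub> z = P [^]\<^bsub>E\<^esub> (int p * (z div int p) + z mod int p)" by simp
 also have "\<dots> = P [^]\<^bsub>E\<^esub> (int p * (z div int p)) \<otimes>\<^bsub>E\<^esub> P [^]\<^bsub>E\<^esub> (z mod int p)"
  using P by (rule E.int_pow_mult[rotated])
 also have "P [^]\<^bsub>E\<^esub> (int p * (z div int p)) = (P [^]\<^bsub>E\<^esub> int p) [^]\<^bsub>E\<^esub> (z div int p)"
  using E.int_pow_pow[OF P] by simp
 also have "P [^]\<^bsub>E\<^esub> int p = \<one>\<^bsub>E\<^esub>" using assms by (simp add: int_pow_int)
 also have "\<one>\<^bsub>E\<^esub> [^]\<^bsub>E\<^esub> (z div int p) = \<one>\<^bsub>E\<^esub>" by (rule E.int_pow_one)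
 finally show ?thesis using E.int_pow_closed[OF P] by simp
qed

lemma lin_mod: "lin (u mod int p) (v mod int p) = lin u v"
 unfolding lin_def using int_pow_mod_p basis_tors by simp

lemma lin_cong: "u mod int p = u' mod int p ==> v mod int p = v' mod int p ==> lin u v = lin u' v'"
 by (metis lin_mod)

lemma lin_bij: "bij_betw (\<lambda>(a, b). lin (int a) (int b)) ({0..<p} \<times> {0..<p}) (tors p)"
proof -
 have "bij_betw (\<lambda>(a, b). S [^]\<^bsub>point_group Qbar W\<^esub> a \<otimes>\<^bsub>point_group Qbar W\<^esub> T [^]\<^bsub>point_group Qbar W\<^esub> b)
   ({0..<p} \<times> {0..<p}) (tors p)"
  using basis unfolding torsion_basis_def torsion_Qbar[OF p_pos(1)] by blast
 moreover have "S [^]\<^bsub>point_group Qbar W\<^esub> a \<otimes>\<^bsub>point_group Qbar W\<^esub> T [^]\<^bsub>point_group Qbar W\<^esub> b = lin (int a) (int b)" for a b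
  using point_group_pow basis_tors add_points_Qbar pts_pow[OF csubring_algebraic]
  by (simp add: lin_def point_group_def int_pow_int)
 ultimately show ?thesis by simp
qed

lemma card_tors: "card (tors p) = p ^ 2"
 using bij_betw_same_card[OF lin_bij] by (simp add: power2_eq_square)

lemma lin_tors: "lin u v \<in> tors p"
proof -
 have "(nat (u mod int p), nat (v mod int p)) \<in> {0..<p} \<times> {0..<p}" using p_pos by (simp add: nat_less_iff)
 from bij_betw_apply[OF lin_bij this]
 have "lin (int (nat (u mod int p))) (int (nat (v mod int p))) \<in> tors p" by simp
 then show ?thesis using p_pos by (simp add: lin_mod)
qed

lemma lin_surj: "P \<in> tors p ==> \<exists>u v. 0 \<le> u \<and> u < int p \<and> 0 \<le> v \<and> v < int p \<and> P = lin u v"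
proof -
 assume "P \<in> tors p"
 then have "P \<in> (\<lambda>(a, b). lin (int a) (int b)) ` ({0..<p} \<times> {0..<p})"
  using lin_bij by (simp only: bij_betw_def)
 then obtain a b where "a < p" "b < p" "P = lin (int a) (int b)" by auto
 then show ?thesis by (intro exI[of _ "int a"] exI[of _ "int b"]) simp
qed

lemma lin_eq_iff: "lin u v = lin u' v' \<longleftrightarrow> u mod int p = u' mod int p \<and> v mod int p = v' mod int p"
proof
 assume eq: "lin u v = lin u' v'"
 have "(\<lambda>(a, b). lin (int a) (int b)) (nat (u mod int p), nat (v mod int p))
   = (\<lambda>(a, b). lin (int a) (int b)) (nat (u' mod int p), nat (v' mod int p))"
  using eq p_pos by (simp add: lin_mod)
 then have "(nat (u mod int p), nat (v mod int p)) = (nat (u' mod int p), nat (v' mod int p))"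
  by (rule inj_onD[OF bij_betw_imp_inj_on[OF lin_bij]]) (use p_pos in \<open>simp_all add: nat_less_iff\<close>)
 then show "u mod int p = u' mod int p \<and> v mod int p = v' mod int p"
  using p_pos by (simp add: eq_nat_nat_iff)
qed (use lin_cong in blast)

lemma lin_0: "lin 0 0 = Infinity"
 by (simp add: lin_def)

lemma lin_add: "lin u v \<otimes>\<^bsub>E\<^esub> lin u' v' = lin (u + u') (v + v')"
 using basis_tors E.int_pow_mult[of S] E.int_pow_mult[of T] E.int_pow_closed[of S] E.int_pow_closed[of T]
 by (simp add: lin_def E.m_ac[simplified] E.m_closed[simplified])

lemma lin_pow: "lin u v [^]\<^bsub>E\<^esub> k = lin (k * u) (k * v)" for k :: int
 using basis_tors E.int_pow_distrib[of "S [^]\<^bsub>E\<^esub> u" "T [^]\<^bsub>E\<^esub> v" k] E.int_pow_pow[of S] E.int_pow_pow[of T]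
  E.int_pow_closed[of S] E.int_pow_closed[of T]
 by (simp add: lin_def mult.commute)

definition M :: "complex set" where "M = torsion_field W p"

lemma M: "csubfield M" "tors p \<subseteq> pts M" "M \<subseteq> AN"
proof -
 show M: "csubfield M" unfolding M_def torsion_field_eq[OF p_pos(1)] by (rule generate_field_CC(1))
 have c: "coordinates (tors p) \<subseteq> M" unfolding M_def torsion_field_eq[OF p_pos(1)] by (rule generate_field_CC(2))
 then show "tors p \<subseteq> pts M" by (auto simp: coordinates_def pts_def tors_def)
 show "M \<subseteq> AN" unfolding M_def torsion_field_eq[OF p_pos(1)]
  by (rule generate_field_CC(3)[OF csubring_algebraic])
    (use tors_finite_algebraic(2)[OF p_pos(1)] in \<open>auto simp: coordinates_def pts_def\<close>)
qed

abbreviation "GG \<equiv> Gal M \<rat>"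

sublocale GG: group "GG"
 by (rule Gal_group[OF M(1)]) (use csubfieldD(4)[OF M(1)] in blast)

lemma GG_hom: "\<sigma> \<in> carrier GG ==> fhom M \<sigma>"
 using Gal_iff[OF M(1)] by blast

lemma GG_tors: "\<sigma> \<in> carrier GG ==> P \<in> tors p ==> map_point \<sigma> P \<in> tors p"
 using map_point_tors[OF GG_hom p_pos(1) M(2)] by (auto simp: bij_betw_def)

lemma tors_add: "P \<in> tors p ==> Q \<in> tors p ==> P \<otimes>\<^bsub>E\<^esub> Q \<in> tors p"
 using lin_surj lin_add lin_tors by metis

lemma GG_add: "\<sigma> \<in> carrier GG ==> P \<in> tors p ==> Q \<in> tors p ==>
  map_point \<sigma> (P \<otimes>\<^bsub>E\<^esub> Q) = map_point \<sigma> P \<otimes>\<^bsub>E\<^esub> map_point \<sigma> Q"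
 using map_point_add[OF GG_hom] M(2) by auto

lemma tors_int_pow: "P \<in> tors p ==> P [^]\<^bsub>E\<^esub> (k::int) \<in> tors p"
 using lin_surj lin_pow lin_tors by metis

lemma GG_int_pow:
 assumes s: "\<sigma> \<in> carrier GG" and P: "P \<in> tors p"
 shows "map_point \<sigma> (P [^]\<^bsub>E\<^esub> (k::int)) = map_point \<sigma> P [^]\<^bsub>E\<^esub> k"
proof -
 have P': "P \<in> ec W" "P [^]\<^bsub>E\<^esub> p = Infinity" "map_point \<sigma> P \<in> ec W" "map_point \<sigma> P [^]\<^bsub>E\<^esub> p = Infinity"
  using P GG_tors[OF s P] by (auto simp: tors_def)
 have "k mod int p = int (nat (k mod int p))" using p_pos by simp
 then show ?thesis
  using map_point_pow[OF GG_hom[OF s], of P "nat (k mod int p)"] M(2) P int_pow_mod_p[OF P'(1,2), of k] int_pow_mod_p[OF P'(3,4), of k]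
  by (metis int_pow_int subsetD)
qed

end

no_notation fps_nth (infixl "$" 75)

context torsion_basis_curve
begin

text \<open>Existence and uniqueness behind the definite description in
  \<open>mod_p_representation\<close>: reduced coordinates of the images of S and T exist and are
  unique, and the determinant is prime to p because an automorphism is injective on the
  p-torsion.\<close>

lemma mod_p_matrix:
 fixes R :: "int ^ 2 ^ 2"
 assumes s: "\<sigma> \<in> carrier GG"
 defines "R \<equiv> mod_p_representation W p S T \<sigma>"
 shows "R \<in> carrier (GL2 p)" "map_point \<sigma> S = lin (R $ 1 $ 1) (R $ 2 $ 1)" "map_point \<sigma> T = lin (R $ 1 $ 2) (R $ 2 $ 2)"
proof -
 have pg: "S [^]\<^bsub>point_group Qbar W\<^esub> u \<otimes>\<^bsub>point_group Qbar W\<^esub> T [^]\<^bsub>point_group Qbar W\<^esub> v = lin u v" if "0 \<le> u" "0 \<le> v" for u v :: int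
 proof -
  obtain a b where ab: "u = int a" "v = int b" using \<open>0 \<le> u\<close> \<open>0 \<le> v\<close> nonneg_int_cases by metis
  have "S [^]\<^bsub>point_group Qbar W\<^esub> u = S [^]\<^bsub>E\<^esub> a" "T [^]\<^bsub>point_group Qbar W\<^esub> v = T [^]\<^bsub>E\<^esub> b"
   using point_group_pow basis_tors(5,6) unfolding ab int_pow_int by auto
  then show ?thesis
   using add_points_Qbar[OF pts_pow[OF csubring_algebraic basis_tors(5)] pts_pow[OF csubring_algebraic basis_tors(6)], of a b]
   by (simp add: lin_def ab int_pow_int point_group_def)
 qed
 define P where "P A \<longleftrightarrow> A \<in> carrier (GL2 p) \<and> map_point \<sigma> S = lin (A $ 1 $ 1) (A $ 2 $ 1) \<and> map_point \<sigma> T = lin (A $ 1 $ 2) (A $ 2 $ 2)"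
  for A :: "int ^ 2 ^ 2"
 have entries: "A $ i $ j mod int p = A $ i $ j \<and> 0 \<le> A $ i $ j" if "A \<in> carrier (GL2 p)" for A :: "int ^ 2 ^ 2" and i j
 proof -
  have "mod_matrix p A = A" using that by (simp add: GL2_def)
  then have "A $ i $ j mod int p = A $ i $ j" by (simp add: mod_matrix_def vec_eq_iff)
  then show ?thesis using p_pos(3) by (metis pos_mod_sign)
 qed
 have R: "R = (THE A. P A)"
  unfolding R_def mod_p_representation_def P_def using entries pg by (intro arg_cong[of _ _ The] ext) (metis (no_types, lifting))
 obtain a c where ac: "0 \<le> a" "a < int p" "0 \<le> c" "c < int p" "map_point \<sigma> S = lin a c"
  using lin_surj[OF GG_tors[OF s basis_tors(1)]] by metis
 obtain b d where bd: "0 \<le> b" "b < int p" "0 \<le> d" "d < int p" "map_point \<sigma> T = lin b d"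
  using lin_surj[OF GG_tors[OF s basis_tors(2)]] by metis
 define A :: "int ^ 2 ^ 2" where "A = vector [vector [a, b], vector [c, d]]"
 have A: "A $ 1 $ 1 = a" "A $ 1 $ 2 = b" "A $ 2 $ 1 = c" "A $ 2 $ 2 = d" by (simp_all add: A_def)
 have act: "map_point \<sigma> (lin u v) = lin (a * u + b * v) (c * u + d * v)" for u v
 proof -
  have "map_point \<sigma> (lin u v) = map_point \<sigma> S [^]\<^bsub>E\<^esub> u \<otimes>\<^bsub>E\<^esub> map_point \<sigma> T [^]\<^bsub>E\<^esub> v"
   unfolding lin_def using GG_add[OF s] GG_int_pow[OF s] tors_int_pow basis_tors by metis
  then show ?thesis unfolding ac bd lin_pow lin_add by (simp add: algebra_simps)
 qed
 have inj: "u mod int p = 0 \<and> v mod int p = 0" if "map_point \<sigma> (lin u v) = Infinity" for u v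
 proof -
  have "map_point \<sigma> (lin u v) = map_point \<sigma> (lin 0 0)" using that by (simp add: lin_0)
  then have "lin u v = lin 0 0" using map_point_inj[OF GG_hom[OF s]] M(2) lin_tors by blast
  then show ?thesis unfolding lin_eq_iff by simp
 qed
 \<comment> \<open>If p divided the determinant, the columns (d, -c) and (-b, a) of the adjugate
   would be mapped to Infinity. By injectivity all entries would vanish modulo p, and S itself would
   be mapped to Infinity.\<close>
 have "\<not> int p dvd a * d - b * c"
 proof
  assume dvd: "int p dvd a * d - b * c"
  have "lin (a * d + b * (- c)) (c * d + d * (- c)) = lin 0 0" "lin (a * (- b) + b * a) (c * (- b) + d * a) = lin 0 0"
   unfolding lin_eq_iff using dvd by (auto simp: mod_eq_0_iff_dvd algebra_simps)
  then have "d mod int p = 0" "(- c) mod int p = 0" "(- b) mod int p = 0" "a mod int p = 0"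
   using inj[of d "- c"] inj[of "- b" a] unfolding act lin_0 by auto
  then have "lin (a * 1 + b * 0) (c * 1 + d * 0) = lin 0 0" unfolding lin_eq_iff by (auto simp: mod_eq_0_iff_dvd)
  then have "(1::int) mod int p = 0" using inj[of 1 0] unfolding act lin_0 by auto
  then show False using p_pos by simp
 qed
 then have cop: "coprime (det A) (int p)"
  using p prime_imp_coprime[of "int p" "det A"] by (simp add: det_2 A coprime_commute)
 then have PA: "P A"
  unfolding P_def A using ac bd by (auto simp: GL2_def mod_matrix_def vec_eq_iff forall_2 A)
 moreover have "A' = A" if "P A'" for A'
 proof -
  have "lin (A' $ 1 $ 1) (A' $ 2 $ 1) = lin a c" "lin (A' $ 1 $ 2) (A' $ 2 $ 2) = lin b d"
   using that ac bd unfolding P_def by metis+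
  then show ?thesis
   unfolding lin_eq_iff using that entries[of A'] ac bd unfolding P_def by (auto simp: vec_eq_iff forall_2 A)
 qed
 ultimately have "P R" unfolding R by (metis theI)
 then show "R \<in> carrier (GL2 p)" "map_point \<sigma> S = lin (R $ 1 $ 1) (R $ 2 $ 1)" "map_point \<sigma> T = lin (R $ 1 $ 2) (R $ 2 $ 2)"
  unfolding P_def by blast+
qed

text \<open>If R = g A g^-1 with A upper triangular, the first column of g is an eigenvector of R,
  the same for every element of the image; U is the point with these coordinates.\<close>

lemma stable_line:
 assumes B: "borel_subgroup p B" and in_B: "mod_p_representation W p S T ` carrier GG \<subseteq> B"
 shows "\<exists>U\<in>tors p. U ~= Infinity \<and> (\<forall>\<sigma>\<in>carrier GG. \<exists>k::int. map_point \<sigma> U = U [^]\<^bsub>E\<^esub> k)"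
proof -
 interpret GL: monoid "GL2 p" by (rule monoid_GL2[OF p_pos(2)])
 obtain g where g: "g \<in> carrier (GL2 p)" and Bg: "B = {g \<otimes>\<^bsub>GL2 p\<^esub> A \<otimes>\<^bsub>GL2 p\<^esub> inv\<^bsub>GL2 p\<^esub> g | A. A \<in> carrier (GL2 p) \<and> A $ 2 $ 1 = 0}"
  using B unfolding borel_subgroup_def by blast
 have gU: "g \<in> Units (GL2 p)" by (rule GL2_Units[OF p_pos(2) g])
 define U where "U = lin (g $ 1 $ 1) (g $ 2 $ 1)"
 have "U ~= Infinity"
 proof
  assume "U = Infinity"
  then have "g $ 1 $ 1 mod int p = 0" "g $ 2 $ 1 mod int p = 0" unfolding U_def lin_0[symmetric] lin_eq_iff by auto
  then have "int p dvd det g" by (auto simp: det_2 mod_eq_0_iff_dvd)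
  moreover have "coprime (det g) (int p)" using g by (simp add: GL2_def)
  ultimately have "is_unit (int p)" by (metis coprime_common_divisor dvd_refl)
  then show False using p_pos by simp
 qed
 moreover have "\<exists>k::int. map_point \<sigma> U = U [^]\<^bsub>E\<^esub> k" if s: "\<sigma> \<in> carrier GG" for \<sigma>
 proof -
  define R :: "int ^ 2 ^ 2" where "R = mod_p_representation W p S T \<sigma>"
  note R = mod_p_matrix[OF s, folded R_def]
  have "R \<in> B" using in_B s by (auto simp: R_def)
  then obtain A :: "int ^ 2 ^ 2" where A: "A \<in> carrier (GL2 p)" "A $ 2 $ 1 = 0" "R = g \<otimes>\<^bsub>GL2 p\<^esub> A \<otimes>\<^bsub>GL2 p\<^esub> inv\<^bsub>GL2 p\<^esub> g"
   unfolding Bg by blast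
  have "R \<otimes>\<^bsub>GL2 p\<^esub> g = g \<otimes>\<^bsub>GL2 p\<^esub> A"
   unfolding A(3) using A(1) g gU by (simp add: GL.m_assoc)
  then have "mod_matrix p (R ** g) = mod_matrix p (g ** A)" by (simp add: GL2_def)
  then have e: "(R $ i $ 1 * g $ 1 $ 1 + R $ i $ 2 * g $ 2 $ 1) mod int p = (A $ 1 $ 1 * g $ i $ 1) mod int p" for i
   using A(2) by (auto simp: mod_matrix_def vec_eq_iff matrix_matrix_mult_def sum_2 mult.commute dest: spec[of _ i] spec[of _ 1])
  have "map_point \<sigma> U = map_point \<sigma> S [^]\<^bsub>E\<^esub> (g $ 1 $ 1) \<otimes>\<^bsub>E\<^esub> map_point \<sigma> T [^]\<^bsub>E\<^esub> (g $ 2 $ 1)"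
   unfolding U_def lin_def using GG_add[OF s] GG_int_pow[OF s] tors_int_pow basis_tors by metis
  also have "\<dots> = lin (R $ 1 $ 1 * g $ 1 $ 1 + R $ 1 $ 2 * g $ 2 $ 1) (R $ 2 $ 1 * g $ 1 $ 1 + R $ 2 $ 2 * g $ 2 $ 1)"
   unfolding R(2,3) lin_pow lin_add by (simp add: algebra_simps)
  also have "\<dots> = lin (A $ 1 $ 1 * g $ 1 $ 1) (A $ 1 $ 1 * g $ 2 $ 1)" by (rule lin_cong; rule e)
  also have "\<dots> = U [^]\<^bsub>E\<^esub> (A $ 1 $ 1)" unfolding U_def lin_pow ..
  finally show ?thesis by blast
 qed
 ultimately show ?thesis using lin_tors unfolding U_def by blast
qed

end

section \<open>The q-adic valuation of rational numbers and the place q\<close>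

definition rmult :: "nat => complex => int"
 where "rmult q z = (THE k. \<exists>a b. a ~= 0 \<and> b ~= 0 \<and> z = of_int a / of_int b \<and>
  k = int (multiplicity (int q) a) - int (multiplicity (int q) b))"

lemma Rats_fraction:
 fixes z :: complex
 assumes "z \<in> \<rat>" "z ~= 0"
 obtains a b :: int where "a ~= 0" "b ~= 0" "z = of_int a / of_int b"
proof -
 obtain c where "z = of_rat c" using assms(1) by (auto elim: Rats_cases)
 then obtain m n :: int where "z = of_int m / of_int n"
  by (metis of_rat_rat quotient_of_denom_pos quotient_of_div of_rat_divide of_rat_of_int_eq surj_pair)
 then show thesis using that[of m n] assms(2) by auto
qed

definition Zq :: "nat => complex set"
 where "Zq q = {of_int a / of_int b | a b. \<not> int q dvd b}"

context
 fixes q :: nat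
 assumes q: "prime q"
begin

lemma pq: "prime (int q)" "prime_elem (int q)"
 using q by auto

text \<open>Independence of the chosen fraction, by comparing multiplicities in a b' = a' b. At 0 no
  fraction qualifies and \<open>rmult\<close> is unspecified, so its rules carry the hypothesis that
  the argument is not 0.\<close>

lemma rmult_eq:
 assumes "a ~= 0" "b ~= 0"
 shows "rmult q (of_int a / of_int b) = int (multiplicity (int q) a) - int (multiplicity (int q) b)"
 unfolding rmult_def
proof (rule the_equality)
 show "\<exists>a' b'. a' ~= 0 \<and> b' ~= 0 \<and> (of_int a / of_int b :: complex) = of_int a' / of_int b' \<and>
   int (multiplicity (int q) a) - int (multiplicity (int q) b) = int (multiplicity (int q) a') - int (multiplicity (int q) b')"
  using assms by blast
next
 fix k assume "\<exists>a' b'. a' ~= 0 \<and> b' ~= 0 \<and> (of_int a / of_int b :: complex) = of_int a' / of_int b' \<and>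
   k = int (multiplicity (int q) a') - int (multiplicity (int q) b')"
 then obtain a' b' where ab: "a' ~= 0" "b' ~= 0" "(of_int a / of_int b :: complex) = of_int a' / of_int b'"
  "k = int (multiplicity (int q) a') - int (multiplicity (int q) b')" by blast
 have "(of_int (a * b') :: complex) = of_int (a' * b)" using ab assms by (simp add: field_simps)
 then have "a * b' = a' * b" by (simp only: of_int_eq_iff)
 then have "multiplicity (int q) (a * b') = multiplicity (int q) (a' * b)" by simp
 then show "k = int (multiplicity (int q) a) - int (multiplicity (int q) b)"
  using ab assms pq by (simp add: prime_elem_multiplicity_mult_distrib)
qed

lemma rmult_int: "n ~= 0 ==> rmult q (of_int n) = int (multiplicity (int q) n)"
 using rmult_eq[of n 1] by simp

lemma rmult_1 [simp]: "rmult q 1 = 0"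
 using rmult_int[of 1] by simp

lemma rmult_mult: "z \<in> \<rat> ==> w \<in> \<rat> ==> z ~= 0 ==> w ~= 0 ==> rmult q (z * w) = rmult q z + rmult q w"
proof -
 assume "z \<in> \<rat>" "w \<in> \<rat>" "z ~= 0" "w ~= 0"
 then obtain a b c d where "a ~= 0" "b ~= 0" "z = of_int a / of_int b" "c ~= 0" "d ~= 0" "w = of_int c / of_int d"
  by (metis Rats_fraction)
 then show ?thesis
  using rmult_eq[of "a * c" "b * d"] rmult_eq[of a b] rmult_eq[of c d] pq by (simp add: prime_elem_multiplicity_mult_distrib)
qed

lemma rmult_inverse: "z \<in> \<rat> ==> z ~= 0 ==> rmult q (inverse z) = - rmult q z"
 using rmult_mult[of z "inverse z"] by simp

lemma rmult_divide: "z \<in> \<rat> ==> w \<in> \<rat> ==> z ~= 0 ==> w ~= 0 ==> rmult q (z / w) = rmult q z - rmult q w"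
 using rmult_mult[of z "inverse w"] rmult_inverse[of w] by (simp add: divide_inverse)

lemma rmult_power: "z \<in> \<rat> ==> z ~= 0 ==> rmult q (z ^ n) = int n * rmult q z"
 by (induction n) (simp_all add: rmult_mult algebra_simps)

lemma rmult_self: "rmult q (of_nat q) = 1"
 using rmult_int[of "int q"] q by (simp add: prime_gt_0_nat)

lemma rmult_minus: "z \<in> \<rat> ==> z ~= 0 ==> rmult q (- z) = rmult q z"
 using rmult_mult[of "-1" z] rmult_int[of "-1"] by simp

text \<open>A square has even valuation at q, whereas q and -q have valuation 1.\<close>

lemma rat_square_not_prime:
 fixes r :: complex
 assumes "r \<in> \<rat>" shows "r ^ 2 ~= of_nat q" "r ^ 2 ~= - of_nat q"
proof -
 have nz: "of_nat q ~= (0::complex)" using q by (simp add: prime_gt_0_nat)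
 have "rmult q (r ^ 2) ~= 1" if "r ~= 0" using rmult_power[of r 2] assms that by presburger
 then show "r ^ 2 ~= of_nat q" "r ^ 2 ~= - of_nat q"
  using rmult_self rmult_minus[of "of_nat q"] nz by force+
qed

lemma Zq_iff: "z \<in> Zq q \<longleftrightarrow> z \<in> \<rat> \<and> (z = 0 \<or> rmult q z \<ge> 0)"
proof
 assume "z \<in> Zq q"
 then obtain a b where ab: "z = of_int a / of_int b" "\<not> int q dvd b" by (auto simp: Zq_def)
 then have "multiplicity (int q) b = 0" by (simp add: not_dvd_imp_multiplicity_0)
 moreover have "b ~= 0" using ab by auto
 ultimately show "z \<in> \<rat> \<and> (z = 0 \<or> rmult q z \<ge> 0)" using ab rmult_eq[of a b] by (cases "a = 0") auto
next
 assume z: "z \<in> \<rat> \<and> (z = 0 \<or> rmult q z \<ge> 0)"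
 show "z \<in> Zq q"
 proof (cases "z = 0")
  case True
  have "(0::complex) = of_int 0 / of_int 1" "\<not> int q dvd 1" using pq by auto
  then show ?thesis unfolding True Zq_def by blast
 next
  case False
  then obtain a b where ab: "a ~= 0" "b ~= 0" "z = of_int a / of_int b" using z Rats_fraction by metis
  define g where "g = gcd a b"
  have g: "g ~= 0" using ab by (simp add: g_def)
  define a' b' where "a' = a div g" and "b' = b div g"
  have ab': "a = a' * g" "b = b' * g" by (simp_all add: a'_def b'_def g_def)
  have cop: "coprime a' b'" unfolding a'_def b'_def g_def using ab by (intro div_gcd_coprime) auto
  have nz: "a' ~= 0" "b' ~= 0" using ab ab' by auto
  have z': "z = of_int a' / of_int b'" using ab(3) ab' g by simp
  have "\<not> int q dvd b'"
  proof
   assume d: "int q dvd b'"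
   then have "\<not> int q dvd a'" using cop pq by (metis coprime_common_divisor prime_elem_def)
   then have "multiplicity (int q) a' = 0" by (simp add: not_dvd_imp_multiplicity_0)
   moreover have "multiplicity (int q) b' > 0" using d nz pq by (simp add: prime_multiplicity_gt_zero_iff)
   ultimately show False using z False rmult_eq[OF nz] z' by simp
  qed
  then show ?thesis using z' by (auto simp: Zq_def)
 qed
qed

lemma csubring_Zq: "csubring (Zq q)"
proof -
 have "x - y \<in> Zq q" "x * y \<in> Zq q" if "x \<in> Zq q" "y \<in> Zq q" for x y
 proof -
  obtain a b c d where ab: "x = of_int a / of_int b" "\<not> int q dvd b" "y = of_int c / of_int d" "\<not> int q dvd d"
   using \<open>x \<in> Zq q\<close> \<open>y \<in> Zq q\<close> by (auto simp: Zq_def)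
  have "b ~= 0" "d ~= 0" using ab by auto
  then have "x - y = of_int (a * d - c * b) / of_int (b * d)" "x * y = of_int (a * c) / of_int (b * d)"
   using ab by (simp_all add: diff_frac_eq)
  moreover have "\<not> int q dvd b * d" using ab pq by (simp add: prime_dvd_mult_iff)
  ultimately show "x - y \<in> Zq q" "x * y \<in> Zq q" unfolding Zq_def by blast+
 qed
 moreover have "1 \<in> Zq q" by (simp add: Zq_iff)
 ultimately show ?thesis by (simp add: csubring_def)
qed

lemma bezout_inverse: "U * Q + V * B = 1 ==> B ~= 0 ==> inverse B = U * (Q / B) + V" for U Q V B :: complex
proof -
 assume "U * Q + V * B = 1" "B ~= 0"
 then have "inverse B = (U * Q + V * B) / B" by (simp add: inverse_eq_divide)
 then show ?thesis using \<open>B ~= 0\<close> by (simp add: add_divide_distrib)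
qed

text \<open>An integer prime to q is invertible in A by a Bezout relation with q. A rational z of
  negative valuation cannot lie in A, because 1 / (q z) does and the product of the two is 1 /
  q.\<close>

lemma val_ring_Rats:
 assumes A: "val_ring A" "inverse (of_nat q) \<notin> A"
 shows "A \<inter> \<rat> = Zq q"
proof -
 have R: "csubring A" using A by (simp add: val_ring_def)
 note D = csubringD[OF R]
 have unit: "inverse (of_int b) \<in> A" if b: "\<not> int q dvd b" for b
 proof (rule ccontr)
  assume n: "inverse (of_int b) \<notin> A"
  have "coprime (int q) b" using b pq by (simp add: prime_imp_coprime)
  then obtain u v where "u * int q + v * b = 1" using bezout_int[of "int q" b] by (auto simp: coprime_iff_gcd_eq_1)
  then have uv: "of_int u * of_nat q + of_int v * of_int b = (1::complex)" by (metis of_int_1 of_int_add of_int_mult of_int_of_nat_eq)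
  have b0: "of_int b ~= (0::complex)" using n D(2) by auto
  have q0: "of_nat q ~= (0::complex)" using A(2) D(2) by (metis inverse_zero)
  show False
  proof (cases "of_nat q / of_int b \<in> A")
   case True
   have "inverse (of_int b) = of_int u * (of_nat q / of_int b) + (of_int v :: complex)"
    by (rule bezout_inverse[OF uv b0])
   moreover have "of_int u * (of_nat q / of_int b) + (of_int v :: complex) \<in> A"
    by (intro D(4,6,9) True)
   ultimately show False using n by metis
  next
   case False
   then have "of_int b / of_nat q \<in> A" using A(1) unfolding val_ring_def by (metis inverse_divide)
   moreover have "inverse (of_nat q) = of_int v * (of_int b / of_nat q) + (of_int u :: complex)"
    using uv by (intro bezout_inverse[OF _ q0]) (simp add: add.commute)
   moreover have "of_int v * (of_int b / of_nat q) + (of_int u :: complex) \<in> A"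
    by (intro D(4,6,9)) fact
   ultimately show False using A(2) by metis
  qed
 qed
 show ?thesis
 proof (intro equalityI subsetI)
  fix z assume z: "z \<in> A \<inter> \<rat>"
  show "z \<in> Zq q"
  proof (rule ccontr)
   assume "z \<notin> Zq q"
   then have n: "z ~= 0" "rmult q z < 0" using z by (auto simp: Zq_iff)
   have q0: "of_nat q ~= (0::complex)" using A(2) D(2) by (metis inverse_zero)
   have "rmult q (inverse z / of_nat q) = - rmult q z - 1"
    using n z q0 rmult_self by (simp add: rmult_divide rmult_inverse)
   then have "inverse z / of_nat q \<in> Zq q" using n z by (auto simp: Zq_iff)
   then obtain a b where ab: "inverse z / of_nat q = of_int a / of_int b" "\<not> int q dvd b" by (auto simp: Zq_def)
   then have "inverse z / of_nat q \<in> A" using unit D by (simp add: divide_inverse)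
   then have "z * (inverse z / of_nat q) \<in> A" using z D by blast
   moreover have "z * (inverse z / of_nat q) = inverse (of_nat q)" using n by (simp add: divide_inverse)
   ultimately show False using A(2) by simp
  qed
 next
  fix z assume "z \<in> Zq q"
  then obtain a b where "z = of_int a / of_int b" "\<not> int q dvd b" by (auto simp: Zq_def)
  then show "z \<in> A \<inter> \<rat>" using unit D by (simp add: divide_inverse)
 qed
qed

lemma Zq_val_ring_ex: "\<exists>A. val_ring A \<and> inverse (of_nat q) \<notin> A"
proof -
 have "of_nat q \<in> Zq q" using csubringD(8)[OF csubring_Zq] .
 moreover have "inverse (of_nat q) \<notin> Zq q" using rmult_inverse[of "of_nat q"] rmult_self q by (auto simp: Zq_iff)
 ultimately show ?thesis using val_ring_exists[OF csubring_Zq] by blast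
qed

end

lemma ring_of_integers_Rats: "ring_of_integers \<rat> = \<int>"
proof (intro equalityI subsetI)
 fix x :: complex assume "x \<in> \<int>"
 then obtain k where "x = of_int k" by (auto elim: Ints_cases)
 then show "x \<in> ring_of_integers \<rat>"
  using csubringD(9)[OF csubring_algebraic_int, of k] by (simp add: ring_of_integers_def)
qed (use rational_algebraic_int_is_int in \<open>auto simp: ring_of_integers_def\<close>)

lemma local_ring_Rats: "local_ring \<rat> (rat_place q) = Zq q"
proof -
 have "of_int b \<in> rat_place q \<longleftrightarrow> int q dvd b" for b
 proof
  assume "of_int b \<in> rat_place q"
  then obtain z where "(of_int b :: complex) = of_int (int q * z)" unfolding rat_place_def by blast
  then have "b = int q * z" by (simp only: of_int_eq_iff)
  then show "int q dvd b" by simp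
 next
  assume "int q dvd b"
  then show "of_int b \<in> rat_place q" unfolding rat_place_def by blast
 qed
 then have "{a / b | a b. a \<in> \<int> \<and> b \<in> \<int> - rat_place q} = {of_int a / of_int b | a b. \<not> int q dvd b}"
  by (auto elim!: Ints_cases) (metis Ints_of_int)
 then show ?thesis unfolding local_ring_def Zq_def ring_of_integers_Rats .
qed

lemma local_max_ideal_Rats: "local_max_ideal \<rat> (rat_place q) = {of_nat q * z | z. z \<in> Zq q}"
proof (intro equalityI subsetI)
 fix x assume "x \<in> local_max_ideal \<rat> (rat_place q)"
 then obtain a b where ab: "x = a / b" "a \<in> rat_place q" "b \<in> \<int> - rat_place q"
  by (auto simp: local_max_ideal_def ring_of_integers_Rats)
 then obtain z where z: "a = of_int (int q * z)" by (auto simp: rat_place_def)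
 have "of_int z / b \<in> local_ring \<rat> (rat_place q)"
  using ab(3) Ints_of_int[of z] unfolding local_ring_def ring_of_integers_Rats by blast
 moreover have "x = of_nat q * (of_int z / b)" using ab z by simp
 ultimately show "x \<in> {of_nat q * z | z. z \<in> Zq q}" unfolding local_ring_Rats by blast
next
 fix x assume "x \<in> {of_nat q * z | z. z \<in> Zq q}"
 then obtain a b where ab: "x = of_nat q * (a / b)" "a \<in> \<int>" "b \<in> \<int> - rat_place q"
  unfolding local_ring_Rats[symmetric] local_ring_def ring_of_integers_Rats by blast
 obtain k where "a = of_int k" using ab by (auto elim: Ints_cases)
 then have "x = of_int (int q * k) / b" "of_int (int q * k) \<in> rat_place q" using ab by (auto simp: rat_place_def)
 then show "x \<in> local_max_ideal \<rat> (rat_place q)"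
  using ab unfolding local_max_ideal_def ring_of_integers_Rats by blast
qed

text \<open>In z = s (t / b)^2 with s squarefree, a prime dividing s has odd valuation in z; hence s
  is 1 or p up to sign.\<close>

lemma even_valuations:
 fixes z :: complex
 assumes p: "prime p" and z: "z \<in> \<rat>" "z ~= 0"
  and ev: "\<And>q. prime q ==> q ~= p ==> even (rmult q z)"
 shows "\<exists>r\<in>\<rat>. r ~= 0 \<and> (z = r ^ 2 \<or> z = - (r ^ 2) \<or> z = of_nat p * r ^ 2 \<or> z = - (of_nat p * r ^ 2))"
proof -
 obtain a b where ab: "a ~= 0" "b ~= 0" "z = of_int a / of_int b" using z Rats_fraction by metis
 define s where "s = squarefree_part (a * b)"
 define t where "t = square_part (a * b)"
 have st: "a * b = s * t ^ 2" unfolding s_def t_def by (rule squarefree_decompose)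
 have s0: "s ~= 0" "t ~= 0" using st ab by auto
 have z': "z = of_int s * (of_int t / of_int b) ^ 2"
 proof -
  have "z = of_int (a * b) / of_int b ^ 2" using ab by (simp add: power2_eq_square)
  then show ?thesis unfolding st by (simp add: power_divide)
 qed
 have sq: "squarefree s" using ab by (simp add: s_def)
 have only_p: "q = p" if q: "prime q" "int q dvd s" for q
 proof (rule ccontr)
  assume "q ~= p"
  have "rmult q z = int (multiplicity (int q) s) + 2 * rmult q (of_int t / of_int b)"
   unfolding z' using s0 ab q(1) by (simp add: rmult_mult rmult_power rmult_int)
  moreover have "multiplicity (int q) s = 1"
  proof (rule antisym)
   show "multiplicity (int q) s \<le> 1"
    unfolding s_def using prime_multiplicity_squarefree_part_le_Suc_0[of "int q"] q(1) by simp
   show "1 \<le> multiplicity (int q) s" using q s0 by (simp add: Suc_leI prime_multiplicity_gt_zero_iff)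
  qed
  ultimately show False using ev[OF q(1) \<open>q ~= p\<close>] by simp
 qed
 have "\<bar>s\<bar> = 1 \<or> \<bar>s\<bar> = int p"
 proof (cases "\<bar>s\<bar> = 1")
  case False
  have "nat \<bar>s\<bar> ~= 1" using False by linarith
  then obtain q where q: "prime q" "q dvd nat \<bar>s\<bar>" using prime_factor_nat by blast
  then have "int q dvd s" by (metis dvd_abs_iff int_dvd_int_iff nat_0_le abs_ge_zero)
  then have "int p dvd s" using only_p q by blast
  then obtain c where c: "s = int p * c" by blast
  have "nat \<bar>c\<bar> = 1"
  proof (rule ccontr)
   assume "nat \<bar>c\<bar> ~= 1"
   then obtain q where q: "prime q" "q dvd nat \<bar>c\<bar>" using prime_factor_nat by blast
   then have qc: "int q dvd c" by (metis dvd_abs_iff int_dvd_int_iff nat_0_le abs_ge_zero)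
   then have "q = p" using only_p[OF q(1)] c by auto
   then have "int p ^ 2 dvd s" using qc c by (simp add: power2_eq_square)
   then have "is_unit (int p)" using sq unfolding squarefree_def by blast
   then show False using p by auto
  qed
  then have "\<bar>c\<bar> = 1" by linarith
  then show ?thesis using c by (simp add: abs_mult)
 qed simp
 then have "s = 1 \<or> s = - 1 \<or> s = int p \<or> s = - int p" by linarith
 then show ?thesis
  using z' s0 ab by (intro bexI[of _ "of_int t / of_int b"]) auto
qed

text \<open>The 2-division function, the derivative of the equation with respect to y. It is odd
  under negation, so a product over representatives of the pairs {P, -P} is determined up to sign,
  and on affine points it vanishes exactly where P = -P. Its value at Infinity is a mere
  default.\<close>

fun psi :: "complex weierstrass => complex point => complex"
 where "psi W Infinity = 0" | "psi W (Affine x y) = 2 * y + a1 W * x + a3 W"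

section \<open>Half products over symmetric sets of torsion points\<close>

lemma psi_neg: "psi W (ec_neg W P) = - psi W P"
 by (cases P) auto

lemma cv_psi:
 assumes u: "u ~= 0" and W': "W' = change_variables u r s t W"
 shows "psi W P = u ^ 3 * psi W' (cv u r s t P)"
proof (cases P)
 case (Affine x y)
 obtain x' y' where xy: "x = u ^ 2 * x' + r" "y = u ^ 3 * y' + s * u ^ 2 * x' + t" "cv u r s t P = Affine x' y'"
  using cv_inv[OF u] Affine by metis
 show ?thesis unfolding xy(3) unfolding Affine psi.simps xy(1,2)
  using cv_coeffs(1,3)[OF u W'] by Groebner_Basis.algebra
qed simp

definition half :: "complex weierstrass => complex point set => complex point set => bool"
 where "half W S H \<longleftrightarrow> H \<subseteq> S \<and> (\<forall>P\<in>S. ec_neg W P \<in> S \<and> (P \<in> H \<longleftrightarrow> ec_neg W P \<notin> H))"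

lemma halfD: "half W S H ==> P \<in> S ==> ec_neg W P \<in> S \<and> (P \<in> H \<longleftrightarrow> ec_neg W P \<notin> H)"
 unfolding half_def by blast

lemma half_ex:
 assumes "\<And>P. P \<in> S ==> ec_neg W P \<in> S \<and> ec_neg W P ~= P"
 shows "\<exists>H. half W S H"
proof
 \<comment> \<open>The choice is made from the unordered pair, so that P and its negative pick the
   same point.\<close>
 define pick where "pick P = (SOME Q. Q \<in> {P, ec_neg W P})" for P
 have pick: "pick P \<in> {P, ec_neg W P}" for P unfolding pick_def by (rule someI[of _ P]) simp
 have sym: "pick (ec_neg W P) = pick P" for P unfolding pick_def by (simp add: insert_commute)
 show "half W S {P \<in> S. pick P = P}"
  unfolding half_def
 proof (intro conjI ballI)
  fix P assume P: "P \<in> S"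
  then show "ec_neg W P \<in> S" using assms by blast
  show "(P \<in> {P \<in> S. pick P = P}) = (ec_neg W P \<notin> {P \<in> S. pick P = P})"
   using assms[OF P] P sym[of P] pick[of P] by auto
 qed blast
qed

lemma half_diff:
 assumes "half W S H" "half W S H'"
 shows "ec_neg W ` (H - H') = H' - H"
proof
 show "ec_neg W ` (H - H') \<subseteq> H' - H" using assms unfolding half_def by blast
 show "H' - H \<subseteq> ec_neg W ` (H - H')"
 proof
  fix P assume P: "P \<in> H' - H"
  then have "ec_neg W P \<in> H - H'" using assms unfolding half_def by (metis DiffD1 DiffD2 DiffI subsetD)
  then show "P \<in> ec_neg W ` (H - H')" by (intro image_eqI[of _ _ "ec_neg W P"]) auto
 qed
qed

lemma inj_ec_neg: "inj_on (ec_neg W) Z"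
 by (metis ec_neg_neg inj_onI)

lemma half_card:
 assumes "finite S" "half W S H"
 shows "card S = 2 * card H"
proof -
 have "half W S (S - H)" using assms(2) unfolding half_def by blast
 from half_diff[OF assms(2) this] have "ec_neg W ` H = S - H"
  using assms(2) by (simp add: half_def double_diff Diff_Diff_Int Int_absorb1 inf.absorb2)
 then have "card (S - H) = card H" using card_image[OF inj_ec_neg] by metis
 then show ?thesis
  using assms card_Diff_subset[of H S] card_mono[of S H] finite_subset[of H S] by (auto simp: half_def)
qed

text \<open>Used with c = -1 for \<open>psi\<close>, where the number of exchanged representatives
  gives the sign, and with c = 1 for functions of the abscissa, whose products do not depend on the
  representatives.\<close>

lemma half_prod:
 fixes g :: "complex point => complex"
 assumes S: "finite S" "half W S H" "half W S H'" and g: "\<And>P. P \<in> S ==> g (ec_neg W P) = c * g P"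
 shows "prod g H' = c ^ card (H - H') * prod g H"
proof -
 have fin: "finite H" "finite H'" using S finite_subset by (auto simp: half_def)
 have "prod g (H' - H) = (\<Prod>P\<in>H - H'. g (ec_neg W P))"
  unfolding half_diff[OF S(2,3), symmetric] by (subst prod.reindex[OF inj_ec_neg]) simp
 also have "\<dots> = (\<Prod>P\<in>H - H'. c * g P)" using g S(2) by (intro prod.cong) (auto simp: half_def)
 also have "\<dots> = c ^ card (H - H') * prod g (H - H')" by (simp add: prod.distrib)
 finally have e: "prod g (H' - H) = c ^ card (H - H') * prod g (H - H')" .
 have split: "prod g U = prod g (U - V) * prod g (U \<inter> V)" if "finite U" for U V
  using prod.union_disjoint[of "U - V" "U \<inter> V" g] that by (metis Diff_disjoint Int_Diff Int_commute Un_Diff_Int finite_Diff finite_Int inf_assoc inf_bot_right)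
 show ?thesis using e split[OF fin(1), of H'] split[OF fin(2), of H] by (simp add: Int_commute)
qed

locale odd_torsion_curve = torsion_basis_curve +
 assumes p5: "p \<ge> 5"
begin

lemma odd_p: "odd p"
 using p p5 prime_odd_nat[of p] by simp

abbreviation "neg \<equiv> ec_neg W"
abbreviation "nz \<equiv> tors p - {Infinity}"

lemma finite_tors: "finite (tors p)"
 using tors_finite_algebraic(1)[OF p_pos(1)] .

lemma inv_neg: "P \<in> ec W ==> inv\<^bsub>E\<^esub> P = neg P"
 by (rule inv_ec_group[OF disc_W])

lemma tors_ec: "P \<in> tors p ==> P \<in> ec W"
 by (simp add: tors_def)

lemma neg_pow: "P \<in> tors p ==> neg P = P [^]\<^bsub>E\<^esub> (-1::int)"
 using inv_neg[of P] tors_ec[of P] E.int_pow_neg[of P 1] by (simp add: E.int_pow_1)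

lemma neg_lin: "neg (lin u v) = lin (- u) (- v)"
 using neg_pow[OF lin_tors] lin_pow by simp

lemma neg_tors: "P \<in> tors p ==> neg P \<in> tors p"
 using neg_pow tors_int_pow by simp

lemma neg_nz: "P \<in> nz ==> neg P \<in> nz \<and> neg P ~= P"
proof -
 assume P: "P \<in> nz"
 then obtain u v where uv: "P = lin u v" using lin_surj by blast
 have "neg P ~= P"
 proof
  assume "neg P = P"
  then have d: "int p dvd u + u" "int p dvd v + v"
   unfolding uv neg_lin lin_eq_iff mod_eq_dvd_iff by (metis diff_minus_eq_add dvd_minus_iff minus_add_distrib uminus_add_conv_diff)+
  have "coprime (int p) 2" using odd_p by simp
  then have "int p dvd u" "int p dvd v" using d by (metis coprime_dvd_mult_right_iff mult_2)+
  then have "P = lin 0 0" unfolding uv lin_eq_iff by simp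
  then show False using P lin_0 by simp
 qed
 moreover have "neg P ~= Infinity" using P by (cases P) auto
 ultimately show ?thesis using P neg_tors by simp
qed

lemma psi_nz: "P \<in> nz ==> psi W P ~= 0"
proof
 assume P: "P \<in> nz" "psi W P = 0"
 then obtain x y where xy: "P = Affine x y" by (cases P) auto
 then have "- y - a1 W * x - a3 W = y" using P(2) by (simp add: algebra_simps add_eq_0_iff)
 then show False using neg_nz[OF P(1)] xy by simp
qed

lemma GG_neg: "\<sigma> \<in> carrier GG ==> P \<in> tors p ==> map_point \<sigma> (neg P) = neg (map_point \<sigma> P)"
 using GG_int_pow neg_pow GG_tors by simp

lemma psi_in_M: "P \<in> tors p ==> psi W P \<in> M"
proof -
 note D = csubringD[OF csubfieldD(1)[OF M(1)]] csubfieldD(4)[OF M(1)]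
 assume "P \<in> tors p"
 then have "P \<in> pts M" using M(2) by blast
 then show ?thesis using D coeffs by (cases P) auto
qed

lemma GG_psi: "\<sigma> \<in> carrier GG ==> P \<in> tors p ==> psi W (map_point \<sigma> P) = \<sigma> (psi W P)"
proof -
 assume s: "\<sigma> \<in> carrier GG" and "P \<in> tors p"
 then have "P \<in> pts M" using M(2) by blast
 note h = GG_hom[OF s]
 note D = csubringD[OF csubfieldD(1)[OF M(1)]] csubfieldD(4)[OF M(1)]
 note c = coeffs[THEN D(11)] and c' = coeffs[THEN fhomD(12)[OF h]] and H = fhomD(4,6,8)[OF h]
 have "\<sigma> 2 = 2" using fhomD(12)[OF h, of 2] by simp
 then show ?thesis using \<open>P \<in> pts M\<close> c c' D by (cases P) (simp_all add: H)
qed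

lemma GG_bij: "\<sigma> \<in> carrier GG ==> bij_betw (map_point \<sigma>) (tors p) (tors p)"
 using map_point_tors[OF GG_hom p_pos(1) M(2)] .

lemma GG_nz: "\<sigma> \<in> carrier GG ==> P \<in> nz ==> map_point \<sigma> P \<in> nz"
 using GG_tors[of \<sigma> P] by (cases P) auto

text \<open>The p-torsion field is Galois over the rationals since every embedding permutes the
  coordinates that generate it.\<close>

lemma fixed_rational:
 assumes z: "z \<in> M" "\<And>\<sigma>. \<sigma> \<in> carrier GG ==> \<sigma> z = z"
 shows "z \<in> \<rat>"
proof (rule ccontr)
 assume n: "z \<notin> \<rat>"
 have "coordinates (tors p) \<subseteq> AN"
  using tors_finite_algebraic(2)[OF p_pos(1)] by (auto simp: coordinates_def pts_def)
 moreover have "csubfield \<rat>" by (auto simp: csubfield_def csubring_def)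
 moreover have "s ` coordinates (tors p) = coordinates (tors p)" if "fhom AN s" for s
  using coordinates_stable[OF that, of "{p}"] p_pos by simp
 moreover have "\<rat> \<subseteq> M" using csubfieldD(4)[OF M(1)] by blast
 ultimately show False
  using Gal_moves[of "coordinates (tors p)" \<rat> z] z n unfolding M_def torsion_field_eq[OF p_pos(1)] by blast
qed

lemma GG_eq:
 assumes s: "\<sigma> \<in> carrier GG" "\<tau> \<in> carrier GG" and eq: "\<And>P. P \<in> tors p ==> map_point \<sigma> P = map_point \<tau> P"
 shows "\<sigma> = \<tau>"
proof -
 have "coordinates (tors p) \<subseteq> {x \<in> M. \<sigma> x = \<tau> x}"
 proof
  fix x assume "x \<in> coordinates (tors p)"
  then obtain P where P: "P \<in> tors p" "x \<in> set_point P" by (auto simp: coordinates_def)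
  then have "x \<in> M" using M(2) by (auto simp: pts_def)
  moreover have "\<sigma> x = \<tau> x" using eq[OF P(1)] P(2) by (cases P) auto
  ultimately show "x \<in> {x \<in> M. \<sigma> x = \<tau> x}" by blast
 qed
 then have "M \<subseteq> {x \<in> M. \<sigma> x = \<tau> x}"
  using generate_field_CC(3)[OF csubfield_equalizer[OF GG_hom[OF s(1)] GG_hom[OF s(2)]]]
  unfolding M_def torsion_field_eq[OF p_pos(1)] by blast
 moreover have "\<sigma> \<in> extensional M" "\<tau> \<in> extensional M" using s Gal_iff[OF M(1)] by auto
 ultimately show ?thesis by (intro extensionalityI[of _ M]) auto
qed

lemma finite_GG: "finite (carrier GG)"
proof -
 let ?r = "\<lambda>\<sigma>. restrict (map_point \<sigma>) (tors p)"
 have "?r ` carrier GG \<subseteq> tors p \<rightarrow>\<^sub>E tors p" using GG_tors by auto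
 then have "finite (?r ` carrier GG)" using finite_PiE[OF finite_tors, of "\<lambda>_. tors p"] finite_tors finite_subset by blast
 moreover have "inj_on ?r (carrier GG)"
  using GG_eq by (intro inj_onI) (metis restrict_apply')
 ultimately show ?thesis using finite_imageD by blast
qed

definition stable :: "complex point set => bool"
 where "stable Z \<longleftrightarrow> Z \<subseteq> nz \<and> (\<forall>P\<in>Z. neg P \<in> Z) \<and> (\<forall>\<sigma>\<in>carrier GG. \<forall>P\<in>Z. map_point \<sigma> P \<in> Z)"

lemma stable_half: "stable Z ==> \<exists>H. half W Z H"
 using neg_nz by (intro half_ex) (auto simp: stable_def)

lemma stable_nz: "stable nz"
 using neg_nz GG_nz by (auto simp: stable_def)

context
 fixes Z H
 assumes Z: "stable Z" and H: "half W Z H"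
begin

lemma Z_tors: "Z \<subseteq> tors p" "finite Z" "H \<subseteq> tors p" "finite H" "H \<subseteq> nz"
 using Z H finite_tors finite_subset[of _ "tors p"] by (auto simp: stable_def half_def)

lemma GG_half:
 assumes s: "\<sigma> \<in> carrier GG"
 shows "half W Z (map_point \<sigma> ` H)"
proof -
 have inj: "inj_on (map_point \<sigma>) Z" using GG_bij[OF s] Z_tors(1) inj_on_subset by (auto simp: bij_betw_def)
 have "map_point \<sigma> ` Z = Z"
  by (rule endo_inj_surj[OF Z_tors(2) _ inj]) (use Z s in \<open>auto simp: stable_def\<close>)
 moreover have "map_point \<sigma> P \<in> map_point \<sigma> ` H \<longleftrightarrow> P \<in> H" if "P \<in> Z" for P
  using inj_on_image_mem_iff[OF inj that] H by (auto simp: half_def)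
 ultimately show ?thesis
 proof -
  assume im: "map_point \<sigma> ` Z = Z" and mem: "\<And>P. P \<in> Z ==> map_point \<sigma> P \<in> map_point \<sigma> ` H \<longleftrightarrow> P \<in> H"
  have "map_point \<sigma> P \<in> map_point \<sigma> ` H \<longleftrightarrow> neg (map_point \<sigma> P) \<notin> map_point \<sigma> ` H" if P: "P \<in> Z" for P
  proof -
   have "neg P \<in> Z" "P \<in> H \<longleftrightarrow> neg P \<notin> H" using halfD[OF H P] by blast+
   moreover have "neg (map_point \<sigma> P) = map_point \<sigma> (neg P)" using GG_neg[OF s] P Z_tors(1) by auto
   ultimately show ?thesis using mem[OF P] mem[of "neg P"] by simp
  qed
  then have "\<forall>P\<in>map_point \<sigma> ` Z. P \<in> map_point \<sigma> ` H \<longleftrightarrow> neg P \<notin> map_point \<sigma> ` H" by (intro ballI) (elim imageE, simp only:)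
  moreover have "map_point \<sigma> ` H \<subseteq> Z" using H im by (auto simp: half_def)
  moreover have "\<forall>P\<in>Z. neg P \<in> Z" using Z by (auto simp: stable_def)
  ultimately have "map_point \<sigma> ` H \<subseteq> Z \<and> (\<forall>P\<in>map_point \<sigma> ` Z. neg P \<in> Z \<and> (P \<in> map_point \<sigma> ` H \<longleftrightarrow> neg P \<notin> map_point \<sigma> ` H))"
   using im by blast
  then show ?thesis unfolding half_def im .
 qed
qed

lemma GG_prod:
 assumes s: "\<sigma> \<in> carrier GG" and g: "\<And>P. P \<in> Z ==> g P \<in> M" "\<And>P. P \<in> Z ==> g (map_point \<sigma> P) = \<sigma> (g P)"
 shows "\<sigma> (prod g H) = prod g (map_point \<sigma> ` H)"
proof -
 have HZ: "H \<subseteq> Z" using H by (simp add: half_def)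
 have "\<sigma> (prod g H) = (\<Prod>P\<in>H. \<sigma> (g P))" using HZ g by (intro fhom_prod[OF GG_hom[OF s]]) auto
 also have "\<dots> = (\<Prod>P\<in>H. g (map_point \<sigma> P))" using HZ g(2) by (intro prod.cong) auto
 also have "\<dots> = prod g (map_point \<sigma> ` H)"
  using GG_bij[OF s] Z_tors(3) by (subst prod.reindex) (auto simp: bij_betw_def inj_on_subset)
 finally show ?thesis .
qed

lemma prod_in_M: "(\<And>P. P \<in> Z ==> g P \<in> M) ==> prod g H \<in> M"
 by (rule csubring_prod[OF csubfieldD(1)[OF M(1)]]) (use H in \<open>auto simp: half_def\<close>)

lemma even_prod_rational:
 assumes g: "\<And>P. P \<in> Z ==> g P \<in> M" "\<And>P. P \<in> Z ==> g (neg P) = g P"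
  "\<And>\<sigma> P. \<sigma> \<in> carrier GG ==> P \<in> Z ==> g (map_point \<sigma> P) = \<sigma> (g P)"
 shows "prod g H \<in> \<rat>"
proof (rule fixed_rational)
 fix \<sigma> assume s: "\<sigma> \<in> carrier GG"
 have "\<sigma> (prod g H) = prod g (map_point \<sigma> ` H)" using GG_prod[OF s, of g] g s by blast
 also have "\<dots> = prod g H" using half_prod[OF Z_tors(2) H GG_half[OF s], of g 1] g(2) by simp
 finally show "\<sigma> (prod g H) = prod g H" .
qed (use prod_in_M g(1) in blast)

abbreviation "psiprod \<equiv> \<Prod>P\<in>H. psi W P"

lemma psiprod: "psiprod \<in> M" "psiprod ~= 0"
 using prod_in_M[of "psi W"] psi_in_M Z_tors psi_nz by (auto simp: prod_zero_iff subset_iff)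

lemma GG_psiprod:
 assumes s: "\<sigma> \<in> carrier GG"
 shows "\<sigma> psiprod = (-1) ^ card (H - map_point \<sigma> ` H) * psiprod"
proof -
 have "\<sigma> psiprod = prod (psi W) (map_point \<sigma> ` H)"
  using GG_prod[OF s, of "psi W"] psi_in_M GG_psi[OF s] Z_tors(1) by auto
 then show ?thesis using half_prod[OF Z_tors(2) H GG_half[OF s], of "psi W" "-1"] psi_neg by simp
qed

lemma psiprod_sign: "\<sigma> \<in> carrier GG ==> \<sigma> psiprod = psiprod \<or> \<sigma> psiprod = - psiprod"
 using GG_psiprod[of \<sigma>] by (cases "even (card (H - map_point \<sigma> ` H))") auto

lemma psiprod_square: "psiprod ^ 2 \<in> \<rat>"
proof (rule fixed_rational)
 show "psiprod ^ 2 \<in> M" using psiprod(1) csubringD(7)[OF csubfieldD(1)[OF M(1)]] by blast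
 fix \<sigma> assume s: "\<sigma> \<in> carrier GG"
 show "\<sigma> (psiprod ^ 2) = psiprod ^ 2"
  using psiprod_sign[OF s] fhomD(11)[OF GG_hom[OF s] psiprod(1), of 2] by auto
qed

end

lemma psiprod_half:
 assumes Z: "stable Z" and H: "half W Z H" "half W Z H'"
 shows "psiprod H' = psiprod H \<or> psiprod H' = - psiprod H"
 using half_prod[OF Z_tors(2)[OF Z H(1)] H, of "psi W" "-1"] psi_neg
 by (cases "even (card (H - H'))") auto

definition minus_part :: "(complex => complex) => complex point set"
 where "minus_part \<tau> = {P \<in> tors p. map_point \<tau> P = neg P}"

text \<open>The sign does not depend on the representatives, so they are adapted to \<tau>. Off the
  minus part they are chosen through P + \<tau> P, which is fixed by \<tau>, and none is exchanged;
  on the minus part \<tau> is negation and exchanges all of them.\<close>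

lemma involution_sign:
 assumes Z: "stable Z" and H: "half W Z H" and t: "\<tau> \<in> carrier GG"
  and inv: "\<And>P. P \<in> tors p ==> map_point \<tau> (map_point \<tau> P) = P"
 shows "\<tau> (psiprod H) = (-1) ^ (card (Z \<inter> minus_part \<tau>) div 2) * psiprod H"
proof -
 obtain K where K: "half W nz K" using stable_half[OF stable_nz] by blast
 define t' where "t' = map_point \<tau>"
 have t': "t' P \<in> tors p" "t' (t' P) = P" "t' (neg P) = neg (t' P)" if "P \<in> tors p" for P
  using GG_tors[OF t that] inv[OF that] GG_neg[OF t that] by (simp_all add: t'_def)
 have Zs: "Z \<subseteq> nz" "\<And>P. P \<in> Z ==> neg P \<in> Z" "\<And>P. P \<in> Z ==> t' P \<in> Z" using Z t by (auto simp: stable_def t'_def)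
 define Q where "Q P = P \<otimes>\<^bsub>E\<^esub> t' P" for P
 have Q: "Q P \<in> tors p" "Q (t' P) = Q P" "Q (neg P) = neg (Q P)" if P: "P \<in> tors p" for P
 proof -
  show "Q P \<in> tors p" using tors_add t' P by (simp add: Q_def)
  show "Q (t' P) = Q P" using t'(1,2)[OF P] tors_ec P E.m_comm[of P "t' P"] by (simp add: Q_def)
  show "Q (neg P) = neg (Q P)"
   using t'(1,3)[OF P] tors_ec P E.inv_mult[of P "t' P"] inv_neg E.m_closed[of P "t' P"] by (simp add: Q_def)
 qed
 have Q0: "Q P = Infinity \<longleftrightarrow> P \<in> minus_part \<tau>" if P: "P \<in> tors p" for P
 proof -
  have c: "P \<in> carrier E" "t' P \<in> carrier E" using P t'(1) tors_ec by auto
  have "Q P = Infinity \<longleftrightarrow> t' P = neg P"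
  proof
   assume "Q P = Infinity"
   then have "t' P \<otimes>\<^bsub>E\<^esub> P = \<one>\<^bsub>E\<^esub>" using E.m_comm[OF c] by (simp add: Q_def)
   then show "t' P = neg P" using E.inv_equality[OF _ c] inv_neg[of P] c by simp
  qed (simp add: Q_def)
  then show ?thesis using P by (simp add: minus_part_def t'_def)
 qed
 \<comment> \<open>Off the minus part Q P is nonzero, so the half system K of all nonzero points
   decides between P and its negative; it decides alike for P and its image, as Q takes the same
   value there.\<close>
 define H' where "H' = {P \<in> Z. P \<in> minus_part \<tau> \<and> P \<in> K \<or> P \<notin> minus_part \<tau> \<and> Q P \<in> K}"
 have mp: "neg P \<in> minus_part \<tau> \<longleftrightarrow> P \<in> minus_part \<tau>" if P: "P \<in> tors p" for P
  using Q0[OF P] Q0[OF neg_tors[OF P]] Q(3)[OF P] by (cases "Q P") auto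
 have H': "half W Z H'"
  unfolding half_def
 proof (intro conjI ballI)
  fix P assume P: "P \<in> Z"
  then have Pn: "P \<in> nz" "P \<in> tors p" using Zs by auto
  show "neg P \<in> Z" using Zs P by blast
  show "(P \<in> H') = (neg P \<notin> H')"
  proof (cases "P \<in> minus_part \<tau>")
   case True
   moreover have "P \<in> K \<longleftrightarrow> neg P \<notin> K" using halfD[OF K Pn(1)] by blast
   ultimately show ?thesis using P Zs(2)[OF P] mp[OF Pn(2)] unfolding H'_def mem_Collect_eq by blast
  next
   case False
   then have "Q P \<in> nz" using Q(1) Q0 Pn by simp
   then have "Q P \<in> K \<longleftrightarrow> neg (Q P) \<notin> K" using halfD[OF K] by blast
   then show ?thesis using False P Zs(2)[OF P] mp[OF Pn(2)] unfolding H'_def mem_Collect_eq Q(3)[OF Pn(2)] by blast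
  qed
 qed (auto simp: H'_def)
 have mt: "t' P = neg P" if "P \<in> minus_part \<tau>" for P using that by (simp add: minus_part_def t'_def)
 have img: "H' - t' ` H' = H' \<inter> minus_part \<tau>"
 proof (intro equalityI subsetI)
  fix P assume P: "P \<in> H' - t' ` H'"
  then have PZ: "P \<in> Z" "P \<in> tors p" using H' Zs by (auto simp: half_def)
  have "P \<in> minus_part \<tau>"
  proof (rule ccontr)
   assume n: "P \<notin> minus_part \<tau>"
   then have "t' P \<notin> minus_part \<tau>" using Q0 Q(2) t'(1) PZ by metis
   then have "t' P \<in> H'" using P n Zs(3)[OF PZ(1)] Q(2)[OF PZ(2)] by (auto simp: H'_def)
   then show False using P t'(2)[OF PZ(2)] by (metis DiffD2 imageI)
  qed
  then show "P \<in> H' \<inter> minus_part \<tau>" using P by blast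
 next
  fix P assume P: "P \<in> H' \<inter> minus_part \<tau>"
  then have PZ: "P \<in> Z" "P \<in> tors p" using H' Zs by (auto simp: half_def)
  have "P \<notin> t' ` H'"
  proof
   assume "P \<in> t' ` H'"
   then obtain R where R: "R \<in> H'" "P = t' R" by blast
   then have "R \<in> Z" "R \<in> tors p" using H' Zs by (auto simp: half_def)
   then have "R = neg P" using t'(2) mt P R by (metis IntD2)
   then show False using R(1) P halfD[OF H' PZ(1)] by simp
  qed
  then show "P \<in> H' - t' ` H'" using P by blast
 qed
 have "half W (Z \<inter> minus_part \<tau>) (H' \<inter> minus_part \<tau>)"
  using H' mp Zs unfolding half_def by blast
 then have "card (Z \<inter> minus_part \<tau>) = 2 * card (H' \<inter> minus_part \<tau>)"
  using half_card Z_tors(2)[OF Z H] by blast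
 then have "\<tau> (psiprod H') = (-1) ^ (card (Z \<inter> minus_part \<tau>) div 2) * psiprod H'"
  using GG_psiprod[OF Z H' t] img by (simp add: t'_def)
 then show ?thesis
  using psiprod_half[OF Z H H'] fhomD(7)[OF GG_hom[OF t] psiprod(1)[OF Z H]] by auto
qed

end

section \<open>Irrationality of the product over all nonzero p-torsion\<close>

lemma cubic_roots:
 fixes A B :: complex
 obtains e1 e2 e3 where "e1 + e2 + e3 = 0" "e1 * e2 + e1 * e3 + e2 * e3 = A" "e1 * e2 * e3 = - B"
proof -
 have "\<not> constant (poly [:B, A, 0, 1:])"
 proof
  assume "constant (poly [:B, A, 0, 1:])"
  then have "poly [:B, A, 0, 1:] 0 = poly [:B, A, 0, 1:] 1" "poly [:B, A, 0, 1:] 1 = poly [:B, A, 0, 1:] 2" unfolding constant_def by blast+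
  then have "(1 :: complex) + A = 0" "8 + 2 * A = 0" by (simp_all add: algebra_simps)
  then have "(6 :: complex) = 0" by Groebner_Basis.algebra
  then show False by simp
 qed
 then obtain e where "poly [:B, A, 0, 1:] e = 0" using fundamental_theorem_of_algebra by blast
 then have e: "e ^ 3 + A * e + B = 0" by (simp add: algebra_simps power3_eq_cube)
 define w where "w = csqrt (e ^ 2 - 4 * (e ^ 2 + A))"
 have w: "w ^ 2 = e ^ 2 - 4 * (e ^ 2 + A)" by (simp add: w_def)
 have h: "2 * ((w - e) / 2) = w - e" "2 * ((- w - e) / 2) = - w - e" by simp_all
 show thesis
 proof (rule that[of e "(w - e) / 2" "(- w - e) / 2"])
  have "4 * (e * ((w - e) / 2) + e * ((- w - e) / 2) + ((w - e) / 2) * ((- w - e) / 2)) = 4 * A"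
   using w h by Groebner_Basis.algebra
  then show "e * ((w - e) / 2) + e * ((- w - e) / 2) + ((w - e) / 2) * ((- w - e) / 2) = A"
   by (subst (asm) mult_cancel_left) simp
  have "4 * (e * ((w - e) / 2) * ((- w - e) / 2)) = 4 * - B"
   using w h e by Groebner_Basis.algebra
  then show "e * ((w - e) / 2) * ((- w - e) / 2) = - B" by (subst (asm) mult_cancel_left) simp
 qed (simp add: field_simps)
qed

lemma rat_square_ne_minus1: "r \<in> \<rat> ==> r ^ 2 ~= (- 1 :: complex)"
proof
 assume r: "r \<in> \<rat>" "r ^ 2 = - 1"
 then have "r ~= 0" by auto
 then obtain a b where ab: "a ~= 0" "b ~= 0" "r = of_int a / of_int b" using Rats_fraction r(1) by metis
 then have "(of_int a ^ 2 :: complex) = - (of_int b ^ 2)" using r(2) by (simp add: power_divide divide_eq_eq)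
 then have "of_int (a ^ 2) = (of_int (- (b ^ 2)) :: complex)" by simp
 then have "a ^ 2 = - (b ^ 2)" by (simp only: of_int_eq_iff)
 then show False using ab zero_less_power2[of a] zero_less_power2[of b] by linarith
qed

text \<open>For rational a and b with b nonzero the factor a^2 + b^2 of a^4 - b^4 does not vanish,
  so one of the two linear factors does.\<close>

lemma rat_fourth_powers:
 fixes a b :: complex
 assumes "a \<in> \<rat>" "b \<in> \<rat>" "b ~= 0" "a ^ 4 = b ^ 4"
 shows "a = b \<or> a = - b"
proof -
 have "(a - b) * (a + b) * (a ^ 2 + b ^ 2) = 0" using assms(4) by Groebner_Basis.algebra
 moreover have "a ^ 2 + b ^ 2 ~= 0"
 proof
  assume "a ^ 2 + b ^ 2 = 0"
  then have "(a / b) ^ 2 = - 1" using assms(3) by (simp add: power_divide field_simps eq_neg_iff_add_eq_0)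
  then show False using rat_square_ne_minus1[of "a / b"] assms by simp
 qed
 ultimately show ?thesis by (auto simp: eq_neg_iff_add_eq_0)
qed

lemma odd_square_8: "odd n ==> \<exists>k. n ^ 2 - 1 = 8 * k" for n :: nat
proof -
 assume "odd n"
 then obtain m where m: "n = 2 * m + 1" by (auto elim: oddE)
 have "even (m * (m + 1))" by simp
 then obtain k where "m * (m + 1) = 2 * k" by (rule evenE)
 then have "n ^ 2 = 8 * k + 1" unfolding m by (simp add: power2_eq_square algebra_simps)
 then show ?thesis by auto
qed

context odd_torsion_curve
begin

lemma Infinity_tors: "Infinity \<in> tors p"
 using lin_tors[of 0 0] lin_0 by simp

text \<open>Multiplying the identity of \<open>torsion_product\<close> over the three roots of the
  cubic gives \<delta>^(2 c) = (p^3 F)^4, with c = (p^2 - 1) / 2 and F the product of the cubic over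
  the torsion abscissas; the square of the half product is 4^c F. As 8 divides 2 c, fourth roots can
  be taken among rationals, p^3 F is a rational square up to sign, and a rational half product would
  make p or -p a rational square.\<close>

lemma psiprod_nz_irrational:
 assumes H: "half W nz H"
 shows "psiprod H \<notin> \<rat>"
proof
 assume Y: "psiprod H \<in> \<rat>"
 obtain A B where AB: "change_variables 1 (- b2 W / 12) (- a1 W / 2) (- (a3 W + (- b2 W / 12) * a1 W) / 2) W = short A B"
  and "short_curve A B" using short_form[OF disc_W] by blast
 define r s t where "r = - b2 W / 12" and "s = - a1 W / 2" and "t = - (a3 W + (- b2 W / 12) * a1 W) / 2"
 have cv: "short A B = change_variables 1 r s t W" unfolding r_def s_def t_def AB ..
 have rat: "r \<in> \<rat>" "s \<in> \<rat>" "t \<in> \<rat>"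
  unfolding r_def s_def t_def b2_def using coeffs by (auto intro!: Rats_divide Rats_minus_iff[THEN iffD2] Rats_add Rats_mult Rats_power Rats_diff)
 have "A = a4 (change_variables 1 r s t W)" "B = a6 (change_variables 1 r s t W)" unfolding cv[symmetric] by simp_all
 then have AB_rat: "A \<in> \<rat>" "B \<in> \<rat>"
  using coeffs rat by (auto simp: change_variables_def intro!: Rats_add Rats_mult Rats_power Rats_diff)
 interpret S: short_curve A B by fact
 let ?c = "cv 1 r s t"
 have pow: "?c P [^]\<^bsub>S.G\<^esub> k = ?c (P [^]\<^bsub>E\<^esub> k)" if "P \<in> ec W" for P and k :: nat
  by (induction k) (use cv_ec_add[OF one_neq_zero cv, of _ P] that E.nat_pow_closed[of P] in auto)
 define Z where "Z = {x. \<exists>y. Affine x y \<in> ec (short A B) \<and> Affine x y [^]\<^bsub>S.G\<^esub> p = Infinity}"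
 define xc where "xc P = (case P of Affine x y => x - r | Infinity => 0)" for P
 have Hn: "H \<subseteq> nz" using H by (simp add: half_def)
 have pt: "\<exists>x y. P = Affine x y \<and> on_ec W x y \<and> xc P = x - r \<and>
   Affine (x - r) (y - s * (x - r) - t) \<in> ec (short A B) \<and> Affine (x - r) (y - s * (x - r) - t) [^]\<^bsub>S.G\<^esub> p = Infinity"
  if "P \<in> nz" for P
 proof -
  obtain x y where xy: "P = Affine x y" using \<open>P \<in> nz\<close> by (cases P) auto
  have "?c P \<in> ec (short A B)" "?c P [^]\<^bsub>S.G\<^esub> p = Infinity"
   using cv_ec[OF one_neq_zero cv, of P] pow[of P] \<open>P \<in> nz\<close> by (auto simp: tors_def)
  then show ?thesis using \<open>P \<in> nz\<close> xy by (simp add: xc_def tors_def)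
 qed
 have xc_eq: "Q = P \<or> Q = neg P" if "P \<in> nz" "Q \<in> nz" "xc P = xc Q" for P Q
 proof -
  obtain x y x' y' where "P = Affine x y" "on_ec W x y" "xc P = x - r" "Q = Affine x' y'" "on_ec W x' y'" "xc Q = x' - r"
   using pt[OF \<open>P \<in> nz\<close>] pt[OF \<open>Q \<in> nz\<close>] by auto
  then show ?thesis using \<open>xc P = xc Q\<close> on_ec_same_x[of W x y y'] by (auto simp: algebra_simps eq_neg_iff_add_eq_0)
 qed
 have inj: "inj_on xc H"
 proof (rule inj_onI)
  fix P Q assume PQ: "P \<in> H" "Q \<in> H" "xc P = xc Q"
  then have "Q = P \<or> Q = neg P" using xc_eq Hn by blast
  then show "P = Q" using halfD[OF H, of P] PQ Hn by blast
 qed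
 have img: "xc ` H = Z"
 proof (intro equalityI subsetI)
  fix z assume "z \<in> xc ` H"
  then obtain P where "P \<in> nz" "z = xc P" using Hn by blast
  then show "z \<in> Z" using pt[of P] by (auto simp: Z_def)
 next
  fix z assume "z \<in> Z"
  then obtain y where y: "Affine z y \<in> ec (short A B)" "Affine z y [^]\<^bsub>S.G\<^esub> p = Infinity" by (auto simp: Z_def)
  define P where "P = Affine (z + r) (y + s * z + t)"
  have cP: "?c P = Affine z y" by (simp add: P_def)
  have P: "P \<in> ec W" using y(1) cv_ec[OF one_neq_zero cv, of P] cP by simp
  have "?c (P [^]\<^bsub>E\<^esub> p) = ?c Infinity" using pow[OF P, of p] cP y(2) by simp
  then have "P [^]\<^bsub>E\<^esub> p = Infinity" using injD[OF cv_inj[OF one_neq_zero]] by metis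
  then have "P \<in> nz" using P by (simp add: tors_def P_def)
  then have "P \<in> H \<or> neg P \<in> H" using halfD[OF H] by blast
  moreover have "xc P = z" "xc (neg P) = z" by (simp_all add: xc_def P_def)
  ultimately show "z \<in> xc ` H" by (metis imageI)
 qed
 have prod: "\<And>e. S.f e = 0 ==> (3 * e ^ 2 + A) ^ (2 * card Z) = of_nat p ^ 4 * (\<Prod>x\<in>Z. (e - x) ^ 4)"
  using S.torsion_product[OF AB_rat odd_p] unfolding Z_def by auto
 obtain e1 e2 e3 where e: "e1 + e2 + e3 = 0" "e1 * e2 + e1 * e3 + e2 * e3 = A" "e1 * e2 * e3 = - B"
  using cubic_roots by blast
 have f: "S.f x = (x - e1) * (x - e2) * (x - e3)" for x
  using e by Groebner_Basis.algebra
 define \<delta> where "\<delta> = 4 * A ^ 3 + 27 * B ^ 2"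
 have \<delta>: "\<delta> ~= 0" "\<delta> \<in> \<rat>"
  using S.nonsing AB_rat by (auto simp: \<delta>_def intro!: Rats_add Rats_mult Rats_power)
 \<comment> \<open>The derivatives of the cubic at its three roots multiply to minus the
   discriminant of the cubic.\<close>
 have disc: "(3 * e1 ^ 2 + A) * (3 * e2 ^ 2 + A) * (3 * e3 ^ 2 + A) = \<delta>"
  unfolding \<delta>_def using e by Groebner_Basis.algebra
 define c where "c = card Z"
 define F where "F = (\<Prod>x\<in>Z. S.f x)"
 have "\<delta> ^ (2 * c) = (of_nat p ^ 3) ^ 4 * (\<Prod>x\<in>Z. ((e1 - x) * (e2 - x) * (e3 - x)) ^ 4)"
 proof -
  have "\<delta> ^ (2 * c) = of_nat p ^ 4 * of_nat p ^ 4 * of_nat p ^ 4 * ((\<Prod>x\<in>Z. (e1 - x) ^ 4) * (\<Prod>x\<in>Z. (e2 - x) ^ 4) * (\<Prod>x\<in>Z. (e3 - x) ^ 4))"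
   unfolding disc[symmetric] power_mult_distrib c_def
   using prod[of e1] prod[of e2] prod[of e3] f by (simp add: mult_ac)
  then show ?thesis by (simp add: prod.distrib power_mult_distrib flip: power_mult power_add)
 qed
 also have "(\<Prod>x\<in>Z. ((e1 - x) * (e2 - x) * (e3 - x)) ^ 4) = F ^ 4"
 proof -
  have "((e1 - x) * (e2 - x) * (e3 - x)) ^ 4 = S.f x ^ 4" for x
   unfolding f by Groebner_Basis.algebra
  then show ?thesis by (simp add: F_def prod_power_distrib)
 qed
 finally have d4: "\<delta> ^ (2 * c) = (of_nat p ^ 3 * F) ^ 4" by (simp add: power_mult_distrib)
 have YF: "psiprod H ^ 2 = 4 ^ c * F"
 proof -
  have "psi W P ^ 2 = 4 * S.f (xc P)" if P: "P \<in> H" for P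
  proof -
   obtain x y where xy: "P = Affine x y" "xc P = x - r" "Affine (x - r) (y - s * (x - r) - t) \<in> ec (short A B)"
    using pt[of P] Hn P by blast
   have "psi W P = 2 * (y - s * (x - r) - t)" using cv_psi[OF one_neq_zero cv, of P] xy(1) by simp
   moreover have "(y - s * (x - r) - t) ^ 2 = S.f (x - r)" using xy(3) by (simp add: on_short)
   ultimately show ?thesis unfolding xy(2) by Groebner_Basis.algebra
  qed
  then have "psiprod H ^ 2 = (\<Prod>P\<in>H. 4 * S.f (xc P))" by (simp add: prod_power_distrib)
  also have "\<dots> = (\<Prod>x\<in>Z. 4 * S.f x)" unfolding img[symmetric] by (simp add: prod.reindex[OF inj])
  also have "\<dots> = (\<Prod>x\<in>Z. 4) * F" unfolding F_def by (rule prod.distrib)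
  finally show ?thesis by (simp add: c_def)
 qed
 have "card (tors p - {Infinity}) = p ^ 2 - 1"
  using card_tors finite_tors Infinity_tors by simp
 moreover have "card H = c" unfolding c_def img[symmetric] using card_image[OF inj] by simp
 ultimately have "2 * c = p ^ 2 - 1" using half_card[of nz W H] H finite_tors by simp
 then obtain k where k: "2 * c = 8 * k" using odd_square_8[OF odd_p] by metis
 have p0: "of_nat p ~= (0::complex)" using p_pos by simp
 define y where "y = psiprod H / 2 ^ c"
 have y: "y \<in> \<rat>" "y ^ 2 = F"
 proof -
  have "((2::complex) ^ c) ^ 2 = 4 ^ c" using power_mult[of "2::complex" c 2] power_mult[of "2::complex" 2 c] by (simp add: mult.commute)
  then show "y ^ 2 = F" using YF by (simp add: y_def power_divide)
 qed (use Y in \<open>simp add: y_def\<close>)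
 have "(of_nat p ^ 3 * F) ^ 4 = (\<delta> ^ (2 * k)) ^ 4" using d4 k by (simp flip: power_mult)
 then have "of_nat p ^ 3 * F = \<delta> ^ (2 * k) \<or> of_nat p ^ 3 * F = - (\<delta> ^ (2 * k))"
  by (intro rat_fourth_powers) (use y \<delta> in auto)
 then have pm: "of_nat p * (of_nat p * y) ^ 2 = (\<delta> ^ k) ^ 2 \<or> of_nat p * (of_nat p * y) ^ 2 = - ((\<delta> ^ k) ^ 2)"
  unfolding y(2)[symmetric] by (simp add: power_mult_distrib power2_eq_square power3_eq_cube mult_ac flip: power_mult power_add mult_2)
 have "y ~= 0"
 proof
  assume "y = 0"
  then have "\<delta> ^ k = 0" using pm by auto
  then show False using \<delta> by simp
 qed
 define z where "z = \<delta> ^ k / (of_nat p * y)"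
 have "z ^ 2 = of_nat p \<or> z ^ 2 = - of_nat p"
 proof -
  have q0: "(of_nat p * y) ^ 2 ~= 0" using p0 \<open>y ~= 0\<close> by simp
  have "z ^ 2 = (\<delta> ^ k) ^ 2 / (of_nat p * y) ^ 2" by (simp only: z_def power_divide)
  moreover have "(\<delta> ^ k) ^ 2 = of_nat p * (of_nat p * y) ^ 2 \<or> (\<delta> ^ k) ^ 2 = - of_nat p * (of_nat p * y) ^ 2"
   using pm by (metis minus_equation_iff mult_minus_left)
  ultimately show ?thesis using nonzero_mult_div_cancel_right[OF q0] by metis
 qed
 moreover have "z \<in> \<rat>" using y \<delta> by (simp add: z_def)
 ultimately show False using rat_square_not_prime[OF p] by blast
qed

lemma GG_comp: "\<sigma> \<in> carrier GG ==> \<tau> \<in> carrier GG ==> x \<in> M ==> (\<sigma> \<otimes>\<^bsub>GG\<^esub> \<tau>) x = \<sigma> (\<tau> x)"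
 by (simp add: Gal_mult compose_eq)

lemma GG_map_comp:
 assumes "\<sigma> \<in> carrier GG" "\<tau> \<in> carrier GG" "P \<in> tors p"
 shows "map_point (\<sigma> \<otimes>\<^bsub>GG\<^esub> \<tau>) P = map_point \<sigma> (map_point \<tau> P)"
proof -
 have "P \<in> pts M" using assms M(2) by blast
 then show ?thesis using GG_comp[OF assms(1,2)] by (cases P) (auto simp del: Gal_mult)
qed

lemma GG_one_map: "P \<in> tors p ==> map_point \<one>\<^bsub>GG\<^esub> P = P"
 using M(2) by (cases P) (auto simp: Gal_one)

lemma involution_map: "\<tau> \<in> carrier GG ==> \<tau> \<otimes>\<^bsub>GG\<^esub> \<tau> = \<one>\<^bsub>GG\<^esub> ==> P \<in> tors p ==> map_point \<tau> (map_point \<tau> P) = P"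
 using GG_map_comp[of \<tau> \<tau> P] GG_one_map by simp

definition closed :: "complex point set => bool"
 where "closed Z \<longleftrightarrow> Z \<subseteq> tors p \<and> Infinity \<in> Z \<and> (\<forall>P\<in>Z. neg P \<in> Z) \<and> (\<forall>P\<in>Z. \<forall>Q\<in>Z. P \<otimes>\<^bsub>E\<^esub> Q \<in> Z)"

lemma closed_card:
 assumes "closed Z" shows "card Z = 1 \<or> card Z = p \<or> card Z = p ^ 2"
proof -
 have sub: "subgroup Z E" if "closed Z" for Z
  by (rule E.subgroupI) (use that tors_ec inv_neg in \<open>auto simp: closed_def\<close>)
 have t: "closed (tors p)" using neg_tors tors_add Infinity_tors by (auto simp: closed_def)
 define TG where "TG = E\<lparr>carrier := tors p\<rparr>"
 interpret TG: group TG unfolding TG_def by (rule E.subgroup_imp_group[OF sub[OF t]])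
 have "subgroup Z TG"
  unfolding TG_def by (rule E.subgroup_incl[OF sub[OF assms] sub[OF t]]) (use assms in \<open>auto simp: closed_def\<close>)
 from TG.lagrange[OF this] have "card Z dvd p ^ 2" using card_tors by (simp add: order_def TG_def) (metis dvd_triv_right)
 then obtain i where i: "i \<le> 2" "card Z = p ^ i" using divides_primepow_nat[OF p] by blast
 then have "i = 0 \<or> i = 1 \<or> i = 2" by linarith
 then show ?thesis using i by auto
qed

lemma closed_minus_part:
 assumes t: "\<tau> \<in> carrier GG" shows "closed (minus_part \<tau>)"
 unfolding closed_def
proof (intro conjI ballI)
 show "minus_part \<tau> \<subseteq> tors p" "Infinity \<in> minus_part \<tau>" using Infinity_tors by (auto simp: minus_part_def)
 fix P assume P: "P \<in> minus_part \<tau>"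
 then have P': "P \<in> tors p" "map_point \<tau> P = neg P" by (auto simp: minus_part_def)
 then show "neg P \<in> minus_part \<tau>" using neg_tors GG_neg[OF t] by (simp add: minus_part_def)
 fix Q assume Q: "Q \<in> minus_part \<tau>"
 then have Q': "Q \<in> tors p" "map_point \<tau> Q = neg Q" by (auto simp: minus_part_def)
 have "neg (P \<otimes>\<^bsub>E\<^esub> Q) = neg P \<otimes>\<^bsub>E\<^esub> neg Q"
  using E.inv_mult[of P Q] inv_neg tors_ec P' Q' E.m_closed[of P Q] by simp
 then show "P \<otimes>\<^bsub>E\<^esub> Q \<in> minus_part \<tau>"
  using P' Q' GG_add[OF t] tors_add by (simp add: minus_part_def)
qed

lemma closed_Int: "closed Z ==> closed Z' ==> closed (Z \<inter> Z')"
 unfolding closed_def by blast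

end

text \<open>Stands in for an argument with a subgroup of index two: translation by one element
  outside exchanges the two halves.\<close>

lemma double_card:
 assumes A: "finite A" and g: "inj_on g A" "\<And>x. x \<in> A ==> g x \<in> A" "\<And>x. x \<in> A ==> P (g x) \<longleftrightarrow> \<not> P x"
 shows "card A = 2 * card {x \<in> A. P x}"
proof -
 have "card {x \<in> A. P x} \<le> card {x \<in> A. \<not> P x}" "card {x \<in> A. \<not> P x} \<le> card {x \<in> A. P x}"
  using A g by (auto intro!: card_inj_on_le[of g] intro: inj_on_subset)
 moreover have "card A = card {x \<in> A. P x} + card {x \<in> A. \<not> P x}"
  using A by (subst card_Un_disjoint[symmetric]) (auto intro: arg_cong[of _ _ card])
 ultimately show ?thesis by simp
qed

lemma sign_parity:
 fixes y :: complex
 assumes "y ~= 0"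
 shows "y = (-1) ^ n * y ==> even n" "- y = (-1) ^ n * y ==> odd n"
 using assms by (cases "even n"; simp)+

section \<open>The Galois group in the presence of a stable line\<close>

locale borel_curve = odd_torsion_curve +
 fixes U
 assumes U: "U \<in> tors p" "U ~= Infinity"
  and stab: "\<And>\<sigma>. \<sigma> \<in> carrier GG ==> \<exists>k::int. map_point \<sigma> U = U [^]\<^bsub>E\<^esub> k"
begin

definition C :: "complex point set" where "C = {U [^]\<^bsub>E\<^esub> (k::int) | k. True}"

lemma U_C: "U [^]\<^bsub>E\<^esub> (k::int) \<in> C" "U \<in> C"
 using E.int_pow_1[of U] tors_ec[OF U(1)] by (auto simp: C_def intro: exI[of _ 1])

lemma closed_C: "closed C"
proof -
 have c: "U \<in> carrier E" using tors_ec[OF U(1)] by simp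
 have "neg (U [^]\<^bsub>E\<^esub> k) = U [^]\<^bsub>E\<^esub> (- k)" "U [^]\<^bsub>E\<^esub> k \<otimes>\<^bsub>E\<^esub> U [^]\<^bsub>E\<^esub> l = U [^]\<^bsub>E\<^esub> (k + l)" for k l :: int
  using E.int_pow_neg[OF c] inv_neg E.int_pow_closed[OF c] E.int_pow_mult[OF c] by auto
 moreover have "Infinity = U [^]\<^bsub>E\<^esub> (0::int)" by simp
 ultimately show ?thesis unfolding closed_def C_def using tors_int_pow[OF U(1)]
  by (safe, blast, metis, metis, metis)
qed

lemma C_tors: "C \<subseteq> tors p" "Infinity \<in> C" "finite C"
 using closed_C finite_tors finite_subset by (auto simp: closed_def)

lemma card_C: "card C = p"
proof -
 have "C \<subseteq> (\<lambda>k. U [^]\<^bsub>E\<^esub> k) ` {0..<int p}"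
 proof
  fix P assume "P \<in> C"
  then obtain k :: int where "P = U [^]\<^bsub>E\<^esub> k" by (auto simp: C_def)
  then have "P = U [^]\<^bsub>E\<^esub> (k mod int p)" using int_pow_mod_p[of U k] U(1) by (simp add: tors_def)
  then show "P \<in> (\<lambda>k. U [^]\<^bsub>E\<^esub> k) ` {0..<int p}" using p_pos by auto
 qed
 then have "card C \<le> p" using surj_card_le[of "{0..<int p}" C] by simp
 moreover have "card {U, Infinity} \<le> card C" using U_C C_tors by (intro card_mono) auto
 then have "card C \<ge> 2" using U(2) by simp
 moreover have "p < p ^ 2" using p_pos by (simp add: power2_eq_square)
 ultimately show ?thesis using closed_card[OF closed_C] by linarith
qed

lemma GG_C: "\<sigma> \<in> carrier GG ==> P \<in> C ==> map_point \<sigma> P \<in> C"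
proof -
 assume s: "\<sigma> \<in> carrier GG" and "P \<in> C"
 then obtain k :: int where k: "P = U [^]\<^bsub>E\<^esub> k" by (auto simp: C_def)
 obtain j :: int where "map_point \<sigma> U = U [^]\<^bsub>E\<^esub> j" using stab[OF s] by blast
 then have "map_point \<sigma> P = U [^]\<^bsub>E\<^esub> (j * k)"
  unfolding k GG_int_pow[OF s U(1)] using E.int_pow_pow[of U j k] tors_ec[OF U(1)] by simp
 then show ?thesis using U_C by simp
qed

lemma stable_C: "stable (C - {Infinity})" "stable (tors p - C)"
proof -
 have nC: "neg P \<in> C" if "P \<in> C" for P using closed_C that by (auto simp: closed_def)
 show "stable (C - {Infinity})"
  unfolding stable_def using C_tors nC GG_C neg_nz GG_nz by blast
 have "P \<in> C" if s: "\<sigma> \<in> carrier GG" and P: "P \<in> tors p" "map_point \<sigma> P \<in> C" for \<sigma> P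
 proof -
  have inj: "inj_on (map_point \<sigma>) (tors p)" using GG_bij[OF s] by (simp add: bij_betw_def)
  have "map_point \<sigma> ` C = C"
   by (rule endo_inj_surj[OF C_tors(3) _ inj_on_subset[OF inj C_tors(1)]]) (use GG_C[OF s] in blast)
  then obtain Q where "Q \<in> C" "map_point \<sigma> Q = map_point \<sigma> P" using P(2) by (metis imageE)
  then show ?thesis using P(1) inj_onD[OF inj] C_tors(1) by blast
 qed
 moreover have "P \<in> C" if "P \<in> tors p" "neg P \<in> C" for P using nC[OF that(2)] by simp
 ultimately show "stable (tors p - C)"
  unfolding stable_def using C_tors(2) neg_tors GG_tors by blast
qed

definition H1 where "H1 = (SOME H. half W (C - {Infinity}) H)"
definition H2 where "H2 = (SOME H. half W (tors p - C) H)"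

lemma H: "half W (C - {Infinity}) H1" "half W (tors p - C) H2"
 unfolding H1_def H2_def using stable_half[OF stable_C(1)] stable_half[OF stable_C(2)] by (simp_all add: someI_ex)

text \<open>Recorded for a parity: if p = 3 mod 4, both numbers of factors, (p - 1) / 2 and p (p -
  1) / 2, are odd.\<close>

lemma card_H: "2 * card H1 = p - 1" "2 * card H2 = p * p - p"
proof -
 have "card (C - {Infinity}) = p - 1" "card (tors p - C) = p * p - p"
  using C_tors card_C card_tors finite_tors by (simp_all add: card_Diff_subset power2_eq_square)
 then show "2 * card H1 = p - 1" "2 * card H2 = p * p - p"
  using half_card[OF _ H(1)] half_card[OF _ H(2)] finite_tors C_tors by simp_all
qed

lemma H12: "half W nz (H1 \<union> H2)" "psiprod (H1 \<union> H2) = psiprod H1 * psiprod H2"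
proof -
 show "half W nz (H1 \<union> H2)"
  unfolding half_def
 proof (intro conjI ballI)
  have sub: "H1 \<subseteq> C - {Infinity}" "H2 \<subseteq> tors p - C" using H by (auto simp: half_def)
  then show "H1 \<union> H2 \<subseteq> nz" using C_tors by blast
  fix P assume P: "P \<in> nz"
  then show "neg P \<in> nz" using neg_nz by blast
  show "P \<in> H1 \<union> H2 \<longleftrightarrow> neg P \<notin> H1 \<union> H2"
   using halfD[OF H(1), of P] halfD[OF H(2), of P] P sub C_tors by blast
 qed
 show "psiprod (H1 \<union> H2) = psiprod H1 * psiprod H2"
 proof (rule prod.union_disjoint)
  have "H1 \<subseteq> C" "H2 \<subseteq> tors p - C" using H by (auto simp: half_def)
  then show "finite H1" "finite H2" "H1 \<inter> H2 = {}"
   using C_tors(3) finite_tors finite_subset[of H1] finite_subset[of H2 "tors p"] by auto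
 qed
qed

abbreviation "Y1 \<equiv> psiprod H1"
abbreviation "Y2 \<equiv> psiprod H2"

lemma Y_facts: "Y1 \<in> M" "Y2 \<in> M" "Y1 ~= 0" "Y2 ~= 0"
 "\<sigma> \<in> carrier GG ==> \<sigma> Y1 = Y1 \<or> \<sigma> Y1 = - Y1" "\<sigma> \<in> carrier GG ==> \<sigma> Y2 = Y2 \<or> \<sigma> Y2 = - Y2"
 using psiprod[OF stable_C(1) H(1)] psiprod[OF stable_C(2) H(2)]
  psiprod_sign[OF stable_C(1) H(1)] psiprod_sign[OF stable_C(2) H(2)] by blast+

lemma GG_mult_Y:
 assumes "\<sigma> \<in> carrier GG" "\<tau> \<in> carrier GG" "y \<in> M" "y ~= 0" "\<sigma> y = y \<or> \<sigma> y = - y" "\<tau> y = y \<or> \<tau> y = - y"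
 shows "(\<sigma> \<otimes>\<^bsub>GG\<^esub> \<tau>) y = y \<longleftrightarrow> (\<sigma> y = y \<longleftrightarrow> \<tau> y = y)"
 using assms GG_comp[of \<sigma> \<tau> y] fhomD(7)[OF GG_hom[of \<sigma>], of y] by auto

lemma mult:
 assumes "a \<in> carrier GG" "b \<in> carrier GG"
 shows "(a \<otimes>\<^bsub>GG\<^esub> b) Y1 = Y1 \<longleftrightarrow> (a Y1 = Y1 \<longleftrightarrow> b Y1 = Y1)" "(a \<otimes>\<^bsub>GG\<^esub> b) Y2 = Y2 \<longleftrightarrow> (a Y2 = Y2 \<longleftrightarrow> b Y2 = Y2)"
 using GG_mult_Y[OF assms Y_facts(1,3) Y_facts(5)[OF assms(1)] Y_facts(5)[OF assms(2)]]
  GG_mult_Y[OF assms Y_facts(2,4) Y_facts(6)[OF assms(1)] Y_facts(6)[OF assms(2)]] .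

lemma double_card_GG:
 assumes s: "\<sigma> \<in> carrier GG" and G: "G \<subseteq> carrier GG" "\<And>\<tau>. \<tau> \<in> G ==> \<sigma> \<otimes>\<^bsub>GG\<^esub> \<tau> \<in> G"
  and y: "y \<in> M" "y ~= 0" "\<And>\<sigma>. \<sigma> \<in> carrier GG ==> \<sigma> y = y \<or> \<sigma> y = - y" "\<sigma> y ~= y"
 shows "card G = 2 * card {\<tau> \<in> G. \<tau> y = y}"
proof (rule double_card)
 show "finite G" using finite_GG G(1) finite_subset by blast
 show "inj_on ((\<otimes>\<^bsub>GG\<^esub>) \<sigma>) G" proof (rule inj_onI)
  fix a b assume "a \<in> G" "b \<in> G" "\<sigma> \<otimes>\<^bsub>GG\<^esub> a = \<sigma> \<otimes>\<^bsub>GG\<^esub> b"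
  then show "a = b" using GG.l_cancel[of \<sigma> a b] G(1) s by blast
 qed
 show "(\<sigma> \<otimes>\<^bsub>GG\<^esub> \<tau>) y = y \<longleftrightarrow> \<not> \<tau> y = y" if "\<tau> \<in> G" for \<tau>
  using GG_mult_Y[OF s, of \<tau> y] that G(1) y s by blast
qed (rule G)

text \<open>Some \<sigma> negates the product of all representatives. If 4 does not divide the
  order, an odd power of \<sigma> has trivial square and still negates it; for p = 1 mod 4 this
  contradicts \<open>involution_sign\<close>, because the minus part has 1, p or p^2 elements. And
  if Y1 and Y2 were both irrational, the two signs would take all four values.\<close>

lemma forward_group:
 assumes n4: "\<not> 4 dvd order GG"
 shows "p mod 4 = 3" "Y1 \<in> \<rat> \<or> Y2 \<in> \<rat>"
proof -
 have "\<exists>\<sigma>\<in>carrier GG. \<sigma> (psiprod (H1 \<union> H2)) ~= psiprod (H1 \<union> H2)"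
  using fixed_rational psiprod[OF stable_nz H12(1)] psiprod_nz_irrational[OF H12(1)] by blast
 then obtain \<sigma> where s: "\<sigma> \<in> carrier GG" "\<sigma> (psiprod (H1 \<union> H2)) ~= psiprod (H1 \<union> H2)" by blast
 define y where "y = psiprod (H1 \<union> H2)"
 have y: "y \<in> M" "y ~= 0" using psiprod[OF stable_nz H12(1)] by (simp_all add: y_def)
 have sy: "\<sigma> y = - y" using psiprod_sign[OF stable_nz H12(1) s(1)] s(2) by (auto simp: y_def)
 show "p mod 4 = 3"
 proof (rule ccontr)
  assume "p mod 4 ~= 3"
  then have p4: "p mod 4 = 1" using odd_p by presburger
  have "\<exists>m. odd m \<and> order GG dvd 2 * m"
  proof (cases "odd (order GG)")
   case False
   then obtain m where m: "order GG = 2 * m" by blast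
   then have "odd m" using n4 by auto
   then show ?thesis using m by auto
  qed auto
  then obtain m where m: "odd m" "order GG dvd 2 * m" by blast
  define \<tau> where "\<tau> = \<sigma> [^]\<^bsub>GG\<^esub> m"
  have t: "\<tau> \<in> carrier GG" using s(1) by (simp add: \<tau>_def)
  have "\<tau> \<otimes>\<^bsub>GG\<^esub> \<tau> = \<sigma> [^]\<^bsub>GG\<^esub> (2 * m)" using s(1) by (simp add: \<tau>_def GG.nat_pow_mult mult_2)
  also obtain k where "2 * m = order GG * k" using m(2) by blast
  then have "\<sigma> [^]\<^bsub>GG\<^esub> (2 * m) = \<one>\<^bsub>GG\<^esub>"
   using s(1) GG.pow_order_eq_1[OF s(1)] by (simp flip: GG.nat_pow_pow)
  finally have tt: "\<tau> \<otimes>\<^bsub>GG\<^esub> \<tau> = \<one>\<^bsub>GG\<^esub>" .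
  have pw: "(\<sigma> [^]\<^bsub>GG\<^esub> k) y = (-1) ^ k * y" for k :: nat
  proof (induction k)
   case (Suc k)
   have "(\<sigma> [^]\<^bsub>GG\<^esub> Suc k) y = (\<sigma> [^]\<^bsub>GG\<^esub> k) (- y)"
    using GG_comp[of "\<sigma> [^]\<^bsub>GG\<^esub> k" \<sigma> y] s(1) y sy by simp
   also have "\<dots> = - ((\<sigma> [^]\<^bsub>GG\<^esub> k) y)" using fhomD(7)[OF GG_hom] s(1) y by simp
   finally show ?case using Suc by simp
  qed (simp add: Gal_one y)
  have "\<tau> y = (-1) ^ (card (nz \<inter> minus_part \<tau>) div 2) * y"
   unfolding y_def by (rule involution_sign[OF stable_nz H12(1) t involution_map[OF t tt]])
  moreover have "\<tau> y = - y" using pw[of m] m(1) by (simp add: \<tau>_def)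
  ultimately have od: "odd (card (nz \<inter> minus_part \<tau>) div 2)" using sign_parity(2)[OF y(2)] by metis
  have mp: "closed (minus_part \<tau>)" by (rule closed_minus_part[OF t])
  then have "nz \<inter> minus_part \<tau> = minus_part \<tau> - {Infinity}" "Infinity \<in> minus_part \<tau>" by (auto simp: closed_def)
  then have "card (nz \<inter> minus_part \<tau>) = card (minus_part \<tau>) - 1"
   using finite_subset[OF _ finite_tors, of "minus_part \<tau>"] mp by (simp add: closed_def)
  moreover obtain k where k: "p = 4 * k + 1" using p4 by (metis add.commute mod_mult_div_eq mult.commute)
  ultimately have "even (card (nz \<inter> minus_part \<tau>) div 2)"
   using closed_card[OF mp] by (auto simp: power2_eq_square algebra_simps)
  then show False using od by simp
 qed
 show "Y1 \<in> \<rat> \<or> Y2 \<in> \<rat>"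
 proof (rule ccontr)
  assume "\<not> (Y1 \<in> \<rat> \<or> Y2 \<in> \<rat>)"
  then obtain s1 s2 where s1: "s1 \<in> carrier GG" "s1 Y1 ~= Y1" and s2: "s2 \<in> carrier GG" "s2 Y2 ~= Y2"
   using fixed_rational Y_facts(1,2) by blast
  have "\<sigma> y = \<sigma> Y1 * \<sigma> Y2" unfolding y_def H12(2) using fhomD(8)[OF GG_hom[OF s(1)]] Y_facts by blast
  then have ss: "\<sigma> Y1 = Y1 \<longleftrightarrow> \<sigma> Y2 ~= Y2"
   using Y_facts(5,6)[OF s(1)] sy Y_facts(3,4) y(2) unfolding y_def H12(2) by auto
  \<comment> \<open>\<sigma> negates exactly one of Y1 and Y2. If that is Y1, then either
    \<open>s2\<close> or the product of \<sigma> and \<open>s2\<close> fixes Y1 and negates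
    Y2.\<close>
  have "\<exists>b\<in>carrier GG. b Y1 = Y1 \<and> b Y2 ~= Y2"
  proof (cases "\<sigma> Y1 = Y1")
   case True
   then show ?thesis using ss s by blast
  next
   case False
   show ?thesis
   proof (cases "s2 Y1 = Y1")
    case True
    then show ?thesis using s2 by blast
   next
    case f: False
    have "(\<sigma> \<otimes>\<^bsub>GG\<^esub> s2) Y1 = Y1" "(\<sigma> \<otimes>\<^bsub>GG\<^esub> s2) Y2 ~= Y2"
     unfolding mult[OF s(1) s2(1)] using False f ss s2(2) by blast+
    then show ?thesis using GG.m_closed[OF s(1) s2(1)] by blast
   qed
  qed
  then obtain b where b: "b \<in> carrier GG" "b Y1 = Y1" "b Y2 ~= Y2" by blast
  define G1 where "G1 = {\<tau> \<in> carrier GG. \<tau> Y1 = Y1}"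
  have "card (carrier GG) = 2 * card G1"
   unfolding G1_def by (rule double_card_GG[OF s1(1), of _ Y1]) (use GG.m_closed[OF s1(1)] Y_facts s1(2) in auto)
  moreover have "card G1 = 2 * card {\<tau> \<in> G1. \<tau> Y2 = Y2}"
   by (rule double_card_GG[OF b(1), of _ Y2]) (use GG.m_closed[OF b(1)] mult(1)[OF b(1)] b(2,3) Y_facts in \<open>auto simp: G1_def\<close>)
  ultimately show False using n4 by (simp add: order_def)
 qed
qed

text \<open>As (p - 1) / 2 is odd, the sign on Y1 forces the minus part to meet C only in Infinity,
  and the sign on Y2 excludes that it has p elements; with p^2 elements it would contain C. So it is
  trivial, and P - \<tau> P, which \<tau> negates, is Infinity for every P.\<close>

lemma involution_trivial:
 assumes p4: "p mod 4 = 3" and t: "\<tau> \<in> carrier GG" "\<tau> \<otimes>\<^bsub>GG\<^esub> \<tau> = \<one>\<^bsub>GG\<^esub>" and f: "\<tau> Y1 = Y1" "\<tau> Y2 = Y2"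
 shows "\<tau> = \<one>\<^bsub>GG\<^esub>"
proof -
 note inv = involution_map[OF t]
 define c c1 where "c = card (minus_part \<tau>)" and "c1 = card (C \<inter> minus_part \<tau>)"
 have mp: "closed (minus_part \<tau>)" by (rule closed_minus_part[OF t(1)])
 then have mp': "minus_part \<tau> \<subseteq> tors p" "Infinity \<in> minus_part \<tau>" "finite (minus_part \<tau>)"
  using finite_subset[OF _ finite_tors] by (auto simp: closed_def)
 have Z1: "card ((C - {Infinity}) \<inter> minus_part \<tau>) = c1 - 1"
 proof -
  have "(C - {Infinity}) \<inter> minus_part \<tau> = (C \<inter> minus_part \<tau>) - {Infinity}" by blast
  then show ?thesis using mp' C_tors by (simp add: c1_def)
 qed
 have Z2: "card ((tors p - C) \<inter> minus_part \<tau>) = c - c1"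
 proof -
  have "(tors p - C) \<inter> minus_part \<tau> = minus_part \<tau> - C \<inter> minus_part \<tau>" using mp' by blast
  then show ?thesis using mp' by (simp add: c1_def c_def card_Diff_subset)
 qed
 have e1: "even ((c1 - 1) div 2)"
  using involution_sign[OF stable_C(1) H(1) t(1) inv] f(1) sign_parity(1)[OF Y_facts(3)] unfolding Z1 by metis
 have e2: "even ((c - c1) div 2)"
  using involution_sign[OF stable_C(2) H(2) t(1) inv] f(2) sign_parity(1)[OF Y_facts(4)] unfolding Z2 by metis
 obtain k where k: "p = 4 * k + 3" using p4 by (metis add.commute mod_mult_div_eq mult.commute)
 have "c1 \<le> p" unfolding c1_def using card_mono[OF C_tors(3), of "C \<inter> minus_part \<tau>"] card_C by simp
 moreover have "p < p ^ 2" using p_pos by (simp add: power2_eq_square)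
 ultimately have "c1 = 1 \<or> c1 = p"
  using closed_card[OF closed_Int[OF closed_C mp]] unfolding c1_def by linarith
 then have c1: "c1 = 1" using e1 k by auto
 have "c = 1 \<or> c = p \<or> c = p ^ 2" using closed_card[OF mp] by (simp add: c_def)
 moreover have "c ~= p" using e2 k c1 by auto
 moreover have "c ~= p ^ 2"
 proof
  assume "c = p ^ 2"
  then have "minus_part \<tau> = tors p" using card_subset_eq[OF finite_tors mp'(1)] card_tors by (simp add: c_def)
  then have "C \<inter> minus_part \<tau> = C" using C_tors by blast
  then show False using c1 card_C p_pos by (simp add: c1_def)
 qed
 ultimately have "c = 1" by blast
 then have m0: "minus_part \<tau> = {Infinity}" using mp'(2) unfolding c_def by (metis card_1_singletonE singletonD)
 have "map_point \<tau> P = P" if P: "P \<in> tors p" for P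
 proof -
  note tP = GG_tors[OF t(1) P]
  have c: "P \<in> carrier E" "map_point \<tau> P \<in> carrier E" "neg P \<in> carrier E" "neg (map_point \<tau> P) \<in> carrier E"
   using tors_ec[OF P] tors_ec[OF tP] ec_neg_ec by auto
  define Q where "Q = P \<otimes>\<^bsub>E\<^esub> neg (map_point \<tau> P)"
  have "map_point \<tau> Q = map_point \<tau> P \<otimes>\<^bsub>E\<^esub> neg P"
   unfolding Q_def using GG_add[OF t(1) P neg_tors[OF tP]] GG_neg[OF t(1) tP] inv[OF P] by simp
  also have "\<dots> = neg Q"
   using E.inv_mult[OF c(1,4)] inv_neg c E.m_closed[OF c(1,4)] E.m_comm[OF c(2,3)] by (simp add: Q_def)
  finally have "Q \<in> minus_part \<tau>" using tors_add[OF P neg_tors[OF tP]] by (simp add: minus_part_def Q_def)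
  then have "P \<otimes>\<^bsub>E\<^esub> inv\<^bsub>E\<^esub> (map_point \<tau> P) = \<one>\<^bsub>E\<^esub>" using m0 inv_neg c by (simp add: Q_def)
  then show ?thesis using E.inv_equality[of P "inv\<^bsub>E\<^esub> (map_point \<tau> P)"] E.inv_inv c E.inv_closed by metis
 qed
 then show ?thesis using GG_eq[OF t(1) GG.one_closed] GG_one_map by simp
qed

text \<open>The common stabiliser of Y1 and Y2 contains no element of order 2 by
  \<open>involution_trivial\<close>, so its order is odd. Its index is at most 2, since Y1 and Y2
  generate at most the one quadratic field of the square root of -p.\<close>

lemma converse_group:
 assumes p4: "p mod 4 = 3" and Y: "\<And>y. y \<in> {Y1, Y2} ==> y \<in> \<rat> \<or> (\<exists>r\<in>\<rat>. y ^ 2 = - (of_nat p * r ^ 2))"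
 shows "\<not> 4 dvd order GG"
proof -
 define K where "K = {\<sigma> \<in> carrier GG. \<sigma> Y1 = Y1 \<and> \<sigma> Y2 = Y2}"
 have one: "\<one>\<^bsub>GG\<^esub> Y1 = Y1" "\<one>\<^bsub>GG\<^esub> Y2 = Y2" using Y_facts by (simp_all add: Gal_one)
 have K: "subgroup K GG"
 proof (rule GG.subgroupI)
  show "K ~= {}" using one by (auto simp: K_def)
  fix a assume a: "a \<in> K"
  then have "inv\<^bsub>GG\<^esub> a \<in> carrier GG" "a \<in> carrier GG" by (auto simp: K_def)
  then show "inv\<^bsub>GG\<^esub> a \<in> K" using mult[of a "inv\<^bsub>GG\<^esub> a"] GG.r_inv[of a] one a unfolding K_def by auto
 qed (use mult in \<open>auto simp: K_def\<close>)
 have oddK: "odd (card K)"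
 proof
  assume "even (card K)"
  then obtain m where m: "card K = 2 ^ 1 * m" by (auto elim: evenE)
  define KG where "KG = GG\<lparr>carrier := K\<rparr>"
  interpret KG: group KG unfolding KG_def by (rule GG.subgroup_imp_group[OF K])
  have "finite (carrier KG)" using finite_GG finite_subset[of K "carrier GG"] by (auto simp: KG_def K_def)
  then obtain S where S: "subgroup S KG" "card S = 2"
   using sylow_thm[of 2 KG 1 m] KG.is_group m by (auto simp: order_def KG_def)
  have oS: "\<one>\<^bsub>GG\<^esub> \<in> S" using subgroup.one_closed[OF S(1)] by (simp add: KG_def)
  obtain a b where ab: "S = {a, b}" "a ~= b" using S(2) by (metis card_2_iff)
  then obtain \<tau> where t: "S = {\<one>\<^bsub>GG\<^esub>, \<tau>}" "\<tau> ~= \<one>\<^bsub>GG\<^esub>" using oS by blast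
  have tK: "\<tau> \<in> K" using subgroup.subset[OF S(1)] t(1) by (auto simp: KG_def)
  then have tG: "\<tau> \<in> carrier GG" by (simp add: K_def)
  have "\<tau> \<otimes>\<^bsub>GG\<^esub> \<tau> \<in> S" using subgroup.m_closed[OF S(1), of \<tau> \<tau>] t(1) by (simp add: KG_def)
  moreover have "\<tau> \<otimes>\<^bsub>GG\<^esub> \<tau> ~= \<tau>" using GG.l_cancel_one[OF tG tG] t(2) by simp
  ultimately have "\<tau> \<otimes>\<^bsub>GG\<^esub> \<tau> = \<one>\<^bsub>GG\<^esub>" using t(1) by blast
  then show False using involution_trivial[OF p4 tG] tK t(2) by (simp add: K_def)
 qed
 have fixes_rat: "\<sigma> r = r" if "\<sigma> \<in> carrier GG" "r \<in> \<rat>" for \<sigma> r using fhomD(12)[OF GG_hom] that by blast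
 have "\<exists>y\<in>{Y1, Y2}. K = {\<sigma> \<in> carrier GG. \<sigma> y = y}"
 proof (cases "Y1 \<in> \<rat> \<or> Y2 \<in> \<rat>")
  case True
  then show ?thesis using fixes_rat unfolding K_def by auto
 next
  case False
  then obtain r1 r2 where r: "r1 \<in> \<rat>" "Y1 ^ 2 = - (of_nat p * r1 ^ 2)" "r2 \<in> \<rat>" "Y2 ^ 2 = - (of_nat p * r2 ^ 2)"
   using Y[of Y1] Y[of Y2] by auto
  have r0: "r1 ~= 0" "r2 ~= 0" using r Y_facts(3,4) by auto
  have "(Y1 * r2) ^ 2 = (Y2 * r1) ^ 2" unfolding power_mult_distrib r by (simp add: algebra_simps)
  then have "Y1 * r2 = Y2 * r1 \<or> Y1 * r2 = - (Y2 * r1)" by (simp add: power2_eq_iff)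
  then have "Y1 = Y2 * (r1 / r2) \<or> Y1 = Y2 * (- r1 / r2)" using r0 by (auto simp: field_simps)
  then obtain c where c: "c \<in> \<rat>" "Y1 = Y2 * c" using r by (metis Rats_divide Rats_minus_iff)
  have "\<sigma> Y1 = Y1 \<longleftrightarrow> \<sigma> Y2 = Y2" if s: "\<sigma> \<in> carrier GG" for \<sigma>
  proof -
   have "\<sigma> Y1 = \<sigma> Y2 * c"
    unfolding c(2) using fhomD(8)[OF GG_hom[OF s] Y_facts(2)] csubfieldD(4)[OF M(1) c(1)] fixes_rat[OF s c(1)] by simp
   then show ?thesis using c(2) Y_facts(3) by auto
  qed
  then show ?thesis unfolding K_def by blast
 qed
 then obtain y where y: "y \<in> {Y1, Y2}" "K = {\<sigma> \<in> carrier GG. \<sigma> y = y}" by blast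
 have "card (carrier GG) = card K \<or> card (carrier GG) = 2 * card K"
 proof (cases "K = carrier GG")
  case False
  then obtain s where s: "s \<in> carrier GG" "s y ~= y" using y(2) by blast
  have "card (carrier GG) = 2 * card {\<sigma> \<in> carrier GG. \<sigma> y = y}"
  proof (rule double_card_GG[OF s(1), of _ y])
   show "y \<in> M" "y ~= 0" using y(1) Y_facts(1-4) by (elim insertE emptyE; simp only:; fail)+
   show "\<sigma> y = y \<or> \<sigma> y = - y" if "\<sigma> \<in> carrier GG" for \<sigma> using y(1) Y_facts(5,6)[OF that] by (elim insertE emptyE) (simp_all only:)
  qed (use GG.m_closed[OF s(1)] s(2) in auto)
  then show ?thesis using y(2) by simp
 qed simp
 then show ?thesis using oddK unfolding order_def by (elim disjE) presburger+
qed

end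

section \<open>Half products in local models\<close>

lemma b8_relation: "4 * b8 W = b2 W * b6 W - b4 W ^ 2" for W :: "complex weierstrass"
 by (simp add: b2_def b4_def b6_def b8_def power2_eq_square algebra_simps)

lemma psi_square:
 assumes "on_ec W x y"
 shows "psi W (Affine x y) ^ 2 = 4 * x ^ 3 + b2 W * x ^ 2 + 2 * b4 W * x + b6 W"
 using assms unfolding on_ec_def psi.simps b2_def b4_def b6_def by Groebner_Basis.algebra

text \<open>Ordinates enter only through \<open>psi\<close>, whose square is a polynomial in the
  abscissa. This is what removes them from the sum and the product of the abscissas of Q + P and Q -
  P.\<close>

lemma chord_abscissa:
 assumes "x1 ~= x2"
 shows "\<exists>x y. ec_add W (Affine x1 y1) (Affine x2 y2) = Affine x y \<and>
  4 * (x2 - x1) ^ 2 * x = (psi W (Affine x2 y2) - psi W (Affine x1 y1)) ^ 2 - (b2 W + 4 * x1 + 4 * x2) * (x2 - x1) ^ 2"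
proof -
 define l where "l = (y2 - y1) / (x2 - x1)"
 have l: "l * (x2 - x1) = y2 - y1" using assms by (simp add: l_def)
 have "ec_slope W x1 y1 x2 y2 = l" using assms by (simp add: ec_slope_def l_def)
 then have "\<exists>y. ec_add W (Affine x1 y1) (Affine x2 y2) = Affine (l ^ 2 + a1 W * l - a2 W - x1 - x2) y"
  using assms by (simp add: Let_def)
 moreover have "4 * (x2 - x1) ^ 2 * (l ^ 2 + a1 W * l - a2 W - x1 - x2)
   = (psi W (Affine x2 y2) - psi W (Affine x1 y1)) ^ 2 - (b2 W + 4 * x1 + 4 * x2) * (x2 - x1) ^ 2"
  unfolding psi.simps b2_def using l by Groebner_Basis.algebra
 ultimately show ?thesis by blast
qed

lemma add_sub_abscissa:
 assumes P: "on_ec W x1 y1" and Q: "on_ec W x2 y2" and x: "x1 ~= x2"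
 shows "\<exists>x3 y3 x4 y4. ec_add W (Affine x1 y1) (Affine x2 y2) = Affine x3 y3 \<and>
  ec_add W (ec_neg W (Affine x1 y1)) (Affine x2 y2) = Affine x4 y4 \<and>
  (x2 - x1) ^ 2 * (x3 + x4) = 2 * x1 * x2 * (x1 + x2) + b2 W * x1 * x2 + b4 W * (x1 + x2) + b6 W \<and>
  (x2 - x1) ^ 2 * (x3 * x4) = x1 ^ 2 * x2 ^ 2 - b4 W * x1 * x2 - b6 W * (x1 + x2) - b8 W"
proof -
 define n1 n2 where "n1 = psi W (Affine x1 y1)" and "n2 = psi W (Affine x2 y2)"
 note b = b8_relation[of W]
 define D where "D = (x2 - x1) ^ 2"
 have D: "D ~= 0" using x by (simp add: D_def)
 have n: "n1 ^ 2 = 4 * x1 ^ 3 + b2 W * x1 ^ 2 + 2 * b4 W * x1 + b6 W" "n2 ^ 2 = 4 * x2 ^ 3 + b2 W * x2 ^ 2 + 2 * b4 W * x2 + b6 W"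
  unfolding n1_def n2_def using psi_square P Q by blast+
 have m: "psi W (Affine x1 (- y1 - a1 W * x1 - a3 W)) = - n1" using psi_neg[of W "Affine x1 y1"] by (simp add: n1_def)
 from chord_abscissa[OF x, of W y1 y2] obtain x3 y3 where
  3: "ec_add W (Affine x1 y1) (Affine x2 y2) = Affine x3 y3" "4 * D * x3 = (n2 - n1) ^ 2 - (b2 W + 4 * x1 + 4 * x2) * D"
  unfolding n1_def n2_def D_def by blast
 from chord_abscissa[OF x, of W "- y1 - a1 W * x1 - a3 W" y2] obtain x4 y4 where
  4: "ec_add W (Affine x1 (- y1 - a1 W * x1 - a3 W)) (Affine x2 y2) = Affine x4 y4" "4 * D * x4 = (n2 + n1) ^ 2 - (b2 W + 4 * x1 + 4 * x2) * D"
  unfolding n2_def[symmetric] D_def m by auto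
 define S where "S = 2 * x1 * x2 * (x1 + x2) + b2 W * x1 * x2 + b4 W * (x1 + x2) + b6 W"
 have S: "n1 ^ 2 + n2 ^ 2 - (b2 W + 4 * x1 + 4 * x2) * D = 2 * S"
  unfolding n S_def D_def by Groebner_Basis.algebra
 have sum: "4 * (D * (x3 + x4)) = 4 * S" using 3(2) 4(2) S by Groebner_Basis.algebra
 have "4 * (4 * (D * (D * (x3 * x4)))) = (4 * D * x3) * (4 * D * x4)" by Groebner_Basis.algebra
 also have "\<dots> = (2 * S - 2 * n1 * n2) * (2 * S + 2 * n1 * n2)" unfolding 3(2) 4(2) using S by Groebner_Basis.algebra
 also have "\<dots> = 4 * (S ^ 2 - n1 ^ 2 * n2 ^ 2)" by Groebner_Basis.algebra
 finally have "4 * (D * (D * (x3 * x4))) = S ^ 2 - n1 ^ 2 * n2 ^ 2"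
  by (metis mult_cancel_left zero_neq_numeral)
 also have "\<dots> = 4 * (D * (x1 ^ 2 * x2 ^ 2 - b4 W * x1 * x2 - b6 W * (x1 + x2) - b8 W))"
  unfolding n S_def D_def using b by Groebner_Basis.algebra
 finally have "D * (x3 * x4) = x1 ^ 2 * x2 ^ 2 - b4 W * x1 * x2 - b6 W * (x1 + x2) - b8 W" using D by simp
 moreover have "D * (x3 + x4) = S" using sum by (metis mult_cancel_left zero_neq_numeral)
 ultimately show ?thesis using 3(1) 4(1) unfolding S_def D_def ec_neg.simps by blast
qed

text \<open>The duplication formula in terms of b2, b4, b6 and b8 alone, so that integrality of
  these invariants suffices below.\<close>

lemma double_abscissa:
 assumes P: "on_ec W x y" and n: "psi W (Affine x y) ~= 0"
 shows "\<exists>x2 y2. ec_add W (Affine x y) (Affine x y) = Affine x2 y2 \<and>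
  psi W (Affine x y) ^ 2 * x2 = x ^ 4 - b4 W * x ^ 2 - 2 * b6 W * x - b8 W"
proof -
 define \<eta> where "\<eta> = psi W (Affine x y)"
 have e: "\<eta> = 2 * y + a1 W * x + a3 W" by (simp add: \<eta>_def)
 define l where "l = (3 * x ^ 2 + 2 * a2 W * x + a4 W - a1 W * y) / \<eta>"
 have l: "l * \<eta> = 3 * x ^ 2 + 2 * a2 W * x + a4 W - a1 W * y" using n by (simp add: l_def \<eta>_def)
 have "ec_slope W x y x y = l" by (simp add: ec_slope_def l_def e)
 moreover have "y + y + a1 W * x + a3 W ~= 0" using n unfolding \<eta>_def[symmetric] e by (simp only: mult_2) simp
 ultimately have "\<exists>y2. ec_add W (Affine x y) (Affine x y) = Affine (l ^ 2 + a1 W * l - a2 W - x - x) y2"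
  by (simp add: Let_def)
 moreover have "\<eta> ^ 2 * (l ^ 2 + a1 W * l - a2 W - x - x) = x ^ 4 - b4 W * x ^ 2 - 2 * b6 W * x - b8 W"
 proof -
  define g N where "g = a1 W * x + a3 W" and "N = 3 * x ^ 2 + 2 * a2 W * x + a4 W"
  have lg: "l * \<eta> = N - a1 W * y" "\<eta> = 2 * y + g" using l e by (simp_all add: g_def N_def)
  have on: "y ^ 2 + y * g = x ^ 3 + a2 W * x ^ 2 + a4 W * x + a6 W"
   using P unfolding on_ec_def g_def by Groebner_Basis.algebra
  have sq: "\<eta> ^ 2 = 4 * x ^ 3 + b2 W * x ^ 2 + 2 * b4 W * x + b6 W"
   unfolding \<eta>_def by (rule psi_square[OF P])
  have "\<eta> ^ 2 * (l ^ 2 + a1 W * l - a2 W - x - x) = (l * \<eta>) * (l * \<eta> + a1 W * \<eta>) - (a2 W + 2 * x) * \<eta> ^ 2"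
   by Groebner_Basis.algebra
  also have "(l * \<eta>) * (l * \<eta> + a1 W * \<eta>) = N ^ 2 + N * a1 W * g - a1 W ^ 2 * (y ^ 2 + y * g)"
   using lg by Groebner_Basis.algebra
  also have "N ^ 2 + N * a1 W * g - a1 W ^ 2 * (y ^ 2 + y * g) - (a2 W + 2 * x) * \<eta> ^ 2
    = x ^ 4 - b4 W * x ^ 2 - 2 * b6 W * x - b8 W"
   unfolding sq unfolding on unfolding g_def N_def b2_def b4_def b6_def b8_def by Groebner_Basis.algebra
  finally show ?thesis .
 qed
 ultimately show ?thesis unfolding \<eta>_def by blast
qed

lemma cv_pow:
 assumes u: "u ~= 0" and W': "W' = change_variables u r s t W" and W: "disc W ~= 0" and P: "P \<in> ec W"
 shows "cv u r s t (P [^]\<^bsub>ec_group W\<^esub> (k::nat)) = cv u r s t P [^]\<^bsub>ec_group W'\<^esub> k"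
proof -
 interpret E: comm_group "ec_group W" by (rule comm_group_ec_group[OF W])
 show ?thesis
  by (induction k) (use cv_ec_add[OF u W', of _ P] P E.nat_pow_closed[of P] in auto)
qed

section \<open>Valuation rings above q and integrality of torsion\<close>

locale place =
 fixes q :: nat and A :: "complex set"
 assumes q: "prime q" and A: "val_ring A" and nq: "inverse (of_nat q) \<notin> A"
begin

lemma csubring_A: "csubring A"
 using A by (simp add: val_ring_def)

lemmas AD = csubringD[OF csubring_A]

lemma val: "x \<in> A \<or> inverse x \<in> A"
 using A by (simp add: val_ring_def)

text \<open>The maximal ideal of A. Zero is listed separately because \<open>inverse 0 = 0\<close>
  lies in A.\<close>

definition mx :: "complex set" where "mx = {x \<in> A. x = 0 \<or> inverse x \<notin> A}"

lemma mx_A: "x \<in> mx ==> x \<in> A" and mx_0: "0 \<in> mx"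
 by (auto simp: mx_def AD)

lemma unit_iff: "x \<in> A - mx \<longleftrightarrow> x \<in> A \<and> x ~= 0 \<and> inverse x \<in> A"
 by (auto simp: mx_def)

lemma not_A: "x \<notin> A ==> inverse x \<in> mx"
 using val[of x] by (auto simp: mx_def)

lemma mx_mult: "a \<in> A ==> x \<in> mx ==> a * x \<in> mx" "a \<in> A ==> x \<in> mx ==> x * a \<in> mx"
proof -
 show 1: "a * x \<in> mx" if ax: "a \<in> A" "x \<in> mx" for a x
 proof (cases "a * x = 0")
  case False
  have "inverse (a * x) \<notin> A"
  proof
   assume "inverse (a * x) \<in> A"
   then have "a * inverse (a * x) \<in> A" using ax(1) AD(4) by blast
   moreover have "a * inverse (a * x) = inverse x" using False by simp
   ultimately have "inverse x \<in> A" by metis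
   then show False using ax(2) False by (auto simp: mx_def)
  qed
  moreover have "a * x \<in> A" using ax mx_A AD(4) by blast
  ultimately show ?thesis unfolding mx_def by blast
 qed (use mx_0 in auto)
 then show "a \<in> A ==> x \<in> mx ==> x * a \<in> mx" by (simp add: mult.commute)
qed

lemma mx_add: "x \<in> mx ==> y \<in> mx ==> x + y \<in> mx"
proof -
 have 1: "x + y \<in> mx" if x: "x \<in> mx" "y \<in> mx" "y ~= 0" "x / y \<in> A" for x y
 proof -
  have "x + y = (x / y + 1) * y" using x(3) by (simp add: field_simps)
  then show ?thesis using mx_mult(1)[of "x / y + 1" y] x AD(1,6) by simp
 qed
 assume x: "x \<in> mx" "y \<in> mx"
 show ?thesis
 proof (cases "x = 0 \<or> y = 0")
  case False
  then show ?thesis using 1[of x y] 1[of y x] x val[of "x / y"] by (auto simp: add.commute)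
 qed (use x in auto)
qed

lemma mx_minus: "x \<in> mx ==> - x \<in> mx"
 using mx_mult(1)[of "-1" x] AD(1,5) by simp

lemma mx_diff: "x \<in> mx ==> y \<in> mx ==> x - y \<in> mx"
 using mx_add[of x "- y"] mx_minus by simp

lemma one_mx: "1 \<notin> mx"
 by (simp add: mx_def AD)

lemma unit_add: "x \<in> A - mx ==> y \<in> mx ==> x + y \<in> A - mx" "x \<in> A - mx ==> y \<in> mx ==> x - y \<in> A - mx"
 using mx_diff[of "x + y" y] mx_add[of "x - y" y] mx_A AD(3,6) by auto

lemma mx_prime: "x \<in> A ==> y \<in> A ==> x * y \<in> mx ==> x \<in> mx \<or> y \<in> mx"
 using AD(4) by (auto simp: mx_def)

lemma unit_mult: "x \<in> A - mx ==> y \<in> A - mx ==> x * y \<in> A - mx"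
 using mx_prime AD(4) by blast

lemma unit_power: "x \<in> A - mx ==> x ^ n \<in> A - mx"
 by (induction n) (use unit_mult one_mx AD(1) in auto)

lemma unit_prod: "(\<And>i. i \<in> I ==> h i \<in> A - mx) ==> prod h I \<in> A - mx"
 by (induction I rule: infinite_finite_induct) (use unit_mult one_mx AD(1) in auto)

lemma unit_divide: "x \<in> A - mx ==> y \<in> A - mx ==> x / y \<in> A - mx"
 unfolding unit_iff divide_inverse by (auto simp: AD inverse_mult_distrib)

lemma mx_power: "x \<in> A ==> x ^ n \<in> mx ==> x \<in> mx"
 using unit_power[of x n] by auto

lemma A_power: "x ^ n \<in> A ==> n > 0 ==> x \<in> A"
proof (rule ccontr)
 assume x: "x ^ n \<in> A" "n > 0" "x \<notin> A"
 then have i: "inverse x \<in> mx" using not_A by blast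
 obtain m where m: "n = Suc m" using x(2) by (cases n) auto
 have "x ~= 0" using x AD(2) by auto
 then have "x ^ m * inverse x ^ m = 1" by (simp add: power_inverse)
 then have "1 = inverse x * (x ^ n * inverse x ^ m)" using \<open>x ~= 0\<close> by (simp add: m mult.assoc)
 then show False using one_mx mx_mult(2)[OF _ i, of "x ^ n * inverse x ^ m"] x(1) i mx_A AD(4,7) by metis
qed

lemma A_Rats: "A \<inter> \<rat> = Zq q"
 by (rule val_ring_Rats[OF q A nq])

lemma q_mx: "of_nat q \<in> mx"
 using nq AD(8) by (auto simp: mx_def)

lemma nat_unit: "\<not> q dvd n ==> of_nat n \<in> A - mx"
proof -
 assume n: "\<not> q dvd n"
 then have "\<not> int q dvd int n" by (simp add: int_dvd_int_iff)
 then have "of_int 1 / of_int (int n) \<in> Zq q" unfolding Zq_def by blast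
 then have "inverse (of_nat n) \<in> A" using A_Rats by (auto simp: inverse_eq_divide)
 moreover have "of_nat n ~= (0::complex)" using n by (metis dvd_0_right of_nat_0_eq_iff)
 ultimately show ?thesis unfolding unit_iff using AD(8) by blast
qed

lemma rmult_unit: "x \<in> A - mx ==> x \<in> \<rat> ==> rmult q x = 0"
proof -
 assume "x \<in> A - mx" and r: "x \<in> \<rat>"
 then have x: "x \<in> A" "x ~= 0" "inverse x \<in> A" unfolding unit_iff by blast+
 then have "x \<in> A \<inter> \<rat>" "inverse x \<in> A \<inter> \<rat>" using r by simp_all
 then have "x \<in> Zq q" "inverse x \<in> Zq q" unfolding A_Rats .
 then have "rmult q x \<ge> 0" "rmult q (inverse x) \<ge> 0" using x(2) unfolding Zq_iff[OF q] by simp_all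
 then show ?thesis using rmult_inverse[OF q r x(2)] by simp
qed

context
 fixes W :: "complex weierstrass"
 assumes W: "disc W ~= 0" and b: "b2 W \<in> A" "b4 W \<in> A" "b6 W \<in> A" "b8 W \<in> A"
begin

interpretation E: comm_group "ec_group W"
 by (rule comm_group_ec_group[OF W])

lemma odd_no_2_torsion:
 fixes n :: nat
 assumes P: "P \<in> ec W" "P [^]\<^bsub>ec_group W\<^esub> n = Infinity" "odd n" and z: "psi W P = 0"
 shows "P = Infinity"
proof (rule ccontr)
 assume "P ~= Infinity"
 then obtain x y where xy: "P = Affine x y" by (cases P) auto
 have "ec_neg W P = P" using z unfolding xy by (simp add: algebra_simps add_eq_0_iff)
 then have "P \<otimes>\<^bsub>ec_group W\<^esub> P = Infinity" using ec_add_neg[of W P] by simp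
 then have 2: "P [^]\<^bsub>ec_group W\<^esub> (2::nat) = \<one>\<^bsub>ec_group W\<^esub>" using P(1) by (simp add: numeral_2_eq_2)
 obtain m where "n = 2 * m + 1" using P(3) by (auto elim: oddE)
 then have "P [^]\<^bsub>ec_group W\<^esub> n = (P [^]\<^bsub>ec_group W\<^esub> (2::nat)) [^]\<^bsub>ec_group W\<^esub> m \<otimes>\<^bsub>ec_group W\<^esub> P"
  using P(1) E.nat_pow_pow[of P 2 m] by simp
 then show False using 2 P(2) \<open>P ~= Infinity\<close> E.nat_pow_one[of m] by simp
qed

text \<open>Takes the place of the formal group. If x0 were not in A, then xi(Q) = x0 / x(Q), which
  behaves like the square of a ratio of local parameters, would satisfy xi(k P) = k^2 modulo the
  maximal ideal for all k. At k = n this says that n^2 lies in the ideal, although n is a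
  unit.\<close>

lemma x_integral:
 fixes n :: nat
 assumes P: "Affine x0 y0 \<in> ec W" "Affine x0 y0 [^]\<^bsub>ec_group W\<^esub> n = Infinity" and n: "odd n" "of_nat n \<in> A - mx"
 shows "x0 \<in> A"
proof (rule ccontr)
 assume "x0 \<notin> A"
 then have z: "inverse x0 \<in> mx" and x0: "x0 ~= 0" using not_A AD(2) by auto
 \<comment> \<open>The invariants of the equation after the scaling that gives P the abscissa 1; all
   of them lie in the maximal ideal.\<close>
 define \<beta>2 \<beta>4 \<beta>6 \<beta>8 where "\<beta>2 = b2 W * inverse x0" and "\<beta>4 = b4 W * inverse x0 ^ 2"
  and "\<beta>6 = b6 W * inverse x0 ^ 3" and "\<beta>8 = b8 W * inverse x0 ^ 4"
 have "inverse x0 ^ Suc k \<in> mx" for k using z mx_A[OF z] AD(7) by (simp add: mx_mult(2))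
 from this[of 1] this[of 2] this[of 3] have zk: "inverse x0 ^ 2 \<in> mx" "inverse x0 ^ 3 \<in> mx" "inverse x0 ^ 4 \<in> mx"
  by (simp_all add: numeral_2_eq_2 numeral_3_eq_3 eval_nat_numeral)
 have \<beta>: "\<beta>2 \<in> mx" "\<beta>4 \<in> mx" "\<beta>6 \<in> mx" "\<beta>8 \<in> mx"
  unfolding \<beta>2_def \<beta>4_def \<beta>6_def \<beta>8_def using b z zk mx_mult by blast+
 have \<beta>': "b2 W = \<beta>2 * x0" "b4 W = \<beta>4 * x0 ^ 2" "b6 W = \<beta>6 * x0 ^ 3" "b8 W = \<beta>8 * x0 ^ 4"
  unfolding \<beta>2_def \<beta>4_def \<beta>6_def \<beta>8_def using x0 by (simp_all add: power_inverse)
 define P where "P = Affine x0 y0"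
 have Pec: "P \<in> ec W" using P by (simp add: P_def)
 have onP: "on_ec W x0 y0" using P by simp
 have psi0: "psi W P ~= 0" using odd_no_2_torsion[OF Pec _ n(1)] P(2) by (auto simp: P_def)
 define \<xi> where "\<xi> Q = (case Q of Infinity => 0 | Affine x y => x0 / x)" for Q
 define good where "good Q \<longleftrightarrow> (case Q of Infinity => True | Affine x y => x ~= (0::complex))" for Q :: "complex point"
 have \<xi>_neg: "\<xi> (ec_neg W Q) = \<xi> Q" "good (ec_neg W Q) = good Q" for Q by (cases Q; simp add: \<xi>_def good_def)+
 \<comment> \<open>The essential factor of the product of the abscissas of Q + P and Q - P in scaled
   coordinates; it is 1 modulo the maximal ideal, hence a unit.\<close>
 define D where "D t = 1 - \<beta>4 * t - \<beta>6 * (t + 1) * t - \<beta>8 * t ^ 2" for t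
 have D: "D t \<in> A - mx" if "t \<in> A" for t
  unfolding D_def using that \<beta> AD(6)[OF that AD(1)] by (intro unit_add(2) mx_mult(2) AD(7)) (use one_mx AD(1) in auto)
 have step: "good (ec_add W P Q) \<and> good (ec_add W (ec_neg W P) Q) \<and>
   (\<xi> (ec_add W P Q) + \<xi> (ec_add W (ec_neg W P) Q)) * D (\<xi> Q) =
    2 * (\<xi> Q + 1) + \<beta>2 * \<xi> Q + \<beta>4 * (\<xi> Q + 1) * \<xi> Q + \<beta>6 * \<xi> Q ^ 2"
  if Q: "Q \<in> ec W" "good Q" "\<xi> Q \<in> A" for Q
 proof (cases Q)
  case Infinity
  then show ?thesis using x0 by (simp add: P_def good_def \<xi>_def D_def)
 next
  case Q': (Affine x y)
  have onQ: "on_ec W x y" using Q Q' by simp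
  have x: "x ~= 0" using Q(2) Q' by (simp add: good_def)
  define t where "t = x0 / x"
  have t: "\<xi> Q = t" "x0 = t * x" "t ~= 0" using x x0 by (simp_all add: \<xi>_def Q' t_def)
  have Dt: "D t ~= 0" using D[of t] Q(3) t(1) mx_0 by auto
  have \<beta>x: "b2 W = \<beta>2 * (t * x)" "b4 W = \<beta>4 * (t * x) ^ 2" "b6 W = \<beta>6 * (t * x) ^ 3" "b8 W = \<beta>8 * (t * x) ^ 4"
   unfolding \<beta>' t(2) by simp_all
  show ?thesis
  proof (cases "x = x0")
   case False
   then obtain x3 y3 x4 y4 where 3: "ec_add W P Q = Affine x3 y3" and 4: "ec_add W (ec_neg W P) Q = Affine x4 y4"
    and s: "(x - x0) ^ 2 * (x3 + x4) = 2 * x0 * x * (x0 + x) + b2 W * x0 * x + b4 W * (x0 + x) + b6 W"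
    and p: "(x - x0) ^ 2 * (x3 * x4) = x0 ^ 2 * x ^ 2 - b4 W * x0 * x - b6 W * (x0 + x) - b8 W"
    using add_sub_abscissa[OF onP onQ] unfolding P_def Q' by blast
   have p': "(x - x0) ^ 2 * (x3 * x4) = t ^ 2 * x ^ 4 * D t"
    using p unfolding \<beta>x t(2) D_def by Groebner_Basis.algebra
   define N where "N = 2 * (t + 1) + \<beta>2 * t + \<beta>4 * (t + 1) * t + \<beta>6 * t ^ 2"
   have s': "(x - x0) ^ 2 * (x3 + x4) = t * x ^ 3 * N"
    using s unfolding \<beta>x t(2) N_def by Groebner_Basis.algebra
   have nz: "x3 ~= 0" "x4 ~= 0" using p' Dt t(3) x by auto
   have d: "(x - x0) ^ 2 ~= 0" using False by simp
   have "(x - x0) ^ 2 * (x3 * x4 * N) = (x - x0) ^ 2 * ((x3 + x4) * (x0 * D t))"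
    using p' s' t(2) by Groebner_Basis.algebra
   then have e: "x3 * x4 * N = (x3 + x4) * (x0 * D t)" using d by simp
   have "(x0 / x3 + x0 / x4) * D t = N"
   proof -
    have "x3 * (x0 / x3) = x0" "x4 * (x0 / x4) = x0" using nz by simp_all
    moreover have "x3 * x4 * ((c + d) * v) = (x3 + x4) * (x0 * v)" if "x3 * c = x0" "x4 * d = x0" for c d v
    proof -
     have "x3 * x4 * ((c + d) * v) = (x4 * (x3 * c) + x3 * (x4 * d)) * v" by (simp add: algebra_simps)
     then show ?thesis unfolding that by (simp add: algebra_simps)
    qed
    ultimately have "x3 * x4 * ((x0 / x3 + x0 / x4) * D t) = x3 * x4 * N" unfolding e by metis
    then show ?thesis using nz by simp
   qed
   then show ?thesis using nz t by (simp add: 3 4 good_def \<xi>_def N_def)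
  next
   \<comment> \<open>Now Q is P or its negative: one of Q + P and Q - P is Infinity, where xi is 0,
     and the other is given by duplication.\<close>
   case True
   have t1: "t = 1" using True x by (simp add: t_def)
   obtain x2 y2 where 2: "ec_add W P P = Affine x2 y2" "psi W P ^ 2 * x2 = x0 ^ 4 - b4 W * x0 ^ 2 - 2 * b6 W * x0 - b8 W"
    using double_abscissa[OF onP] psi0 unfolding P_def by blast
   have D1: "D 1 = 1 - \<beta>4 - 2 * \<beta>6 - \<beta>8" by (simp add: D_def)
   have dd: "psi W P ^ 2 * x2 = x0 ^ 4 * D 1" using 2(2) unfolding \<beta>' D1 by Groebner_Basis.algebra
   then have x2: "x2 ~= 0" using x0 Dt t1 by auto
   have "psi W P ^ 2 = 4 * x0 ^ 3 + b2 W * x0 ^ 2 + 2 * b4 W * x0 + b6 W" unfolding P_def by (rule psi_square[OF onP])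
   then have N: "psi W P ^ 2 = x0 ^ 3 * (4 + \<beta>2 + 2 * \<beta>4 + \<beta>6)" unfolding \<beta>' by Groebner_Basis.algebra
   have "x0 ^ 3 * (x0 * D 1) = x0 ^ 3 * ((4 + \<beta>2 + 2 * \<beta>4 + \<beta>6) * x2)" using dd N by Groebner_Basis.algebra
   then have "x0 * D 1 = (4 + \<beta>2 + 2 * \<beta>4 + \<beta>6) * x2" using x0 by simp
   then have \<xi>2: "x0 / x2 * D 1 = 4 + \<beta>2 + 2 * \<beta>4 + \<beta>6" using x2 by simp
   have n2: "ec_add W (ec_neg W P) (ec_neg W P) = ec_neg W (ec_add W P P)"
    using E.inv_mult[of P P] inv_ec_group[OF W] Pec E.m_closed[of P P] by simp
   have "Q = P \<or> Q = ec_neg W P"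
    using on_ec_same_x[OF onP, of y] onQ True unfolding P_def Q' by (auto simp: algebra_simps eq_neg_iff_add_eq_0)
   then show ?thesis
   proof
    assume "Q = P"
    moreover have "ec_add W (ec_neg W P) P = Infinity" using ec_add_comm[OF ec_neg_ec[OF Pec] Pec] by simp
    ultimately show ?thesis using \<xi>2 x2 t t1 2(1) by (simp add: good_def \<xi>_def algebra_simps)
   next
    assume "Q = ec_neg W P"
    then show ?thesis using \<xi>2 x2 t t1 2(1) n2 by (simp add: good_def \<xi>_def algebra_simps)
   qed
  qed
 qed

 define R where "R k = P [^]\<^bsub>ec_group W\<^esub> (k::nat)" for k
 have R: "R k \<in> ec W" "R (Suc k) = ec_add W P (R k)" "ec_add W (ec_neg W P) (R (Suc k)) = R k" for k
 proof -
  show Rk: "R k \<in> ec W" for k using E.nat_pow_closed[of P k] Pec by (simp add: R_def)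
  show Rs: "R (Suc k) = ec_add W P (R k)" for k using ec_add_comm[OF Pec Rk] by (simp add: R_def)
  show "ec_add W (ec_neg W P) (R (Suc k)) = R k"
   unfolding Rs using E.m_assoc[of "ec_neg W P" P "R k"] ec_neg_ec[OF Pec] Pec Rk[of k] ec_add_comm[OF ec_neg_ec[OF Pec] Pec] by simp
 qed
 \<comment> \<open>Two consecutive multiples are carried along, because the recurrence expresses xi
   at (k + 2) P by the values at its two predecessors.\<close>
 have "good (R k) \<and> \<xi> (R k) - of_nat k ^ 2 \<in> mx \<and> good (R (Suc k)) \<and> \<xi> (R (Suc k)) - of_nat (Suc k) ^ 2 \<in> mx" for k
 proof (induction k)
  case 0
  have "R (Suc 0) = P" using R(2)[of 0] by (simp add: R_def)
  then show ?case using x0 mx_0 by (simp add: R_def good_def \<xi>_def P_def)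
 next
  case (Suc k)
  define s t v where "s = \<xi> (R k)" and "t = \<xi> (R (Suc k))" and "v = \<xi> (R (Suc (Suc k)))"
  have IH: "s - of_nat k ^ 2 \<in> mx" "t - of_nat (Suc k) ^ 2 \<in> mx" using Suc by (auto simp: s_def t_def)
  have "t - of_nat (Suc k) ^ 2 + of_nat (Suc k) ^ 2 \<in> A" "s - of_nat k ^ 2 + of_nat k ^ 2 \<in> A"
   by (intro AD(6,7,8) mx_A[OF IH(2)] mx_A[OF IH(1)])+
  then have tA: "t \<in> A" "s \<in> A" by simp_all
  have g: "good (R (Suc (Suc k)))" and e: "(v + s) * D t = 2 * (t + 1) + \<beta>2 * t + \<beta>4 * (t + 1) * t + \<beta>6 * t ^ 2"
   using step[OF R(1)[of "Suc k"]] Suc tA unfolding R(3) R(2)[of "Suc k", symmetric] s_def t_def v_def by auto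
  have "inverse (D t) \<in> A" "D t ~= 0" using D[OF tA(1)] unfolding unit_iff by blast+
  moreover have "(v + s) = inverse (D t) * (2 * (t + 1) + \<beta>2 * t + \<beta>4 * (t + 1) * t + \<beta>6 * t ^ 2)"
   unfolding e[symmetric] using \<open>D t ~= 0\<close> by simp
  moreover have "2 * (t + 1) + \<beta>2 * t + \<beta>4 * (t + 1) * t + \<beta>6 * t ^ 2 \<in> A"
   using tA \<beta>[THEN mx_A] by (intro AD(4,6,7,10,1))
  ultimately have vs: "v + s \<in> A" using AD(4) by metis
  define \<epsilon> where "\<epsilon> = \<beta>2 * t + \<beta>4 * (t + 1) * t + \<beta>6 * t ^ 2 + (\<beta>4 * t + \<beta>6 * (t + 1) * t + \<beta>8 * t ^ 2) * (v + s)"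
  have \<epsilon>: "\<epsilon> \<in> mx"
   unfolding \<epsilon>_def using tA \<beta> vs AD(6)[OF tA(1) AD(1)] by (intro mx_add mx_mult(2) AD(7))
  \<comment> \<open>The main term of the recurrence is v + s = 2 (t + 1), and the squares satisfy it
    exactly: (k + 2)^2 + k^2 = 2 (k + 1)^2 + 2.\<close>
  have "v - of_nat (Suc (Suc k)) ^ 2 = 2 * (t - of_nat (Suc k) ^ 2) - (s - of_nat k ^ 2) + \<epsilon>"
   using e unfolding D_def \<epsilon>_def of_nat_Suc by Groebner_Basis.algebra
  moreover have "2 * (t - of_nat (Suc k) ^ 2) - (s - of_nat k ^ 2) + \<epsilon> \<in> mx"
   using mx_add[OF mx_diff[OF mx_mult(1)[OF AD(10) IH(2)] IH(1)] \<epsilon>] .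
  ultimately show ?case using Suc g by (simp add: v_def)
 qed
 from this[of n] have "\<xi> Infinity - of_nat n ^ 2 \<in> mx" using P(2) by (simp add: R_def P_def)
 then have "of_nat n ^ 2 \<in> mx" using mx_minus[of "- (of_nat n ^ 2)"] by (simp add: \<xi>_def)
 then show False using unit_power[OF n(2), of 2] by blast
qed

lemma double_integral:
 fixes n :: nat
 assumes P: "Affine x y \<in> ec W" "Affine x y [^]\<^bsub>ec_group W\<^esub> n = Infinity" and n: "odd n" "of_nat n \<in> A - mx"
 shows "x \<in> A" "\<exists>x2 y2. ec_add W (Affine x y) (Affine x y) = Affine x2 y2 \<and> x2 \<in> A \<and> on_ec W x2 y2 \<and>
   Affine x2 y2 [^]\<^bsub>ec_group W\<^esub> n = Infinity \<and> psi W (Affine x y) ^ 2 * x2 = x ^ 4 - b4 W * x ^ 2 - 2 * b6 W * x - b8 W"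
proof -
 show "x \<in> A" by (rule x_integral[OF P n])
 have on: "on_ec W x y" using P by simp
 have "psi W (Affine x y) ~= 0" using odd_no_2_torsion[OF P n(1)] by blast
 then obtain x2 y2 where 2: "ec_add W (Affine x y) (Affine x y) = Affine x2 y2"
  "psi W (Affine x y) ^ 2 * x2 = x ^ 4 - b4 W * x ^ 2 - 2 * b6 W * x - b8 W"
  using double_abscissa[OF on] by blast
 have 3: "Affine x2 y2 \<in> ec W" using E.m_closed[of "Affine x y" "Affine x y"] P(1) unfolding 2(1)[symmetric] by simp
 have "Affine x2 y2 [^]\<^bsub>ec_group W\<^esub> n = Affine x y [^]\<^bsub>ec_group W\<^esub> n \<otimes>\<^bsub>ec_group W\<^esub> Affine x y [^]\<^bsub>ec_group W\<^esub> n"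
  using E.pow_mult_distrib[of "Affine x y" "Affine x y" n] P(1) 2(1) by simp
 then have "Affine x2 y2 [^]\<^bsub>ec_group W\<^esub> n = Infinity" using P(2) by simp
 then show "\<exists>x2 y2. ec_add W (Affine x y) (Affine x y) = Affine x2 y2 \<and> x2 \<in> A \<and> on_ec W x2 y2 \<and>
   Affine x2 y2 [^]\<^bsub>ec_group W\<^esub> n = Infinity \<and> psi W (Affine x y) ^ 2 * x2 = x ^ 4 - b4 W * x ^ 2 - 2 * b6 W * x - b8 W"
  using 2 3 x_integral[OF 3 _ n] by auto
qed

text \<open>The discriminant is a combination, with coefficients in A, of \<open>psi\<close>(P)^2
  and of the duplication numerator \<open>psi\<close>(P)^2 x(2 P). If \<open>psi\<close>(P) were in
  the maximal ideal, so would be the discriminant.\<close>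

lemma psi_unit:
 fixes n :: nat
 assumes \<Delta>: "disc W \<in> A - mx"
  and P: "P \<in> ec W" "P ~= Infinity" "P [^]\<^bsub>ec_group W\<^esub> n = Infinity" and n: "odd n" "of_nat n \<in> A - mx"
 shows "psi W P \<in> A - mx"
proof -
 obtain x y where xy: "P = Affine x y" using P by (cases P) auto
 obtain x2 where x: "x \<in> A" "x2 \<in> A" "psi W P ^ 2 * x2 = x ^ 4 - b4 W * x ^ 2 - 2 * b6 W * x - b8 W"
  using double_integral[of x y n] P n unfolding xy by blast
 have p: "psi W P ^ 2 = 4 * x ^ 3 + b2 W * x ^ 2 + 2 * b4 W * x + b6 W"
  unfolding xy by (rule psi_square) (use P xy in simp)
 then have "psi W P ^ 2 \<in> A" using x b by (simp add: AD)
 then have pA: "psi W P \<in> A" by (rule A_power) simp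
 have "psi W P \<notin> mx"
 proof
  assume m: "psi W P \<in> mx"
  then have m2: "psi W P ^ 2 \<in> mx" using mx_mult(1)[OF pA m] by (simp add: power2_eq_square)
  have "disc W = (b2 W ^ 2 - 32 * b4 W - 8 * x * b2 W - 48 * x ^ 2) * (psi W P ^ 2 * x2)
    + (12 * x ^ 3 - x ^ 2 * b2 W - 10 * x * b4 W + b2 W * b4 W - 27 * b6 W) * psi W P ^ 2"
   unfolding x(3) unfolding p disc_def using b8_relation[of W] by Groebner_Basis.algebra
  moreover have "\<dots> \<in> mx"
   by (rule mx_add[OF mx_mult(1)[OF _ mx_mult(2)[OF x(2) m2]] mx_mult(1)[OF _ m2]])
    (use x(1) b in \<open>auto intro!: AD(3,4,6,7,10)\<close>)
  ultimately show False using \<Delta> by simp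
 qed
 then show ?thesis using pA by blast
qed

end

end

text \<open>The numbers r, s and t are solved from the prescribed b2, a1 and a3. Then c4 and c6
  determine b4 and b6, and with them the remaining coefficients.\<close>

lemma change_variables_exists:
 assumes u: "u ~= 0" and c4: "c4 W = u ^ 4 * c4 W'" and c6: "c6 W = u ^ 6 * c6 W'"
 defines "r \<equiv> (u ^ 2 * b2 W' - b2 W) / 12" and "s \<equiv> (u * a1 W' - a1 W) / 2"
 defines "t \<equiv> (u ^ 3 * a3 W' - a3 W - r * a1 W) / 2"
 shows "W' = change_variables u r s t W"
proof -
 define V where "V = change_variables u r s t W"
 have a1: "a1 V = a1 W'" and a3: "a3 V = a3 W'" using u by (simp_all add: V_def change_variables_def s_def t_def)
 have "u ^ 2 * b2 V = u ^ 2 * b2 W'" using cv_b(1)[OF u V_def] by (simp add: r_def)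
 then have b2: "b2 V = b2 W'" using u by simp
 then have a2: "a2 V = a2 W'" using a1 by (simp add: b2_def)
 have "u ^ 4 * c4 V = u ^ 4 * c4 W'" "u ^ 6 * c6 V = u ^ 6 * c6 W'" using cv_c4[OF u V_def] cv_c6[OF u V_def] c4 c6 by metis+
 then have c: "c4 V = c4 W'" "c6 V = c6 W'" using u by simp_all
 then have b4: "b4 V = b4 W'" using b2 by (simp add: c4_def)
 then have "b6 V = b6 W'" using b2 c(2) by (simp add: c6_def)
 moreover have "a4 V = a4 W'" using b4 a1 a3 by (simp add: b4_def)
 ultimately have "a6 V = a6 W'" using a3 by (simp add: b6_def)
 then show ?thesis using a1 a2 a3 \<open>a4 V = a4 W'\<close> unfolding V_def[symmetric] by (simp add: weierstrass.expand)
qed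

text \<open>A model of the curve with given \<open>j = 1728 + 1 / t\<close>.\<close>

definition tate :: "complex => complex weierstrass"
 where "tate t = Weierstrass 1 0 0 (- 36 * t) (- t)"

lemma tate_simps: "a1 (tate t) = 1" "a2 (tate t) = 0" "a3 (tate t) = 0" "a4 (tate t) = - 36 * t" "a6 (tate t) = - t"
 "b2 (tate t) = 1" "b4 (tate t) = - 72 * t" "b6 (tate t) = - 4 * t" "b8 (tate t) = - t - 1296 * t ^ 2"
 "c4 (tate t) = 1 + 1728 * t" "c6 (tate t) = - (1 + 1728 * t)"
 by (simp_all add: tate_def b2_def b4_def b6_def b8_def c4_def c6_def power_mult_distrib)

lemma disc_tate: "disc (tate t) = t * (1 + 1728 * t) ^ 2"
 by (simp add: disc_def tate_simps power2_eq_square power3_eq_cube algebra_simps)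

section \<open>Torsion on a model whose j is not integral\<close>

context place
begin

text \<open>The factors 1 + 4 w are what is kept of \<open>psi\<close>^2 up to squares; their shape
  carries the information at q = 2.\<close>

lemma prod_1_4: "finite I ==> (\<And>i. i \<in> I ==> w i \<in> A) ==> \<exists>v\<in>A. (\<Prod>i\<in>I. 1 + 4 * w i) = 1 + 4 * v"
proof (induction I rule: finite_induct)
 case empty
 then show ?case using AD(2) by force
next
 case (insert i I)
 then obtain v where v: "v \<in> A" "(\<Prod>i\<in>I. 1 + 4 * w i) = 1 + 4 * v" by blast
 have "(\<Prod>i\<in>insert i I. 1 + 4 * w i) = 1 + 4 * (w i + v + 4 * w i * v)"
  using insert.hyps v(2) by (simp add: algebra_simps)
 moreover have "w i + v + 4 * w i * v \<in> A" using insert.prems v(1) by (intro AD(4,6,10)) auto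
 ultimately show ?case by blast
qed

lemma unit_factor: "x \<in> A ==> y \<in> A ==> x * y \<in> A - mx ==> x \<in> A - mx \<and> y \<in> A - mx"
 using mx_mult by blast

text \<open>Modulo the maximal ideal the curve is y^2 + x y = x^3, with a node at the origin. If x^2
  / t were integral, the double of the point would have a unit as abscissa, and so would all further
  doubles; but 2^(p-1) times the point is the point itself, and x is not a unit. Hence t / x^2 lies
  in the maximal ideal, and \<open>psi\<close>^2 is x^2 up to a factor in 1 + 4 A.\<close>

lemma tate_psi:
 fixes p :: nat
 assumes t: "t \<in> mx" "t ~= 0" and P: "Affine x y \<in> ec (tate t)" "Affine x y [^]\<^bsub>ec_group (tate t)\<^esub> p = Infinity"
  and p: "prime p" "odd p" "of_nat p \<in> A - mx"
 shows "x ~= 0" "\<exists>w\<in>A. psi (tate t) (Affine x y) ^ 2 = x ^ 2 * (1 + 4 * w) \<and> 1 + 4 * w \<in> A - mx"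
proof -
 have tA: "t \<in> A" using t mx_A by blast
 have "1 + 1728 * t \<in> A - mx" using one_mx AD(1) mx_mult(1)[OF AD(10) t(1)] by (intro unit_add(1)) auto
 then have d: "disc (tate t) ~= 0" using t(2) mx_0 by (auto simp: disc_tate)
 have b: "b2 (tate t) \<in> A" "b4 (tate t) \<in> A" "b6 (tate t) \<in> A" "b8 (tate t) \<in> A"
  unfolding tate_simps using tA by (intro AD | simp)+
 interpret E: comm_group "ec_group (tate t)" by (rule comm_group_ec_group[OF d])
 note dbl = double_integral[OF d b _ _ p(2,3), unfolded tate_simps]
 have psi2: "psi (tate t) (Affine x' y') ^ 2 = 4 * x' ^ 3 + x' ^ 2 - 144 * t * x' - 4 * t" if "on_ec (tate t) x' y'" for x' y'
  using psi_square[OF that] unfolding tate_simps by Groebner_Basis.algebra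
 have unit_double: "psi (tate t) (Affine x' y') ^ 2 \<in> A - mx \<and> x2 \<in> A - mx"
  if on: "on_ec (tate t) x' y'" and x': "x' \<in> A - mx" and x2: "x2 \<in> A"
   "psi (tate t) (Affine x' y') ^ 2 * x2 = x' ^ 4 - (- 72 * t) * x' ^ 2 - 2 * (- 4 * t) * x' - (- t - 1296 * t ^ 2)" for x' y' x2
 proof (rule unit_factor)
  show "psi (tate t) (Affine x' y') ^ 2 \<in> A" unfolding psi2[OF on] using x' tA by (intro AD(3,4,6,7,10)) auto
  have "x' ^ 4 + t * (72 * x' ^ 2 + 8 * x' + 1 + 1296 * t) \<in> A - mx"
   using x' tA by (intro unit_add(1)[OF unit_power[OF x']] mx_mult(2)[OF _ t(1)] AD(4,6,7,10,1)) auto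
  moreover have "psi (tate t) (Affine x' y') ^ 2 * x2 = x' ^ 4 + t * (72 * x' ^ 2 + 8 * x' + 1 + 1296 * t)"
   unfolding x2(2) by Groebner_Basis.algebra
  ultimately show "psi (tate t) (Affine x' y') ^ 2 * x2 \<in> A - mx" by simp
 qed (rule x2(1))
 have on: "on_ec (tate t) x y" using P by simp
 have xA: "x \<in> A" using dbl(1)[OF P] .
 have ns: "x ^ 2 / t \<notin> A"
 proof
  define s where "s = x ^ 2 / t"
  assume "x ^ 2 / t \<in> A"
  then have s: "s \<in> A" "x ^ 2 = s * t" using t(2) by (simp_all add: s_def)
  then have "x ^ 2 \<in> mx" using mx_mult(1)[OF s(1) t(1)] by simp
  then have x: "x \<in> mx" using mx_power[OF xA] by blast
  have iter: "\<exists>x' y'. Affine x y [^]\<^bsub>ec_group (tate t)\<^esub> ((2::nat) ^ Suc k) = Affine x' y' \<and> x' \<in> A - mx \<and> on_ec (tate t) x' y' \<and>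
    Affine x' y' [^]\<^bsub>ec_group (tate t)\<^esub> p = Infinity" for k
  proof (induction k)
   case 0
   obtain x2 y2 where 2: "ec_add (tate t) (Affine x y) (Affine x y) = Affine x2 y2" "x2 \<in> A" "on_ec (tate t) x2 y2"
    "Affine x2 y2 [^]\<^bsub>ec_group (tate t)\<^esub> p = Infinity"
    "psi (tate t) (Affine x y) ^ 2 * x2 = x ^ 4 - (- 72 * t) * x ^ 2 - 2 * (- 4 * t) * x - (- t - 1296 * t ^ 2)"
    using dbl(2)[OF P] by blast
   \<comment> \<open>The two sides of the duplication formula divided by t, which is possible
     because x^2 = s t.\<close>
   define \<kappa> \<rho> where "\<kappa> = s * (1 + 4 * x) - 144 * x - 4" and "\<rho> = 1 + (s * x + 72 * x + 8) * x + 1296 * t"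
   have "t * (\<kappa> * x2) = t * \<rho>"
    using 2(5) s(2) unfolding psi2[OF on] \<kappa>_def \<rho>_def by Groebner_Basis.algebra
   then have "\<kappa> * x2 = \<rho>" using t(2) by simp
   moreover have "\<rho> \<in> A - mx"
    unfolding \<rho>_def using x t xA s one_mx
    by (intro unit_add(1) mx_mult(1)) (auto intro!: AD(4,6,10) simp: AD)
   moreover have "\<kappa> \<in> A" unfolding \<kappa>_def using xA s by (intro AD(1,3,4,6,10)) auto
   ultimately have "x2 \<in> A - mx" using unit_factor[of \<kappa> x2] 2(2) by simp
   moreover have "Affine x y [^]\<^bsub>ec_group (tate t)\<^esub> ((2::nat) ^ Suc 0) = Affine x2 y2"
    using 2(1) P(1) by (simp add: numeral_2_eq_2)
   ultimately show ?case using 2 by blast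
  next
   case (Suc k)
   then obtain x' y' where R: "Affine x y [^]\<^bsub>ec_group (tate t)\<^esub> ((2::nat) ^ Suc k) = Affine x' y'" "x' \<in> A - mx" "on_ec (tate t) x' y'"
    "Affine x' y' [^]\<^bsub>ec_group (tate t)\<^esub> p = Infinity" by blast
   obtain x2 y2 where 2: "ec_add (tate t) (Affine x' y') (Affine x' y') = Affine x2 y2" "x2 \<in> A" "on_ec (tate t) x2 y2"
    "Affine x2 y2 [^]\<^bsub>ec_group (tate t)\<^esub> p = Infinity"
    "psi (tate t) (Affine x' y') ^ 2 * x2 = x' ^ 4 - (- 72 * t) * x' ^ 2 - 2 * (- 4 * t) * x' - (- t - 1296 * t ^ 2)"
    using dbl(2)[of x' y'] R by auto
   have "x2 \<in> A - mx" using unit_double[OF R(3,2) 2(2,5)] by blast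
   moreover have "Affine x y [^]\<^bsub>ec_group (tate t)\<^esub> ((2::nat) ^ Suc (Suc k)) = Affine x2 y2"
   proof -
    have "(2::nat) ^ Suc (Suc k) = 2 ^ Suc k + 2 ^ Suc k" by simp
    then have "Affine x y [^]\<^bsub>ec_group (tate t)\<^esub> ((2::nat) ^ Suc (Suc k)) = Affine x' y' \<otimes>\<^bsub>ec_group (tate t)\<^esub> Affine x' y'"
     using E.nat_pow_mult[of "Affine x y" "2 ^ Suc k" "2 ^ Suc k"] P(1) unfolding R(1) by simp
    then show ?thesis using 2(1) by simp
   qed
   ultimately show ?case using 2 by blast
  qed
  \<comment> \<open>Fermat's little theorem closes the chain of doublings.\<close>
  have "[2 ^ (p - 1) = 1] (mod p)"
   by (rule fermat_theorem) (use p primes_dvd_imp_eq[of p 2] in auto)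
  then have "p dvd 2 ^ (p - 1) - 1" by (simp add: cong_altdef_nat)
  then obtain m where "2 ^ (p - 1) - 1 = p * m" by blast
  moreover have "(2::nat) ^ (p - 1) \<ge> 1" by simp
  ultimately have m: "2 ^ (p - 1) = p * m + 1" by linarith
  have "p - 1 = Suc (p - 2)" using prime_ge_2_nat[OF p(1)] by simp
  then obtain x' y' where R: "Affine x y [^]\<^bsub>ec_group (tate t)\<^esub> ((2::nat) ^ (p - 1)) = Affine x' y'" "x' \<in> A - mx"
   using iter[of "p - 2"] by metis
  have "Affine x y [^]\<^bsub>ec_group (tate t)\<^esub> ((2::nat) ^ (p - 1)) = (Affine x y [^]\<^bsub>ec_group (tate t)\<^esub> p) [^]\<^bsub>ec_group (tate t)\<^esub> m \<otimes>\<^bsub>ec_group (tate t)\<^esub> Affine x y"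
   unfolding m using P(1) E.nat_pow_pow[of "Affine x y" p m] by simp
  then have "x' = x" using R(1) P(2) E.nat_pow_one[of m] by simp
  then show False using R(2) x by blast
 qed
 show x0: "x ~= 0"
 proof
  assume "x = 0"
  then show False using ns AD(2) by simp
 qed
 define \<tau> where "\<tau> = t / x ^ 2"
 have \<tau>: "\<tau> \<in> mx" "t = \<tau> * x ^ 2" using not_A[OF ns] x0 by (simp_all add: \<tau>_def)
 have \<tau>A: "\<tau> \<in> A" using \<tau>(1) mx_A by blast
 define w where "w = x - 36 * x * \<tau> - \<tau>"
 have w: "w \<in> A" unfolding w_def using xA \<tau>A by (intro AD(3,4,10))
 have e: "psi (tate t) (Affine x y) ^ 2 = x ^ 2 * (1 + 4 * w)"
  unfolding psi2[OF on] w_def using \<tau>(2) by Groebner_Basis.algebra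
 \<comment> \<open>If x is in the maximal ideal, so is w. If x is a unit, then \<open>psi\<close>^2
   is one by the duplication formula, and 1 + 4 w is a factor of it.\<close>
 have "1 + 4 * w \<in> A - mx"
 proof (cases "x \<in> mx")
  case True
  have "w \<in> mx" unfolding w_def using True \<tau>(1) xA by (intro mx_diff mx_mult(1) AD(4,10))
  then show ?thesis using one_mx AD(1) mx_mult(1)[OF AD(10)] by (intro unit_add(1)) auto
 next
  case False
  obtain x2 where "x2 \<in> A" "psi (tate t) (Affine x y) ^ 2 * x2 = x ^ 4 - (- 72 * t) * x ^ 2 - 2 * (- 4 * t) * x - (- t - 1296 * t ^ 2)"
   using dbl(2)[OF P] by blast
  then have "x ^ 2 * (1 + 4 * w) \<in> A - mx" using unit_double[OF on] xA False unfolding e by blast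
  moreover have "1 + 4 * w \<in> A" using w by (intro AD(1,4,6,10))
  ultimately show ?thesis using unit_factor[OF AD(7)[OF xA]] by blast
 qed
 then show "\<exists>w\<in>A. psi (tate t) (Affine x y) ^ 2 = x ^ 2 * (1 + 4 * w) \<and> 1 + 4 * w \<in> A - mx" using e w by blast
qed

end

section \<open>Half products at a place prime to p\<close>

locale local_curve = odd_torsion_curve + place +
 assumes qp: "q ~= p"
begin

lemma p_unit: "of_nat p \<in> A - mx"
 using nat_unit primes_dvd_imp_eq[OF q p] qp by blast

context
 fixes Z H
 assumes Z: "stable Z" and H: "half W Z H"
begin

lemma cv_H:
 assumes u: "u ~= 0" and W': "W' = change_variables u r s t W" and P: "P \<in> H"
 shows "cv u r s t P \<in> ec W'" "cv u r s t P ~= Infinity" "cv u r s t P [^]\<^bsub>ec_group W'\<^esub> p = Infinity"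
proof -
 have Pn: "P \<in> nz" using Z_tors[OF Z H] P by blast
 then have Pt: "P \<in> ec W" "P [^]\<^bsub>E\<^esub> p = Infinity" by (simp_all add: tors_def)
 show "cv u r s t P \<in> ec W'" using cv_ec[OF u W'] Pt by simp
 show "cv u r s t P ~= Infinity" using Pn by (cases P) auto
 show "cv u r s t P [^]\<^bsub>ec_group W'\<^esub> p = Infinity" using cv_pow[OF u W' disc_W Pt(1), of p] Pt(2) by simp
qed

text \<open>With h factors, the fourth power of the half product and the h-th power of the
  discriminant scale by the same u^(12 h). Their quotient is a rational number and a unit of A, even
  though u need not be rational.\<close>

lemma rmult_good:
 assumes u: "u ~= 0" and W': "W' = change_variables u r s t W"
  and b: "b2 W' \<in> A" "b4 W' \<in> A" "b6 W' \<in> A" "b8 W' \<in> A" and d: "disc W' \<in> A - mx"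
 shows "2 * rmult q (psiprod H ^ 2) = int (card H) * rmult q (disc W)"
proof -
 have d0: "disc W' ~= 0" using d mx_0 by auto
 define Q where "Q = (\<Prod>P\<in>H. psi W' (cv u r s t P))"
 have Q: "Q \<in> A - mx"
  unfolding Q_def by (rule unit_prod) (rule psi_unit[OF d0 b d cv_H[OF u W'] odd_p p_unit])
 have Y: "psiprod H = (u ^ 3) ^ card H * Q"
  unfolding Q_def using cv_psi[OF u W'] by (simp add: prod.distrib)
 have D: "psiprod H ^ 2 \<in> \<rat>" "psiprod H ^ 2 ~= 0" using psiprod_square[OF Z H] psiprod(2)[OF Z H] by simp_all
 have dr: "disc W \<in> \<rat>" unfolding disc_def b2_def b4_def b6_def b8_def using coeffs
  by (intro Rats_diff Rats_add Rats_mult Rats_power Rats_minus_iff[THEN iffD2]) auto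
 have "(psiprod H ^ 2) ^ 2 = u ^ (12 * card H) * Q ^ 4" unfolding Y by (simp add: power_mult_distrib flip: power_mult)
 moreover have "disc W ^ card H = u ^ (12 * card H) * disc W' ^ card H"
  unfolding cv_disc[OF u W'] by (simp add: power_mult_distrib flip: power_mult)
 ultimately have "(psiprod H ^ 2) ^ 2 / disc W ^ card H = Q ^ 4 / disc W' ^ card H" using u by simp
 moreover have "Q ^ 4 / disc W' ^ card H \<in> A - mx" using unit_divide unit_power Q d by blast
 moreover have "(psiprod H ^ 2) ^ 2 / disc W ^ card H \<in> \<rat>" by (rule Rats_divide[OF Rats_power[OF D(1)] Rats_power[OF dr]])
 ultimately have "rmult q ((psiprod H ^ 2) ^ 2 / disc W ^ card H) = 0" using rmult_unit by metis
 moreover have "(psiprod H ^ 2) ^ 2 ~= 0" "disc W ^ card H ~= 0" using D(2) disc_W by simp_all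
 ultimately show ?thesis
  using rmult_divide[OF q Rats_power[OF D(1), of 2] Rats_power[OF dr, of "card H"]]
   rmult_power[OF q D, of 2] rmult_power[OF q dr disc_W, of "card H"] by linarith
qed

text \<open>Single factors are irrational, but u^2, the product of the g P and the square of the
  half product are rational. Hence so is v in the remaining factor 1 + 4 v, and v lies in the
  intersection of A with the rationals, which is \<open>Zq q\<close>.\<close>

lemma square_class:
 assumes u: "u ~= 0" "u ^ 2 \<in> \<rat>" and W': "W' = change_variables u r s t W"
  and g: "(\<Prod>P\<in>H. g P) \<in> \<rat>" "\<And>P. P \<in> H ==> g P ~= 0"
  and e: "\<And>P. P \<in> H ==> \<exists>w\<in>A. psi W' (cv u r s t P) ^ 2 = g P ^ 2 * (1 + 4 * w) \<and> 1 + 4 * w \<in> A - mx"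
 shows "\<exists>x\<in>\<rat>. \<exists>w\<in>Zq q. x ~= 0 \<and> psiprod H ^ 2 = (u ^ 2) ^ (3 * card H) * x ^ 2 * (1 + 4 * w) \<and> 1 + 4 * w \<in> A - mx"
proof -
 obtain w where w: "\<And>P. P \<in> H ==> w P \<in> A \<and> psi W' (cv u r s t P) ^ 2 = g P ^ 2 * (1 + 4 * w P) \<and> 1 + 4 * w P \<in> A - mx"
  using e by metis
 have fin: "finite H" using Z_tors[OF Z H] by blast
 obtain v where v: "v \<in> A" "(\<Prod>P\<in>H. 1 + 4 * w P) = 1 + 4 * v" using prod_1_4[OF fin] w by metis
 define x where "x = (\<Prod>P\<in>H. g P)"
 have x: "x \<in> \<rat>" "x ~= 0" using g fin by (simp_all add: x_def prod_zero_iff)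
 have "psiprod H ^ 2 = (\<Prod>P\<in>H. (u ^ 2) ^ 3 * (g P ^ 2 * (1 + 4 * w P)))"
  unfolding prod_power_distrib
 proof (rule prod.cong[OF refl])
  fix P assume "P \<in> H"
  have "psi W P ^ 2 = (u ^ 2) ^ 3 * psi W' (cv u r s t P) ^ 2"
   unfolding cv_psi[OF u(1) W', of P] by Groebner_Basis.algebra
  then show "psi W P ^ 2 = (u ^ 2) ^ 3 * (g P ^ 2 * (1 + 4 * w P))" using w[OF \<open>P \<in> H\<close>] by simp
 qed
 also have "\<dots> = (u ^ 2) ^ (3 * card H) * (x ^ 2 * (1 + 4 * v))"
  by (simp add: prod.distrib v(2) x_def flip: prod_power_distrib power_mult)
 finally have D: "psiprod H ^ 2 = (u ^ 2) ^ (3 * card H) * x ^ 2 * (1 + 4 * v)" by simp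
 define c where "c = (u ^ 2) ^ (3 * card H) * x ^ 2"
 have c: "c \<in> \<rat>" "c ~= 0" unfolding c_def using u x by auto
 have "(psiprod H ^ 2 / c - 1) / 4 = v" unfolding D using c by (simp add: c_def)
 moreover have "(psiprod H ^ 2 / c - 1) / 4 \<in> \<rat>" using psiprod_square[OF Z H] c by auto
 ultimately have "v \<in> A \<inter> \<rat>" using v(1) by simp
 moreover have "1 + 4 * v \<in> A - mx" using unit_prod[of H "\<lambda>P. 1 + 4 * w P"] w v(2) by auto
 ultimately show ?thesis using x D unfolding A_Rats by blast
qed

text \<open>A function of the abscissa takes the same value at P and its negative, so the product
  over representatives is Galois invariant.\<close>

lemma even_rational_prod:
 assumes f: "\<And>x y. f (Affine x y) = c * x + d" and cd: "c \<in> \<rat>" "d \<in> \<rat>"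
 shows "(\<Prod>P\<in>H. f P) \<in> \<rat>"
proof (rule even_prod_rational[OF Z H])
 note D = csubringD[OF csubfieldD(1)[OF M(1)]] csubfieldD(4)[OF M(1)]
 fix P assume P: "P \<in> Z"
 then have Pn: "P \<in> nz" "P \<in> pts M" using Z M(2) by (auto simp: stable_def)
 then obtain x y where xy: "P = Affine x y" "x \<in> M" "P \<in> nz" by (cases P) auto
 show "f P \<in> M" "f (neg P) = f P" using xy D cd by (simp_all add: f)
 fix \<sigma> assume s: "\<sigma> \<in> carrier GG"
 show "f (map_point \<sigma> P) = \<sigma> (f P)"
  using xy D cd fhomD(6,8)[OF GG_hom[OF s]] fhomD(12)[OF GG_hom[OF s]] by (simp add: f)
qed

lemma square_class_tate:
 assumes u: "u ~= 0" "u ^ 2 \<in> \<rat>" and W': "tate t = change_variables u r s v W" and t: "t \<in> mx" "t ~= 0" and r: "r \<in> \<rat>"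
 shows "\<exists>x\<in>\<rat>. \<exists>w\<in>Zq q. x ~= 0 \<and> psiprod H ^ 2 = (u ^ 2) ^ (3 * card H) * x ^ 2 * (1 + 4 * w) \<and> 1 + 4 * w \<in> A - mx"
proof -
 define g where "g P = (case cv u r s v P of Affine x y => x | Infinity => 0)" for P
 have gx: "\<exists>x y. cv u r s v P = Affine x y \<and> g P = x" if "P \<in> H" for P
  using cv_H(2)[OF u(1) W' that] by (cases "cv u r s v P") (auto simp: g_def)
 have tp: "g P ~= 0 \<and> (\<exists>w\<in>A. psi (tate t) (cv u r s v P) ^ 2 = g P ^ 2 * (1 + 4 * w) \<and> 1 + 4 * w \<in> A - mx)" if P: "P \<in> H" for P
 proof -
  obtain x y where xy: "cv u r s v P = Affine x y" "g P = x" using gx[OF P] by blast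
  show ?thesis using tate_psi[OF t _ _ p odd_p p_unit, of x y] cv_H[OF u(1) W' P] unfolding xy by blast
 qed
 have "(\<Prod>P\<in>H. g P) \<in> \<rat>"
  by (rule even_rational_prod[of _ "1 / u ^ 2" "- r / u ^ 2"]) (use u r in \<open>auto simp: g_def diff_divide_distrib\<close>)
 then show ?thesis using tp by (intro square_class[OF u W', of g]) auto
qed

text \<open>On a model with good reduction at 2, \<open>psi\<close>^2 = (a1 x + a3)^2 + 4 F with F
  integral. As \<open>psi\<close> is a unit and 2 is not, a1 x + a3 is a unit; it depends on the
  abscissa only, so the product of these terms is rational.\<close>

lemma square_class_good_2:
 assumes q2: "q = 2" and u: "u ~= 0" "u ^ 2 \<in> \<rat>" and W': "W' = change_variables u r s v W"
  and a: "a1 W' \<in> A \<inter> \<rat>" "a2 W' \<in> A" "a3 W' \<in> A \<inter> \<rat>" "a4 W' \<in> A" "a6 W' \<in> A" and r: "r \<in> \<rat>"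
  and d: "disc W' \<in> A - mx"
 shows "\<exists>x\<in>\<rat>. \<exists>w\<in>Zq q. x ~= 0 \<and> psiprod H ^ 2 = (u ^ 2) ^ (3 * card H) * x ^ 2 * (1 + 4 * w) \<and> 1 + 4 * w \<in> A - mx"
proof -
 have two: "2 \<in> mx" using q_mx q2 by simp
 have d0: "disc W' ~= 0" using d mx_0 by auto
 have b: "b2 W' \<in> A" "b4 W' \<in> A" "b6 W' \<in> A" "b8 W' \<in> A"
  unfolding b2_def b4_def b6_def b8_def using a by (auto intro!: AD(3,4,6,7,10))
 define g where "g P = (case cv u r s v P of Affine x y => a1 W' * x + a3 W' | Infinity => 0)" for P
 have tp: "g P ~= 0 \<and> (\<exists>w\<in>A. psi W' (cv u r s v P) ^ 2 = g P ^ 2 * (1 + 4 * w) \<and> 1 + 4 * w \<in> A - mx)" if P: "P \<in> H" for P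
 proof -
  obtain x y where xy: "cv u r s v P = Affine x y" using cv_H(2)[OF u(1) W' P] by (cases "cv u r s v P") auto
  note cP = cv_H[OF u(1) W' P, unfolded xy]
  have xA: "x \<in> A" by (rule x_integral[OF d0 b cP(1,3) odd_p p_unit])
  have unit: "psi W' (Affine x y) \<in> A - mx" by (rule psi_unit[OF d0 b d cP odd_p p_unit])
  define G F where "G = a1 W' * x + a3 W'" and "F = x ^ 3 + a2 W' * x ^ 2 + a4 W' * x + a6 W'"
  have GA: "G \<in> A" "F \<in> A" unfolding G_def F_def using a xA by (auto intro!: AD(4,6,7))
  have e: "psi W' (Affine x y) ^ 2 = G ^ 2 + 4 * F"
   using cP(1) unfolding ec_simps on_ec_def psi.simps G_def F_def by Groebner_Basis.algebra
  have "4 * F \<in> mx" using mx_mult(2)[OF GA(2) mx_mult(2)[OF AD(10)[of "num.Bit0 num.One"] two]] by simp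
  then have "G ^ 2 \<in> A - mx" using unit_add(2)[OF unit_power[OF unit, of 2], of "4 * F"] unfolding e by simp
  then have G: "inverse (G ^ 2) \<in> A" "G ~= 0" unfolding unit_iff by auto
  define w where "w = F * inverse (G ^ 2)"
  have w: "w \<in> A" unfolding w_def using G GA AD(4) by blast
  have "4 * w \<in> mx" using mx_mult(2)[OF w mx_mult(2)[OF AD(10)[of "num.Bit0 num.One"] two]] by simp
  then have "1 + 4 * w \<in> A - mx" using one_mx AD(1) by (intro unit_add(1)) auto
  moreover have "psi W' (Affine x y) ^ 2 = G ^ 2 * (1 + 4 * w)" unfolding e w_def using G(2) by (simp add: algebra_simps)
  ultimately show ?thesis using w G(2) unfolding xy g_def G_def by auto
 qed
 have "(\<Prod>P\<in>H. g P) \<in> \<rat>"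
  by (rule even_rational_prod[of _ "a1 W' / u ^ 2" "a3 W' - a1 W' * r / u ^ 2"])
   (use u r a in \<open>auto simp: g_def diff_divide_distrib right_diff_distrib\<close>)
 then show ?thesis using tp by (intro square_class[OF u W', of g]) auto
qed

end

end

section \<open>Number fields and potentially good reduction for integral j\<close>

lemma CC_pow [simp]: "x [^]\<^bsub>\<CC>\<^esub> (n::nat) = x ^ n" for x :: complex
proof -
 interpret CC: field \<CC> by (rule field_CC)
 show ?thesis by (induction n) auto
qed

lemma finite_extension_number_field:
 fixes xs :: "complex list"
 assumes "\<And>x. x \<in> set xs ==> algebraic x"
 shows "\<exists>L. number_field L \<and> csubfield L \<and> set xs \<subseteq> L"
proof -
 interpret CC: field \<CC> by (rule field_CC)
 have Q: "subfield \<rat> \<CC>" unfolding subfield_CC by (auto simp: csubfield_def csubring_def)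
 have ev: "CC.eval l x = poly (Poly (rev l)) x" for l x
  by (induction l) (auto simp: Poly_append poly_monom algebra_simps)
 have "(CC.algebraic over \<rat>) x" if x: "x \<in> set xs" for x
 proof -
  obtain u where u: "\<forall>i. coeff u i \<in> \<int>" "u ~= 0" "poly u x = 0" using assms[OF x] by (auto simp: algebraic_def)
  show ?thesis
  proof (rule CC.algebraicI[of "rev (coeffs u)"])
   have "set (coeffs u) \<subseteq> \<rat>" using u(1) Ints_subset_Rats by (auto simp: coeffs_def)
   moreover have "hd (rev (coeffs u)) ~= 0" using u(2) by (simp add: hd_rev last_coeffs_eq_coeff_degree)
   ultimately show "rev (coeffs u) \<in> carrier (\<rat> [X]\<^bsub>\<CC>\<^esub>)"
    by (auto simp: univ_poly_def polynomial_def)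
   show "rev (coeffs u) ~= []" using u(2) by simp
   show "CC.eval (rev (coeffs u)) x = \<zero>\<^bsub>\<CC>\<^esub>" unfolding ev using u(3) by simp
  qed
 qed
 then have "subfield (CC.finite_extension \<rat> xs) \<CC>" "CC.finite_dimension \<rat> (CC.finite_extension \<rat> xs)"
  using CC.finite_extension_is_subfield[OF Q, of xs] CC.finite_extension_finite_dimension(1)[OF Q, of xs] by auto
 moreover have "set xs \<subseteq> CC.finite_extension \<rat> xs"
  by (rule CC.finite_extension_mem[OF subfieldE(1)[OF Q]]) simp
 ultimately show ?thesis unfolding number_field_def subfield_CC by blast
qed

lemma csubring_ring_of_integers: "csubfield L ==> csubring (ring_of_integers L)"
 using csubring_algebraic_int csubfieldD(1)[of L] unfolding ring_of_integers_def csubring_def by auto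

lemma primes_aboveD:
 assumes L: "csubfield L" and P: "P \<in> primes_above L q"
 shows "P \<subseteq> ring_of_integers L" "of_nat q \<in> P" "0 \<in> P" "1 \<notin> P" "x \<in> P ==> y \<in> P ==> x + y \<in> P"
  "x \<in> ring_of_integers L ==> y \<in> P ==> x * y \<in> P"
  "x \<in> ring_of_integers L ==> y \<in> ring_of_integers L ==> x * y \<in> P ==> x \<in> P \<or> y \<in> P"
proof -
 let ?R = "\<CC>\<lparr>carrier := ring_of_integers L\<rparr>"
 have P': "primeideal P ?R" "of_nat q \<in> P" using P by (auto simp: primes_above_def)
 interpret P: primeideal P ?R by (rule P')
 show "of_nat q \<in> P" by (rule P')
 show sub: "P \<subseteq> ring_of_integers L" using P.a_subset by simp
 show "0 \<in> P" "x \<in> P ==> y \<in> P ==> x + y \<in> P"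
  using additive_subgroup.zero_closed[OF P.is_additive_subgroup] additive_subgroup.a_closed[OF P.is_additive_subgroup, of x y] by simp_all
 show abs: "x \<in> ring_of_integers L ==> y \<in> P ==> x * y \<in> P" for x y using P.I_l_closed[of y x] by simp
 show "x \<in> ring_of_integers L ==> y \<in> ring_of_integers L ==> x * y \<in> P ==> x \<in> P \<or> y \<in> P"
  using P.I_prime[of x y] by simp
 show "1 \<notin> P"
 proof
  assume "1 \<in> P"
  then have "ring_of_integers L \<subseteq> P" using abs[of _ 1] by auto
  then show False using P.I_notcarr sub by auto
 qed
qed

lemma common_denominator:
 fixes c :: "nat => complex"
 assumes q: "prime q" and c: "\<And>i. i < d ==> c i \<in> Zq q"
 shows "\<exists>n. \<not> int q dvd n \<and> (\<forall>i<d. of_int n * c i \<in> \<int>)"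
 using c
proof (induction d)
 case 0
 show ?case using pq[OF q] by (intro exI[of _ 1]) auto
next
 case (Suc d)
 then obtain n where n: "\<not> int q dvd n" "\<forall>i<d. of_int n * c i \<in> \<int>" by auto
 obtain a b where ab: "c d = of_int a / of_int b" "\<not> int q dvd b" using Suc.prems[of d] by (auto simp: Zq_def)
 have "b ~= 0" using ab by auto
 have "\<not> int q dvd n * b" using n(1) ab(2) pq[OF q] by (simp add: prime_dvd_mult_iff)
 moreover have "of_int (n * b) * c i \<in> \<int>" if "i < Suc d" for i
 proof (cases "i = d")
  case True
  then have "of_int (n * b) * c i = of_int (n * a)" using ab \<open>b ~= 0\<close> by simp
  then show ?thesis by (metis Ints_of_int)
 next
  case False
  then have "of_int n * c i \<in> \<int>" using n(2) that by simp
  then have "of_int b * (of_int n * c i) \<in> \<int>" by simp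
  then show ?thesis by (simp add: algebra_simps)
 qed
 ultimately show ?case by blast
qed

text \<open>Tested on valuation rings B. If x is not in B, its inverse is, and the equation divided
  by x^(d-1) writes x as a combination of powers of the inverse that is linear in the coefficients;
  so a common denominator n of these is enough.\<close>

lemma integral_multiple:
 assumes q: "prime q" and d: "d > 0" and c: "\<And>i. i < d ==> c i \<in> Zq q" and x: "x ^ d = (\<Sum>i<d. c i * x ^ i)"
 shows "\<exists>n. \<not> int q dvd n \<and> algebraic_int (of_int n * x)"
proof -
 have "\<exists>n. \<not> int q dvd n \<and> (\<forall>i<d. of_int n * c i \<in> \<int>)" by (rule common_denominator[OF q]) (rule c)
 then obtain n where n: "\<not> int q dvd n" "\<forall>i<d. of_int n * c i \<in> \<int>" by blast
 have "of_int n * x \<in> B" if B: "val_ring B" for B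
 proof (cases "x \<in> B")
  case True
  then show ?thesis using csubringD(4,9) B by (auto simp: val_ring_def)
 next
  case False
  have RB: "csubring B" using B by (simp add: val_ring_def)
  have i: "inverse x \<in> B" using B False by (auto simp: val_ring_def)
  have x0: "x ~= 0" using False csubringD(2)[OF RB] by auto
  obtain e where e: "d = Suc e" using d by (cases d) auto
  have "of_int n * x = of_int n * x ^ d * inverse x ^ e" using x0 by (simp add: e power_inverse)
  also have "\<dots> = (\<Sum>i<d. (of_int n * c i) * (x ^ i * inverse x ^ e))"
   unfolding x by (simp add: sum_distrib_left sum_distrib_right mult.assoc)
  also have "\<dots> = (\<Sum>i<d. (of_int n * c i) * inverse x ^ (e - i))"
  proof (rule sum.cong[OF refl])
   fix i assume "i \<in> {..<d}"
   then have "inverse x ^ e = inverse x ^ i * inverse x ^ (e - i)" by (simp add: e flip: power_add)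
   then have "x ^ i * inverse x ^ e = inverse x ^ (e - i)" using x0 by (simp add: power_inverse)
   then show "of_int n * c i * (x ^ i * inverse x ^ e) = of_int n * c i * inverse x ^ (e - i)" by simp
  qed
  also have "\<dots> \<in> B"
  proof (rule csubring_sum[OF RB])
   fix k assume "k \<in> {..<d}"
   then have "of_int n * c k \<in> \<int>" using n(2) by simp
   then have "of_int n * c k \<in> B" using csubringD(9)[OF RB] by (metis Ints_cases)
   then show "of_int n * c k * inverse x ^ (e - k) \<in> B" by (rule csubringD(4)[OF RB _ csubringD(7)[OF RB i]])
  qed
  finally show ?thesis .
 qed
 then show ?thesis using n(1) unfolding algebraic_int_iff_val_rings by blast
qed

context
 fixes L P q
 assumes q: "prime q" and L: "csubfield L" and P: "P \<in> primes_above L q"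
begin

lemma int_in_prime: "of_int n \<in> P ==> int q dvd n"
proof (rule ccontr)
 note D = primes_aboveD[OF L P] and R = csubringD[OF csubring_ring_of_integers[OF L]]
 assume n: "of_int n \<in> P" "\<not> int q dvd n"
 have "coprime (int q) n" using n pq[OF q] by (simp add: prime_imp_coprime)
 then obtain u v where "u * int q + v * n = 1" using bezout_int[of "int q" n] by (auto simp: coprime_iff_gcd_eq_1)
 then have "of_int u * of_nat q + of_int v * of_int n = (1::complex)" by (metis of_int_1 of_int_add of_int_mult of_int_of_nat_eq)
 moreover have "of_int u * of_nat q + of_int v * of_int n \<in> P" by (intro D(5,6) R(9) D(2) n)
 ultimately show False using D(4) by metis
qed

lemma csubring_local_ring: "csubring (local_ring L P)"
proof -
 note D = primes_aboveD[OF L P] and R = csubringD[OF csubring_ring_of_integers[OF L]]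
 have "x - y \<in> local_ring L P \<and> x * y \<in> local_ring L P" if xy: "x \<in> local_ring L P" "y \<in> local_ring L P" for x y
 proof -
  obtain a b c d where ab: "x = a / b" "a \<in> ring_of_integers L" "b \<in> ring_of_integers L - P"
   "y = c / d" "c \<in> ring_of_integers L" "d \<in> ring_of_integers L - P"
   using xy unfolding local_ring_def by blast
  have nz: "b ~= 0" "d ~= 0" using ab D(3) by auto
  have "x - y = (a * d - c * b) / (b * d)" "x * y = (a * c) / (b * d)" using ab nz by (simp_all add: diff_frac_eq)
  moreover have "b * d \<in> ring_of_integers L - P" using ab D(7) R(4) by blast
  moreover have "a * d - c * b \<in> ring_of_integers L" "a * c \<in> ring_of_integers L" using ab by (auto intro!: R(3,4))
  ultimately show ?thesis unfolding local_ring_def by blast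
 qed
 moreover have "1 = (1::complex) / 1" "1 \<in> ring_of_integers L - P" using D(4) R(1) by auto
 then have "1 \<in> local_ring L P" unfolding local_ring_def by blast
 ultimately show ?thesis by (simp add: csubring_def)
qed

lemma local_ring_integral:
 assumes "x \<in> L" "algebraic_int (of_int n * x)" "\<not> int q dvd n"
 shows "x \<in> local_ring L P"
proof -
 have "of_int n \<in> ring_of_integers L - P"
  using int_in_prime assms(3) csubringD(9)[OF csubring_ring_of_integers[OF L]] by blast
 moreover have "of_int n * x \<in> ring_of_integers L"
  using assms csubringD(4,9)[OF csubfieldD(1)[OF L]] by (simp add: ring_of_integers_def)
 moreover have "x = (of_int n * x) / of_int n" using assms(3) by auto
 ultimately show ?thesis unfolding local_ring_def by blast
qed

lemma Zq_local_ring: "Zq q \<subseteq> local_ring L P"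
proof
 fix x assume "x \<in> Zq q"
 then obtain a b where ab: "x = of_int a / of_int b" "\<not> int q dvd b" by (auto simp: Zq_def)
 have "of_int a \<in> ring_of_integers L" "of_int b \<in> ring_of_integers L - P"
  using int_in_prime ab(2) csubringD(9)[OF csubring_ring_of_integers[OF L]] by auto
 then show "x \<in> local_ring L P" using ab unfolding local_ring_def by blast
qed

lemma local_unit_not_max: "x \<in> local_ring L P ==> inverse x \<in> local_ring L P ==> x ~= 0 ==> x \<notin> local_max_ideal L P"
proof
 note D = primes_aboveD[OF L P]
 assume x: "inverse x \<in> local_ring L P" "x ~= 0" "x \<in> local_max_ideal L P"
 obtain a b c d where ab: "x = a / b" "a \<in> P" "b \<in> ring_of_integers L - P"
  and cd: "inverse x = c / d" "c \<in> ring_of_integers L" "d \<in> ring_of_integers L - P"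
  using x(1,3) unfolding local_max_ideal_def local_ring_def by blast
 have "a ~= 0" "b ~= 0" "d ~= 0" using ab cd D(3) x(2) by auto
 moreover have "b / a = c / d" using ab(1) cd(1) by simp
 ultimately have "c * a = b * d" by (simp add: frac_eq_eq mult.commute)
 then show False using D(6)[OF cd(2) ab(2)] D(7)[of b d] ab cd by auto
qed

text \<open>An integral model with unit discriminant is minimal because every integral model has
  integral discriminant.\<close>

lemma good_reductionI:
 assumes u: "u \<in> L - {0}" "r \<in> L" "s \<in> L" "t \<in> L" and W': "W' = change_variables u r s t W"
  and i: "set_weierstrass W' \<subseteq> local_ring L P" "inverse (disc W') \<in> local_ring L P" and d: "disc W' ~= 0"
 shows "good_reduction L P W"
proof -
 note R = csubringD[OF csubring_local_ring]
 note disc = csubring_invariants(7)[OF csubring_local_ring]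
 have "isomorphic_over L W W'" unfolding isomorphic_over_def using u W' by blast
 moreover have "disc V / disc W' \<in> local_ring L P" if "set_weierstrass V \<subseteq> local_ring L P" for V
  using disc[OF that] i(2) R(4) by (simp add: divide_inverse)
 ultimately have "minimal_model L P W W'" using i(1) unfolding minimal_model_def by blast
 then show ?thesis using local_unit_not_max[OF disc[OF i(1)] i(2) d] unfolding good_reduction_def by blast
qed

end

text \<open>A twelfth root u0 of the quotient of the discriminants matches c4 up to a cube root of
  unity z and c6 up to sign. The factor z e with e equal to 1 or \<i> corrects both: z^4 = z, z^6 =
  1, e^4 = 1, and e^6 is the sign.\<close>

lemma isomorphic_of_j:
 fixes W W' :: "complex weierstrass"
 assumes d: "disc W ~= 0" "disc W' ~= 0" and j: "c4 W ^ 3 * disc W' = c4 W' ^ 3 * disc W"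
 shows "\<exists>u. u ^ 12 * disc W' = disc W \<and> c4 W = u ^ 4 * c4 W' \<and> c6 W = u ^ 6 * c6 W'"
proof -
 have j6: "c6 W ^ 2 * disc W' = c6 W' ^ 2 * disc W"
  using j disc_c4_c6[of W] disc_c4_c6[of W'] by Groebner_Basis.algebra
 define p where "p = monom 1 12 - [:disc W / disc W':]"
 have "coeff p 12 = 1" by (simp add: p_def coeff_pCons eval_nat_numeral)
 then have "degree p ~= 0" using le_degree[of p 12] by auto
 then have "\<not> constant (poly p)" by (simp add: constant_degree)
 then obtain u0 where "poly p u0 = 0" using fundamental_theorem_of_algebra by blast
 then have u0: "u0 ^ 12 * disc W' = disc W" using d by (simp add: p_def poly_monom field_simps)
 have c3: "c4 W ^ 3 = (u0 ^ 4 * c4 W') ^ 3" "c6 W ^ 2 = (u0 ^ 6 * c6 W') ^ 2"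
 proof -
  have "disc W' * c4 W ^ 3 = disc W' * (u0 ^ 4 * c4 W') ^ 3" "disc W' * c6 W ^ 2 = disc W' * (u0 ^ 6 * c6 W') ^ 2"
   using j j6 u0 by Groebner_Basis.algebra+
  then show "c4 W ^ 3 = (u0 ^ 4 * c4 W') ^ 3" "c6 W ^ 2 = (u0 ^ 6 * c6 W') ^ 2" using d by simp_all
 qed
 obtain z where z: "z ^ 3 = 1" "c4 W = z * (u0 ^ 4 * c4 W')"
 proof (cases "u0 ^ 4 * c4 W' = 0")
  case True
  then have "c4 W = 0" using c3(1) unfolding True by simp
  then show thesis using that[of 1] True by simp
 next
  case False
  then show thesis using that[of "c4 W / (u0 ^ 4 * c4 W')"] c3(1) by (simp add: power_divide)
 qed
 obtain e where e: "e ^ 4 = 1" "c6 W = e ^ 6 * (u0 ^ 6 * c6 W')"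
 proof -
  have "c6 W = u0 ^ 6 * c6 W' \<or> c6 W = - (u0 ^ 6 * c6 W')" using c3(2) by (simp add: power2_eq_iff)
  moreover have "\<i> ^ 4 = 1" "\<i> ^ 6 = - 1" by (simp_all add: eval_nat_numeral)
  ultimately show thesis using that[of 1] that[of \<i>] by auto
 qed
 define u where "u = u0 * z * e"
 have "u ^ 4 * c4 W' = c4 W" "u ^ 6 * c6 W' = c6 W" "u ^ 12 * disc W' = disc W"
  unfolding u_def using z e u0 by Groebner_Basis.algebra+
 then show ?thesis by metis
qed

context rational_curve
begin

text \<open>The hypotheses speak of all rings R containing \<alpha>, so that one auxiliary model
  serves the local rings at all primes above q of a number field containing \<alpha> and the scaling
  factor u.\<close>

lemma potentially_goodI:
 assumes q: "prime q" and d: "disc W' ~= 0" and j: "c4 W ^ 3 * disc W' = c4 W' ^ 3 * disc W"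
  and co: "\<And>R. csubring R ==> \<alpha> \<in> R ==> set_weierstrass W' \<subseteq> R"
  and int: "\<And>R. csubring R ==> \<alpha> \<in> R ==> Zq q \<subseteq> R ==> inverse (disc W') \<in> R"
  and n: "\<not> int q dvd n" "algebraic_int (of_int n * \<alpha>)"
 shows "potentially_good_reduction q W"
proof -
 obtain u where u: "u ^ 12 * disc W' = disc W" "c4 W = u ^ 4 * c4 W'" "c6 W = u ^ 6 * c6 W'"
  using isomorphic_of_j[OF disc_W d j] by blast
 have u0: "u ~= 0" using u(1) disc_W by auto
 note AN = csubringD[OF csubfieldD(1)[OF csubring_algebraic]] csubfieldD(2,3,4)[OF csubring_algebraic]
 note alg = csubfieldD(1)[OF csubring_algebraic]
 have \<alpha>: "algebraic \<alpha>"
 proof -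
  have n0: "of_int n ~= (0 :: complex)" using n(1) by auto
  have "algebraic (of_int n * \<alpha>)"
   using n(2) unfolding algebraic_int_iff_val_rings algebraic_iff_val_rings by blast
  then have "of_int n * \<alpha> / of_int n \<in> AN" using AN(9) by (intro AN(12)) simp_all
  then show ?thesis using n0 by simp
 qed
 have WQ: "set_weierstrass W \<subseteq> \<rat>" using W by (simp add: elliptic_curve_over_def)
 have "disc W / disc W' \<in> AN"
 proof (rule AN(12))
  show "disc W \<in> AN" using AN(13) WQ by (intro csubring_invariants(7)[OF alg]) auto
  show "disc W' \<in> AN" using co[OF alg] \<alpha> by (intro csubring_invariants(7)[OF alg]) simp
 qed
 moreover have "u ^ 12 = disc W / disc W'" using u(1) d by (simp add: field_simps)
 ultimately have "algebraic u"
  using algebraic_root[of "u ^ 12" "monom 1 12" u] by (simp add: poly_monom degree_monom_eq)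
 then obtain L where L: "number_field L" "csubfield L" "\<alpha> \<in> L" "u \<in> L"
  using finite_extension_number_field[of "[\<alpha>, u]"] \<alpha> by auto
 note D = csubringD[OF csubfieldD(1)[OF L(2)]] csubfieldD(3,4)[OF L(2)]
 define r s t where "r = (u ^ 2 * b2 W' - b2 W) / 12" and "s = (u * a1 W' - a1 W) / 2" and "t = (u ^ 3 * a3 W' - a3 W - r * a1 W) / 2"
 have W': "W' = change_variables u r s t W"
  unfolding r_def s_def t_def by (rule change_variables_exists[OF u0 u(2,3)])
 have cL: "a1 W' \<in> L" "a2 W' \<in> L" "a3 W' \<in> L" using co[OF csubfieldD(1)[OF L(2)] L(3)] by (cases W'; simp)+
 note cW = coeffs[THEN D(12)]
 have rst: "r \<in> L" "s \<in> L" "t \<in> L"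
 proof -
  show r: "r \<in> L" unfolding r_def b2_def using cL cW L(4) by (intro D(3,4,6,7,10,11))
  show "s \<in> L" unfolding s_def using cL cW L(4) by (intro D(3,4,6,7,10,11))
  show "t \<in> L" unfolding t_def using cL cW L(4) r by (intro D(3,4,6,7,10,11))
 qed
 have "good_reduction L P W" if P: "P \<in> primes_above L q" for P
 proof (rule good_reductionI[OF q L(2) P _ rst W' _ _ d])
  have R: "csubring (local_ring L P)" by (rule csubring_local_ring[OF q L(2) P])
  have \<alpha>R: "\<alpha> \<in> local_ring L P" by (rule local_ring_integral[OF q L(2) P L(3) n(2,1)])
  show "set_weierstrass W' \<subseteq> local_ring L P" by (rule co[OF R \<alpha>R])
  show "inverse (disc W') \<in> local_ring L P" by (rule int[OF R \<alpha>R Zq_local_ring[OF q L(2) P]])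
 qed (use u0 L in auto)
 then show ?thesis unfolding potentially_good_reduction_def using L(1) by blast
qed

text \<open>For q other than 3 the Deuring form y^2 + \<alpha> x y + y = x^3 is used, for q = 3 the
  Legendre form y^2 = x (x - 1) (x - \<alpha>). As j is integral, \<alpha> satisfies a monic
  equation over \<open>Zq q\<close>, and the discriminant becomes a unit once 3, respectively 2, is
  invertible.\<close>

lemma potentially_good_of_j:
 assumes q: "prime q" and j: "c4 W ^ 3 / disc W \<in> Zq q"
 shows "potentially_good_reduction q W"
proof -
 define J where "J = c4 W ^ 3 / disc W"
 have J: "J \<in> Zq q" "c4 W ^ 3 = J * disc W" using j disc_W by (simp_all add: J_def)
 note Z = csubringD[OF csubring_Zq[OF q]]
 have inv: "inverse (of_nat n) \<in> Zq q" if "\<not> q dvd n" for n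
 proof -
  have "inverse (of_nat n) = of_int 1 / (of_int (int n) :: complex)" by (simp add: inverse_eq_divide)
  moreover have "\<not> int q dvd int n" using that by (simp add: int_dvd_int_iff)
  ultimately show ?thesis unfolding Zq_def by blast
 qed
 show ?thesis
 proof (cases "q = 3")
  case False
  \<comment> \<open>The condition \<beta> (\<beta> - 24)^3 = j (\<beta> - 27) on \<beta> =
    \<alpha>^3, expanded.\<close>
  define p where "p = [:27 * J, - 13824 - J, 1728, - 72, 1:]"
  have "\<not> constant (poly p)" by (simp add: p_def constant_degree)
  then obtain \<beta> where "poly p \<beta> = 0" using fundamental_theorem_of_algebra by blast
  then have \<beta>: "\<beta> * (\<beta> - 24) ^ 3 = J * (\<beta> - 27)" unfolding p_def poly_pCons poly_0 by Groebner_Basis.algebra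
  have "\<not> constant (poly [:- \<beta>, 0, 0, 1:])" by (simp add: constant_degree)
  then obtain \<alpha> where "poly [:- \<beta>, 0, 0, 1:] \<alpha> = 0" using fundamental_theorem_of_algebra by blast
  then have \<alpha>: "\<beta> = \<alpha> ^ 3" by (simp add: power3_eq_cube mult.assoc)
  define W' where "W' = Weierstrass \<alpha> 0 1 0 0"
  have s: "disc W' = \<alpha> ^ 3 - 27" "c4 W' = \<alpha> ^ 4 - 24 * \<alpha>"
   by (simp_all add: disc_def c4_def b2_def b4_def b6_def b8_def W'_def algebra_simps eval_nat_numeral)
  have i729: "inverse 729 \<in> Zq q"
  proof -
   have "\<not> q dvd 3 ^ 6" using False q prime_dvd_power[of q 3 6] primes_dvd_imp_eq[of q 3] by auto
   then show ?thesis using inv[of 729] by simp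
  qed
  define c where "c i = [- 27 * J, 0, 0, 13824 + J, 0, 0, - 1728, 0, 0, 72, 0, 0] ! i" for i
  have "\<alpha> ^ 12 = (\<Sum>i<12. c i * \<alpha> ^ i)"
   using \<beta> unfolding \<alpha> c_def by (simp add: eval_nat_numeral algebra_simps)
  moreover have "c i \<in> Zq q" if "i < 12" for i
  proof -
   have "set [- 27 * J, 0, 0, 13824 + J, 0, 0, - 1728, 0, 0, 72, 0, 0] \<subseteq> Zq q"
    using J(1) Z(2,10) Z(4)[OF Z(5)[OF Z(10)[of "num.Bit1 (num.Bit1 (num.Bit0 (num.Bit1 num.One)))"]] J(1)] Z(5,6) by auto
   then show ?thesis unfolding c_def using that nth_mem[of i "[- 27 * J, 0, 0, 13824 + J, 0, 0, - 1728, 0, 0, 72, 0, 0]"] by auto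
  qed
  ultimately obtain n where n: "\<not> int q dvd n" "algebraic_int (of_int n * \<alpha>)"
   using integral_multiple[OF q, of 12 c \<alpha>] by auto
  \<comment> \<open>With D = \<alpha>^3 - 27 the equation reads (D + 27) (D + 3)^3 = j D; moving all
    multiples of D to one side leaves D P = 729 = 3^6.\<close>
  define P where "P = J - (\<alpha> ^ 3 - 27) ^ 3 - 36 * (\<alpha> ^ 3 - 27) ^ 2 - 270 * (\<alpha> ^ 3 - 27) - 756"
  have e: "(\<alpha> ^ 3 - 27) * P = 729"
   using \<beta> unfolding \<alpha> P_def by Groebner_Basis.algebra
  have d: "disc W' ~= 0" using e unfolding s by auto
  show ?thesis
  proof (rule potentially_goodI[OF q d _ _ _ n])
   have "c4 W' ^ 3 = J * disc W'" using \<beta> unfolding s \<alpha> by Groebner_Basis.algebra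
   then show "c4 W ^ 3 * disc W' = c4 W' ^ 3 * disc W" using J(2) by simp
   fix R assume R: "csubring R" "\<alpha> \<in> R"
   note D = csubringD[OF R(1)]
   show "set_weierstrass W' \<subseteq> R" using R D(1,2) by (simp add: W'_def)
   assume "Zq q \<subseteq> R"
   then have "J \<in> R" "inverse 729 \<in> R" using J i729 by auto
   then have "P * inverse 729 \<in> R" unfolding P_def using R(2) by (intro D(3,4,7,10))
   moreover have "inverse (disc W') = P * inverse 729" using e d unfolding s by (simp add: field_simps)
   ultimately show "inverse (disc W') \<in> R" by metis
  qed
 next
  case True
  \<comment> \<open>The Legendre form has j = 256 (\<alpha>^2 - \<alpha> + 1)^3 / (\<alpha>
    (\<alpha> - 1))^2, and 256 is a unit at 3.\<close>
  define K where "K = J * inverse 256"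
  have K: "K \<in> Zq q" "J = 256 * K" using Z(4)[OF J(1) inv[of 256]] True by (simp_all add: K_def)
  define c where "c i = [- 1, 3, K - 6, 7 - 2 * K, K - 6, 3] ! i" for i
  define p where "p = [:1, - 3, 6 - K, 2 * K - 7, 6 - K, - 3, 1:]"
  have "\<not> constant (poly p)" by (simp add: p_def constant_degree)
  then obtain \<alpha> where "poly p \<alpha> = 0" using fundamental_theorem_of_algebra by blast
  then have \<alpha>: "(\<alpha> ^ 2 - \<alpha> + 1) ^ 3 = K * \<alpha> ^ 2 * (\<alpha> - 1) ^ 2" unfolding p_def poly_pCons poly_0 by Groebner_Basis.algebra
  define W' where "W' = Weierstrass 0 (- (1 + \<alpha>)) 0 \<alpha> 0"
  have s: "disc W' = 16 * \<alpha> ^ 2 * (\<alpha> - 1) ^ 2" "c4 W' = 16 * (\<alpha> ^ 2 - \<alpha> + 1)"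
   by (simp_all add: disc_def c4_def b2_def b4_def b6_def b8_def W'_def algebra_simps eval_nat_numeral)
  have "\<alpha> ^ 6 = (\<Sum>i<6. c i * \<alpha> ^ i)"
   using \<alpha> unfolding c_def by (simp add: eval_nat_numeral algebra_simps)
  moreover have "c i \<in> Zq q" if "i < 6" for i
  proof -
   have "set [- 1, 3, K - 6, 7 - 2 * K, K - 6, 3] \<subseteq> Zq q" using K(1) Z(1,3,4,5,10) by auto
   then show ?thesis unfolding c_def using that nth_mem[of i "[- 1, 3, K - 6, 7 - 2 * K, K - 6, 3]"] by auto
  qed
  ultimately obtain n where n: "\<not> int q dvd n" "algebraic_int (of_int n * \<alpha>)"
   using integral_multiple[OF q, of 6 c \<alpha>] by auto
  \<comment> \<open>P and Q are the inverses of \<alpha> and \<alpha> - 1 as polynomials in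
    \<alpha>: the sextic defining \<alpha> takes the value 1 at 0 and at 1.\<close>
  define P where "P = K * \<alpha> * (\<alpha> - 1) ^ 2 - (\<alpha> ^ 5 - 3 * \<alpha> ^ 4 + 6 * \<alpha> ^ 3 - 7 * \<alpha> ^ 2 + 6 * \<alpha> - 3)"
  define Q where "Q = K * \<alpha> ^ 2 * (\<alpha> - 1) - \<alpha> * ((\<alpha> * (\<alpha> - 1)) ^ 2 + 3 * (\<alpha> * (\<alpha> - 1)) + 3)"
  have e: "\<alpha> * P = 1" "(\<alpha> - 1) * Q = 1" using \<alpha> unfolding P_def Q_def by Groebner_Basis.algebra+
  then have nz: "\<alpha> ~= 0" "\<alpha> - 1 ~= 0" by auto
  have d: "disc W' ~= 0" using nz unfolding s by simp
  show ?thesis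
  proof (rule potentially_goodI[OF q d _ _ _ n])
   have "c4 W' ^ 3 = J * disc W'" using \<alpha> unfolding s K(2) by Groebner_Basis.algebra
   then show "c4 W ^ 3 * disc W' = c4 W' ^ 3 * disc W" using J(2) by simp
   fix R assume R: "csubring R" "\<alpha> \<in> R"
   note D = csubringD[OF R(1)]
   show "set_weierstrass W' \<subseteq> R" using R D(1,2,5,6) by (simp add: W'_def del: minus_add_distrib)
   assume "Zq q \<subseteq> R"
   then have KR: "K \<in> R" "inverse 16 \<in> R" using K inv[of 16] True by auto
   have "P \<in> R" unfolding P_def using KR R(2) by (intro D(1,3,4,6,7,10))
   moreover have "Q \<in> R" unfolding Q_def using KR R(2) by (intro D(1,3,4,6,7,10))
   ultimately have "inverse 16 * P ^ 2 * Q ^ 2 \<in> R" using KR by (intro D(4,7))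
   moreover have "inverse (disc W') = inverse 16 * P ^ 2 * Q ^ 2"
   proof -
    have "P = inverse \<alpha>" "Q = inverse (\<alpha> - 1)" using e by (metis inverse_unique)+
    then show ?thesis unfolding s by (simp add: power_inverse)
   qed
   ultimately show "inverse (disc W') \<in> R" by metis
  qed
 qed
qed

end

context place
begin

text \<open>The prime of L under the fixed place. Through it a statement about all primes of L above
  q is used inside one valuation ring of the complex numbers.\<close>

definition above :: "complex set => complex set" where "above L = mx \<inter> ring_of_integers L"

context
 fixes L assumes L: "csubfield L"
begin

lemma integers_A: "ring_of_integers L \<subseteq> A"
 using A by (auto simp: ring_of_integers_def algebraic_int_iff_val_rings)

lemma above_prime: "above L \<in> primes_above L q"
proof -
 interpret CC: field \<CC> by (rule field_CC)
 let ?R = "\<CC>\<lparr>carrier := ring_of_integers L\<rparr>"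
 note R = csubringD[OF csubring_ring_of_integers[OF L]]
 have sub: "subring (ring_of_integers L) \<CC>" by (rule CC.subringI) (use R in auto)
 have cr: "cring ?R"
  by (rule CC.subcring_iff[THEN iffD1, OF _ CC.subcringI[OF sub]]) (auto simp: mult.commute)
 interpret R: cring ?R by (rule cr)
 have "primeideal (above L) ?R"
 proof (rule primeidealI[OF idealI cr])
  show "ring ?R" by (rule R.ring_axioms)
  show "subgroup (above L) (add_monoid ?R)"
  proof (rule group.subgroupI)
   show "group (add_monoid ?R)" by (rule R.a_group)
   fix a assume a: "a \<in> above L"
   have "- a \<in> ring_of_integers L" using a R(5) by (auto simp: above_def)
   then have "inv\<^bsub>add_monoid ?R\<^esub> a = - a"
    using a R.add.inv_equality[of "- a" a] by (simp add: above_def a_inv_def)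
   then show "inv\<^bsub>add_monoid ?R\<^esub> a \<in> above L" using a mx_minus R(5) by (auto simp: above_def)
  qed (use mx_0 mx_add R in \<open>auto simp: above_def\<close>)
  show "carrier ?R ~= above L" using R(1) one_mx by (auto simp: above_def)
 qed (use mx_mult mx_prime integers_A R(4) in \<open>auto simp: above_def subset_iff\<close>)
 moreover have "of_nat q \<in> above L" using q_mx R(8) by (simp add: above_def)
 ultimately show ?thesis by (simp add: primes_above_def)
qed

lemma local_ring_above: "local_ring L (above L) \<subseteq> A"
proof
 fix x assume "x \<in> local_ring L (above L)"
 then obtain a b where ab: "x = a / b" "a \<in> A" "b \<in> A - mx"
  using integers_A unfolding local_ring_def above_def by blast
 then show "x \<in> A" using AD(4) unfolding unit_iff by (simp add: divide_inverse)
qed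

lemma local_unit_above: "x \<in> local_ring L (above L) ==> x \<notin> local_max_ideal L (above L) ==> x \<in> A - mx"
proof -
 assume x: "x \<in> local_ring L (above L)" "x \<notin> local_max_ideal L (above L)"
 then obtain a b where ab: "x = a / b" "a \<in> ring_of_integers L" "b \<in> ring_of_integers L - above L"
  unfolding local_ring_def by blast
 then have "a \<notin> above L" using x(2) unfolding local_max_ideal_def by blast
 then show "x \<in> A - mx" using ab integers_A unit_divide[of a b] by (auto simp: above_def)
qed

end

lemma potentially_good_model:
 assumes "potentially_good_reduction q V"
 shows "\<exists>u r s t V'. u ~= 0 \<and> V' = change_variables u r s t V \<and> set_weierstrass V' \<subseteq> A \<and> disc V' \<in> A - mx"
proof -
 obtain L where L: "number_field L" "\<forall>P\<in>primes_above L q. good_reduction L P V"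
  using assms by (auto simp: potentially_good_reduction_def)
 have Lf: "csubfield L" using L(1) by (simp add: number_field_def subfield_CC)
 obtain V' where V': "minimal_model L (above L) V V'" "disc V' \<notin> local_max_ideal L (above L)"
  using L(2) above_prime[OF Lf] by (auto simp: good_reduction_def)
 have co: "set_weierstrass V' \<subseteq> local_ring L (above L)" using V'(1) by (simp add: minimal_model_def)
 obtain u r s t where "u ~= 0" "V' = change_variables u r s t V"
  using V'(1) by (auto simp: minimal_model_def isomorphic_over_def)
 moreover have "disc V' \<in> local_ring L (above L)"
  by (rule csubring_invariants(7)[OF csubring_local_ring[OF q Lf above_prime[OF Lf]] co])
 ultimately show ?thesis using local_unit_above[OF Lf] V'(2) co local_ring_above[OF Lf] by blast
qed

end

section \<open>Inertia at 2 and reduction types\<close>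

lemma fhom_poly:
 assumes h: "fhom K \<sigma>" and x: "x \<in> K" and u: "\<forall>i. coeff u i \<in> \<rat>"
 shows "poly u x \<in> K \<and> \<sigma> (poly u x) = poly u (\<sigma> x)"
 using u
proof (induction u)
 case 0
 then show ?case using fhomD(4)[OF h] csubringD(2)[OF fhomD(2)[OF h]] by simp
next
 case (pCons a u)
 have "\<forall>i. coeff u i \<in> \<rat>" "a \<in> \<rat>"
  using pCons.prems by (metis coeff_pCons_Suc, metis coeff_pCons_0)
 then have "poly u x \<in> K" "\<sigma> (poly u x) = poly u (\<sigma> x)" "a \<in> K" "\<sigma> a = a"
  using pCons.IH csubfieldD(4)[OF fhomD(1)[OF h]] fhomD(12)[OF h] by auto
 then show ?case using x csubringD(4,6)[OF fhomD(2)[OF h]] fhomD(6,8)[OF h] by simp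
qed

lemma fhom_algebraic_int:
 assumes h: "fhom K \<sigma>" and x: "x \<in> K" "algebraic_int x"
 shows "algebraic_int (\<sigma> x)"
proof -
 obtain u where u: "lead_coeff u = 1" "\<forall>i. coeff u i \<in> \<int>" "poly u x = 0"
  using x(2) by (auto simp: algebraic_int.simps)
 then have "poly u (\<sigma> x) = 0" using fhom_poly[OF h x(1), of u] Ints_subset_Rats fhomD(4)[OF h] by auto
 then show ?thesis using u(1,2) by (auto simp: algebraic_int.simps)
qed

text \<open>An automorphism is determined by its values on a finite spanning set, and each value is
  a root of a fixed polynomial.\<close>

lemma finite_Gal:
 assumes K: "number_field K" "K \<subseteq> AN"
 shows "finite (carrier (Gal K \<rat>))"
proof -
 interpret CC: field \<CC> by (rule field_CC)
 have Kf: "csubfield K" using K(1) by (simp add: number_field_def subfield_CC)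
 have Q: "subfield \<rat> \<CC>" unfolding subfield_CC by (auto simp: csubfield_def csubring_def)
 obtain Us where Us: "CC.Span \<rat> Us = K"
  using CC.exists_base[OF Q CC.finite_dimensionE[OF Q]] K(1) by (auto simp: number_field_def)
 have sp: "K = {CC.combine Ks Us | Ks. set Ks \<subseteq> \<rat>}" unfolding Us[symmetric] by (rule CC.Span_eq_combine_set[OF Q]) simp
 have UK: "set Us \<subseteq> K" unfolding Us[symmetric] by (rule CC.Span_base_incl[OF Q]) simp
 have g: "\<sigma> = \<tau>" if s: "\<sigma> \<in> carrier (Gal K \<rat>)" "\<tau> \<in> carrier (Gal K \<rat>)" and eq: "\<And>u. u \<in> set Us ==> \<sigma> u = \<tau> u" for \<sigma> \<tau>
 proof -
  define N where "N = {x \<in> K. \<sigma> x = \<tau> x}"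
  have N: "csubfield N"
   unfolding N_def using s Gal_iff[OF Kf] by (intro csubfield_equalizer) auto
  have "CC.combine Ks Vs \<in> N" if "set Ks \<subseteq> \<rat>" "set Vs \<subseteq> N" for Ks Vs
   using that
  proof (induction Ks Vs rule: CC.combine.induct)
   case (1 k Ks u Vs)
   then show ?case using csubringD(4,6)[OF csubfieldD(1)[OF N]] csubfieldD(4)[OF N] by auto
  qed (use csubringD(2)[OF csubfieldD(1)[OF N]] in auto)
  moreover have "set Us \<subseteq> N" using UK eq by (auto simp: N_def)
  ultimately have "K \<subseteq> N" using sp by blast
  moreover have "\<sigma> \<in> extensional K" "\<tau> \<in> extensional K" using s Gal_iff[OF Kf] by auto
  ultimately show "\<sigma> = \<tau>" by (intro extensionalityI[of _ K]) (auto simp: N_def)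
 qed
 have "\<exists>B. finite B \<and> (\<forall>\<sigma>\<in>carrier (Gal K \<rat>). \<sigma> u \<in> B)" if u: "u \<in> set Us" for u
 proof -
  have uK: "u \<in> K" using u UK by blast
  then have "algebraic u" using K(2) by blast
  then obtain f where f: "\<forall>i. coeff f i \<in> \<int>" "f ~= 0" "poly f u = 0" by (auto simp: algebraic_def)
  have fQ: "\<forall>i. coeff f i \<in> \<rat>" using f(1) Ints_subset_Rats by blast
  have "poly f (\<sigma> u) = 0" if "\<sigma> \<in> carrier (Gal K \<rat>)" for \<sigma>
   using fhom_poly[of K \<sigma> u f] that Gal_iff[OF Kf] uK fQ f(3) fhomD(4)[of K \<sigma>] by simp
  then show ?thesis using poly_roots_finite[OF f(2)] by (intro exI[of _ "{x. poly f x = 0}"]) auto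
 qed
 then obtain B where B: "\<And>u. u \<in> set Us ==> finite (B u) \<and> (\<forall>\<sigma>\<in>carrier (Gal K \<rat>). \<sigma> u \<in> B u)" by metis
 let ?r = "\<lambda>\<sigma>. restrict \<sigma> (set Us)"
 have "?r ` carrier (Gal K \<rat>) \<subseteq> Pi\<^sub>E (set Us) B" using B by auto
 then have "finite (?r ` carrier (Gal K \<rat>))" using finite_PiE[of "set Us" B] B finite_subset by blast
 moreover have "inj_on ?r (carrier (Gal K \<rat>))" using g by (intro inj_onI) (metis restrict_apply')
 ultimately show ?thesis using finite_imageD by blast
qed

context place
begin

lemma prod_cong_mx:
 assumes "\<And>i. i \<in> I ==> a i \<in> A \<and> b i \<in> A \<and> a i - b i \<in> mx"
 shows "prod a I - prod b I \<in> mx"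
 using assms
proof (induction I rule: infinite_finite_induct)
 case (insert i I)
 have "prod a (insert i I) - prod b (insert i I) = a i * (prod a I - prod b I) + (a i - b i) * prod b I"
  using insert.hyps by (simp add: algebra_simps)
 moreover have "prod b I \<in> A" using insert.prems by (intro csubring_prod[OF csubring_A]) auto
 ultimately show ?case using insert mx_add mx_mult by simp
qed (use mx_0 in auto)

lemma sum_mx: "(\<And>i. i \<in> I ==> a i \<in> mx) ==> sum a I \<in> mx"
 by (induction I rule: infinite_finite_induct) (use mx_0 mx_add in auto)

text \<open>Adjoining a square root of d is ramified at 2, shown here by twisted traces. If inertia
  had odd order, the quadratic character \<open>\<eta>\<close> of \<alpha> would be trivial on it.
  Every trace twisted by \<open>\<eta>\<close> lies in the maximal ideal; a combination of such
  traces is built whose terms vanish off inertia and agree modulo the ideal with one fixed unit on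
  it, which forces the odd order of inertia into the ideal.\<close>

lemma even_inertia:
 assumes q2: "q = 2" and K: "finite_galois_over_Q K" "K \<subseteq> AN"
  and \<alpha>: "\<alpha> \<in> K" "\<alpha> ^ 2 = of_int d" "d mod 4 = 3"
 shows "even (card (inertia_group K (above K)))"
proof (rule ccontr)
 assume odd: "odd (card (inertia_group K (above K)))"
 define \<Gamma> where "\<Gamma> = carrier (Gal K \<rat>)"
 define In where "In = inertia_group K (above K)"
 have Kn: "number_field K" and fix_Q: "{x \<in> K. \<forall>\<sigma>\<in>\<Gamma>. \<sigma> x = x} = \<rat>" using K(1) by (auto simp: finite_galois_over_Q_def \<Gamma>_def)
 have Kf: "csubfield K" using Kn by (simp add: number_field_def subfield_CC)
 note D = csubringD[OF csubfieldD(1)[OF Kf]]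
 interpret G: group "Gal K \<rat>" by (rule Gal_group[OF Kf]) (use csubfieldD(4)[OF Kf] in blast)
 have fin: "finite \<Gamma>" unfolding \<Gamma>_def by (rule finite_Gal[OF Kn K(2)])
 let ?O = "ring_of_integers K"
 note O = csubringD[OF csubring_ring_of_integers[OF Kf]]
 have OA: "?O \<subseteq> A" by (rule integers_A[OF Kf])
 have OK: "?O \<subseteq> K" by (auto simp: ring_of_integers_def)
 have h: "fhom K \<sigma>" "bij_betw \<sigma> K K" if "\<sigma> \<in> \<Gamma>" for \<sigma> using that Gal_iff[OF Kf] by (auto simp: \<Gamma>_def)
 have sK: "\<sigma> x \<in> K" if "\<sigma> \<in> \<Gamma>" "x \<in> K" for \<sigma> x using h(2)[OF that(1)] that(2) by (auto simp: bij_betw_def)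
 have sO: "\<sigma> x \<in> ?O" if "\<sigma> \<in> \<Gamma>" "x \<in> ?O" for \<sigma> x
  using sK[OF that(1)] fhom_algebraic_int[OF h(1)[OF that(1)]] that(2) by (auto simp: ring_of_integers_def)
 have comp: "(\<sigma> \<otimes>\<^bsub>Gal K \<rat>\<^esub> \<tau>) x = \<sigma> (\<tau> x)" if "\<sigma> \<in> \<Gamma>" "\<tau> \<in> \<Gamma>" "x \<in> K" for \<sigma> \<tau> x
  using that by (simp add: Gal_mult \<Gamma>_def compose_eq)
 have Z: "x \<in> \<int>" if "x \<in> ?O" "x \<in> \<rat>" for x
  using rational_algebraic_int_is_int[of x] that by (auto simp: ring_of_integers_def)
 have \<alpha>O: "\<alpha> \<in> ?O"
 proof -
  have "\<alpha> \<in> B" if B: "val_ring B" for B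
  proof (rule ccontr)
   have RB: "csubring B" using B by (simp add: val_ring_def)
   assume n: "\<alpha> \<notin> B"
   then have "inverse \<alpha> \<in> B" using B by (auto simp: val_ring_def)
   moreover have "\<alpha> ^ 2 \<in> B" unfolding \<alpha>(2) by (rule csubringD(9)[OF RB])
   ultimately have "inverse \<alpha> * \<alpha> ^ 2 \<in> B" using csubringD(4)[OF RB] by blast
   moreover have "inverse \<alpha> * \<alpha> ^ 2 = \<alpha>" by (cases "\<alpha> = 0") (simp_all add: power2_eq_square)
   ultimately show False using n by simp
  qed
  then have "algebraic_int \<alpha>" unfolding algebraic_int_iff_val_rings by blast
  then show ?thesis using \<alpha>(1) by (simp add: ring_of_integers_def)
 qed
 have d0: "d ~= 0" using \<alpha>(3) by auto
 then have \<alpha>0: "\<alpha> ~= 0" using \<alpha>(2) by auto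
 define \<eta> where "\<eta> \<gamma> = \<gamma> \<alpha> / \<alpha>" for \<gamma>
 have \<eta>\<alpha>: "\<eta> \<gamma> * \<alpha> = \<gamma> \<alpha>" for \<gamma> using \<alpha>0 by (simp add: \<eta>_def)
 have \<eta>: "\<eta> \<gamma> = 1 \<or> \<eta> \<gamma> = - 1" if g: "\<gamma> \<in> \<Gamma>" for \<gamma>
 proof -
  have "\<gamma> \<alpha> ^ 2 = \<alpha> ^ 2"
   using fhomD(11)[OF h(1)[OF g] \<alpha>(1), of 2] fhomD(12)[OF h(1)[OF g], of "of_int d"] \<alpha>(2) by simp
  then have "\<gamma> \<alpha> = \<alpha> \<or> \<gamma> \<alpha> = - \<alpha>" by (simp add: power2_eq_iff)
  then show ?thesis using \<alpha>0 by (auto simp: \<eta>_def)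
 qed
 define Tr where "Tr x = (\<Sum>\<gamma>\<in>\<Gamma>. \<gamma> x)" for x
 have Tr: "Tr x \<in> \<int>" if x: "x \<in> ?O" for x
 proof (rule Z)
  show O: "Tr x \<in> ?O" unfolding Tr_def by (rule csubring_sum[OF csubring_ring_of_integers[OF Kf]]) (rule sO[OF _ x])
  have xK: "x \<in> K" using x OK by blast
  have "\<sigma> (Tr x) = Tr x" if s: "\<sigma> \<in> \<Gamma>" for \<sigma>
  proof -
   have "\<sigma> (\<Sum>\<gamma>\<in>F. \<gamma> x) = (\<Sum>\<gamma>\<in>F. \<sigma> (\<gamma> x)) \<and> (\<Sum>\<gamma>\<in>F. \<gamma> x) \<in> K" if "F \<subseteq> \<Gamma>" for F
    using finite_subset[OF that fin] that
   proof (induction F rule: finite_induct)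
    case (insert g F)
    then show ?case using fhomD(6)[OF h(1)[OF s]] sK[OF _ xK] D(6) by simp
   qed (use fhomD(4)[OF h(1)[OF s]] D(2) in auto)
   then have "\<sigma> (Tr x) = (\<Sum>\<gamma>\<in>\<Gamma>. \<sigma> (\<gamma> x))" by (simp add: Tr_def)
   also have "\<dots> = (\<Sum>\<gamma>\<in>\<Gamma>. (\<sigma> \<otimes>\<^bsub>Gal K \<rat>\<^esub> \<gamma>) x)" using comp[OF s _ xK] by (intro sum.cong) auto
   also have "\<dots> = (\<Sum>\<gamma>\<in>((\<otimes>\<^bsub>Gal K \<rat>\<^esub>) \<sigma>) ` \<Gamma>. \<gamma> x)"
    using s by (subst sum.reindex) (auto simp: \<Gamma>_def inj_on_def)
   also have "((\<otimes>\<^bsub>Gal K \<rat>\<^esub>) \<sigma>) ` \<Gamma> = \<Gamma>"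
    by (rule endo_inj_surj[OF fin]) (use s in \<open>auto simp: \<Gamma>_def inj_on_def\<close>)
   finally show ?thesis by (simp add: Tr_def)
  qed
  then show "Tr x \<in> \<rat>" using O OK fix_Q by blast
 qed
 define e where "e x = (\<Sum>\<gamma>\<in>\<Gamma>. \<eta> \<gamma> * \<gamma> x)" for x
 have e_mx: "e x \<in> mx" if x: "x \<in> ?O" for x
 proof -
  have xK: "x \<in> K" using x OK by blast
  obtain n where n: "Tr x = of_int n" using Tr[OF x] by (auto elim: Ints_cases)
  have "Tr (\<alpha> * x) = e x * \<alpha>"
   unfolding Tr_def e_def sum_distrib_right
  proof (rule sum.cong[OF refl])
   fix \<gamma> assume "\<gamma> \<in> \<Gamma>"
   then have "\<gamma> (\<alpha> * x) = \<gamma> \<alpha> * \<gamma> x" using fhomD(8)[OF h(1)] \<alpha>(1) xK by blast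
   then show "\<gamma> (\<alpha> * x) = \<eta> \<gamma> * \<gamma> x * \<alpha>" unfolding \<eta>\<alpha>[of \<gamma>, symmetric] by simp
  qed
  moreover obtain m where m: "Tr (\<alpha> * x) = of_int m" using Tr[OF O(4)[OF \<alpha>O x]] by (auto elim: Ints_cases)
  ultimately have em: "e x * \<alpha> = of_int m" by simp
  \<comment> \<open>The trace of x to the field of \<alpha> and its conjugate. Their product is an
    integer; for d = 3 mod 4 this gives n^2 + m^2 = 0 mod 4, so m is even and e x = m / \<alpha> is
    2 times an element of A.\<close>
  define t1 t2 where "t1 = (\<Sum>\<gamma>\<in>\<Gamma>. (1 + \<eta> \<gamma>) / 2 * \<gamma> x)" and "t2 = (\<Sum>\<gamma>\<in>\<Gamma>. (1 - \<eta> \<gamma>) / 2 * \<gamma> x)"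
  have t: "t1 \<in> ?O" "t2 \<in> ?O"
  proof -
   have "(1 + \<eta> \<gamma>) / 2 * \<gamma> x \<in> ?O \<and> (1 - \<eta> \<gamma>) / 2 * \<gamma> x \<in> ?O" if "\<gamma> \<in> \<Gamma>" for \<gamma>
    using \<eta>[OF that] sO[OF that x] O(2) by auto
   then show "t1 \<in> ?O" "t2 \<in> ?O" unfolding t1_def t2_def
    by (auto intro!: csubring_sum[OF csubring_ring_of_integers[OF Kf]])
  qed
  have "2 * t1 = of_int n + e x" "2 * t2 = of_int n - e x"
   unfolding n[symmetric] t1_def t2_def Tr_def e_def by (simp_all add: sum_distrib_left sum.distrib sum_subtractf algebra_simps)
  then have t12: "4 * of_int d * (t1 * t2) = of_int (d * n ^ 2 - m ^ 2)"
   using em \<alpha>(2) unfolding of_int_diff of_int_mult of_int_power by Groebner_Basis.algebra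
  have "t1 * t2 = of_int (d * n ^ 2 - m ^ 2) / (4 * of_int d)" using t12 d0 by (simp add: field_simps)
  then have "t1 * t2 \<in> \<rat>" by (metis Rats_divide Rats_mult Rats_number_of Rats_of_int)
  then obtain c where "t1 * t2 = of_int c" using Z[OF O(4)[OF t]] by (auto elim: Ints_cases)
  then have "of_int (4 * d * c) = (of_int (d * n ^ 2 - m ^ 2) :: complex)" using t12 by simp
  then have "4 * d * c = d * n ^ 2 - m ^ 2" by (simp only: of_int_eq_iff)
  moreover obtain l where l: "d = 4 * l + 3" using \<alpha>(3) by (metis add.commute mod_mult_div_eq mult.commute)
  ultimately have nm: "n ^ 2 + m ^ 2 = 4 * (n ^ 2 * (l + 1) - d * c)" by (simp add: algebra_simps)
  have "even m"
  proof (rule ccontr)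
   assume "odd m"
   moreover have "even (n ^ 2 + m ^ 2)" unfolding nm by simp
   ultimately have "odd n" by simp
   then obtain a b where ab: "n = 2 * a + 1" "m = 2 * b + 1" using \<open>odd m\<close> by (auto elim!: oddE)
   have "n ^ 2 + m ^ 2 = 4 * (a ^ 2 + a + b ^ 2 + b) + 2" unfolding ab by (simp add: power2_eq_square algebra_simps)
   then show False using nm by presburger
  qed
  then obtain k where k: "m = 2 * k" by blast
  have "\<not> int q dvd d" using \<alpha>(3) q2 by presburger
  then have "of_int 1 / of_int d \<in> Zq q" unfolding Zq_def by blast
  then have di: "inverse (of_int d) \<in> A" using A_Rats by (auto simp: inverse_eq_divide)
  have "e x * of_int d = of_nat q * (of_int k * \<alpha>)" using em \<alpha>(2) unfolding k q2 of_int_mult by (simp add: power2_eq_square) (metis mult.assoc)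
  then have "e x = of_nat q * (of_int k * \<alpha>) * inverse (of_int d)" using d0 by (simp add: field_simps)
  moreover have "of_nat q * (of_int k * \<alpha>) * inverse (of_int d) \<in> mx"
   using q_mx di \<alpha>O OA by (intro mx_mult(2) AD(4,9)) auto
  ultimately show ?thesis by simp
 qed
 have In: "\<sigma> \<in> In \<longleftrightarrow> \<sigma> \<in> \<Gamma> \<and> (\<forall>x\<in>?O. \<sigma> x - x \<in> mx)" for \<sigma>
  unfolding In_def inertia_group_def \<Gamma>_def[symmetric] above_def using sO O(3) by auto
 have finI: "finite In" "In \<subseteq> \<Gamma>" using fin In finite_subset[of In \<Gamma>] by auto
 \<comment> \<open>Multiplication by an element of inertia that moves \<alpha> would pair off the
   elements of inertia fixing \<alpha> with the others.\<close>
 have In_\<alpha>: "\<eta> \<sigma> = 1" if s: "\<sigma> \<in> In" for \<sigma>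
 proof (rule ccontr)
  assume n: "\<eta> \<sigma> ~= 1"
  have sG: "\<sigma> \<in> \<Gamma>" using s finI by blast
  have "card In = 2 * card {\<tau> \<in> In. \<tau> \<alpha> = \<alpha>}"
  proof (rule double_card[of In "(\<otimes>\<^bsub>Gal K \<rat>\<^esub>) \<sigma>"])
   show "inj_on ((\<otimes>\<^bsub>Gal K \<rat>\<^esub>) \<sigma>) In"
   proof (rule inj_onI)
    fix a b assume "a \<in> In" "b \<in> In" "\<sigma> \<otimes>\<^bsub>Gal K \<rat>\<^esub> a = \<sigma> \<otimes>\<^bsub>Gal K \<rat>\<^esub> b"
    then show "a = b" using G.l_cancel[of \<sigma> a b] finI(2) sG by (auto simp: \<Gamma>_def)
   qed
   fix \<tau> assume t: "\<tau> \<in> In"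
   then have tG: "\<tau> \<in> \<Gamma>" using finI by blast
   show "\<sigma> \<otimes>\<^bsub>Gal K \<rat>\<^esub> \<tau> \<in> In"
    unfolding In
   proof (intro conjI ballI)
    show "\<sigma> \<otimes>\<^bsub>Gal K \<rat>\<^esub> \<tau> \<in> \<Gamma>" using G.m_closed sG tG unfolding \<Gamma>_def by blast
    fix x assume x: "x \<in> ?O"
    have "(\<sigma> (\<tau> x) - \<tau> x) + (\<tau> x - x) \<in> mx" using s t sO[OF tG x] x unfolding In by (intro mx_add) auto
    then show "(\<sigma> \<otimes>\<^bsub>Gal K \<rat>\<^esub> \<tau>) x - x \<in> mx" using comp[OF sG tG, of x] x OK by auto
   qed
   have "\<sigma> \<alpha> = - \<alpha>" using \<eta>[OF sG] n \<eta>\<alpha>[of \<sigma>] by auto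
   moreover have "\<tau> \<alpha> = \<alpha> \<or> \<tau> \<alpha> = - \<alpha>" using \<eta>[OF tG] \<eta>\<alpha>[of \<tau>] by auto
   ultimately show "(\<sigma> \<otimes>\<^bsub>Gal K \<rat>\<^esub> \<tau>) \<alpha> = \<alpha> \<longleftrightarrow> \<not> \<tau> \<alpha> = \<alpha>"
    using comp[OF sG tG \<alpha>(1)] fhomD(7)[OF h(1)[OF sG] \<alpha>(1)] \<alpha>0 by auto
  qed (rule finI(1))
  then show False using odd by (simp add: In_def)
 qed
 \<comment> \<open>For each j outside inertia an integer of K that j moves modulo the place. The
   product \<open>pr\<close> formed from them vanishes at every j outside inertia and is congruent
   to the unit \<open>Q\<close> on inertia.\<close>
 have "\<exists>x. \<forall>j\<in>\<Gamma> - In. x j \<in> ?O \<and> j (x j) - x j \<notin> mx"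
  by (rule bchoice) (use In in blast)
 then obtain x where x: "\<And>j. j \<in> \<Gamma> - In ==> x j \<in> ?O \<and> j (x j) - x j \<notin> mx" by blast
 define J where "J = \<Gamma> - In"
 have J: "finite J" "\<And>j. j \<in> J ==> x j \<in> ?O" "\<And>j. j \<in> J ==> j (x j) \<in> ?O" "\<And>j. j \<in> J ==> x j - j (x j) \<in> A - mx"
 proof -
  show "finite J" using fin by (simp add: J_def)
  fix j assume j: "j \<in> J"
  show xj: "x j \<in> ?O" using x j by (simp add: J_def)
  show jx: "j (x j) \<in> ?O" using sO[OF _ xj] j by (simp add: J_def)
  have "x j - j (x j) \<in> A" using O(3)[OF xj jx] OA by blast
  moreover have "x j - j (x j) \<notin> mx" using x[of j] j mx_minus[of "x j - j (x j)"] by (auto simp: J_def)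
  ultimately show "x j - j (x j) \<in> A - mx" by blast
 qed
 \<comment> \<open>\<open>c\<close> and \<open>y\<close> are the two parts of the expansion of
   \<open>pr\<close> over subsets V of J: the sign with the constant terms j (x j), and the
   remaining x j, to which the automorphism applies. The expansion turns the weighted sum of
   \<open>pr\<close> into a combination of twisted traces.\<close>
 define c where "c V = (-1) ^ card V * (\<Prod>j\<in>V. j (x j))" for V
 define y where "y V = (\<Prod>j\<in>J - V. x j)" for V
 define pr where "pr \<gamma> = (\<Prod>j\<in>J. \<gamma> (x j) - j (x j))" for \<gamma>
 have pr: "pr \<gamma> = (\<Sum>V\<in>Pow J. c V * \<gamma> (y V))" if g: "\<gamma> \<in> \<Gamma>" for \<gamma>
 proof -
  have "(\<Prod>j\<in>J - V. \<gamma> (x j)) = \<gamma> (y V)" for V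
   unfolding y_def using J(2) OK by (subst fhom_prod[OF h(1)[OF g]]) auto
  then show ?thesis unfolding pr_def prod_diff_conv_sum[OF J(1)] c_def by (intro sum.cong) auto
 qed
 have "(\<Sum>\<gamma>\<in>\<Gamma>. \<eta> \<gamma> * pr \<gamma>) = (\<Sum>V\<in>Pow J. c V * e (y V))"
 proof -
  have "(\<Sum>\<gamma>\<in>\<Gamma>. \<eta> \<gamma> * pr \<gamma>) = (\<Sum>\<gamma>\<in>\<Gamma>. \<Sum>V\<in>Pow J. c V * (\<eta> \<gamma> * \<gamma> (y V)))"
   using pr by (intro sum.cong) (auto simp: sum_distrib_left algebra_simps)
  also have "\<dots> = (\<Sum>V\<in>Pow J. \<Sum>\<gamma>\<in>\<Gamma>. c V * (\<eta> \<gamma> * \<gamma> (y V)))" by (rule sum.swap)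
  finally show ?thesis by (simp add: e_def sum_distrib_left)
 qed
 also have "\<dots> \<in> mx"
 proof (rule sum_mx)
  fix V assume V: "V \<in> Pow J"
  have "(\<Prod>j\<in>V. j (x j)) \<in> ?O" using J(3) V by (intro csubring_prod[OF csubring_ring_of_integers[OF Kf]]) auto
  then have "c V \<in> ?O" unfolding c_def by (intro O(4) O(7) O(5) O(1))
  moreover have "y V \<in> ?O" unfolding y_def using J(2) by (intro csubring_prod[OF csubring_ring_of_integers[OF Kf]]) auto
  ultimately show "c V * e (y V) \<in> mx" using mx_mult(1) e_mx OA by blast
 qed
 finally have S: "(\<Sum>\<gamma>\<in>\<Gamma>. \<eta> \<gamma> * pr \<gamma>) \<in> mx" .
 define Q where "Q = (\<Prod>j\<in>J. x j - j (x j))"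
 have "(\<Sum>\<gamma>\<in>\<Gamma>. \<eta> \<gamma> * pr \<gamma>) = (\<Sum>\<gamma>\<in>In. pr \<gamma>)"
 proof -
  have "pr \<gamma> = 0" if "\<gamma> \<in> \<Gamma> - In" for \<gamma> unfolding pr_def using J(1) that by (auto simp: J_def prod_zero_iff)
  then have "(\<Sum>\<gamma>\<in>\<Gamma>. \<eta> \<gamma> * pr \<gamma>) = (\<Sum>\<gamma>\<in>In. \<eta> \<gamma> * pr \<gamma>)"
   using fin finI by (intro sum.mono_neutral_right) auto
  then show ?thesis using In_\<alpha> by simp
 qed
 moreover have "(\<Sum>\<gamma>\<in>In. pr \<gamma> - Q) \<in> mx"
 proof (rule sum_mx)
  fix \<gamma> assume g: "\<gamma> \<in> In"
  then have gG: "\<gamma> \<in> \<Gamma>" using finI by blast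
  show "pr \<gamma> - Q \<in> mx"
   unfolding pr_def Q_def
  proof (rule prod_cong_mx)
   fix j assume j: "j \<in> J"
   have "\<gamma> (x j) - j (x j) - (x j - j (x j)) \<in> mx" using g J(2)[OF j] In[of \<gamma>] by simp
   moreover have "\<gamma> (x j) - j (x j) \<in> A" "x j - j (x j) \<in> A"
    using O(3)[OF sO[OF gG J(2)[OF j]] J(3)[OF j]] O(3)[OF J(2)[OF j] J(3)[OF j]] OA by blast+
   ultimately show "\<gamma> (x j) - j (x j) \<in> A \<and> x j - j (x j) \<in> A \<and> \<gamma> (x j) - j (x j) - (x j - j (x j)) \<in> mx" by blast
  qed
 qed
 ultimately have "of_nat (card In) * Q \<in> mx"
  using S mx_diff[of "\<Sum>\<gamma>\<in>In. pr \<gamma>" "\<Sum>\<gamma>\<in>In. pr \<gamma> - Q"] by (simp add: sum_subtractf)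
 moreover have "of_nat (card In) \<in> A - mx" using nat_unit[of "card In"] odd q2 by (simp add: In_def)
 moreover have "Q \<in> A - mx" unfolding Q_def by (rule unit_prod) (rule J(4))
 ultimately show False using unit_mult by blast
qed

end

section \<open>Square roots in a pro-p extension\<close>

context rational_curve
begin

text \<open>Otherwise the stabiliser of y would be an open normal subgroup of index 2, while p is
  odd. This brings square roots found in the p-torsion field down to K, where inertia is
  considered.\<close>

lemma square_root_in_base:
 fixes p :: nat
 assumes p: "p \<ge> 1" "odd p" and K: "csubfield K" "K \<subseteq> p_power_torsion_field W p" and pro: "pro_p_galois p (p_power_torsion_field W p) K"
  and y: "y \<in> p_power_torsion_field W p" "y ^ 2 \<in> K"
 shows "y \<in> K"
proof (rule ccontr)
 assume nK: "y \<notin> K"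
 define N where "N = p_power_torsion_field W p"
 define Co where "Co = coordinates (\<Union>n\<in>range (\<lambda>n. p ^ n). tors n)"
 have N: "N = generate_field \<CC> Co"
  unfolding N_def p_power_torsion_field_eq[OF p(1)] Co_def by (simp add: image_image)
 have Nf: "csubfield N" unfolding N by (rule generate_field_CC(1))
 have "Co \<subseteq> AN"
  using tors_finite_algebraic(2)[of "p ^ _"] p(1) by (fastforce simp: Co_def coordinates_def pts_def)
 moreover have "s ` Co = Co" if "fhom AN s" for s
  unfolding Co_def by (rule coordinates_stable[OF that]) (use p(1) in auto)
 ultimately obtain \<sigma> where s: "\<sigma> \<in> carrier (Gal N K)" "\<sigma> y ~= y"
  using Gal_moves[of Co K y] K y(1) nK unfolding N_def[symmetric] N by metis
 interpret G: group "Gal N K" by (rule Gal_group[OF Nf]) (use K(2) in \<open>simp add: N_def\<close>)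
 have yN: "y \<in> N" using y(1) by (simp add: N_def)
 have sg: "g y = y \<or> g y = - y" and neg: "g (- y) = - g y" if g: "g \<in> carrier (Gal N K)" for g
 proof -
  have h: "fhom N g" "\<forall>x\<in>K. g x = x" using g Gal_iff[OF Nf] by auto
  have "g y ^ 2 = y ^ 2" using fhomD(11)[OF h(1) yN, of 2] h(2) y(2) by simp
  then show "g y = y \<or> g y = - y" by (simp add: power2_eq_iff)
  show "g (- y) = - g y" using fhomD(7)[OF h(1) yN] .
 qed
 have y0: "y ~= 0" using nK csubringD(2)[OF csubfieldD(1)[OF K(1)]] by auto
 have mult: "(g \<otimes>\<^bsub>Gal N K\<^esub> h) y = y \<longleftrightarrow> (g y = y \<longleftrightarrow> h y = y)" if gh: "g \<in> carrier (Gal N K)" "h \<in> carrier (Gal N K)" for g h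
 proof -
  have "(g \<otimes>\<^bsub>Gal N K\<^esub> h) y = g (h y)" using gh yN by (simp add: Gal_mult compose_eq)
  then show ?thesis using sg[OF gh(1)] sg[OF gh(2)] neg[OF gh(1)] y0 by auto
 qed
 define S where "S = {g \<in> carrier (Gal N K). g y = y}"
 have one: "\<one>\<^bsub>Gal N K\<^esub> y = y" using yN by (simp add: Gal_one)
 have inv: "(inv\<^bsub>Gal N K\<^esub> g) y = y \<longleftrightarrow> g y = y" if "g \<in> carrier (Gal N K)" for g
  using mult[of g "inv\<^bsub>Gal N K\<^esub> g"] that one by auto
 have sub: "subgroup S (Gal N K)"
  by (rule G.subgroupI) (use mult inv one in \<open>auto simp: S_def\<close>)
 have normal: "S \<lhd> Gal N K"
  unfolding G.normal_inv_iff using sub mult inv by (auto simp: S_def)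
 have "openin (krull_topology N K) S"
 proof -
  have "openin (product_topology (\<lambda>_. discrete_topology N) N) {f \<in> topspace (product_topology (\<lambda>_. discrete_topology N) N). f y \<in> {y}}"
   using yN by (intro openin_continuous_map_preimage[OF continuous_map_product_projection]) auto
  moreover have "S = {f \<in> topspace (product_topology (\<lambda>_. discrete_topology N) N). f y \<in> {y}} \<inter> carrier (Gal N K)"
   using Gal_iff[OF Nf] by (auto simp: S_def PiE_def bij_betw_def)
  ultimately show ?thesis unfolding krull_topology_def openin_subtopology by blast
 qed
 then obtain k where k: "card (rcosets\<^bsub>Gal N K\<^esub> S) = p ^ k"
  using pro normal unfolding pro_p_galois_def N_def by blast
 have c: "S #>\<^bsub>Gal N K\<^esub> g = (if g y = y then S else S #>\<^bsub>Gal N K\<^esub> \<sigma>)" if g: "g \<in> carrier (Gal N K)" for g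
 proof (cases "g y = y")
  case True
  then show ?thesis using G.coset_join2[OF g sub] g by (simp add: S_def)
 next
  case False
  have "g \<otimes>\<^bsub>Gal N K\<^esub> inv\<^bsub>Gal N K\<^esub> \<sigma> \<in> S"
   using mult[OF g, of "inv\<^bsub>Gal N K\<^esub> \<sigma>"] inv[OF s(1)] s False g by (simp add: S_def)
  then have "(g \<otimes>\<^bsub>Gal N K\<^esub> inv\<^bsub>Gal N K\<^esub> \<sigma>) \<otimes>\<^bsub>Gal N K\<^esub> \<sigma> \<in> S #>\<^bsub>Gal N K\<^esub> \<sigma>" by (auto simp: r_coset_def)
  then have "g \<in> S #>\<^bsub>Gal N K\<^esub> \<sigma>" using g s(1) by (simp add: G.m_assoc)
  then show ?thesis using G.repr_independence[OF _ s(1) sub] False by simp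
 qed
 have "\<sigma> \<in> S #>\<^bsub>Gal N K\<^esub> \<sigma>" using G.rcos_self[OF s(1) sub] .
 then have ne: "S #>\<^bsub>Gal N K\<^esub> \<sigma> ~= S" using s(2) by (auto simp: S_def)
 have "rcosets\<^bsub>Gal N K\<^esub> S = {S, S #>\<^bsub>Gal N K\<^esub> \<sigma>}"
 proof (intro equalityI subsetI)
  fix U assume "U \<in> rcosets\<^bsub>Gal N K\<^esub> S"
  then obtain g where "g \<in> carrier (Gal N K)" "U = S #>\<^bsub>Gal N K\<^esub> g" by (auto simp: RCOSETS_def)
  then show "U \<in> {S, S #>\<^bsub>Gal N K\<^esub> \<sigma>}" using c by auto
 next
  have "S = S #>\<^bsub>Gal N K\<^esub> \<one>\<^bsub>Gal N K\<^esub>" using c[OF G.one_closed] one by simp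
  moreover fix U assume "U \<in> {S, S #>\<^bsub>Gal N K\<^esub> \<sigma>}"
  ultimately show "U \<in> rcosets\<^bsub>Gal N K\<^esub> S" using s(1) G.one_closed unfolding RCOSETS_def by blast
 qed
 then have "card (rcosets\<^bsub>Gal N K\<^esub> S) = 2" using ne by simp
 then show False using k p(2) by (metis even_power even_numeral)
qed

end

section \<open>Reduction types over the rationals and half products\<close>

context local_curve
begin

lemma invariants_rational: "c4 W \<in> \<rat>" "c6 W \<in> \<rat>" "disc W \<in> \<rat>" "b2 W \<in> \<rat>"
proof -
 have "set_weierstrass W \<subseteq> \<rat>" using W by (simp add: elliptic_curve_over_def)
 then show "c4 W \<in> \<rat>" "c6 W \<in> \<rat>" "disc W \<in> \<rat>" "b2 W \<in> \<rat>" by (rule csubring_invariants[OF csubring_Rats])+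
qed

lemma Zq_A: "x \<in> Zq q ==> x \<in> A" "x \<in> Zq q ==> x \<in> \<rat>" "x \<in> A ==> x \<in> \<rat> ==> x \<in> Zq q"
 using A_Rats by auto

lemma local_max_mx: "x \<in> local_max_ideal \<rat> (rat_place q) ==> x \<in> mx"
 unfolding local_max_ideal_Rats using mx_mult(2)[OF Zq_A(1) q_mx] by auto

lemma Zq_unit:
 assumes "z \<in> Zq q" "z \<notin> local_max_ideal \<rat> (rat_place q)"
 shows "z \<in> A - mx"
proof -
 have z: "z \<in> \<rat>" "z = 0 \<or> rmult q z \<ge> 0" using assms(1) by (auto simp: Zq_iff[OF q])
 have q0: "of_nat q ~= (0::complex)" using q by (simp add: prime_gt_0_nat)
 have z0: "z ~= 0"
 proof
  assume "z = 0"
  then have "z = of_nat q * z" by simp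
  then show False using assms unfolding local_max_ideal_Rats by blast
 qed
 have "\<not> rmult q z \<ge> 1"
 proof
  assume "rmult q z \<ge> 1"
  then have "z / of_nat q \<in> Zq q" using z z0 q0 by (simp add: Zq_iff[OF q] rmult_divide[OF q] rmult_self[OF q])
  moreover have "z = of_nat q * (z / of_nat q)" using q0 by simp
  ultimately show False using assms(2) unfolding local_max_ideal_Rats by blast
 qed
 then have "rmult q z = 0" using z z0 by linarith
 then have "inverse z \<in> Zq q" using z z0 by (simp add: Zq_iff[OF q] rmult_inverse[OF q])
 then show ?thesis unfolding unit_iff using assms(1) z0 Zq_A by blast
qed

lemma minimal_modelE:
 assumes "minimal_model \<rat> (rat_place q) W V"
 obtains u r s t where "u \<in> \<rat>" "u ~= 0" "r \<in> \<rat>" "V = change_variables u r s t W"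
  "set_weierstrass V \<subseteq> Zq q" "rmult q (disc W) = 12 * rmult q u + rmult q (disc V)" "disc V \<in> Zq q" "c4 V \<in> Zq q" "disc V ~= 0"
proof -
 obtain u r s t where u: "u \<in> \<rat>" "u ~= 0" "r \<in> \<rat>" and V: "V = change_variables u r s t W"
  using assms by (auto simp: minimal_model_def isomorphic_over_def)
 have sub: "set_weierstrass V \<subseteq> Zq q" using assms by (simp add: minimal_model_def local_ring_Rats)
 have Z: "disc V \<in> Zq q" "c4 V \<in> Zq q" using csubring_invariants[OF csubring_Zq[OF q] sub] by blast+
 have d: "disc W = u ^ 12 * disc V" by (rule cv_disc[OF u(2) V])
 then have d0: "disc V ~= 0" using disc_W by auto
 have "rmult q (disc W) = 12 * rmult q u + rmult q (disc V)"
  unfolding d using rmult_mult[OF q, of "u ^ 12" "disc V"] rmult_power[OF q u(1,2), of 12] u Zq_A(2)[OF Z(1)] d0 by simp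
 then show thesis using that u V sub Z d0 by blast
qed

text \<open>The invariants c4 = 1 + 1728 t and c6 = -(1 + 1728 t) of the model force u^2 = - c6 /
  c4, evaluated on the given curve. So u is in general a quadratic irrationality, that of the twist
  relating the two curves.\<close>

lemma tate_model:
 assumes j: "c4 W ^ 3 / disc W \<notin> A"
 defines "t \<equiv> disc W / c6 W ^ 2"
 obtains u r s v where "u ~= 0" "u ^ 2 = - c6 W / c4 W" "tate t = change_variables u r s v W" "r \<in> \<rat>"
  "t \<in> mx" "t ~= 0" "t \<in> \<rat>" "c4 W ~= 0" "c6 W ~= 0"
proof -
 define J where "J = c4 W ^ 3 / disc W"
 have J: "J \<notin> A" using j by (simp add: J_def)
 have e: "J - 1728 = c6 W ^ 2 / disc W"
  using disc_c4_c6[of W] disc_W by (simp add: J_def field_simps)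
 have nA: "J - 1728 \<notin> A"
 proof
  assume "J - 1728 \<in> A"
  then have "(J - 1728) + 1728 \<in> A" by (rule AD(6)[OF _ AD(10)])
  then show False using J by simp
 qed
 have c4: "c4 W ~= 0" using J AD(2) by (auto simp: J_def)
 have c6: "c6 W ~= 0" using nA AD(2) unfolding e by auto
 have t: "t \<in> mx" using not_A[OF nA] unfolding e t_def by simp
 have t0: "t ~= 0" using disc_W c6 by (simp add: t_def)
 have tQ: "t \<in> \<rat>" using invariants_rational by (simp add: t_def)
 have ct: "c6 W ^ 2 * (1 + 1728 * t) = c4 W ^ 3"
  using disc_c4_c6[of W] c6 by (simp add: t_def field_simps)
 define u where "u = csqrt (- c6 W / c4 W)"
 have u2: "u ^ 2 = - c6 W / c4 W" by (simp add: u_def)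
 then have u: "u ^ 2 * c4 W = - c6 W" using c4 by simp
 have u0: "u ~= 0" using u c6 by auto
 have "c6 W ^ 2 * c4 W = c6 W ^ 2 * (u ^ 4 * (1 + 1728 * t))" "c6 W ^ 2 * c6 W = c6 W ^ 2 * (u ^ 6 * - (1 + 1728 * t))"
  using ct u by Groebner_Basis.algebra+
 then have c: "c4 W = u ^ 4 * c4 (tate t)" "c6 W = u ^ 6 * c6 (tate t)" using c6 by (simp_all add: tate_simps)
 have "(u ^ 2 * b2 (tate t) - b2 W) / 12 \<in> \<rat>" unfolding u2 tate_simps using invariants_rational by simp
 then show thesis using that[OF u0 u2 change_variables_exists[OF u0 c]] t t0 tQ c4 c6 by blast
qed

context
 fixes Z H
 assumes Z: "stable Z" and H: "half W Z H"
begin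

lemma tate_square_class:
 assumes j: "c4 W ^ 3 / disc W \<notin> A"
 shows "\<exists>x\<in>\<rat>. \<exists>w\<in>Zq q. x ~= 0 \<and> psiprod H ^ 2 = (- c6 W / c4 W) ^ (3 * card H) * x ^ 2 * (1 + 4 * w) \<and> 1 + 4 * w \<in> A - mx"
proof -
 obtain u r s v where u: "u ~= 0" "u ^ 2 = - c6 W / c4 W" "tate (disc W / c6 W ^ 2) = change_variables u r s v W" "r \<in> \<rat>"
  "disc W / c6 W ^ 2 \<in> mx" "disc W / c6 W ^ 2 ~= 0"
  by (rule tate_model[OF j]) (rule that; assumption)
 have "u ^ 2 \<in> \<rat>" unfolding u(2) using invariants_rational by simp
 from square_class_tate[OF Z H u(1) this u(3,5,6,4)] show ?thesis unfolding u(2) .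
qed

text \<open>With an odd number of factors, a rational half product reveals that - c6 / c4 is a
  rational square times e = 1 + 4 w. The twist of the model by e is integral with unit c4 and
  isomorphic to the curve over the rationals, so the minimal model cannot have c4 in the maximal
  ideal.\<close>

lemma tate_not_additive:
 assumes j: "c4 W ^ 3 / disc W \<notin> A" and Y: "psiprod H \<in> \<rat>" "odd (card H)"
 shows "\<not> additive_reduction \<rat> (rat_place q) W"
proof
 assume "additive_reduction \<rat> (rat_place q) W"
 then obtain V where V: "minimal_model \<rat> (rat_place q) W V" "c4 V \<in> mx"
  using local_max_mx by (auto simp: additive_reduction_def)
 define t d where "t = disc W / c6 W ^ 2" and "d = - c6 W / c4 W"
 obtain u r s v where u: "u ~= 0" "u ^ 2 = d" "tate t = change_variables u r s v W"
  and t: "t \<in> mx" "t ~= 0" "t \<in> \<rat>" and c0: "c4 W ~= 0" "c6 W ~= 0"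
  by (rule tate_model[OF j, folded t_def d_def]) (rule that; assumption)
 obtain x w where x: "x \<in> \<rat>" "x ~= 0" and w: "w \<in> Zq q" "1 + 4 * w \<in> A - mx"
  and D: "psiprod H ^ 2 = d ^ (3 * card H) * x ^ 2 * (1 + 4 * w)"
  using tate_square_class[OF j] unfolding d_def by blast
 define e where "e = 1 + 4 * w"
 have e: "e \<in> \<rat>" "e ~= 0" "e \<in> A - mx"
  using w Zq_A(2) mx_0 by (auto simp: e_def)
 have d: "d \<in> \<rat>" "d ~= 0" using invariants_rational c0 by (simp_all add: d_def)
 have "odd (3 * card H)" using Y(2) by simp
 then obtain m where m: "3 * card H = 2 * m + 1" by (rule oddE)
 \<comment> \<open>The exponent 3 h is odd; dividing out the square part leaves k^2 e = - c6 /
   c4.\<close>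
 define k where "k = psiprod H / (d ^ m * x * e)"
 have kQ: "k \<in> \<rat>" using Y d x e by (simp add: k_def)
 have kd: "k ^ 2 * e = d"
 proof -
  have "k ^ 2 = psiprod H ^ 2 / (d ^ m * x * e) ^ 2" by (simp add: k_def power_divide)
  also have "psiprod H ^ 2 = d * (d ^ m) ^ 2 * x ^ 2 * e" unfolding D m e_def by (simp add: power_mult mult.commute)
  finally show ?thesis using d x e by (simp add: power_mult_distrib power2_eq_square)
 qed
 have k0: "k ~= 0" using kd d by auto
 \<comment> \<open>The quadratic twist of \<open>tate t\<close> by e, written with a1 = 1 and a2 = w
   so that b2 = 1 + 4 w and the equation stays integral at 2.\<close>
 define V' where "V' = Weierstrass 1 w 0 (- 36 * t * e ^ 2) (- t * e ^ 3)"
 have b: "b2 V' = e" "b4 V' = - 72 * t * e ^ 2" "b6 V' = - 4 * t * e ^ 3"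
  by (simp_all add: V'_def b2_def b4_def b6_def e_def)
 have c: "c4 V' = e ^ 2 * (1 + 1728 * t)" "c6 V' = - (e ^ 3 * (1 + 1728 * t))"
  unfolding c4_def c6_def b by Groebner_Basis.algebra+
 have cW: "c4 W = k ^ 4 * c4 V'" "c6 W = k ^ 6 * c6 V'"
  using cv_c4[OF u(1,3)] cv_c6[OF u(1,3)] u(2) kd unfolding c tate_simps by Groebner_Basis.algebra+
 define r' s' t' where "r' = (k ^ 2 * b2 V' - b2 W) / 12" and "s' = (k * a1 V' - a1 W) / 2" and "t' = (k ^ 3 * a3 V' - a3 W - r' * a1 W) / 2"
 have V': "V' = change_variables k r' s' t' W"
  unfolding r'_def s'_def t'_def by (rule change_variables_exists[OF k0 cW])
 have r'Q: "r' \<in> \<rat>" unfolding r'_def b using kQ e invariants_rational by simp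
 have "s' \<in> \<rat>" "t' \<in> \<rat>" unfolding s'_def t'_def using kQ r'Q coeffs by (simp_all add: V'_def)
 then have iso: "isomorphic_over \<rat> W V'" unfolding isomorphic_over_def using kQ k0 r'Q V' by blast
 note DZ = csubringD[OF csubring_Zq[OF q]]
 have te: "t \<in> Zq q" "e \<in> Zq q" using Zq_A(3) t(1,3) mx_A e by auto
 have "- 36 * t * e ^ 2 \<in> Zq q" using te by (intro DZ(4,5,7,10))
 moreover have "- t * e ^ 3 \<in> Zq q" using te by (intro DZ(4,5,7))
 ultimately have "set_weierstrass V' \<subseteq> Zq q" using w DZ(1,2) by (simp add: V'_def)
 then have q1: "disc V' / disc V \<in> A"
  using V(1) iso Zq_A(1) unfolding minimal_model_def local_ring_Rats by blast
 obtain u1 r1 s1 t1 where u1: "u1 ~= 0" "V = change_variables u1 r1 s1 t1 W" using minimal_modelE[OF V(1)] by metis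
 \<comment> \<open>The scaling between the two integral models: c4 V in the maximal ideal puts l^4
   there, while minimality of V keeps disc V' / disc V, the inverse of l^12, in A.\<close>
 define l where "l = k / u1"
 have l: "k = l * u1" "l ~= 0" using u1 k0 by (simp_all add: l_def)
 have "u1 ^ 4 * c4 V = u1 ^ 4 * (l ^ 4 * c4 V')" "u1 ^ 12 * disc V = u1 ^ 12 * (l ^ 12 * disc V')"
 proof -
  have "k ^ 4 * c4 V' = u1 ^ 4 * (l ^ 4 * c4 V')" "k ^ 12 * disc V' = u1 ^ 12 * (l ^ 12 * disc V')"
   unfolding l(1) by (simp_all add: power_mult_distrib mult_ac)
  then show "u1 ^ 4 * c4 V = u1 ^ 4 * (l ^ 4 * c4 V')" "u1 ^ 12 * disc V = u1 ^ 12 * (l ^ 12 * disc V')"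
   using cv_c4[OF u1] cv_disc[OF u1] cW(1) cv_disc[OF k0 V'] by metis+
 qed
 then have cl: "c4 V = l ^ 4 * c4 V'" "disc V = l ^ 12 * disc V'" using u1(1) by simp_all
 have "1 + 1728 * t \<in> A - mx" using one_mx AD(1) mx_mult(1)[OF AD(10) t(1)] by (intro unit_add(1)) auto
 then have "c4 V' \<in> A - mx" unfolding c using unit_mult unit_power e(3) by blast
 then have "c4 V' ~= 0" "inverse (c4 V') \<in> A" unfolding unit_iff by blast+
 moreover have "l ^ 4 = c4 V * inverse (c4 V')" unfolding cl using \<open>c4 V' ~= 0\<close> by simp
 ultimately have "l ^ 4 \<in> mx" using mx_mult(2)[OF _ V(2)] by metis
 then have "l ^ 4 * (l ^ 4 * l ^ 4) \<in> mx" using mx_mult mx_A by blast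
 then have "disc V' / disc V * (l ^ 4 * (l ^ 4 * l ^ 4)) \<in> mx" by (rule mx_mult(1)[OF q1])
 moreover have "disc V' ~= 0" using cv_disc[OF k0 V'] disc_W by auto
 then have "disc V' / disc V * l ^ 12 = 1" unfolding cl using l(2) by simp
 moreover have "l ^ 4 * (l ^ 4 * l ^ 4) = l ^ 12" by (simp flip: power_add)
 ultimately show False using one_mx by simp
qed

lemma rmult_potentially_good:
 assumes "potentially_good_reduction q W"
 shows "2 * rmult q (psiprod H ^ 2) = int (card H) * rmult q (disc W)"
proof -
 obtain u r s t V where V: "u ~= 0" "V = change_variables u r s t W" "set_weierstrass V \<subseteq> A" "disc V \<in> A - mx"
  using potentially_good_model[OF assms] by blast
 then show ?thesis using rmult_good[OF Z H V(1,2) csubring_invariants(1-4)[OF csubring_A V(3)] V(4)] by blast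
qed

text \<open>By \<open>tate_not_additive\<close> j is integral, so reduction is potentially good and
  2 v(Y^2) = h v(disc) for the half product Y with h factors. As Y is rational, the left side is
  divisible by 4, and h is odd; passing to the minimal model changes v(disc) by a multiple of
  12.\<close>

lemma additive_condition:
 assumes Y: "psiprod H \<in> \<rat>" "odd (card H)" and add: "additive_reduction \<rat> (rat_place q) W"
  and V: "minimal_model \<rat> (rat_place q) W V" "disc V = of_int \<Delta>"
 shows "potentially_good_reduction q W \<and> 4 dvd multiplicity (int q) \<Delta>"
proof -
 have "c4 W ^ 3 / disc W \<in> A" using tate_not_additive[OF _ Y] add by blast
 then have "c4 W ^ 3 / disc W \<in> Zq q" using Zq_A(3) invariants_rational by simp
 then have pg: "potentially_good_reduction q W" using potentially_good_of_j[OF q] by blast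
 obtain u where u: "rmult q (disc W) = 12 * rmult q u + rmult q (disc V)" "disc V ~= 0" using minimal_modelE[OF V(1)] by metis
 have "4 * rmult q (psiprod H) = int (card H) * (12 * rmult q u + int (multiplicity (int q) \<Delta>))"
  using rmult_potentially_good[OF pg] rmult_power[OF q Y(1) psiprod(2)[OF Z H], of 2] u rmult_int[OF q, of \<Delta>]
  unfolding V(2) by auto
 then have "4 dvd int (card H) * (12 * rmult q u + int (multiplicity (int q) \<Delta>))" by (metis dvd_triv_left)
 moreover have "coprime 4 (int (card H))"
  using Y(2) coprime_power_left_iff[of "2::int" 2 "int (card H)"] by simp
 ultimately have "4 dvd 12 * rmult q u + int (multiplicity (int q) \<Delta>)" by (simp add: coprime_dvd_mult_right_iff)
 then have "4 dvd int (multiplicity (int q) \<Delta>)" by presburger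
 then have "4 dvd multiplicity (int q) \<Delta>" by presburger
 then show ?thesis using pg by blast
qed

text \<open>The relation 1728 disc = c4^3 - c6^2 makes c6 a unit along with c4. Between models - c6
  / c4 changes by the square of u, so up to rational squares it is a unit.\<close>

lemma multiplicative_j:
 assumes V: "minimal_model \<rat> (rat_place q) W V" and m: "disc V \<in> local_max_ideal \<rat> (rat_place q)" "c4 V \<notin> local_max_ideal \<rat> (rat_place q)"
 shows "c4 W ^ 3 / disc W \<notin> A" "c6 V \<in> A - mx" "c4 V \<in> A - mx"
  "\<And>u r s t. u ~= 0 ==> V = change_variables u r s t W ==> - c6 W / c4 W = u ^ 2 * (- c6 V / c4 V)"
proof -
 obtain u r s t where u: "u ~= 0" "V = change_variables u r s t W" "c4 V \<in> Zq q" "disc V ~= 0" "set_weierstrass V \<subseteq> Zq q"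
  using minimal_modelE[OF V] by metis
 show c4: "c4 V \<in> A - mx" by (rule Zq_unit[OF u(3) m(2)])
 have d: "disc V \<in> mx" by (rule local_max_mx[OF m(1)])
 have e: "c4 W ^ 3 / disc W = c4 V ^ 3 / disc V" unfolding cv_c4[OF u(1,2)] cv_disc[OF u(1,2)] using u(1) by (simp add: power_mult_distrib flip: power_mult)
 show "c4 W ^ 3 / disc W \<notin> A"
 proof
  assume "c4 W ^ 3 / disc W \<in> A"
  then have "c4 V ^ 3 / disc V * disc V \<in> mx" unfolding e using mx_mult(1)[OF _ d] by blast
  then show False using unit_power[OF c4, of 3] u(4) by simp
 qed
 have "set_weierstrass V \<subseteq> A" using u(5) Zq_A(1) by blast
 then have c6A: "c6 V \<in> A" by (rule csubring_invariants(6)[OF csubring_A])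
 have "c4 V ^ 3 - 1728 * disc V \<in> A - mx" by (intro unit_add(2) unit_power c4 mx_mult(1) d AD(10))
 then have "c6 V ^ 2 \<in> A - mx" using disc_c4_c6[of V] by simp
 then show "c6 V \<in> A - mx" using c6A mx_mult(1)[OF c6A] by (auto simp: power2_eq_square)
 show "- c6 W / c4 W = u ^ 2 * (- c6 V / c4 V)" if "u ~= 0" "V = change_variables u r s t W" for u r s t
 proof -
  have "- (a * b * c) / (a * d) = b * (- c / d)" if "a ~= 0" for a b c d :: complex using that by simp
  from this[of "u ^ 4" "u ^ 2" "c6 V" "c4 V"] show ?thesis
   unfolding cv_c4[OF that] cv_c6[OF that] using that(1) by (simp flip: power_add)
 qed
qed

text \<open>For good and for additive reduction, 2 v(Y^2) = h v(disc) is used with 4 dividing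
  v(disc); for multiplicative reduction Y^2 is a rational square times a unit, by the class of - c6
  / c4.\<close>

lemma even_valuation:
 assumes cond: "additive_reduction \<rat> (rat_place q) W ==> potentially_good_reduction q W \<and> 4 dvd multiplicity (int q) \<Delta>"
  and V: "minimal_model \<rat> (rat_place q) W V" "disc V = of_int \<Delta>"
 shows "even (rmult q (psiprod H ^ 2))"
proof -
 obtain u r s t where u: "u \<in> \<rat>" "u ~= 0" "V = change_variables u r s t W" "set_weierstrass V \<subseteq> Zq q"
  "rmult q (disc W) = 12 * rmult q u + rmult q (disc V)" "disc V \<in> Zq q" "c4 V \<in> Zq q" "disc V ~= 0"
  using minimal_modelE[OF V(1)] by metis
 have div4: "even (rmult q (psiprod H ^ 2))" if e: "2 * rmult q (psiprod H ^ 2) = int (card H) * rmult q (disc W)" and "4 dvd rmult q (disc W)"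
 proof -
  obtain k where "rmult q (disc W) = 4 * k" using \<open>4 dvd rmult q (disc W)\<close> by blast
  then have "rmult q (psiprod H ^ 2) = 2 * (int (card H) * k)" using e by simp
  then show ?thesis by simp
 qed
 consider "disc V \<notin> local_max_ideal \<rat> (rat_place q)" | "disc V \<in> local_max_ideal \<rat> (rat_place q)" "c4 V \<in> local_max_ideal \<rat> (rat_place q)"
  | "disc V \<in> local_max_ideal \<rat> (rat_place q)" "c4 V \<notin> local_max_ideal \<rat> (rat_place q)" by blast
 then show ?thesis
 proof cases
  case 1
  have d: "disc V \<in> A - mx" by (rule Zq_unit[OF u(6) 1])
  have "set_weierstrass V \<subseteq> A" using u(4) Zq_A(1) by blast
  from rmult_good[OF Z H u(2,3) csubring_invariants(1-4)[OF csubring_A this] d]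
  have "2 * rmult q (psiprod H ^ 2) = int (card H) * rmult q (disc W)" .
  moreover have "4 dvd rmult q (disc W)" using u(5) rmult_unit[OF d Zq_A(2)[OF u(6)]] by simp
  ultimately show ?thesis by (rule div4)
 next
  case 2
  then have c: "potentially_good_reduction q W" "4 dvd multiplicity (int q) \<Delta>"
   using cond V(1) by (auto simp: additive_reduction_def)
  have "rmult q (disc V) = int (multiplicity (int q) \<Delta>)" using rmult_int[OF q, of \<Delta>] u(8) unfolding V(2) by simp
  then have "4 dvd rmult q (disc W)" unfolding u(5) using c(2) by presburger
  then show ?thesis using div4 rmult_potentially_good[OF c(1)] by blast
 next
  case 3
  note mj = multiplicative_j[OF V(1) 3]
  obtain x w where x: "x \<in> \<rat>" "x ~= 0" "w \<in> Zq q" "1 + 4 * w \<in> A - mx"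
   and D: "psiprod H ^ 2 = (- c6 W / c4 W) ^ (3 * card H) * x ^ 2 * (1 + 4 * w)"
   using tate_square_class[OF mj(1)] by blast
  define g where "g = - c6 V / c4 V"
  have g: "g \<in> A - mx" unfolding g_def minus_divide_left[symmetric]
   using unit_divide[OF mj(2,3)] mx_minus[of "- (c6 V / c4 V)"] AD(5) by auto
  have w: "1 + 4 * w \<in> \<rat>" "1 + 4 * w ~= 0" using Zq_A(2)[OF x(3)] x(4) mx_0 by auto
  have "psiprod H ^ 2 = (u ^ (3 * card H) * x) ^ 2 * (g ^ (3 * card H) * (1 + 4 * w))"
   unfolding D mj(4)[OF u(2,3)] g_def[symmetric] by (simp add: power_mult_distrib mult_ac flip: power_mult)
  moreover have unit: "g ^ (3 * card H) * (1 + 4 * w) \<in> A - mx" using unit_mult unit_power g x(4) by blast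
  moreover have "g ^ (3 * card H) * (1 + 4 * w) = psiprod H ^ 2 / (u ^ (3 * card H) * x) ^ 2"
   unfolding \<open>psiprod H ^ 2 = (u ^ (3 * card H) * x) ^ 2 * (g ^ (3 * card H) * (1 + 4 * w))\<close> using u(2) x(2) by simp
  then have gQ: "g ^ (3 * card H) * (1 + 4 * w) \<in> \<rat>" using psiprod_square[OF Z H] u(1) x(1) by (metis Rats_divide Rats_mult Rats_power)
  have ux: "u ^ (3 * card H) * x \<in> \<rat>" "u ^ (3 * card H) * x ~= 0" using u x by auto
  have "g ^ (3 * card H) * (1 + 4 * w) ~= 0" using unit unfolding unit_iff by blast
  then have "rmult q ((u ^ (3 * card H) * x) ^ 2 * (g ^ (3 * card H) * (1 + 4 * w))) = 2 * rmult q (u ^ (3 * card H) * x)"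
   using rmult_mult[OF q Rats_power[OF ux(1), of 2] gQ] rmult_power[OF q ux, of 2] rmult_unit[OF unit gQ] ux(2) by simp
  then have "rmult q (psiprod H ^ 2) = 2 * rmult q (u ^ (3 * card H) * x)"
   unfolding \<open>psiprod H ^ 2 = (u ^ (3 * card H) * x) ^ 2 * (g ^ (3 * card H) * (1 + 4 * w))\<close> .
  then show ?thesis by simp
 qed
qed

text \<open>Good reduction is \<open>square_class_good_2\<close>. For multiplicative reduction a1 is
  a unit and - c6 = a1^2 c4 + 4 n, so that - c6 / c4 is itself a square times an element 1 + 4 v;
  this is inserted into \<open>tate_square_class\<close>.\<close>

lemma semistable_2:
 assumes q2: "q = 2" and ss: "semistable_reduction \<rat> (rat_place q) W"
 shows "\<exists>x\<in>\<rat>. \<exists>w\<in>Zq q. x ~= 0 \<and> psiprod H ^ 2 = x ^ 2 * (1 + 4 * w)"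
proof -
 obtain V where V: "minimal_model \<rat> (rat_place q) W V" and
  c: "disc V \<notin> local_max_ideal \<rat> (rat_place q) \<or> disc V \<in> local_max_ideal \<rat> (rat_place q) \<and> c4 V \<notin> local_max_ideal \<rat> (rat_place q)"
  using ss by (auto simp: semistable_reduction_def good_reduction_def multiplicative_reduction_def)
 obtain u r s t where u: "u \<in> \<rat>" "u ~= 0" "r \<in> \<rat>" "V = change_variables u r s t W" "set_weierstrass V \<subseteq> Zq q" "disc V \<in> Zq q"
  using minimal_modelE[OF V] by metis
 have aZ: "a1 V \<in> Zq q" "a2 V \<in> Zq q" "a3 V \<in> Zq q" "a4 V \<in> Zq q" "a6 V \<in> Zq q" using u(5) by (cases V; simp)+
 note a = aZ[THEN Zq_A(1)] and aQ = aZ[THEN Zq_A(2)]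
 show ?thesis
 proof (cases "disc V \<in> local_max_ideal \<rat> (rat_place q)")
  case False
  have "u ^ 2 \<in> \<rat>" "a1 V \<in> A \<inter> \<rat>" "a3 V \<in> A \<inter> \<rat>" using u(1) a aQ by auto
  then obtain x w where x: "x \<in> \<rat>" "x ~= 0" "w \<in> Zq q" "psiprod H ^ 2 = (u ^ 2) ^ (3 * card H) * x ^ 2 * (1 + 4 * w)"
   using square_class_good_2[OF Z H q2 u(2) _ u(4)] a(2,4,5) u(3) Zq_unit[OF u(6) False] by blast
  have "psiprod H ^ 2 = (u ^ (3 * card H) * x) ^ 2 * (1 + 4 * w)"
   unfolding x(4) by (simp add: power_mult_distrib mult.commute flip: power_mult)
  moreover have "u ^ (3 * card H) * x \<in> \<rat>" "u ^ (3 * card H) * x ~= 0" using u x by auto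
  ultimately show ?thesis using x(3) by blast
 next
  case True
  then have c4: "c4 V \<notin> local_max_ideal \<rat> (rat_place q)" using c by blast
  note mj = multiplicative_j[OF V True c4]
  obtain x w where x: "x \<in> \<rat>" "x ~= 0" "w \<in> Zq q"
   and D: "psiprod H ^ 2 = (- c6 W / c4 W) ^ (3 * card H) * x ^ 2 * (1 + 4 * w)"
   using tate_square_class[OF mj(1)] by blast
  have two: "2 \<in> mx" using q_mx q2 by simp
  have four: "4 * z \<in> mx" if "z \<in> A" for z
   using mx_mult(2)[OF that mx_mult(2)[OF AD(10)[of "num.Bit0 num.One"] two]] by simp
  have bZ: "b2 V \<in> Zq q" "b4 V \<in> Zq q" "b6 V \<in> Zq q" "c4 V \<in> Zq q"
   using csubring_invariants[OF csubring_Zq[OF q] u(5)] by blast+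
  note bA = bZ[THEN Zq_A(1)] and bQ = bZ(1-3)[THEN Zq_A(2)] and cQ = bZ(4)[THEN Zq_A(2)]
  \<comment> \<open>c4 is congruent to a1^4 modulo 4, so a unit c4 makes a1 a unit.\<close>
  have "c4 V + 4 * (6 * b4 V) - 4 * (2 * a1 V ^ 2 * a2 V + 4 * a2 V ^ 2) \<in> A - mx"
   using bA a by (intro unit_add mj(3) four AD(4,6,7,10))
  moreover have "c4 V + 4 * (6 * b4 V) - 4 * (2 * a1 V ^ 2 * a2 V + 4 * a2 V ^ 2) = a1 V ^ 4"
   unfolding c4_def b2_def by Groebner_Basis.algebra
  ultimately have "a1 V * a1 V ^ 3 \<in> A - mx" by (simp flip: power_Suc)
  then have a1u: "a1 V \<in> A - mx" using a(1) mx_mult(2)[OF AD(7)[OF a(1)], of "a1 V" 3] by blast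
  define n where "n = b2 V ^ 2 * a2 V - 9 * b2 V * b4 V + 54 * b6 V + 6 * a1 V ^ 2 * b4 V"
  have n: "n \<in> A" "n \<in> \<rat>" unfolding n_def using bA a bQ aQ by (auto intro!: AD(3,4,6,7,10))
  have e: "- c6 V = a1 V ^ 2 * c4 V + 4 * n"
   unfolding n_def c6_def c4_def using refl[of "b2 V", unfolded b2_def[of V]] by (simp add: b2_def power2_eq_square power3_eq_cube algebra_simps)
  define v where "v = n / (a1 V ^ 2 * c4 V)"
  have un: "a1 V ^ 2 * c4 V \<in> A - mx" using unit_mult unit_power a1u mj(3) by blast
  have vZ: "v \<in> Zq q"
  proof (rule Zq_A(3))
   have "inverse (a1 V ^ 2 * c4 V) \<in> A" using un unfolding unit_iff by blast
   then show "v \<in> A" unfolding v_def divide_inverse by (rule AD(4)[OF n(1)])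
   show "v \<in> \<rat>" unfolding v_def using n(2) aQ(1) cQ by simp
  qed
  have nz: "a1 V ~= 0" "c4 V ~= 0" proof -
   have "a1 V ^ 2 * c4 V ~= 0" using un unfolding unit_iff by blast
   then show "a1 V ~= 0" "c4 V ~= 0" by auto
  qed
  have "a1 V ^ 2 * v = n / c4 V" using nz by (simp add: v_def)
  moreover have "- c6 V / c4 V = a1 V ^ 2 + 4 * (n / c4 V)" unfolding e using nz by (simp add: add_divide_distrib)
  ultimately have g: "- c6 V / c4 V = a1 V ^ 2 * (1 + 4 * v)" by (metis distrib_left mult.left_commute mult_1_right)
  note DZ = csubringD[OF csubring_Zq[OF q]]
  have "\<exists>v'\<in>Zq q. (1 + 4 * v) ^ k = 1 + 4 * v'" for k
  proof (induction k)
   case 0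
   then show ?case using DZ(2) by force
  next
   case (Suc k)
   then obtain v' where v': "v' \<in> Zq q" "(1 + 4 * v) ^ k = 1 + 4 * v'" by blast
   have "(1 + 4 * v) ^ Suc k = 1 + 4 * (v + v' + 4 * v * v')" using v'(2) by (simp add: algebra_simps)
   moreover have "v + v' + 4 * v * v' \<in> Zq q" using v'(1) vZ by (intro DZ(4,6,10))
   ultimately show ?case by blast
  qed
  then obtain v' where v': "v' \<in> Zq q" "(1 + 4 * v) ^ (3 * card H) = 1 + 4 * v'" by blast
  have "psiprod H ^ 2 = ((u * a1 V) ^ 2 * (1 + 4 * v)) ^ (3 * card H) * x ^ 2 * (1 + 4 * w)"
   unfolding D mj(4)[OF u(2,4)] g by (simp add: power_mult_distrib mult.assoc)
  also have "\<dots> = ((u * a1 V) ^ (3 * card H) * x) ^ 2 * ((1 + 4 * v) ^ (3 * card H) * (1 + 4 * w))"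
   by (simp add: power_mult_distrib mult_ac flip: power_mult)
  also have "(1 + 4 * v) ^ (3 * card H) * (1 + 4 * w) = 1 + 4 * (v' + w + 4 * v' * w)"
   unfolding v'(2) by (simp add: algebra_simps)
  finally have "psiprod H ^ 2 = ((u * a1 V) ^ (3 * card H) * x) ^ 2 * (1 + 4 * (v' + w + 4 * v' * w))" .
  moreover have "v' + w + 4 * v' * w \<in> Zq q" using v'(1) x(3) by (intro DZ(4,6,10))
  moreover have "(u * a1 V) ^ (3 * card H) * x \<in> \<rat>" "(u * a1 V) ^ (3 * card H) * x ~= 0" using u x aQ nz by auto
  ultimately show ?thesis by blast
 qed
qed

end

end

text \<open>In lowest terms r / x has odd numerator and denominator, whose squares are 1 modulo 4;
  the equation becomes d f = f modulo 4 with f odd, so d = 1 mod 4.\<close>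

lemma square_class_mod_4:
 assumes w: "w \<in> Zq 2" and x: "x \<in> \<rat>" "x ~= 0" and r: "r \<in> \<rat>" "r ~= 0" and e: "of_int d * r ^ 2 = x ^ 2 * (1 + 4 * w)"
 shows "d mod 4 ~= (3::int)"
proof
 assume d: "d mod 4 = 3"
 obtain e f where ef: "w = of_int e / of_int f" "\<not> int 2 dvd f" using w by (auto simp: Zq_def)
 define y where "y = r / x"
 have y: "y \<in> \<rat>" "y ~= 0" using x r by (simp_all add: y_def)
 have ye: "of_int d * y ^ 2 = 1 + 4 * w" using e x by (simp add: y_def power_divide field_simps)
 obtain a b where ab0: "a ~= 0" "b ~= 0" "y = of_int a / of_int b" using Rats_fraction[OF y] by metis
 define g where "g = gcd a b"
 have g0: "g ~= 0" using ab0 by (simp add: g_def)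
 define a' b' where "a' = a div g" and "b' = b div g"
 have "a = a' * g" "b = b' * g" by (simp_all add: a'_def b'_def g_def)
 then have y': "y = of_int a' / of_int b'" "b' ~= 0" using ab0 g0 by auto
 have cop: "coprime a' b'" unfolding a'_def b'_def g_def using ab0 by (intro div_gcd_coprime) auto
 have "f ~= 0" using ef by auto
 have "of_int (d * a' ^ 2 * f) = (of_int (b' ^ 2 * (f + 4 * e)) :: complex)"
  using ye \<open>f ~= 0\<close> y'(2) unfolding y'(1) ef(1) by (simp add: field_simps power_divide)
 then have eq: "d * a' ^ 2 * f = b' ^ 2 * (f + 4 * e)" by (simp only: of_int_eq_iff)
 have odd: "odd d" "odd f" using d ef(2) by (presburger, simp)
 have "odd a' \<and> odd b'"
 proof -
  have "even a' \<longleftrightarrow> even b'" using arg_cong[OF eq, of even] odd by simp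
  moreover have "\<not> (even a' \<and> even b')" using cop by (metis coprime_common_divisor odd_one)
  ultimately show ?thesis by blast
 qed
 then obtain i j where ij: "a' = 2 * i + 1" "b' = 2 * j + 1" by (auto elim!: oddE)
 obtain k l where kl: "d = 4 * k + 3" "f = 2 * l + 1" using d odd(2) by (metis add.commute mod_mult_div_eq mult.commute oddE)
 have "d * a' ^ 2 * f - b' ^ 2 * (f + 4 * e) = 2 + 4 * (d * (i ^ 2 + i) * f + k * f + l - (j ^ 2 + j) * (f + 4 * e) - e)"
  unfolding ij kl by (simp add: power2_eq_square algebra_simps)
 then show False using eq by presburger
qed

theorem theorem5p11:
  fixes E :: "complex weierstrass" and \<Delta> :: int and p :: nat and K :: "complex set"
    and S T :: "complex point" and B :: "(int ^ 2 ^ 2) set"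
  assumes E: "elliptic_curve_over \<rat> E"
    and not_CM: "\<not> complex_multiplication E"
    and \<Delta>: "minimal_discriminant E \<Delta>"
    and p: "prime p"
    and K: "minimal_pro_p_base p E K"
    and I: "p \<ge> 5"
    and II: "\<forall>\<pp>\<in>primes_above K p. good_ordinary_reduction p K \<pp> E"
    and III: "pro_p_galois p (p_power_torsion_field E p) K"
    and basis: "torsion_basis E p S T"
    and B: "borel_subgroup p B"
    and in_B: "mod_p_representation E p S T ` carrier (Gal (torsion_field E p) \<rat>) \<subseteq> B"
  shows "let
      four_divides = 4 dvd order (Gal (torsion_field E p) \<rat>);
      cond1 = (p mod 4 = 3);
      cond2 = (\<forall>q. prime q \<and> q \<noteq> p \<and> additive_reduction \<rat> (rat_place q) E \<longrightarrow>
        potentially_good_reduction q E \<and> 4 dvd multiplicity (int q) \<Delta>);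
      semistable_at_2_3 = (semistable_reduction \<rat> (rat_place 2) E \<and>
        semistable_reduction \<rat> (rat_place 3) E);
      odd_inertia_at_2_3 = ((\<forall>\<pp>\<in>primes_above K 2. odd (card (inertia_group K \<pp>))) \<and>
        (\<forall>\<pp>\<in>primes_above K 3. odd (card (inertia_group K \<pp>))))
    in (\<not> four_divides \<longrightarrow> cond1 \<and> cond2) \<and>
       (cond1 \<and> cond2 \<and> (semistable_at_2_3 \<or> odd_inertia_at_2_3) \<longrightarrow> \<not> four_divides)"
proof -
  interpret C: odd_torsion_curve E p S T by unfold_locales (fact E p basis I)+
  obtain U where U: "U \<in> C.tors p" "U \<noteq> Infinity" "\<forall>\<sigma>\<in>carrier C.GG. \<exists>k::int. map_point \<sigma> U = U [^]\<^bsub>C.E\<^esub> k"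
    using C.stable_line[OF B] in_B unfolding C.M_def by blast
  interpret borel_curve E p S T U by unfold_locales (use U in blast)+
  obtain V where V: "\<And>q. prime q \<Longrightarrow> minimal_model \<rat> (rat_place q) E V" "disc V = of_int \<Delta>"
    using \<Delta> by (auto simp: minimal_discriminant_def)
  have GGeq: "C.GG = Gal (torsion_field E p) \<rat>" by (simp add: C.M_def)
  have loc: "\<exists>A. local_curve E p S T q A" if "prime q" "q \<noteq> p" for q
  proof -
    obtain A where "val_ring A" "inverse (of_nat q) \<notin> A" using Zq_val_ring_ex[OF \<open>prime q\<close>] by blast
    then have "local_curve E p S T q A" using that by unfold_locales
    then show ?thesis by blast
  qed
  define cond2 where "cond2 \<longleftrightarrow> (\<forall>q. prime q \<and> q \<noteq> p \<and> additive_reduction \<rat> (rat_place q) E \<longrightarrow>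
        potentially_good_reduction q E \<and> 4 dvd multiplicity (int q) \<Delta>)"
  have forward: "p mod 4 = 3 \<and> cond2" if n4: "\<not> 4 dvd order C.GG"
  proof -
    have p4: "p mod 4 = 3" by (rule forward_group(1)[OF n4])
    have oddH: "odd (card H1)" "odd (card H2)"
    proof -
      obtain k where k: "p = 4 * k + 3" using p4 by (metis add.commute mod_mult_div_eq mult.commute)
      have "card H1 = 2 * k + 1" using card_H(1) k by simp
      then show "odd (card H1)" by simp
      have "p * p - p = 2 * (p * (2 * k + 1))" unfolding k by (simp add: algebra_simps)
      then have "card H2 = p * (2 * k + 1)" using card_H(2) by linarith
      then show "odd (card H2)" using C.odd_p by simp
    qed
    \<comment> \<open>The local argument needs one rational half product with an odd number of
      factors, whether it belongs to the line or to its complement.\<close>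
    have "\<exists>Z H. C.stable Z \<and> half E Z H \<and> C.psiprod H \<in> \<rat> \<and> odd (card H)"
      using forward_group(2)[OF n4] stable_C H oddH by blast
    then obtain Z Hh where Z: "C.stable Z" "half E Z Hh" "C.psiprod Hh \<in> \<rat>" "odd (card Hh)" by blast
    have "potentially_good_reduction q E \<and> 4 dvd multiplicity (int q) \<Delta>"
      if q: "prime q" "q \<noteq> p" "additive_reduction \<rat> (rat_place q) E" for q
    proof -
      obtain A where "local_curve E p S T q A" using loc[OF q(1,2)] by blast
      then interpret Q: local_curve E p S T q A .
      show ?thesis by (rule Q.additive_condition[OF Z q(3) V(1)[OF q(1)] V(2)])
    qed
    then show ?thesis using p4 unfolding cond2_def by blast
  qed
  have K': "finite_galois_over_Q K" "K \<subseteq> p_power_torsion_field E p"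
    using K by (auto simp: minimal_pro_p_base_def Let_def)
  have Kf: "csubfield K" using K'(1) by (simp add: finite_galois_over_Q_def number_field_def subfield_CC)
  have p1: "p \<ge> 1" using I by simp
  have AN: "K \<subseteq> AN" "C.M \<subseteq> p_power_torsion_field E p"
  proof -
    have "coordinates (\<Union>n. C.tors (p ^ n)) \<subseteq> AN"
      using C.tors_finite_algebraic(2)[of "p ^ _"] p1 by (fastforce simp: coordinates_def C.pts_def)
    then show "K \<subseteq> AN"
      using generate_field_CC(3)[OF csubring_algebraic] K'(2) unfolding C.p_power_torsion_field_eq[OF p1] by blast
    have "C.tors (p ^ 1) \<subseteq> (\<Union>n. C.tors (p ^ n))" by (rule UN_upper) simp
    then have "coordinates (C.tors p) \<subseteq> coordinates (\<Union>n. C.tors (p ^ n))"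
      unfolding coordinates_def power_one_right by (rule UN_mono) (rule subset_refl)
    then show "C.M \<subseteq> p_power_torsion_field E p"
      unfolding C.M_def C.torsion_field_eq[OF p1] C.p_power_torsion_field_eq[OF p1]
      by (rule generate_field_CC(3)[OF generate_field_CC(1) order_trans[OF _ generate_field_CC(2)]])
  qed
  have converse: "\<not> 4 dvd order C.GG" if p4: "p mod 4 = 3" and c2: cond2
    and c3: "semistable_reduction \<rat> (rat_place 2) E \<or> (\<forall>\<pp>\<in>primes_above K 2. odd (card (inertia_group K \<pp>)))"
  proof (rule converse_group[OF p4])
    fix y assume "y \<in> {Y1, Y2}"
    then obtain Z Hh where Z: "C.stable Z" "half E Z Hh" and yH: "y = C.psiprod Hh" using stable_C H by blast
    have y: "y \<in> C.M" "y \<noteq> 0" "y ^ 2 \<in> \<rat>" "y ^ 2 \<noteq> 0"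
      using C.psiprod[OF Z] C.psiprod_square[OF Z] unfolding yH by simp_all
    \<comment> \<open>Even valuations away from p leave four classes modulo rational squares: 1, -1,
      p and -p. Of these -1 and p are 3 modulo 4, and they are excluded at the prime 2.\<close>
    have "even (rmult q (y ^ 2))" if q: "prime q" "q \<noteq> p" for q
    proof -
      obtain A where "local_curve E p S T q A" using loc[OF q] by blast
      then interpret Q: local_curve E p S T q A .
      show ?thesis unfolding yH
        by (rule Q.even_valuation[OF Z _ V(1)[OF q(1)] V(2)]) (use c2 q in \<open>auto simp: cond2_def\<close>)
    qed
    then obtain r where r: "r \<in> \<rat>" "r \<noteq> 0"
      and cases: "y ^ 2 = r ^ 2 \<or> y ^ 2 = - (r ^ 2) \<or> y ^ 2 = of_nat p * r ^ 2 \<or> y ^ 2 = - (of_nat p * r ^ 2)"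
      using even_valuations[OF p y(3,4)] by blast
    have no: False if d: "y ^ 2 = of_int d * r ^ 2" "d mod 4 = 3" for d
    proof -
      have "prime (2::nat)" "2 \<noteq> p" using I by auto
      then obtain A where "local_curve E p S T 2 A" using loc by blast
      then interpret Q: local_curve E p S T 2 A .
      show False
      proof (cases "semistable_reduction \<rat> (rat_place 2) E")
        case True
        then obtain x w where "x \<in> \<rat>" "x \<noteq> 0" "w \<in> Zq 2" "y ^ 2 = x ^ 2 * (1 + 4 * w)"
          using Q.semistable_2[OF Z] unfolding yH by blast
        then show False using square_class_mod_4[of w x r d] r d by simp
      next
        case False
        \<comment> \<open>A square root of d in the p-torsion field; it lies in K by the pro-p
          property, which makes inertia at 2 even.\<close>
        define \<alpha> where "\<alpha> = y / r"
        have a2: "\<alpha> ^ 2 = of_int d" using d(1) r(2) by (simp add: \<alpha>_def power_divide)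
        have "\<alpha> \<in> C.M" unfolding \<alpha>_def using csubfieldD(3,4)[OF C.M(1)] y(1) r(1) by blast
        then have "\<alpha> \<in> p_power_torsion_field E p" using AN(2) by blast
        moreover have "\<alpha> ^ 2 \<in> K" unfolding a2 using csubringD(9)[OF csubfieldD(1)[OF Kf]] .
        ultimately have "\<alpha> \<in> K" by (rule C.square_root_in_base[OF p1 C.odd_p Kf K'(2) III])
        then have "even (card (inertia_group K (Q.above K)))" by (rule Q.even_inertia[OF refl K'(1) AN(1) _ a2 d(2)])
        then show False using c3 False Q.above_prime[OF Kf] by blast
      qed
    qed
    have "int p mod 4 = 3" using p4 by presburger
    then have "y ^ 2 \<noteq> of_nat p * r ^ 2" using no[of "int p"] by auto
    moreover have "y ^ 2 \<noteq> - (r ^ 2)" using no[of "- 1"] by auto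
    ultimately have "y ^ 2 = r ^ 2 \<or> y ^ 2 = - (of_nat p * r ^ 2)" using cases by blast
    then show "y \<in> \<rat> \<or> (\<exists>r\<in>\<rat>. y ^ 2 = - (of_nat p * r ^ 2))"
      using r(1) by (auto simp: power2_eq_iff)
  qed
  show ?thesis
    unfolding Let_def using forward converse unfolding GGeq cond2_def by blast
qed

end
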